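(* Consider the uncertain nonlinear time-delay system with state $(x,\psi)$, $x=[x_1,\ldots,x_n]^T\in\mathbb{R}^n$, $\psi\in\mathbb{R}^{n_\psi}$, control input $u\in\mathbb{R}$ and measured output $y\in\mathbb{R}^2$: $$\dot x_i=\phi_{(i,i+1)}(x_1)x_{i+1}+\phi_i(t,x),\quad i=1,\ldots,n-1;\qquad \dot x_n=\mu(t,x,\psi,u);$$ $$\dot\psi=q_\psi(t,x,\psi,u,x_\Delta,\psi_\Delta,u_\Delta);\qquad y=[x_1,x_n]^T,$$ where $x_\Delta=x(t-\Delta)$, $\psi_\Delta=\psi(t-\Delta)$, $u_\Delta=u(t-\Delta)$, $\Delta=\Delta(t)$ is a possibly time-varying time delay, the functions $\phi_{(i,i+1)}$ are known and continuous, and $\phi_1,\ldots,\phi_{n-1},\mu,q_\psi$ are uncertain continuous functions. Assume the following. **A1.** There is a constant $\sigma>0$ with $\phi_{(i,i+1)}(x_1)\ge\sigma$ for all $1\le i\le n-1$ and all $x_1\in\mathbb{R}$. **A2.** There are a known continuous function $\Gamma:\mathbb{R}\to[0,\infty)$ and an unknown constant $\theta\ge0$ such that for all $t\ge0$, $x\in\mathbb{R}^n$ and $1\le i\le n-1$, $|\phi_i(t,x)|\le\Gamma(x_1)\big[\theta|x_1|+\sum_{j=2}^i|x_j|\big]$. **A3.** There are positive constants $\overline\rho_i,\underline\rho_i$ such that $\overline\rho_i\,\phi_{(i-1,i)}(x_1)\le\phi_{(i,i+1)}(x_1)\le\underline\rho_i\,\phi_{(i-1,i)}(x_1)$ for all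 $x_1\in\mathbb{R}$ and $3\le i\le n-1$. **A4.** There are known non-negative continuous functions $\overline\mu(y,u)$, $\overline\mu_1(y,u)$, $\overline\mu_{1a}(x_1)$, $\tilde\mu_1(y,u)$, $\overline\mu_2(y,u)$, non-negative (possibly uncertain) functions $\overline\mu_{1\psi}(\psi)$, $\tilde\mu_{1\psi}(\psi)$, $\overline\mu_{2\psi}(\psi)$, an uncertain constant $\theta$ and a known constant $\underline\mu$ such that for all times $t$, $x\in\mathbb{R}^n$, $\psi\in\overline S_\psi$, $u\in\mathbb{R}$: (a) $\frac{\partial}{\partial u}\mu(t,x,\psi,u)\ge\underline\mu>0$; (b) $|\mu(t,x,\psi,u)|\le\overline\mu(y,u)$; (c) $\big|\frac{\partial\mu(t,x,\psi,u)}{\partial\psi}q_\psi(t,x,\psi,u,x_\Delta,\psi_\Delta,u_\Delta)\big|\le\overline\mu_1(y,u)\sum_{k=0}^1\Big\{\overline\mu_{1a}(x_1(t-k\Delta))\big[\theta|x_1(t-k\Delta)|+\sum_{j=2}^n|x_j(t-k\Delta)|\big]+\overline\mu_{1\psi}(\psi(t-k\Delta))\Big\}$; (d) $\big|\frac{\partial\mu(t,x,\psi,u)}{\partial t}\big|\le\tilde\mu_1(y,u)\big[\theta|x_1|+\sum_{j=2}^n|x_j|+\tilde\mu_{1\psi}(\psi)\big]$; (e) $\big|\frac{\partial\mu(t,x,\psi,u)}{\partial x}\big|\le\overline\mu_2(y,u)+\overline\mu_{2\psi}(\psi)$. Moreover, for all $x\in\mathbb{R}^n$, $t\in\mathbb{R}$,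 $\psi\in\overline S_\psi$, $\lim_{|u|\to\infty}|\mu(t,x,\psi,u)|=\infty$. **A5.** There is a Lyapunov function $V_\psi:\mathbb{R}^{n_\psi}\to[0,\infty)$ such that for all $t\ge0$, $x\in\mathbb{R}^n$, $u\in\mathbb{R}$, $\psi\in\overline S_\psi$, $$\frac{\partial V_\psi}{\partial\psi}q_\psi(t,x,\psi,u,x_\Delta,\psi_\Delta,u_\Delta)\le-\alpha_\psi(|\psi|)+\sum_{k=0}^1\Big\{\Gamma_2(x_1(t-k\Delta))\big[\theta x_1^2(t-k\Delta)+\sum_{j=2}^nx_j^2(t-k\Delta)+\gamma_s(y(t-k\Delta),u(t-k\Delta))\big]\Big\},$$ where $\alpha_\psi$ is a known class $\mathcal{K}_\infty$ function, $\gamma_s$ and $\Gamma_2$ are known non-negative functions and $\theta$ is an unknown non-negative constant. Also $\gamma_s(y,u)\le\overline\gamma_s(x_1)|\mu(t,x,\psi,u)|^2$ with $\overline\gamma_s$ a known non-negative function. Furthermore, for all $\psi\in\mathbb{R}^{n_\psi}$, $\alpha_\psi(|\psi|)\ge\underline V_\psi V_\psi(\psi)$ and $\overline\mu_{1\psi}^2(\psi)+\tilde\mu_{1\psi}^2(\psi)+\overline\mu_{2\psi}^2(\psi)\le\overline k_\psi\alpha_\psi(|\psi|)$, where $\underline V_\psi,\overline k_\psi$ are known positive constants and $\overline\mu_{1\psi},\tilde\mu_{1\psi},\overline\mu_{2\psi}$ are the functions in A4. **A6.** The unknown time-varying delay $\Delta$ is uniformly bounded in time and satisfies, for all time, $|\dot\Delta|\le\overline\Delta<1$,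 where $\dot\Delta=\frac{d}{dt}\Delta$ and $\overline\Delta$ is a known positive constant. Then a positive constant $a_\theta$, continuous functions $g_i$, $k_i$ ($i=2,\ldots,n$), and non-negative continuous functions $\vartheta_1,\lambda,R,\Omega,R_u,\Omega_u,\overline Q_\theta$ can be found such that the following holds for the dynamic output-feedback controller with state $[\hat x_2,\ldots,\hat x_n,\zeta,r,r_u,\hat\theta]^T$ given by $$\dot{\hat x}_i=\phi_{(i,i+1)}(x_1)[\hat x_{i+1}+r^if_{i+1}(x_1)]-r^{i-1}g_i(x_1)[\hat x_2+rf_2(x_1)]-(i-1)\dot r\,r^{i-2}f_i(x_1),\quad 2\le i\le n-1,$$ $$\dot{\hat x}_n=\tilde u-r^{n-1}g_n(x_1)[\hat x_2+rf_2(x_1)]-(n-1)\dot r\,r^{n-2}f_n(x_1),$$ $$\hat x=[\hat x_2,\ldots,\hat x_n]^T,\qquad f_i(x_1)=\int_0^{x_1}\frac{g_i(\pi)}{\phi_{(1,2)}(\pi)}\,d\pi,\quad i=2,\ldots,n,$$ $$\varpi_2=\frac{\hat x_2+rf_2(x_1)+\vartheta(x_1,\hat\theta)}{r},\qquad \varpi_i=\frac{\hat x_i+r^{i-1}f_i(x_1)}{r^{i-1}},\ i=3,\ldots,n,\qquad \varpi=[\varpi_2,\ldots,\varpi_n]^T,$$ $$\vartheta(x_1,\hat\theta)=\hat\theta x_1\vartheta_1(x_1),\qquad \tilde u=-r^nK(x_1)\varpi,\qquad K(x_1)=[k_2(x_1),k_3(x_1),\ldots,k_n(x_1)],$$ $$\dot\zeta=\dot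 r_ux_n+r_u\tilde u,\qquad u=\zeta-r_ux_n,$$ $$\dot r=\lambda\big(R(x_1,\hat\theta,\dot{\hat\theta})-r\big)\,\Omega(x_1,\hat\theta,\dot{\hat\theta},r),\qquad r(0)\ge1,$$ $$\dot r_u=\lambda\big(R_u(y,u,r,\dot r,\hat\theta,\dot{\hat\theta},\varpi)-r_u\big)\,\Omega_u(y,u,r,\dot r,\hat\theta,\dot{\hat\theta},\varpi,r_u),\qquad r_u(0)\ge1,$$ $$\dot{\hat\theta}=\overline Q_\theta(x_1),\qquad \hat\theta(0)\ge a_\theta.$$ When this controller is put in closed loop with the system, then for any initial conditions $(x(0),\psi(0),\hat x(0),\zeta(0),r(0),r_u(0),\hat\theta(0))\in\mathbb{R}^n\times S_\psi\times\mathbb{R}^{n-1}\times\mathbb{R}\times[1,\infty)\times[1,\infty)\times[a_\theta,\infty)$, all the closed-loop signals ($x_1,\ldots,x_n$, $\psi$, $\hat x_2,\ldots,\hat x_n$, $\zeta$, $r$, $r_u$, $\hat\theta$, $u$) are uniformly bounded over the time interval $[0,\infty)$ and, furthermore, the signals $x_1,\ldots,x_n,\psi,\hat x_2,\ldots,\hat x_n$ converge to zero asymptotically as $t\to\infty$.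
   Context: Notation. The time argument is omitted for signals at the current time $t$ (e.g. $u$ means $u(t)$). $|a|$ denotes Euclidean norm if $a$ is a column vector, absolute value if $a$ is a scalar, and the Euclidean norm of the stacked columns if $a$ is a matrix. A strictly increasing continuous function $\alpha:[0,a)\to[0,\infty)$ with $\alpha(0)=0$ is of class $\mathcal{K}$; it is of class $\mathcal{K}_\infty$ if moreover $a=\infty$ and $\alpha(r)\to\infty$ as $r\to\infty$. "Known" functions and constants are those that may be used in constructing the controller; "unknown" or "uncertain" ones (including $\phi_i$, $\mu$, $q_\psi$, $\theta$, $\Delta$) are not available to the controller. Only $y=[x_1,x_n]^T$ is measured. The same symbol $\theta\ge0$ in A2, A4, A5 denotes one common unknown constant. $S_\psi\subseteq\mathbb{R}^{n_\psi}$ is a known set (possibly non-compact or unbounded) of possible initial values $\psi(0)$. $\overline S_\psi\subseteq\mathbb{R}^{n_\psi}$ is the set of all possible values of $\psi(t)$ over all time, given the set $S_\psi$ of initial values and the dynamics of $\psi$ (it may be all of $\mathbb{R}^{n_\psi}$). Standing assumption: the functions $\phi_i$, $\phi_{(i,i+1)}$, $q_\psi$, $\mu$ satisfy sufficient conditions for local existence and uniqueness of solution trajectories of the system (e.g. local Lipschitz conditions).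
   Formalization: In A5 the known functions Γ_2 and \overline γ_s are additionally assumed continuous (without local boundedness the claim fails, since ψ can be driven to infinity as x_1→0); V_ψ is read as differentiable, positive definite and radially unbounded. *)

theory Defs
  imports "HOL-Analysis.Analysis"
begin

text \<open>
  Vectors with components numbered 1, ..., n (resp. 2, ..., n) are elements of \<open>real ^ 'n\<close>
  (resp. \<open>real ^ 'm\<close>), accessed through bijections \<open>ix\<close> from \<open>{1..n}\<close> to \<open>'n\<close> and \<open>jx\<close> from
  \<open>{2..n}\<close> to \<open>'m\<close>: the i-th component of \<open>x\<close> is \<open>x $ ix i\<close>, that of the observer state is
  \<open>xh $ jx i\<close>.

  The data are split into three records: what the designer knows, what is uncertain in the plant,
  and the free parameters of the controller. The controller has to be chosen from the first
  record alone.
\<close>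

definition class_K_infinity :: "(real \<Rightarrow> real) \<Rightarrow> bool" where
  "class_K_infinity \<alpha> \<longleftrightarrow>
     continuous_on {0..} \<alpha> \<and> strict_mono_on {0..} \<alpha> \<and> \<alpha> 0 = 0 \<and> filterlim \<alpha> at_top at_top"

record 'p known =
  phi :: "nat \<Rightarrow> real \<Rightarrow> real" \<comment> \<open>\<open>phi K i\<close> is \<open>\<phi>\<^bsub>(i,i+1)\<^esub>\<close>\<close>
  Gam :: "real \<Rightarrow> real"
  mu_lo :: real
  mu_bar :: "real \<times> real \<Rightarrow> real \<Rightarrow> real"
  mu1_bar :: "real \<times> real \<Rightarrow> real \<Rightarrow> real"
  mu1a_bar :: "real \<Rightarrow> real"
  mu1_tilde :: "real \<times> real \<Rightarrow> real \<Rightarrow> real"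
  mu2_bar :: "real \<times> real \<Rightarrow> real \<Rightarrow> real"
  alpha_psi :: "real \<Rightarrow> real"
  Gam2 :: "real \<Rightarrow> real"
  gam_s :: "real \<times> real \<Rightarrow> real \<Rightarrow> real"
  gam_s_bar :: "real \<Rightarrow> real"
  V_lo :: real
  k_bar :: real
  Delta_bar :: real
  S_psi :: "(real ^ 'p) set"

record ('n, 'p) plant =
  drift :: "nat \<Rightarrow> real \<Rightarrow> real ^ 'n \<Rightarrow> real" \<comment> \<open>\<open>drift P i\<close> is \<open>\<phi>\<^sub>i\<close>\<close>
  mu :: "real \<Rightarrow> real ^ 'n \<Rightarrow> real ^ 'p \<Rightarrow> real \<Rightarrow> real"
  q_psi :: "real \<Rightarrow> real ^ 'n \<Rightarrow> real ^ 'p \<Rightarrow> real \<Rightarrow> real ^ 'n \<Rightarrow> real ^ 'p \<Rightarrow> real \<Rightarrow> real ^ 'p"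
  delay :: "real \<Rightarrow> real"

record 'm ctrl =
  a_theta :: real
  g_gain :: "nat \<Rightarrow> real \<Rightarrow> real"
  k_gain :: "nat \<Rightarrow> real \<Rightarrow> real"
  theta1 :: "real \<Rightarrow> real" \<comment> \<open>\<open>\<vartheta>\<^sub>1\<close>\<close>
  lam :: "real \<Rightarrow> real"
  R_fun :: "real \<Rightarrow> real \<Rightarrow> real \<Rightarrow> real"
  Om_fun :: "real \<Rightarrow> real \<Rightarrow> real \<Rightarrow> real \<Rightarrow> real"
  Ru_fun :: "real \<times> real \<Rightarrow> real \<Rightarrow> real \<Rightarrow> real \<Rightarrow> real \<Rightarrow> real \<Rightarrow> real ^ 'm \<Rightarrow> real"
  Omu_fun :: "real \<times> real \<Rightarrow> real \<Rightarrow> real \<Rightarrow> real \<Rightarrow> real \<Rightarrow> real \<Rightarrow> real ^ 'm \<Rightarrow> real \<Rightarrow> real"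
  Q_theta :: "real \<Rightarrow> real"

definition outp :: "(nat \<Rightarrow> 'n::finite) \<Rightarrow> nat \<Rightarrow> real ^ 'n \<Rightarrow> real \<times> real" where
  "outp ix n x = (x $ ix 1, x $ ix n)"

definition phi_lower_bound :: "nat \<Rightarrow> 'p::finite known \<Rightarrow> bool" where
  "phi_lower_bound n K \<longleftrightarrow> (\<exists>\<sigma>>0. \<forall>i\<in>{1..n-1}. \<forall>s. \<sigma> \<le> phi K i s)"

definition cascading_dominance :: "nat \<Rightarrow> 'p::finite known \<Rightarrow> bool" where
  "cascading_dominance n K \<longleftrightarrow>
     (\<exists>(\<rho>1 :: nat \<Rightarrow> real) (\<rho>2 :: nat \<Rightarrow> real). \<forall>i\<in>{3..n-1}. 0 < \<rho>1 i \<and> 0 < \<rho>2 i \<and>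
        (\<forall>s. \<rho>1 i * phi K (i - 1) s \<le> phi K i s \<and> phi K i s \<le> \<rho>2 i * phi K (i - 1) s))"

text \<open>
  Without some local boundedness of \<open>Gam2\<close> and \<open>gam_s_bar\<close> the bounds they enter give no
  information near a point where they blow up, so they are taken to be continuous, like the other
  known functions. Continuity of \<open>gam_s\<close> is not needed.
\<close>

definition known_regular :: "nat \<Rightarrow> 'p::finite known \<Rightarrow> bool" where
  "known_regular n K \<longleftrightarrow>
     (\<forall>i\<in>{1..n-1}. continuous_on UNIV (phi K i)) \<and>
     continuous_on UNIV (Gam K) \<and> (\<forall>s. 0 \<le> Gam K s) \<and>
     0 < mu_lo K \<and>
     continuous_on UNIV (\<lambda>(y, u). mu_bar K y u) \<and> (\<forall>y u. 0 \<le> mu_bar K y u) \<and>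
     continuous_on UNIV (\<lambda>(y, u). mu1_bar K y u) \<and> (\<forall>y u. 0 \<le> mu1_bar K y u) \<and>
     continuous_on UNIV (mu1a_bar K) \<and> (\<forall>s. 0 \<le> mu1a_bar K s) \<and>
     continuous_on UNIV (\<lambda>(y, u). mu1_tilde K y u) \<and> (\<forall>y u. 0 \<le> mu1_tilde K y u) \<and>
     continuous_on UNIV (\<lambda>(y, u). mu2_bar K y u) \<and> (\<forall>y u. 0 \<le> mu2_bar K y u) \<and>
     class_K_infinity (alpha_psi K) \<and>
     continuous_on UNIV (Gam2 K) \<and> (\<forall>s. 0 \<le> Gam2 K s) \<and>
     (\<forall>y u. 0 \<le> gam_s K y u) \<and>
     continuous_on UNIV (gam_s_bar K) \<and> (\<forall>s. 0 \<le> gam_s_bar K s) \<and>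
     0 < V_lo K \<and> 0 < k_bar K \<and>
     0 < Delta_bar K \<and> Delta_bar K < 1"

text \<open>
  Signals are functions on the whole time axis; their values at negative times are the initial
  history that the delayed arguments refer to. The history of \<open>\<psi>\<close> is required to take values in
  a set \<open>H\<close>, about which nothing is assumed (\<open>H = UNIV\<close> is allowed). The history of \<open>u\<close> need
  not match the value \<open>u(0)\<close> produced by the controller.
\<close>

definition admissible_past ::
  "'p::finite known \<Rightarrow> (real ^ 'p) set \<Rightarrow> (real \<Rightarrow> real ^ 'n::finite) \<Rightarrow> (real \<Rightarrow> real ^ 'p) \<Rightarrow>
     (real \<Rightarrow> real) \<Rightarrow> bool" where
  "admissible_past K H x \<psi> u \<longleftrightarrow>
     continuous_on {..0} x \<and>
     continuous_on {..0} \<psi> \<and> \<psi> 0 \<in> S_psi K \<and> (\<forall>s<0. \<psi> s \<in> H) \<and>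
     continuous_on {..<0} u \<and> (\<exists>L. (u \<longlongrightarrow> L) (at_left 0))"

definition horizon :: "ereal \<Rightarrow> real set" where
  "horizon T = {t. 0 \<le> t \<and> ereal t < T}"

text \<open>
  The equation for \<open>\<psi>\<close> is not imposed at an instant where the delayed time is 0, since \<open>u\<close> may
  jump there; \<open>\<psi>\<close> is continuous throughout. As the delay has derivative less than 1, there is at
  most one such instant.
\<close>

definition plant_solution ::
  "(nat \<Rightarrow> 'n::finite) \<Rightarrow> nat \<Rightarrow> 'p::finite known \<Rightarrow> ('n, 'p) plant \<Rightarrow> (real ^ 'p) set \<Rightarrow> ereal \<Rightarrow>
     (real \<Rightarrow> real ^ 'n) \<Rightarrow> (real \<Rightarrow> real ^ 'p) \<Rightarrow> (real \<Rightarrow> real) \<Rightarrow> bool" where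
  "plant_solution ix n K P H T x \<psi> u \<longleftrightarrow>
     admissible_past K H x \<psi> u \<and>
     continuous_on (horizon T) u \<and>
     continuous_on (horizon T) \<psi> \<and>
     (\<forall>t\<in>horizon T.
        (\<forall>i\<in>{1..n-1}. ((\<lambda>s. x s $ ix i) has_real_derivative
             phi K i (x t $ ix 1) * x t $ ix (i + 1) + drift P i t (x t)) (at t within {0..})) \<and>
        ((\<lambda>s. x s $ ix n) has_real_derivative mu P t (x t) (\<psi> t) (u t)) (at t within {0..}) \<and>
        (let d = t - delay P t in d \<noteq> 0 \<longrightarrow>
           (\<psi> has_vector_derivative q_psi P t (x t) (\<psi> t) (u t) (x d) (\<psi> d) (u d))
             (at t within {0..})))"

text \<open>
  \<open>psi_values\<close> is the set of possible values of \<open>\<psi>\<close> over all time. It is formed over all inputs \<open>u\<close>,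
  since it must not depend on the controller; history values are not counted.
\<close>

definition psi_values ::
  "(nat \<Rightarrow> 'n::finite) \<Rightarrow> nat \<Rightarrow> 'p::finite known \<Rightarrow> ('n, 'p) plant \<Rightarrow> (real ^ 'p) set \<Rightarrow>
     (real ^ 'p) set" where
  "psi_values ix n K P H =
     {\<psi> t | x \<psi> u T t. plant_solution ix n K P H T x \<psi> u \<and> t \<in> horizon T}"

definition locally_well_posed ::
  "(nat \<Rightarrow> 'n::finite) \<Rightarrow> nat \<Rightarrow> 'p::finite known \<Rightarrow> ('n, 'p) plant \<Rightarrow> (real ^ 'p) set \<Rightarrow> bool" where
  "locally_well_posed ix n K P H \<longleftrightarrow>
     (\<forall>x0 \<psi>0 u. admissible_past K H x0 \<psi>0 u \<and> continuous_on {0..} u \<longrightarrow>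
        (\<exists>T>0. \<exists>x \<psi>. plant_solution ix n K P H T x \<psi> u \<and> (\<forall>t\<le>0. x t = x0 t \<and> \<psi> t = \<psi>0 t))) \<and>
     (\<forall>T x \<psi> x' \<psi>' u. plant_solution ix n K P H T x \<psi> u \<and> plant_solution ix n K P H T x' \<psi>' u \<and>
        (\<forall>t\<le>0. x t = x' t \<and> \<psi> t = \<psi>' t) \<longrightarrow>
        (\<forall>t\<in>horizon T. x t = x' t \<and> \<psi> t = \<psi>' t))"

definition plant_continuous :: "nat \<Rightarrow> ('n::finite, 'p::finite) plant \<Rightarrow> bool" where
  "plant_continuous n P \<longleftrightarrow>
     (\<forall>i\<in>{1..n-1}. continuous_on UNIV (\<lambda>(t, x). drift P i t x)) \<and>
     continuous_on UNIV (\<lambda>(t, x, \<psi>, u). mu P t x \<psi> u) \<and>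
     continuous_on UNIV (\<lambda>(t, x, \<psi>, u, xd, \<psi>d, ud). q_psi P t x \<psi> u xd \<psi>d ud)"

definition drift_bound ::
  "(nat \<Rightarrow> 'n::finite) \<Rightarrow> nat \<Rightarrow> 'p::finite known \<Rightarrow> ('n, 'p) plant \<Rightarrow> real \<Rightarrow> bool" where
  "drift_bound ix n K P \<theta> \<longleftrightarrow>
     (\<forall>t\<ge>0. \<forall>x. \<forall>i\<in>{1..n-1}.
        \<bar>drift P i t x\<bar> \<le> Gam K (x $ ix 1) * (\<theta> * \<bar>x $ ix 1\<bar> + (\<Sum>j=2..i. \<bar>x $ ix j\<bar>)))"

text \<open>
  The partial derivatives of \<open>\<mu>\<close> are the blocks \<open>Dt\<close>, \<open>Dx\<close>, \<open>D\<psi>\<close>, \<open>Du\<close> of its total derivative,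
  the row vectors \<open>Dx\<close> and \<open>D\<psi>\<close> being represented as gradients. The delayed arguments of
  \<open>q_psi\<close> range over all values that they can take; for \<open>\<psi>(t - \<Delta>)\<close> these are the values of \<open>\<psi>\<close>
  at nonnegative times (\<open>Sb\<close>) and those of its initial history (\<open>H\<close>).
\<close>

definition mu_bounds ::
  "(nat \<Rightarrow> 'n::finite) \<Rightarrow> nat \<Rightarrow> 'p::finite known \<Rightarrow> ('n, 'p) plant \<Rightarrow> (real ^ 'p) set \<Rightarrow>
     (real ^ 'p) set \<Rightarrow> real \<Rightarrow> (real ^ 'p \<Rightarrow> real) \<Rightarrow> (real ^ 'p \<Rightarrow> real) \<Rightarrow> (real ^ 'p \<Rightarrow> real) \<Rightarrow>
     bool" where
  "mu_bounds ix n K P Sb H \<theta> m1 m1t m2 \<longleftrightarrow>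
     (\<forall>\<psi>. 0 \<le> m1 \<psi> \<and> 0 \<le> m1t \<psi> \<and> 0 \<le> m2 \<psi>) \<and>
     (\<forall>t x. \<forall>\<psi>\<in>Sb.
        filterlim (\<lambda>u. \<bar>mu P t x \<psi> u\<bar>) at_top at_infinity \<and>
        (\<forall>u. \<bar>mu P t x \<psi> u\<bar> \<le> mu_bar K (outp ix n x) u \<and>
          (\<exists>Dt Dx D\<psi> Du.
             ((\<lambda>(t, x, \<psi>, u). mu P t x \<psi> u) has_derivative
               (\<lambda>(ht, hx, h\<psi>, hu). Dt * ht + Dx \<bullet> hx + D\<psi> \<bullet> h\<psi> + Du * hu)) (at (t, x, \<psi>, u)) \<and>
             mu_lo K \<le> Du \<and>
             (\<forall>xd. \<forall>\<psi>d \<in> Sb \<union> H. \<forall>ud.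
               \<bar>D\<psi> \<bullet> q_psi P t x \<psi> u xd \<psi>d ud\<bar> \<le> mu1_bar K (outp ix n x) u *
                 ((mu1a_bar K (x $ ix 1) *
                     (\<theta> * \<bar>x $ ix 1\<bar> + (\<Sum>j=2..n. \<bar>x $ ix j\<bar>)) + m1 \<psi>) +
                  (mu1a_bar K (xd $ ix 1) *
                     (\<theta> * \<bar>xd $ ix 1\<bar> + (\<Sum>j=2..n. \<bar>xd $ ix j\<bar>)) + m1 \<psi>d))) \<and>
             \<bar>Dt\<bar> \<le> mu1_tilde K (outp ix n x) u *
                 (\<theta> * \<bar>x $ ix 1\<bar> + (\<Sum>j=2..n. \<bar>x $ ix j\<bar>) + m1t \<psi>) \<and>
             norm Dx \<le> mu2_bar K (outp ix n x) u + m2 \<psi>)))"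

text \<open>
  ``Lyapunov function'' has its usual global meaning: differentiable, positive definite and
  radially unbounded.
\<close>

definition lyapunov_candidate :: "(real ^ 'p::finite \<Rightarrow> real) \<Rightarrow> bool" where
  "lyapunov_candidate V \<longleftrightarrow>
     (\<forall>\<psi>. \<exists>D. GDERIV V \<psi> :> D) \<and> V 0 = 0 \<and> (\<forall>\<psi>. \<psi> \<noteq> 0 \<longrightarrow> 0 < V \<psi>) \<and>
     filterlim V at_top at_infinity"

definition psi_dissipation ::
  "(nat \<Rightarrow> 'n::finite) \<Rightarrow> nat \<Rightarrow> 'p::finite known \<Rightarrow> ('n, 'p) plant \<Rightarrow> (real ^ 'p) set \<Rightarrow>
     (real ^ 'p) set \<Rightarrow> real \<Rightarrow> (real ^ 'p \<Rightarrow> real) \<Rightarrow> (real ^ 'p \<Rightarrow> real) \<Rightarrow> (real ^ 'p \<Rightarrow> real) \<Rightarrow>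
     bool" where
  "psi_dissipation ix n K P Sb H \<theta> m1 m1t m2 \<longleftrightarrow>
     (\<exists>V. lyapunov_candidate V \<and>
        (\<forall>t\<ge>0. \<forall>x u. \<forall>\<psi>\<in>Sb. \<forall>D. GDERIV V \<psi> :> D \<longrightarrow>
           (\<forall>xd. \<forall>\<psi>d \<in> Sb \<union> H. \<forall>ud.
              D \<bullet> q_psi P t x \<psi> u xd \<psi>d ud \<le> - alpha_psi K (norm \<psi>) +
                (Gam2 K (x $ ix 1) * (\<theta> * (x $ ix 1)\<^sup>2 + (\<Sum>j=2..n. (x $ ix j)\<^sup>2) +
                    gam_s K (outp ix n x) u) +
                 Gam2 K (xd $ ix 1) * (\<theta> * (xd $ ix 1)\<^sup>2 + (\<Sum>j=2..n. (xd $ ix j)\<^sup>2) +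
                    gam_s K (outp ix n xd) ud)))) \<and>
        (\<forall>\<psi>. V_lo K * V \<psi> \<le> alpha_psi K (norm \<psi>))) \<and>
     (\<forall>t\<ge>0. \<forall>x u. \<forall>\<psi>\<in>Sb. gam_s K (outp ix n x) u \<le> gam_s_bar K (x $ ix 1) * \<bar>mu P t x \<psi> u\<bar>\<^sup>2) \<and>
     (\<forall>\<psi>. (m1 \<psi>)\<^sup>2 + (m1t \<psi>)\<^sup>2 + (m2 \<psi>)\<^sup>2 \<le> k_bar K * alpha_psi K (norm \<psi>))"

definition delay_bound :: "'p::finite known \<Rightarrow> ('n::finite, 'p::finite) plant \<Rightarrow> bool" where
  "delay_bound K P \<longleftrightarrow>
     (\<exists>M. \<forall>t\<ge>0. 0 \<le> delay P t \<and> delay P t \<le> M) \<and>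
     (\<forall>t\<ge>0. \<exists>D. (delay P has_real_derivative D) (at t within {0..}) \<and> \<bar>D\<bar> \<le> Delta_bar K)"

definition admissible_plant ::
  "(nat \<Rightarrow> 'n::finite) \<Rightarrow> nat \<Rightarrow> 'p::finite known \<Rightarrow> ('n, 'p) plant \<Rightarrow> (real ^ 'p) set \<Rightarrow> bool" where
  "admissible_plant ix n K P H \<longleftrightarrow>
     plant_continuous n P \<and> locally_well_posed ix n K P H \<and> delay_bound K P \<and>
     (\<exists>\<theta> m1 m1t m2. 0 \<le> \<theta> \<and> drift_bound ix n K P \<theta> \<and>
        mu_bounds ix n K P (psi_values ix n K P H) H \<theta> m1 m1t m2 \<and>
        psi_dissipation ix n K P (psi_values ix n K P H) H \<theta> m1 m1t m2)"

definition controller_regular :: "nat \<Rightarrow> 'm::finite ctrl \<Rightarrow> bool" where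
  "controller_regular n C \<longleftrightarrow>
     0 < a_theta C \<and>
     (\<forall>i\<in>{2..n}. continuous_on UNIV (g_gain C i) \<and> continuous_on UNIV (k_gain C i)) \<and>
     continuous_on UNIV (theta1 C) \<and> (\<forall>s. 0 \<le> theta1 C s) \<and>
     continuous_on UNIV (lam C) \<and> (\<forall>s. 0 \<le> lam C s) \<and>
     continuous_on UNIV (\<lambda>(x1, th, thd). R_fun C x1 th thd) \<and>
     (\<forall>x1 th thd. 0 \<le> R_fun C x1 th thd) \<and>
     continuous_on UNIV (\<lambda>(x1, th, thd, r). Om_fun C x1 th thd r) \<and>
     (\<forall>x1 th thd r. 0 \<le> Om_fun C x1 th thd r) \<and>
     continuous_on UNIV (\<lambda>(y, u, r, rd, th, thd, w). Ru_fun C y u r rd th thd w) \<and>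
     (\<forall>y u r rd th thd w. 0 \<le> Ru_fun C y u r rd th thd w) \<and>
     continuous_on UNIV (\<lambda>(y, u, r, rd, th, thd, w, ru). Omu_fun C y u r rd th thd w ru) \<and>
     (\<forall>y u r rd th thd w ru. 0 \<le> Omu_fun C y u r rd th thd w ru) \<and>
     continuous_on UNIV (Q_theta C) \<and> (\<forall>s. 0 \<le> Q_theta C s)"

definition f_obs :: "'p::finite known \<Rightarrow> 'm::finite ctrl \<Rightarrow> nat \<Rightarrow> real \<Rightarrow> real" where
  "f_obs K C i x1 = (LBINT s=ereal 0..ereal x1. g_gain C i s / phi K 1 s)"

definition vartheta :: "'m::finite ctrl \<Rightarrow> real \<Rightarrow> real \<Rightarrow> real" where
  "vartheta C x1 th = th * x1 * theta1 C x1"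

definition varpi ::
  "(nat \<Rightarrow> 'm::finite) \<Rightarrow> nat \<Rightarrow> 'p::finite known \<Rightarrow> 'm ctrl \<Rightarrow> real \<Rightarrow> real ^ 'm \<Rightarrow> real \<Rightarrow> real \<Rightarrow>
     real ^ 'm" where
  "varpi jx n K C x1 xh r th =
     (\<chi> j. let i = inv_into {2..n} jx j in
        if i = 2 then (xh $ j + r * f_obs K C 2 x1 + vartheta C x1 th) / r
        else (xh $ j + r ^ (i - 1) * f_obs K C i x1) / r ^ (i - 1))"

definition u_tilde ::
  "(nat \<Rightarrow> 'm::finite) \<Rightarrow> nat \<Rightarrow> 'p::finite known \<Rightarrow> 'm ctrl \<Rightarrow> real \<Rightarrow> real ^ 'm \<Rightarrow> real \<Rightarrow> real \<Rightarrow>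
     real" where
  "u_tilde jx n K C x1 xh r th =
     - (r ^ n) * (\<Sum>i=2..n. k_gain C i x1 * varpi jx n K C x1 xh r th $ jx i)"

definition r_dot :: "'m::finite ctrl \<Rightarrow> real \<Rightarrow> real \<Rightarrow> real \<Rightarrow> real" where
  "r_dot C x1 r th =
     lam C (R_fun C x1 th (Q_theta C x1) - r) * Om_fun C x1 th (Q_theta C x1) r"

definition ru_dot ::
  "(nat \<Rightarrow> 'm::finite) \<Rightarrow> nat \<Rightarrow> 'p::finite known \<Rightarrow> 'm ctrl \<Rightarrow> real \<times> real \<Rightarrow> real \<Rightarrow> real ^ 'm \<Rightarrow>
     real \<Rightarrow> real \<Rightarrow> real \<Rightarrow> real" where
  "ru_dot jx n K C y u xh r ru th =
     (let x1 = fst y; rd = r_dot C x1 r th; thd = Q_theta C x1; w = varpi jx n K C x1 xh r th in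
        lam C (Ru_fun C y u r rd th thd w - ru) * Omu_fun C y u r rd th thd w ru)"

record ('n, 'p, 'm) signals =
  x_sig :: "real \<Rightarrow> real ^ 'n"
  psi_sig :: "real \<Rightarrow> real ^ 'p"
  u_sig :: "real \<Rightarrow> real"
  xh_sig :: "real \<Rightarrow> real ^ 'm"
  zeta_sig :: "real \<Rightarrow> real"
  r_sig :: "real \<Rightarrow> real"
  ru_sig :: "real \<Rightarrow> real"
  th_sig :: "real \<Rightarrow> real"

text \<open>Only the values at nonpositive times (for \<open>u_sig\<close>: negative times) matter here.\<close>

definition admissible_initial ::
  "'p::finite known \<Rightarrow> 'm::finite ctrl \<Rightarrow> (real ^ 'p) set \<Rightarrow> ('n::finite, 'p, 'm) signals \<Rightarrow>
     bool" where
  "admissible_initial K C H w \<longleftrightarrow>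
     admissible_past K H (x_sig w) (psi_sig w) (u_sig w) \<and>
     1 \<le> r_sig w 0 \<and> 1 \<le> ru_sig w 0 \<and> a_theta C \<le> th_sig w 0"

definition same_initial ::
  "('n::finite, 'p::finite, 'm::finite) signals \<Rightarrow> ('n, 'p, 'm) signals \<Rightarrow> bool" where
  "same_initial w w' \<longleftrightarrow>
     (\<forall>t\<le>0. x_sig w t = x_sig w' t \<and> psi_sig w t = psi_sig w' t) \<and>
     (\<forall>t<0. u_sig w t = u_sig w' t) \<and>
     xh_sig w 0 = xh_sig w' 0 \<and> zeta_sig w 0 = zeta_sig w' 0 \<and>
     r_sig w 0 = r_sig w' 0 \<and> ru_sig w 0 = ru_sig w' 0 \<and> th_sig w 0 = th_sig w' 0"

definition same_on_horizon ::
  "ereal \<Rightarrow> ('n::finite, 'p::finite, 'm::finite) signals \<Rightarrow> ('n, 'p, 'm) signals \<Rightarrow> bool" where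
  "same_on_horizon T w w' \<longleftrightarrow>
     (\<forall>t\<in>horizon T. x_sig w t = x_sig w' t \<and> psi_sig w t = psi_sig w' t \<and> u_sig w t = u_sig w' t \<and>
        xh_sig w t = xh_sig w' t \<and> zeta_sig w t = zeta_sig w' t \<and> r_sig w t = r_sig w' t \<and>
        ru_sig w t = ru_sig w' t \<and> th_sig w t = th_sig w' t)"

definition closed_loop_solution ::
  "(nat \<Rightarrow> 'n::finite) \<Rightarrow> (nat \<Rightarrow> 'm::finite) \<Rightarrow> nat \<Rightarrow> 'p::finite known \<Rightarrow> 'm ctrl \<Rightarrow>
     ('n, 'p) plant \<Rightarrow> (real ^ 'p) set \<Rightarrow> ereal \<Rightarrow> ('n, 'p, 'm) signals \<Rightarrow> bool" where
  "closed_loop_solution ix jx n K C P H T w \<longleftrightarrow>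
     admissible_initial K C H w \<and>
     plant_solution ix n K P H T (x_sig w) (psi_sig w) (u_sig w) \<and>
     (\<forall>t\<in>horizon T.
        (let x1 = x_sig w t $ ix 1; xn = x_sig w t $ ix n; y = outp ix n (x_sig w t);
             u = u_sig w t; xh = xh_sig w t; r = r_sig w t; ru = ru_sig w t; th = th_sig w t;
             rd = r_dot C x1 r th; rud = ru_dot jx n K C y u xh r ru th;
             ut = u_tilde jx n K C x1 xh r th;
             innov = xh $ jx 2 + r * f_obs K C 2 x1 in
           u = zeta_sig w t - ru * xn \<and>
           (\<forall>i\<in>{2..n-1}. ((\<lambda>s. xh_sig w s $ jx i) has_real_derivative
               phi K i x1 * (xh $ jx (i + 1) + r ^ i * f_obs K C (i + 1) x1)
               - r ^ (i - 1) * g_gain C i x1 * innov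
               - real (i - 1) * rd * r ^ (i - 2) * f_obs K C i x1) (at t within {0..})) \<and>
           ((\<lambda>s. xh_sig w s $ jx n) has_real_derivative
               ut - r ^ (n - 1) * g_gain C n x1 * innov
               - real (n - 1) * rd * r ^ (n - 2) * f_obs K C n x1) (at t within {0..}) \<and>
           (zeta_sig w has_real_derivative rud * xn + ru * ut) (at t within {0..}) \<and>
           (r_sig w has_real_derivative rd) (at t within {0..}) \<and>
           (ru_sig w has_real_derivative rud) (at t within {0..}) \<and>
           (th_sig w has_real_derivative Q_theta C x1) (at t within {0..})))"

definition signals_bounded :: "('n::finite, 'p::finite, 'm::finite) signals \<Rightarrow> bool" where
  "signals_bounded w \<longleftrightarrow>
     bounded (x_sig w ` {0..}) \<and> bounded (psi_sig w ` {0..}) \<and> bounded (u_sig w ` {0..}) \<and>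
     bounded (xh_sig w ` {0..}) \<and> bounded (zeta_sig w ` {0..}) \<and> bounded (r_sig w ` {0..}) \<and>
     bounded (ru_sig w ` {0..}) \<and> bounded (th_sig w ` {0..})"

definition signals_converge :: "('n::finite, 'p::finite, 'm::finite) signals \<Rightarrow> bool" where
  "signals_converge w \<longleftrightarrow>
     (x_sig w \<longlongrightarrow> 0) at_top \<and> (psi_sig w \<longlongrightarrow> 0) at_top \<and> (xh_sig w \<longlongrightarrow> 0) at_top"

end

theory Submission
  imports Defs "HOL-Complex_Analysis.Great_Picard"
begin

text \<open>
  The controller is a dual dynamic high-gain design. Let \<open>\<epsilon>\<^sub>i\<close> be the error of the observer in
  \<open>x\<^sub>i\<close>, divided by \<open>r ^ (i-1)\<close>, and \<open>\<omega>\<^sub>i\<close> the scaled estimate \<open>\<varpi>\<^sub>i\<close>. Both vectors obey chains of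
  integrators with output injection resp. state feedback, whose coefficients are \<open>r\<close> times
  \<open>\<phi>\<^bsub>(2,3)\<^esub>(x\<^sub>1)\<close> times ratios that cascading dominance confines to a compact interval. One quadratic form
  per chain decreases for all such coefficients (\<open>observer_lyapunov_exists\<close>,
  \<open>feedback_lyapunov_exists\<close>), and these forms can be chosen so that a growing \<open>r\<close> only helps. With
  \<open>x\<^sub>1\<^sup>2 / 2\<close> added they form the core of the storage function. The damping
  \<open>\<theta>hat x\<^sub>1 \<vartheta>\<^sub>1(x\<^sub>1)\<close> together with \<open>(\<theta>hat - 2 - \<theta>\<^sup>2)\<^sup>2 / 2\<close> takes care of the unknown \<open>\<theta>\<close>.

  The control enters through \<open>u = \<zeta> - r\<^sub>u x\<^sub>n\<close>, which gives \<open>u' = - r\<^sub>u (\<mu> - utilde)\<close>. Hence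
  \<open>s = \<mu> - utilde\<close> satisfies a scalar equation with damping at least \<open>\<mu>lo r\<^sub>u\<close>, where \<open>\<mu>lo\<close> is the
  lower bound of \<open>\<partial>\<mu>/\<partial>u\<close>. It contributes \<open>s\<^sup>2 / (2 sqrt r\<^sub>u)\<close>, and \<open>\<psi>\<close> contributes
  \<open>V(\<psi>) / r ^ (2n)\<close>, so that what \<open>x\<close> and \<open>\<mu>\<close> feed into \<open>\<psi>\<close> is scaled back to the size of
  \<open>\<epsilon>\<close>, \<open>\<omega>\<close> and \<open>s\<close>.

  The remaining terms have coefficients \<open>W\<^sub>1(x\<^sub>1, \<theta>hat)\<close> and \<open>W\<^sub>2(...)\<close> that are known but unbounded.
  When \<open>r \<ge> R\<close> the dissipation of order \<open>r\<^sup>2\<close> dominates the first. When \<open>r < R\<close> one has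
  \<open>r' = r\<^sup>2 W\<^sub>1\<close>, and multiplying the storage function by \<open>exp (c / r)\<close> produces the term
  \<open>- c W\<^sub>1\<close> times the storage function; but \<open>1 / r\<close> is bounded, so this weight stays between two
  constants. The pair \<open>(r\<^sub>u, R\<^sub>u)\<close> is used in the same way. The constant \<open>\<theta>\<close> may occur in the
  exponent since the weight is not part of the controller. Delayed terms are moved to the present
  by the substitution \<open>s = t - \<Delta>(t)\<close>, whose Jacobian is controlled by the bound on \<open>\<Delta>'\<close>; all weights are
  non-increasing in time, so that nothing is lost in this step.

  The resulting inequality \<open>energy_bound\<close> bounds \<open>x\<^sub>1\<close>, \<open>\<theta>hat\<close>, \<open>\<epsilon>\<close> and \<open>\<omega>\<close>. Then \<open>r\<close> is
  bounded because it does not grow above \<open>R + 1\<close>, hence \<open>x\<close> and \<open>\<psi>\<close> are; a second Lyapunov argument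
  bounds \<open>s\<close> without reference to the size of \<open>r\<^sub>u\<close> (\<open>tracking_error_bound\<close>), hence \<open>\<mu>\<close> and, by
  the lower bound on its slope, \<open>u\<close>; finally \<open>R\<^sub>u\<close> and so \<open>r\<^sub>u\<close> are bounded. These bounds depend on
  the initial data only (\<open>uniform_bound\<close>). Outside the ball that they define the equations may be
  truncated, and Peano's theorem for delay equations then continues every solution to all times.
  Convergence follows from the integrability of the dissipation by a one-sided Barbalat argument.
\<close>

section \<open>Analytic preliminaries\<close>

lemma has_real_derivative_max0_sq: "((\<lambda>y::real. (max 0 y)^2) has_real_derivative 2 * max 0 y) (at y)"
proof -
  consider "y > 0" | "y < 0" | "y = 0" by linarith
  then show ?thesis
  proof cases
    case 1
    have "((\<lambda>y::real. y^2) has_real_derivative 2 * y) (at y)"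
      by (auto intro!: derivative_eq_intros)
    then have "((\<lambda>y::real. (max 0 y)^2) has_real_derivative 2 * y) (at y)"
      by (rule has_field_derivative_transform_within_open[of _ _ _ "{0<..}"]) (use 1 in auto)
    then show ?thesis using 1 by simp
  next
    case 2
    have "((\<lambda>y::real. 0::real) has_real_derivative 0) (at y)" by simp
    then have "((\<lambda>y::real. (max 0 y)^2) has_real_derivative 0) (at y)"
      by (rule has_field_derivative_transform_within_open[of _ _ _ "{..<0}"]) (use 2 in auto)
    then show ?thesis using 2 by simp
  next
    case 3
    have "((\<lambda>h. ((max 0 (0+h))^2 - (max 0 0)^2) / h) \<longlongrightarrow> (0::real)) (at 0)"
    proof (rule Lim_null_comparison[where g = "\<lambda>h. \<bar>h\<bar>"])
      show "\<forall>\<^sub>F h in at 0. norm (((max 0 (0 + h))^2 - (max 0 0)^2) / h) \<le> \<bar>h::real\<bar>"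
        by (auto simp: max_def power2_eq_square intro!: always_eventually)
      show "((\<lambda>h::real. \<bar>h\<bar>) \<longlongrightarrow> 0) (at 0)" by (intro tendsto_eq_intros) auto
    qed
    then show ?thesis using 3 by (simp add: DERIV_def)
  qed
qed

text \<open>
  On every compact set only finitely many of the functions
  \<open>c\<^sub>k max 0 (x\<^sup>2 + 2 - k)\<^sup>2\<close> are nonzero, and at each \<open>x\<close> the one with \<open>\<bar>x\<bar> \<le> k \<le> x\<^sup>2 + 1\<close>
  already exceeds a bound \<open>c\<^sub>k\<close> of \<open>q\<close> on \<open>[-k, k]\<close>. The gains of the controller are replaced
  by such majorants, since their derivatives enter the error equations.
\<close>

lemma C1_majorant:
  fixes q :: "real => real"
  assumes q: "continuous_on UNIV q"
  shows "\<exists>h h'. (\<forall>x. (h has_real_derivative h' x) (at x)) \<and> continuous_on UNIV h' \<and>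
    (\<forall>x. q x \<le> h x \<and> 0 \<le> h x)"
proof -
  have "\<exists>c. \<forall>x\<in>{- real k..real k}. \<bar>q x\<bar> \<le> c" for k
  proof -
    have "compact (q ` {- real k..real k})"
      using q by (intro compact_continuous_image) (auto intro: continuous_on_subset)
    then show ?thesis using bounded_iff[of "q ` {- real k..real k}"] compact_imp_bounded by auto
  qed
  then obtain c where c: "\<And>k x. \<bar>x\<bar> \<le> real k ==> \<bar>q x\<bar> \<le> c k"
    by (metis abs_le_iff atLeastAtMost_iff minus_le_iff)
  have c0: "0 \<le> c k" for k using c[of 0 k] by simp
  define g where "g k x = c k * (max 0 (x^2 + 2 - real k))^2" for k x
  define g' where "g' k x = c k * (2 * max 0 (x^2 + 2 - real k) * (2 * x))" for k x
  define N where "N x = nat \<lceil>x^2 + 3\<rceil>" for x :: real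
  define h where "h x = (\<Sum>k<N x. g k x)" for x
  define h' where "h' x = (\<Sum>k<N x. g' k x)" for x
  have Ng: "real (N x) \<ge> x^2 + 3" for x unfolding N_def by (rule real_nat_ceiling_ge)
  have sum_eq: "h x = (\<Sum>k<m. g k x)" "h' x = (\<Sum>k<m. g' k x)" if "x^2 + 2 \<le> real m" for x m
  proof -
    have z: "g k x = 0 \<and> g' k x = 0" if "x^2 + 2 \<le> real k" for k
      using that by (simp add: g_def g'_def max_def)
    have "(\<Sum>k<N x. g k x) = (\<Sum>k<max m (N x). g k x)"
      by (rule sum.mono_neutral_left) (use z Ng[of x] in \<open>auto simp: not_less; force\<close>)+
    moreover have "(\<Sum>k<m. g k x) = (\<Sum>k<max m (N x). g k x)"
      by (rule sum.mono_neutral_left) (use z \<open>x^2 + 2 \<le> real m\<close> in \<open>auto simp: not_less; force\<close>)+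
    moreover have "(\<Sum>k<N x. g' k x) = (\<Sum>k<max m (N x). g' k x)"
      by (rule sum.mono_neutral_left) (use z Ng[of x] in \<open>auto simp: not_less; force\<close>)+
    moreover have "(\<Sum>k<m. g' k x) = (\<Sum>k<max m (N x). g' k x)"
      by (rule sum.mono_neutral_left) (use z \<open>x^2 + 2 \<le> real m\<close> in \<open>auto simp: not_less; force\<close>)+
    ultimately show "h x = (\<Sum>k<m. g k x)" "h' x = (\<Sum>k<m. g' k x)" by (auto simp: h_def h'_def)
  qed
  have dg: "(g k has_real_derivative g' k x) (at x)" for k x
  proof -
    have "((\<lambda>x. x^2 + 2 - real k) has_real_derivative 2 * x) (at x)"
      by (auto intro!: derivative_eq_intros)
    from DERIV_cmult[OF DERIV_chain2[OF has_real_derivative_max0_sq this], of "c k"]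
    show ?thesis by (simp add: g_def[abs_def] g'_def)
  qed
  have nb: "\<forall>\<^sub>F y in nhds x. y^2 + 2 \<le> real (N x)" for x
  proof -
    have "open {y::real. y^2 + 2 < real (N x)}" by (intro open_Collect_less continuous_intros)
    moreover have "x \<in> {y::real. y^2 + 2 < real (N x)}" using Ng[of x] by simp
    ultimately show ?thesis unfolding eventually_nhds by fastforce
  qed
  have "(h has_real_derivative h' x) (at x)" for x
  proof -
    have "((\<lambda>x. \<Sum>k<N x0. g k x) has_real_derivative (\<Sum>k<N x0. g' k x)) (at x)" for x0
      by (intro DERIV_sum dg)
    moreover have "\<forall>\<^sub>F y in nhds x. h y = (\<Sum>k<N x. g k y)"
      using nb[of x] by eventually_elim (rule sum_eq(1))
    ultimately show ?thesis using sum_eq(2)[of x "N x"] Ng[of x]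
      by (subst DERIV_cong_ev[OF refl _ refl]) (auto simp: h'_def)
  qed
  moreover have "continuous_on UNIV h'"
  proof -
    have "isCont h' x" for x
    proof -
      have "isCont (\<lambda>y. \<Sum>k<N x. g' k y) x" unfolding g'_def
        by (intro continuous_intros)
      moreover have "\<forall>\<^sub>F y in nhds x. h' y = (\<Sum>k<N x. g' k y)"
        using nb[of x] by eventually_elim (rule sum_eq(2))
      ultimately show ?thesis by (simp add: isCont_cong)
    qed
    then show ?thesis by (simp add: continuous_on_eq_continuous_at)
  qed
  moreover have "q x \<le> h x \<and> 0 \<le> h x" for x
  proof -
    define k where "k = nat \<lfloor>x^2 + 1\<rfloor>"
    have k: "real k \<le> x^2 + 1" "x^2 + 1 < real k + 1" unfolding k_def by (auto simp: floor_less_iff) linarith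
    have "\<bar>x\<bar> \<le> real k"
    proof (cases "\<bar>x\<bar> \<le> 1")
      case True
      have "1 \<le> k" unfolding k_def by (simp add: le_nat_iff le_floor_iff)
      then show ?thesis using True by linarith
    next
      case False
      have "\<bar>x\<bar> * 1 \<le> \<bar>x\<bar> * \<bar>x\<bar>" using False by (intro mult_left_mono) auto
      then have a: "\<bar>x\<bar> \<le> x^2" by (simp add: power2_eq_square)
      show ?thesis using a k by linarith
    qed
    then have "q x \<le> c k" using c by fastforce
    also have "c k * 1 \<le> g k x" unfolding g_def
      using k c0[of k] by (intro mult_left_mono) (auto simp: max_def)
    then have "c k \<le> g k x" by simp
    also have "g k x \<le> h x" unfolding h_def
      using c0 k Ng[of x] by (intro member_le_sum) (auto simp: g_def)
    finally show ?thesis using c0 by (auto simp: h_def g_def intro!: sum_nonneg)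
  qed
  ultimately show ?thesis by blast
qed

text \<open>
  The exceptional point \<open>e\<close> is the instant at which the delayed time passes 0; there the
  equation for \<open>\<psi>\<close> is not available.
\<close>

lemma nonincreasing_except_one:
  fixes f :: "real => real"
  assumes "a \<le> b" "continuous_on {a..b} f"
    "\<And>t. a < t ==> t < b ==> t \<noteq> e ==> \<exists>D\<le>0. (f has_real_derivative D) (at t)"
  shows "f b \<le> f a"
proof -
  have *: "f v \<le> f u" if "a \<le> u" "u \<le> v" "v \<le> b" "\<not> (u < e \<and> e < v)" for u v
    by (rule DERIV_nonpos_imp_decreasing_open[OF \<open>u \<le> v\<close>])
       (use assms that in \<open>force intro: continuous_on_subset\<close>)+
  show ?thesis
  proof (cases "a < e \<and> e < b")
    case True
    have "f b \<le> f e" by (rule *) (use True in auto)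
    also have "f e \<le> f a" by (rule *) (use True in auto)
    finally show ?thesis .
  next
    case False
    show ?thesis by (rule *) (use False assms(1) in auto)
  qed
qed

lemma stays_below:
  fixes f :: "real => real"
  assumes "0 \<le> b" "continuous_on {0..b} f" "f 0 \<le> m"
    "\<And>t. 0 < t ==> t < b ==> t \<noteq> e ==> m < f t ==> \<exists>D\<le>0. (f has_real_derivative D) (at t)"
  shows "f b \<le> m"
proof (rule ccontr)
  assume n: "\<not> f b \<le> m"
  define S where "S = {t\<in>{0..b}. f t \<le> m}"
  have "closed S" unfolding S_def
    by (rule continuous_on_closed_Collect_le) (use assms in \<open>auto intro: continuous_intros\<close>)
  moreover have "bounded S" by (rule bounded_subset[of "{0..b}"]) (auto simp: S_def)
  ultimately have S: "compact S" by (simp add: compact_eq_bounded_closed)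
  have "S \<noteq> {}" using assms by (auto simp: S_def)
  then obtain t0 where t0: "t0 \<in> S" "\<And>t. t \<in> S ==> t \<le> t0" using compact_attains_sup[OF S] by blast
  have "f b \<le> f t0"
  proof (rule nonincreasing_except_one[where e=e and f=f])
    show "t0 \<le> b" "continuous_on {t0..b} f" using t0 continuous_on_subset[OF assms(2), of "{t0..b}"] by (auto simp: S_def)
    fix t assume t: "t0 < t" "t < b" "t \<noteq> e"
    then have "t \<notin> S" using t0(2)[of t] by auto
    then show "\<exists>D\<le>0. (f has_real_derivative D) (at t)" using assms(4)[of t] t t0 by (auto simp: S_def)
  qed
  then show False using n t0 by (auto simp: S_def)
qed

text \<open>
  If \<open>f t \<ge> \<epsilon>\<close>, then \<open>f \<ge> \<epsilon> / 2\<close> on the interval of length \<open>\<epsilon> / (2 C)\<close> before \<open>t\<close>, which the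
  bound on the integral permits only finitely often. A bound on the slope
  from above is what differential inequalities for storage functions provide.
\<close>

lemma one_sided_barbalat:
  fixes f :: "real => real"
  assumes f0: "\<And>t. 0 \<le> t ==> 0 \<le> f t" and cf: "continuous_on {0..} f"
    and C: "0 < C" "\<And>s t. 0 \<le> s ==> s \<le> t ==> f t - f s \<le> C * (t - s)"
    and I: "\<And>t. 0 \<le> t ==> integral {0..t} f \<le> B"
  shows "(f \<longlongrightarrow> 0) at_top"
proof (rule tendstoI)
  fix \<epsilon> :: real assume e: "0 < \<epsilon>"
  define d where "d = \<epsilon> / (2 * C)"
  have d: "0 < d" using e C by (simp add: d_def)
  define G where "G t = integral {0..t} f" for t
  have ion: "f integrable_on {s..t}" if "0 \<le> s" for s t
    using that by (intro integrable_continuous_interval continuous_on_subset[OF cf]) auto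
  have comb: "G t = G s + integral {s..t} f" if "0 \<le> s" "s \<le> t" for s t
    unfolding G_def using that Henstock_Kurzweil_Integration.integral_combine[of 0 s t f] ion[of 0 t] by simp
  have mono: "G s \<le> G t" if "0 \<le> s" "s \<le> t" for s t
    using comb[OF that] that integral_nonneg[OF ion[of s t]] f0 by auto
  have bdd: "bdd_above (G ` {0..})" using I by (auto simp: G_def intro!: bdd_aboveI[of _ B])
  define L where "L = Sup (G ` {0..})"
  have "L - d * \<epsilon> / 2 < L" using d e by simp
  then obtain t0 where t0: "0 \<le> t0" "L - d * \<epsilon> / 2 < G t0"
    unfolding L_def using less_cSup_iff[OF _ bdd] by fastforce
  have "\<bar>f t\<bar> < \<epsilon>" if t: "t0 + d \<le> t" for t
  proof -
    have "d * (f t - C * d) \<le> integral {t - d..t} f"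
    proof -
      have "integral {t-d..t} (\<lambda>_. f t - C * d) \<le> integral {t - d..t} f"
      proof (rule integral_le)
        fix s assume s: "s \<in> {t - d..t}"
        then have "f t - f s \<le> C * (t - s)" using C(2)[of s t] t t0 by auto
        also have "... \<le> C * d" using s C by (intro mult_left_mono) auto
        finally show "f t - C * d \<le> f s" by simp
      qed (use ion t t0 in auto)
      then show ?thesis using d by simp
    qed
    also have "... = G t - G (t - d)" using comb[of "t-d" t] t t0 d by simp
    also have "... < d * \<epsilon> / 2"
    proof -
      have "G t \<le> L" unfolding L_def using t t0 d by (intro cSup_upper bdd) auto
      moreover have "G t0 \<le> G (t - d)" using t t0 by (intro mono) auto
      ultimately show ?thesis using t0 by linarith
    qed
    finally have "d * (f t - C * d) < d * (\<epsilon> / 2)" by simp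
    then have "f t - C * d < \<epsilon> / 2" using d by simp
    moreover have "C * d = \<epsilon> / 2" using C by (simp add: d_def)
    moreover have "0 \<le> f t" using f0[of t] t t0 d by auto
    ultimately show ?thesis by auto
  qed
  then show "\<forall>\<^sub>F x in at_top. dist (f x) 0 < \<epsilon>"
    unfolding eventually_at_top_linorder by (intro exI[of _ "t0 + d"]) auto
qed

lemma integrable_continuous_except_finite:
  fixes f :: "real => 'a::euclidean_space"
  assumes "finite E" "continuous_on ({a..b} - E) f" "\<And>t. t \<in> {a..b} ==> norm (f t) \<le> M"
  shows "f integrable_on {a..b}"
proof -
  have m: "{a..b} - E \<in> sets lebesgue" using finite_imp_closed[OF assms(1)] by (intro sets.Diff) auto
  have "f \<in> borel_measurable (lebesgue_on ({a..b} - E))"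
    by (rule continuous_imp_measurable_on_sets_lebesgue[OF assms(2) m])
  moreover have "(\<lambda>_. M) integrable_on ({a..b} - E)"
    by (rule integrable_spike_set[of _ "{a..b}"])
       (auto intro: negligible_subset[OF negligible_finite[OF assms(1)]])
  ultimately have "f integrable_on ({a..b} - E)"
    by (rule measurable_bounded_by_integrable_imp_integrable[OF _ _ _ m]) (use assms in auto)
  then show ?thesis
    by (rule integrable_spike_set) (auto intro: negligible_subset[OF negligible_finite[OF assms(1)]])
qed

lemma lipschitz_primitive:
  fixes g :: "real => 'a::euclidean_space"
  assumes "g integrable_on {0..b}" "\<And>s. s \<in> {0..b} ==> norm (g s) \<le> M" "u \<in> {0..b}" "v \<in> {0..b}"
  shows "norm (integral {0..v} g - integral {0..u} g) \<le> M * \<bar>v - u\<bar>"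
proof -
  have M0: "0 \<le> M" using assms(2)[OF assms(3)] norm_ge_zero order_trans by blast
  have *: "norm (integral {0..v} g - integral {0..u} g) \<le> M * (v - u)"
    if "u \<in> {0..b}" "v \<in> {0..b}" "u \<le> v" for u v
  proof -
    have i: "g integrable_on {0..v}" "g integrable_on {u..v}"
      using that by (auto intro: integrable_on_subinterval[OF assms(1)])
    then have "integral {0..v} g - integral {0..u} g = integral {u..v} g"
      using that Henstock_Kurzweil_Integration.integral_combine[of 0 u v g] by (simp add: algebra_simps)
    moreover have "norm (integral {u..v} g) \<le> M * (v - u)"
      using has_integral_bound[of M g "integral {u..v} g" u v] i(2) that assms(2) M0 by (auto simp: content_real)
    ultimately show ?thesis by simp
  qed
  show ?thesis using *[of u v] *[of v u] assms(3,4)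
    by (cases "u \<le> v") (auto simp: norm_minus_commute)
qed

text \<open>
  Tonelli's method: delaying the state by an additional \<open>h > 0\<close> makes the integral equation
  solvable by finitely many substitutions, and the Arzela-Ascoli theorem yields a limit as \<open>h\<close> tends
  to 0. The set \<open>E\<close> admits jumps of the right-hand side in time.
\<close>

theorem peano_delay:
  fixes F :: "real => 'a::euclidean_space => 'a => 'a" and d :: "real => real" and X0 :: 'a
  assumes b: "0 \<le> b" and E: "finite E"
    and cF: "continuous_on (({0..b} - E) \<times> UNIV \<times> UNIV) (\<lambda>(t, p, q). F t p q)"
    and M: "\<And>t p q. t \<in> {0..b} ==> norm (F t p q) \<le> M"
    and d: "continuous_on {0..b} d" "\<And>t. t \<in> {0..b} ==> d t \<le> t"
  shows "\<exists>X. continuous_on {0..b} X \<and>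
    (\<forall>t\<in>{0..b}. ((\<lambda>s. F s (X s) (X (max 0 (d s)))) has_integral (X t - X0)) {0..t})"
proof -
  have M0: "0 \<le> M" using M[of 0] b norm_ge_zero order_trans by (metis atLeastAtMost_iff order_refl)
  have comp: "continuous_on ({0..b} - E) (\<lambda>s. F s (p s) (q s))"
    if "continuous_on ({0..b} - E) p" "continuous_on ({0..b} - E) q" for p q :: "real => 'a"
  proof -
    have "continuous_on ({0..b} - E) (\<lambda>s. (s, p s, q s))" by (intro continuous_intros that)
    from continuous_on_compose2[OF cF this] show ?thesis by auto
  qed
  define D where "D h Y s = F s (Y (max 0 (s - h))) (Y (max 0 (d s - h)))" for h and Y :: "real => 'a" and s
  define \<Phi> where "\<Phi> h Y t = X0 + integral {0..t} (D h Y)" for h and Y :: "real => 'a" and t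
  have Dint: "D h Y integrable_on {0..b}" if "continuous_on {0..b} Y" "0 \<le> h" for h Y
  proof -
    have "continuous_on {0..b} (\<lambda>s. Y (max 0 (s - h)))"
      by (rule continuous_on_compose2[OF that(1)]) (use that in \<open>auto intro!: continuous_intros\<close>)
    moreover have "continuous_on {0..b} (\<lambda>s. Y (max 0 (d s - h)))"
      by (rule continuous_on_compose2[OF that(1)])
         (use that d b in \<open>fastforce intro!: continuous_intros\<close>)+
    ultimately show ?thesis unfolding D_def
      by (intro integrable_continuous_except_finite[OF E comp, where M=M] M)
         (auto intro: continuous_on_subset)
  qed
  have Dbd: "norm (D h Y s) \<le> M" if "s \<in> {0..b}" for h Y s using M that by (simp add: D_def)
  have Lip: "norm (\<Phi> h Y v - \<Phi> h Y u) \<le> M * \<bar>v - u\<bar>"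
    if "continuous_on {0..b} Y" "0 \<le> h" "u \<in> {0..b}" "v \<in> {0..b}" for h Y u v
    using lipschitz_primitive[OF Dint[OF that(1,2)] Dbd that(3,4)] by (simp add: \<Phi>_def)
  have cont_of_lip: "continuous_on {0..b} Y"
    if "\<And>u v. u \<in> {0..b} ==> v \<in> {0..b} ==> norm (Y v - Y u) \<le> M * \<bar>v - u\<bar>" for Y :: "real => 'a"
    by (rule lipschitz_on_continuous_on[of M], rule lipschitz_onI)
       (use that M0 in \<open>auto simp: dist_norm\<close>)
  have approx: "\<exists>Y. (\<forall>u\<in>{0..b}. \<forall>v\<in>{0..b}. norm (Y v - Y u) \<le> M * \<bar>v - u\<bar>) \<and>
      (\<forall>t\<in>{0..b}. Y t = \<Phi> h Y t)" if h: "0 < h" for h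
  proof -
    define Y where "Y j = ((\<Phi> h) ^^ j) (\<lambda>_. X0)" for j
    have YS: "Y (Suc j) = \<Phi> h (Y j)" for j by (simp add: Y_def)
    have cY: "continuous_on {0..b} (Y j)" for j
    proof (induction j)
      case 0 show ?case by (simp add: Y_def)
    next
      case (Suc j) show ?case unfolding YS by (rule cont_of_lip) (use Lip[OF Suc] h in auto)
    qed
    have eq: "Y (Suc j) t = Y j t" if "0 \<le> t" "t \<le> real j * h" "t \<le> b" for j t
      using that
    proof (induction j arbitrary: t)
      case 0 then show ?case by (simp add: YS \<Phi>_def) (simp add: Y_def)
    next
      case (Suc j)
      have "integral {0..t} (D h (Y (Suc j))) = integral {0..t} (D h (Y j))"
      proof (rule integral_cong)
        fix s assume s: "s \<in> {0..t}"
        have ds: "d s \<le> s" using d(2)[of s] s Suc.prems by auto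
        have "Y (Suc j) (max 0 (s - h)) = Y j (max 0 (s - h))"
          "Y (Suc j) (max 0 (d s - h)) = Y j (max 0 (d s - h))"
          by (rule Suc.IH; use s Suc.prems h ds in \<open>auto simp: algebra_simps max_def\<close>)+
        then show "D h (Y (Suc j)) s = D h (Y j) s" by (simp add: D_def)
      qed
      then show ?case by (simp add: YS \<Phi>_def)
    qed
    obtain j where j: "b / h \<le> real j" using real_arch_simple by blast
    then have bj: "b \<le> real j * h" using h by (simp add: pos_divide_le_eq)
    have "Y (Suc j) t = \<Phi> h (Y (Suc j)) t" if "t \<in> {0..b}" for t
      using eq[of t "Suc j"] that bj h YS[of "Suc j"] by (auto simp: algebra_simps)
    moreover have "\<forall>u\<in>{0..b}. \<forall>v\<in>{0..b}. norm (Y (Suc j) v - Y (Suc j) u) \<le> M * \<bar>v - u\<bar>"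
      unfolding YS using Lip[OF cY] h by auto
    ultimately show ?thesis by blast
  qed
  define h where "h k = 1 / real (Suc k)" for k
  have h: "0 < h k" for k by (simp add: h_def)
  have h0: "h \<longlonglongrightarrow> 0" unfolding h_def using LIMSEQ_inverse_real_of_nat by (simp add: inverse_eq_divide)
  obtain Y where Ylip: "\<And>k u v. u \<in> {0..b} ==> v \<in> {0..b} ==> norm (Y k v - Y k u) \<le> M * \<bar>v - u\<bar>"
    and Yeq: "\<And>k t. t \<in> {0..b} ==> Y k t = \<Phi> (h k) (Y k) t"
    using approx[OF h] by metis
  have Y0: "Y k 0 = X0" for k using Yeq[of 0 k] b by (simp add: \<Phi>_def)
  obtain g r where g: "continuous_on {0..b} g" "strict_mono (r :: nat => nat)"
    and lim: "\<And>e. 0 < e ==> \<exists>N. \<forall>n x. N \<le> n \<and> x \<in> {0..b} \<longrightarrow> norm (Y (r n) x - g x) < e"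
  proof (rule Arzela_Ascoli[of "{0..b}" Y "norm X0 + M * b"])
    show "norm (Y n x) \<le> norm X0 + M * b" if "x \<in> {0..b}" for n x
    proof -
      have "norm (Y n x - X0) \<le> M * \<bar>x\<bar>" using Ylip[of 0 x n] that b Y0 by simp
      also have "... \<le> M * b" using that M0 by (intro mult_left_mono) auto
      finally show ?thesis using norm_triangle_ineq2[of "Y n x" X0] by linarith
    qed
    show "\<exists>d>0. \<forall>n y. y \<in> {0..b} \<and> norm (x - y) < d \<longrightarrow> norm (Y n x - Y n y) < e"
      if "x \<in> {0..b}" "0 < e" for x e
    proof (intro exI[of _ "e / (M + 1)"] conjI allI impI)
      show "0 < e / (M + 1)" using that M0 by simp
      fix n y assume y: "y \<in> {0..b} \<and> norm (x - y) < e / (M + 1)"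
      have "norm (Y n x - Y n y) \<le> M * \<bar>x - y\<bar>" using Ylip y that by blast
      also have "... \<le> (M + 1) * \<bar>x - y\<bar>" by (intro mult_right_mono) auto
      also have "... < (M + 1) * (e / (M + 1))" using y M0 by (intro mult_strict_left_mono) auto
      finally show "norm (Y n x - Y n y) < e" using M0 by simp
    qed
  qed auto
  have ptw: "(\<lambda>k. Y (r k) (x k)) \<longlonglongrightarrow> g y"
    if "\<And>k. x k \<in> {0..b}" "y \<in> {0..b}" "x \<longlonglongrightarrow> y" for x y
  proof -
    have "(\<lambda>k. Y (r k) y) \<longlonglongrightarrow> g y"
      unfolding tendsto_iff dist_norm eventually_sequentially using lim that(2) by blast
    moreover have "(\<lambda>k. Y (r k) (x k) - Y (r k) y) \<longlonglongrightarrow> 0"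
    proof (rule Lim_null_comparison[where g = "\<lambda>k. M * \<bar>x k - y\<bar>"])
      show "\<forall>\<^sub>F k in sequentially. norm (Y (r k) (x k) - Y (r k) y) \<le> M * \<bar>x k - y\<bar>"
        using Ylip that by (intro always_eventually) auto
      have "(\<lambda>k. M * \<bar>x k - y\<bar>) \<longlonglongrightarrow> M * \<bar>y - y\<bar>" by (intro tendsto_intros that)
      then show "(\<lambda>k. M * \<bar>x k - y\<bar>) \<longlonglongrightarrow> 0" by simp
    qed
    ultimately show ?thesis using tendsto_add by fastforce
  qed
  have hr: "(\<lambda>k. h (r k)) \<longlonglongrightarrow> 0" using LIMSEQ_subseq_LIMSEQ[OF h0 g(2)] by (simp add: o_def)
  have cYk: "continuous_on {0..b} (Y k)" for k by (rule cont_of_lip) (use Ylip in auto)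
  have "((\<lambda>s. F s (g s) (g (max 0 (d s)))) has_integral (g t - X0)) {0..t}" if t: "t \<in> {0..b}" for t
  proof -
    define f where "f k s = (if s \<in> E then 0 else D (h (r k)) (Y (r k)) s)" for k s
    define f0 where "f0 s = (if s \<in> E then 0 else F s (g s) (g (max 0 (d s))))" for s
    have negl: "negligible E" using E by (rule negligible_finite)
    have Di: "D (h k) (Y k) integrable_on {0..t}" for k
      using Dint[OF cYk[of k], of "h k"] h[of k] t by (auto intro: integrable_on_subinterval)
    have fi: "(f k has_integral Y (r k) t - X0) {0..t}" for k
    proof -
      have "(D (h (r k)) (Y (r k)) has_integral Y (r k) t - X0) {0..t}"
        using Yeq[of t "r k"] t Di[of "r k"] by (simp add: \<Phi>_def has_integral_iff)
      then show ?thesis by (rule has_integral_spike[OF negl, rotated]) (auto simp: f_def)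
    qed
    have conv: "(\<lambda>k. f k s) \<longlonglongrightarrow> f0 s" if s: "s \<in> {0..t}" for s
    proof (cases "s \<in> E")
      case True then show ?thesis by (simp add: f_def f0_def)
    next
      case False
      have sb: "s \<in> {0..b}" "d s \<le> s" using s t d(2)[of s] by auto
      have hl: "0 < h (r k)" for k using h by simp
      have 1: "(\<lambda>k. Y (r k) (max 0 (s - h (r k)))) \<longlonglongrightarrow> g s"
      proof (rule ptw)
        show "max 0 (s - h (r k)) \<in> {0..b}" for k using sb hl[of k] by auto
        have "(\<lambda>k. max 0 (s - h (r k))) \<longlonglongrightarrow> max 0 (s - 0)" by (intro tendsto_intros hr)
        then show "(\<lambda>k. max 0 (s - h (r k))) \<longlonglongrightarrow> s" using sb by simp
      qed (use sb in auto)
      have 2: "(\<lambda>k. Y (r k) (max 0 (d s - h (r k)))) \<longlonglongrightarrow> g (max 0 (d s))"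
      proof (rule ptw)
        show "max 0 (d s - h (r k)) \<in> {0..b}" for k using sb hl[of k] by auto
        have "(\<lambda>k. max 0 (d s - h (r k))) \<longlonglongrightarrow> max 0 (d s - 0)" by (intro tendsto_intros hr)
        then show "(\<lambda>k. max 0 (d s - h (r k))) \<longlonglongrightarrow> max 0 (d s)" by simp
      qed (use sb in auto)
      have "continuous_on UNIV (\<lambda>(p, q). F s p q)"
      proof -
        have c: "continuous_on UNIV (\<lambda>z::'a \<times> 'a. (s, z))" by (intro continuous_intros)
        have "(s, z) \<in> ({0..b} - E) \<times> UNIV \<times> UNIV" for z :: "'a \<times> 'a"
          using sb False by (cases z) auto
        then have "range (\<lambda>z::'a \<times> 'a. (s, z)) \<subseteq> ({0..b} - E) \<times> UNIV \<times> UNIV" by blast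
        from continuous_on_compose2[OF cF c this] show ?thesis by (simp add: split_def)
      qed
      then have "isCont (\<lambda>(p, q). F s p q) (g s, g (max 0 (d s)))"
        by (simp add: continuous_on_eq_continuous_at)
      from isCont_tendsto_compose[OF this tendsto_Pair[OF 1 2]]
      show ?thesis using False by (simp add: f_def f0_def D_def)
    qed
    have nb: "norm (f k s) \<le> M" if "s \<in> {0..t}" for k s
      using Dbd[of s] that t M0 by (auto simp: f_def)
    have "f0 integrable_on {0..t}" "(\<lambda>k. integral {0..t} (f k)) \<longlonglongrightarrow> integral {0..t} f0"
      using dominated_convergence[of f "{0..t}" "\<lambda>_. M" f0] fi nb conv by (auto simp: has_integral_iff)
    moreover have "(\<lambda>k. integral {0..t} (f k)) \<longlonglongrightarrow> g t - X0"
    proof -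
      have "(\<lambda>k. Y (r k) t - X0) \<longlonglongrightarrow> g t - X0"
        by (intro tendsto_intros ptw[of "\<lambda>_. t"]) (use t in auto)
      then show ?thesis using fi by (simp add: has_integral_iff)
    qed
    ultimately have "(f0 has_integral g t - X0) {0..t}"
      using LIMSEQ_unique[of "\<lambda>k. integral {0..t} (f k)"] by (simp add: has_integral_iff)
    then show ?thesis by (rule has_integral_spike[OF negl, rotated]) (auto simp: f0_def)
  qed
  then show ?thesis using g(1) by blast
qed

section \<open>Quadratic forms that decrease along uncertain chains of integrators\<close>

definition bform :: "nat set => ((nat => real) => (nat => real) => real) => bool" where
  "bform I B \<longleftrightarrow> (\<forall>v w. B v w = B w v) \<and>
     (\<forall>u v w. B u (\<lambda>i. v i + w i) = B u v + B u w) \<and>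
     (\<forall>a u v. B u (\<lambda>i. a * v i) = a * B u v) \<and>
     (\<exists>C\<ge>0. \<forall>v w. \<bar>B v w\<bar> \<le> C * L2_set v I * L2_set w I)"

lemma bform_sym: "bform I B ==> B v w = B w v"
  and bform_add: "bform I B ==> B u (\<lambda>i. v i + w i) = B u v + B u w"
  and bform_scale: "bform I B ==> B u (\<lambda>i. a * v i) = a * B u v"
  by (simp_all add: bform_def)

lemma bform_zero:
  assumes "bform I B" "\<And>i. i \<in> I ==> w i = 0" shows "B u w = 0"
proof -
  obtain C where "\<bar>B u w\<bar> \<le> C * L2_set u I * L2_set w I" using assms(1) unfolding bform_def by blast
  moreover have "L2_set w I = 0" unfolding L2_set_def using assms(2) by simp
  ultimately show ?thesis by simp
qed

lemma bform_cong:
  assumes B: "bform I B" and "\<And>i. i \<in> I ==> w i = w' i" shows "B u w = B u w'"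
proof -
  have "B u w = B u (\<lambda>i. w' i + (w i - w' i))" by simp
  also have "... = B u w' + B u (\<lambda>i. w i - w' i)" by (rule bform_add[OF B])
  also have "B u (\<lambda>i. w i - w' i) = 0" by (rule bform_zero[OF B]) (use assms in auto)
  finally show ?thesis by simp
qed

lemma bform_sum:
  assumes B: "bform I B" and J: "finite J"
  shows "B u (\<lambda>i. \<Sum>j\<in>J. c j * w j i) = (\<Sum>j\<in>J. c j * B u (w j))"
  using J
proof (induction J)
  case empty
  show ?case using bform_zero[OF B, of "\<lambda>_. 0"] by simp
next
  case (insert j J)
  then show ?case
    using bform_add[OF B, of u "\<lambda>i. c j * w j i"] bform_scale[OF B, of u "c j" "w j"] by simp
qed

lemma bform_expand:
  assumes B: "bform I B" and I: "finite I"
  shows "B v w = (\<Sum>i\<in>I. \<Sum>j\<in>I. v i * w j * B (\<lambda>k. if k = i then 1 else 0) (\<lambda>k. if k = j then 1 else 0))"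
proof -
  define e where "e j = (\<lambda>k::nat. if k = j then 1 else (0::real))" for j
  have *: "B u w = (\<Sum>j\<in>I. w j * B u (e j))" for u w
  proof -
    have "B u w = B u (\<lambda>i. \<Sum>j\<in>I. w j * e j i)"
      by (rule bform_cong[OF B]) (use I in \<open>simp add: e_def if_distrib cong: if_cong\<close>)
    then show ?thesis by (simp add: bform_sum[OF B I])
  qed
  have **: "B v (e j) = (\<Sum>i\<in>I. v i * B (e i) (e j))" for j
    using *[of "e j" v] by (simp only: bform_sym[OF B, of v "e j"] bform_sym[OF B, of "e j" "e _"])
  have "B v w = (\<Sum>j\<in>I. w j * B v (e j))" by (rule *)
  also have "... = (\<Sum>j\<in>I. w j * (\<Sum>i\<in>I. v i * B (e i) (e j)))"
    by (simp only: **)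
  also have "... = (\<Sum>j\<in>I. \<Sum>i\<in>I. v i * w j * B (e i) (e j))"
    by (simp add: sum_distrib_left mult_ac)
  also have "... = (\<Sum>i\<in>I. \<Sum>j\<in>I. v i * w j * B (e i) (e j))" by (rule sum.swap)
  finally show ?thesis unfolding e_def .
qed

lemma bform_has_real_derivative:
  assumes B: "bform I B" and I: "finite I"
    and v: "\<And>i. i \<in> I ==> ((\<lambda>t. v t i) has_real_derivative v' i) (at t within S)"
  shows "((\<lambda>t. B (v t) (v t)) has_real_derivative 2 * B (v t) v') (at t within S)"
proof -
  define b where "b i j = B (\<lambda>k. if k = i then 1 else 0) (\<lambda>k. if k = j then 1 else 0)" for i j
  have e: "B v w = (\<Sum>i\<in>I. \<Sum>j\<in>I. v i * w j * b i j)" for v w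
    unfolding b_def by (rule bform_expand[OF B I])
  have "((\<lambda>t. \<Sum>i\<in>I. \<Sum>j\<in>I. v t i * v t j * b i j) has_real_derivative
      (\<Sum>i\<in>I. \<Sum>j\<in>I. (v' i * v t j + v' j * v t i) * b i j)) (at t within S)"
    by (intro DERIV_sum DERIV_cmult_right DERIV_mult v)
  moreover have "(\<Sum>i\<in>I. \<Sum>j\<in>I. (v' i * v t j + v' j * v t i) * b i j) = B v' (v t) + B (v t) v'"
    unfolding e by (simp add: sum.distrib[symmetric] algebra_simps)
  ultimately show ?thesis using bform_sym[OF B, of v' "v t"] by (simp add: e)
qed

lemma quad_bound: fixes c :: real assumes "0 < c"
  shows "A * x * y \<le> c / 2 * x^2 + A^2 / (2 * c) * y^2"
proof -
  have "0 \<le> (c * x - A * y)^2 / (2 * c)" using assms by simp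
  also have "... = c / 2 * x^2 + A^2 / (2 * c) * y^2 - A * x * y"
    using assms by (simp add: field_simps power2_eq_square)
  finally show ?thesis by simp
qed

text \<open>
  Both recursions below change coordinates by a shear; this compares the norms before and after.
\<close>

lemma split_square_lower:
  fixes a e g x X Y :: real
  assumes "0 < a" "0 < e" "0 \<le> x" "x \<le> X + g * Y"
  shows "min a e / (2 + 2 * g^2) * (x^2 + Y^2) \<le> a * X^2 + e * Y^2"
proof -
  have g: "0 < 2 + 2 * g^2" by (rule add_pos_nonneg) auto
  have "x^2 \<le> (X + g * Y)^2" using assms by (intro power_mono) auto
  also have "... \<le> 2 * X^2 + 2 * (g * Y)^2" using sum_squares_bound[of X "g * Y"] by (simp add: power2_sum)
  finally have "x^2 \<le> 2 * X^2 + 2 * (g * Y)^2" .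
  then have "x^2 + Y^2 \<le> (2 + 2 * g^2) * (X^2 + Y^2)"
  proof -
    have "(2 + 2 * g^2) * (X^2 + Y^2) = 2 * X^2 + 2 * (g * Y)^2 + Y^2 + (2 * (g * X)^2 + Y^2)"
      by (simp add: power_mult_distrib algebra_simps)
    moreover have "0 \<le> 2 * (g * X)^2 + Y^2" by simp
    ultimately show ?thesis using \<open>x^2 \<le> 2 * X^2 + 2 * (g * Y)^2\<close> by linarith
  qed
  then have "min a e / (2 + 2 * g^2) * (x^2 + Y^2) \<le> min a e / (2 + 2 * g^2) * ((2 + 2 * g^2) * (X^2 + Y^2))"
    using assms g by (intro mult_left_mono) auto
  also have "... = min a e * (X^2 + Y^2)" using g by simp
  also have "... \<le> a * X^2 + e * Y^2" unfolding distrib_left by (intro add_mono mult_right_mono) auto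
  finally show ?thesis .
qed

lemma L2_set_scale: "L2_set (\<lambda>i. c * f i) I = \<bar>c\<bar> * L2_set f I"
  by (simp add: L2_set_def power_mult_distrib sum_distrib_left[symmetric] real_sqrt_mult)

lemma L2_set_abs_mono:
  assumes "\<And>i. i \<in> I ==> \<bar>f i\<bar> \<le> g i" shows "L2_set f I \<le> L2_set g I"
proof -
  have "(f i)^2 \<le> (g i)^2" if "i \<in> I" for i using assms[OF that] by (simp add: abs_le_square_iff[symmetric])
  then show ?thesis unfolding L2_set_def by (intro real_sqrt_le_mono sum_mono) auto
qed

lemma abs_le_L2_set: "finite I ==> i \<in> I ==> \<bar>f i\<bar> \<le> L2_set f I"
  using member_le_L2_set[of I i "\<lambda>i. \<bar>f i\<bar>"] by (simp add: L2_set_def)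

lemma abs_sum_mult_le_L2: "\<bar>\<Sum>i\<in>I. f i * g i\<bar> \<le> L2_set f I * L2_set g I"
  using sum_abs[of "\<lambda>i. f i * g i" I] L2_set_mult_ineq[of f g I] by (simp add: abs_mult)

lemma L2_set_sq: "finite I ==> (L2_set f I)^2 = (\<Sum>i\<in>I. (f i)^2)"
  by (simp add: L2_set_def sum_nonneg)

definition obs_op :: "nat => nat => (nat => real) => real => (nat => real) => (nat => real) => nat => real" where
  "obs_op n k a a' G v i = (if i < n then a i * v (i + 1) else 0) - a' * G i * v k"

definition fb_op :: "nat => (nat => real) => real => (nat => real) => (nat => real) => nat => real" where
  "fb_op k a b \<kappa> v i = (if i < k then a i * v (i + 1) else - b * (\<Sum>j=2..k. \<kappa> j * v j))"

text \<open>
  The third condition concerns \<open>r\<close>: a component scaled by \<open>r ^ (i-1)\<close> acquires the term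
  \<open>- (i-1) (r'/r) v\<^sub>i\<close>, and with the factor \<open>r\<close> in front of the form the total is
  \<open>- 2 r' B v ((i - 3/2) v\<^sub>i)\<close>.
\<close>

definition robust_lyapunov where
  "robust_lyapunov I c B F \<longleftrightarrow> 0 < c \<and> bform I B \<and>
     (\<forall>v. c * (L2_set v I)^2 \<le> B v v) \<and>
     (\<forall>v. c * (L2_set v I)^2 \<le> B v (\<lambda>i. (real i - 3/2) * v i)) \<and>
     (\<forall>f\<in>F. \<forall>v. B v (f v) \<le> - c * (L2_set v I)^2)"

text \<open>
  Backstepping from the last equation to the first. Given gains \<open>G\<close> for the chain starting at
  \<open>h + 1\<close>, the new variable \<open>v\<^sub>h\<close> is injected through \<open>v\<^sub>i - G\<^sub>i v\<^sub>h\<close>, whose dynamics are the old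
  chain up to multiples of \<open>v\<^sub>h\<close>; a gain \<open>L\<close> that is large compared with these multiples then
  makes the sum of the old form and \<open>l v\<^sub>h\<^sup>2\<close> decrease. The weight \<open>l\<close> is fixed first, by the
  condition on \<open>i - 3/2\<close>.
\<close>

lemma observer_lyapunov_exists:
  assumes c: "0 < c1" "c1 \<le> 1" "1 \<le> (c2::real)" and n: "2 \<le> n"
  shows "\<exists>G B c. robust_lyapunov {2..n} c B
    {obs_op n 2 a a' G | a a'. (\<forall>i\<in>{2..<n}. c1 \<le> a i \<and> a i \<le> c2) \<and> c1 \<le> a' \<and> a' \<le> c2}"
  using n
proof (induction rule: inc_induct)
  case base
  have "bform {n..n} (\<lambda>v w. v n * w n)"
    unfolding bform_def by (auto simp: algebra_simps abs_mult intro: exI[of _ 1])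
  then have "robust_lyapunov {n..n} (min c1 (1/2)) (\<lambda>v w. v n * w n)
    {obs_op n n a a' (\<lambda>_. 1) | a a'. (\<forall>i\<in>{n..<n}. c1 \<le> a i \<and> a i \<le> c2) \<and> c1 \<le> a' \<and> a' \<le> c2}"
    unfolding robust_lyapunov_def using c n
  proof (intro conjI allI ballI)
    fix v :: "nat => real"
    have N: "(L2_set v {n..n})^2 = (v n)^2" by (simp add: L2_set_sq)
    have m: "min c1 (1/2) * (v n)^2 \<le> d * (v n)^2" if "c1 \<le> d \<or> 1/2 \<le> d" for d
      using that by (intro mult_right_mono) auto
    show "min c1 (1/2) * (L2_set v {n..n})^2 \<le> v n * v n"
      using m[of 1] by (simp add: N power2_eq_square)
    show "min c1 (1/2) * (L2_set v {n..n})^2 \<le> v n * ((real n - 3/2) * v n)"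
      using m[of "real n - 3/2"] n by (simp add: N power2_eq_square algebra_simps)
    fix f assume "f \<in> {obs_op n n a a' (\<lambda>_. 1) | a a'. (\<forall>i\<in>{n..<n}. c1 \<le> a i \<and> a i \<le> c2) \<and> c1 \<le> a' \<and> a' \<le> c2}"
    then obtain a a' where f: "f = obs_op n n a a' (\<lambda>_. 1)" "c1 \<le> a'" by blast
    show "v n * f v n \<le> - min c1 (1/2) * (L2_set v {n..n})^2"
      using m[of a'] f by (simp add: N obs_op_def power2_eq_square algebra_simps)
  qed (use c in auto)
  then show ?case by blast
next
  case (step h)
  let ?I = "{Suc h..n}"
  have I': "{h..n} = insert h ?I" and hI: "h \<notin> ?I" using step.hyps by auto
  obtain G B c where RL: "robust_lyapunov ?I c B
    {obs_op n (Suc h) a a' G | a a'. (\<forall>i\<in>{Suc h..<n}. c1 \<le> a i \<and> a i \<le> c2) \<and> c1 \<le> a' \<and> a' \<le> c2}"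
    using step.IH by blast
  then have c0: "0 < c" and B: "bform ?I B" and co: "\<And>v. c * (L2_set v ?I)^2 \<le> B v v"
    and cd: "\<And>v. c * (L2_set v ?I)^2 \<le> B v (\<lambda>i. (real i - 3/2) * v i)"
    and cf: "\<And>a a' v. (\<forall>i\<in>{Suc h..<n}. c1 \<le> a i \<and> a i \<le> c2) ==> c1 \<le> a' ==> a' \<le> c2 ==>
       B v (obs_op n (Suc h) a a' G v) \<le> - c * (L2_set v ?I)^2"
    unfolding robust_lyapunov_def by blast+
  obtain C where C: "0 \<le> C" "\<And>v w. \<bar>B v w\<bar> \<le> C * L2_set v ?I * L2_set w ?I"
    using B by (auto simp: bform_def)
  define T where "T v = (\<lambda>i. v i - G i * v h)" for v :: "nat => real"
  define \<gamma> where "\<gamma> = L2_set G ?I"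
  define A2 where "A2 = C * L2_set (\<lambda>i. G i * (real i - real h)) ?I"
  define l where "l = 2 * (A2^2 / (2 * c) + 1)"
  define \<beta> where "\<beta> = L2_set (\<lambda>i. c2 * \<bar>G (i + 1)\<bar> + c2 * \<bar>G i\<bar> * \<bar>G (Suc h)\<bar>) ?I"
  define A where "A = C * \<beta> + l * c2"
  define L where "L = (A^2 / (2 * c) + l * c2 * \<bar>G (Suc h)\<bar> + 1) / (l * c1)"
  define B' where "B' v w = B (T v) (T w) + l * (v h * w h)" for v w
  define G' where "G' i = (if i = h then L else G i * L)" for i
  define K where "K = 2 + 2 * \<gamma>^2"
  define c' where "c' = min (c / 2) 1 / K"
  have g0: "0 \<le> \<gamma>" "0 \<le> A2" "0 \<le> \<beta>" using C by (auto simp: \<gamma>_def A2_def \<beta>_def)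
  have l1: "1 \<le> l" using c0 by (auto simp: l_def)
  have A0: "0 \<le> A" using g0 C l1 c by (auto simp: A_def)
  have L0: "0 \<le> L" using c0 l1 c by (auto simp: L_def)
  have K: "2 \<le> K" by (simp add: K_def)
  have Tadd: "T (\<lambda>i. v i + w i) = (\<lambda>i. T v i + T w i)" "T (\<lambda>i. a * v i) = (\<lambda>i. a * T v i)" for v w a
    by (auto simp: T_def algebra_simps)
  have N': "(L2_set v {h..n})^2 = (v h)^2 + (L2_set v ?I)^2" for v
    unfolding I' using hI by (simp add: L2_set_sq sum_nonneg)
  have Tle: "L2_set (T v) ?I \<le> L2_set v ?I + \<gamma> * \<bar>v h\<bar>" for v
  proof -
    have "L2_set (T v) ?I \<le> L2_set v ?I + L2_set (\<lambda>i. (- v h) * G i) ?I"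
      using L2_set_triangle_ineq[of v "\<lambda>i. (- v h) * G i" ?I] by (simp add: T_def algebra_simps)
    then show ?thesis unfolding L2_set_scale by (simp add: \<gamma>_def mult.commute)
  qed
  have vle: "L2_set v ?I \<le> L2_set (T v) ?I + \<gamma> * \<bar>v h\<bar>" for v
  proof -
    have "L2_set v ?I \<le> L2_set (T v) ?I + L2_set (\<lambda>i. v h * G i) ?I"
      using L2_set_triangle_ineq[of "T v" "\<lambda>i. v h * G i" ?I] by (simp add: T_def algebra_simps)
    then show ?thesis unfolding L2_set_scale by (simp add: \<gamma>_def mult.commute)
  qed
  have le': "L2_set v ?I \<le> L2_set v {h..n}" "\<bar>v h\<bar> \<le> L2_set v {h..n}" for v
  proof -
    show "L2_set v ?I \<le> L2_set v {h..n}"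
      by (rule power2_le_imp_le[OF _ L2_set_nonneg]) (simp add: N')
    show "\<bar>v h\<bar> \<le> L2_set v {h..n}" using step.hyps by (intro abs_le_L2_set) auto
  qed
  have fin: "c' * (L2_set v {h..n})^2 \<le> c / 2 * (L2_set (T v) ?I)^2 + (v h)^2" for v
    using split_square_lower[OF _ _ L2_set_nonneg vle[of v], of "c / 2" 1] c0 by (simp add: N' c'_def K_def add.commute)
  have bf: "bform {h..n} B'"
    unfolding bform_def
  proof (intro conjI allI)
    show "B' v w = B' w v" for v w by (simp add: B'_def bform_sym[OF B, of "T v"] mult.commute)
    show "B' u (\<lambda>i. v i + w i) = B' u v + B' u w" for u v w
      by (simp add: B'_def Tadd bform_add[OF B] algebra_simps)
    show "B' u (\<lambda>i. a * v i) = a * B' u v" for a u v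
      by (simp add: B'_def Tadd bform_scale[OF B] algebra_simps)
    have "\<bar>B' v w\<bar> \<le> (C * (1 + \<gamma>)^2 + l) * L2_set v {h..n} * L2_set w {h..n}" for v w
    proof -
      have t: "L2_set (T v) ?I \<le> (1 + \<gamma>) * L2_set v {h..n}" for v
        using Tle[of v] le'[of v] mult_left_mono[OF le'(2)[of v] g0(1)] by (simp add: algebra_simps)
      have "\<bar>B (T v) (T w)\<bar> \<le> C * (L2_set (T v) ?I * L2_set (T w) ?I)" using C(2)[of "T v" "T w"] by (simp add: mult.assoc)
      also have "... \<le> C * (((1 + \<gamma>) * L2_set v {h..n}) * ((1 + \<gamma>) * L2_set w {h..n}))"
        using C g0 by (intro mult_left_mono mult_mono t) auto
      finally have 1: "\<bar>B (T v) (T w)\<bar> \<le> C * (1 + \<gamma>)^2 * L2_set v {h..n} * L2_set w {h..n}"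
        by (simp add: power2_eq_square mult_ac)
      have "\<bar>l * (v h * w h)\<bar> = l * (\<bar>v h\<bar> * \<bar>w h\<bar>)" using l1 by (simp add: abs_mult)
      also have "... \<le> l * (L2_set v {h..n} * L2_set w {h..n})"
        using l1 by (intro mult_left_mono mult_mono le') auto
      finally show ?thesis using 1 unfolding B'_def
        by (intro order_trans[OF abs_triangle_ineq]) (simp add: algebra_simps)
    qed
    then show "\<exists>C\<ge>0. \<forall>v w. \<bar>B' v w\<bar> \<le> C * L2_set v {h..n} * L2_set w {h..n}"
      using C l1 by (intro exI[of _ "C * (1 + \<gamma>)^2 + l"]) auto
  qed
  have "robust_lyapunov {h..n} c' B'
    {obs_op n h a a' G' | a a'. (\<forall>i\<in>{h..<n}. c1 \<le> a i \<and> a i \<le> c2) \<and> c1 \<le> a' \<and> a' \<le> c2}"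
    unfolding robust_lyapunov_def
  proof (intro conjI allI ballI bf)
    show "0 < c'" using c0 K by (simp add: c'_def)
    fix v
    let ?X = "L2_set (T v) ?I"
    show "c' * (L2_set v {h..n})^2 \<le> B' v v"
    proof -
      have "c' * (L2_set v {h..n})^2 \<le> c / 2 * ?X^2 + (v h)^2" by (rule fin)
      also have "... \<le> c * ?X^2 + l * (v h)^2"
        using c0 l1 mult_right_mono[OF l1, of "(v h)^2"] by (intro add_mono mult_right_mono) auto
      also have "... \<le> B' v v" using co[of "T v"] by (simp add: B'_def power2_eq_square)
      finally show ?thesis .
    qed
    show "c' * (L2_set v {h..n})^2 \<le> B' v (\<lambda>i. (real i - 3/2) * v i)"
    proof -
      let ?g = "\<lambda>i. G i * (real i - real h)"
      have "T (\<lambda>i. (real i - 3/2) * v i) = (\<lambda>i. (real i - 3/2) * T v i + v h * ?g i)"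
        by (auto simp: T_def algebra_simps)
      then have "B (T v) (T (\<lambda>i. (real i - 3/2) * v i)) = B (T v) (\<lambda>i. (real i - 3/2) * T v i) + v h * B (T v) ?g"
        by (simp add: bform_add[OF B] bform_scale[OF B])
      moreover have "\<bar>v h * B (T v) ?g\<bar> \<le> A2 * ?X * \<bar>v h\<bar>"
        using mult_right_mono[OF C(2)[of "T v" ?g], of "\<bar>v h\<bar>"] by (simp add: abs_mult A2_def mult_ac)
      moreover have "A2 * ?X * \<bar>v h\<bar> \<le> c / 2 * ?X^2 + A2^2 / (2 * c) * (v h)^2"
        using quad_bound[OF c0, of A2 ?X "\<bar>v h\<bar>"] by simp
      moreover have "l * (v h)^2 * (1/2) \<le> l * (v h)^2 * (real h - 3/2)"
        using step.hyps l1 by (intro mult_left_mono) auto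
      moreover have "l * (v h)^2 * (1/2) = A2^2 / (2 * c) * (v h)^2 + (v h)^2" by (simp add: l_def algebra_simps)
      moreover have "B' v (\<lambda>i. (real i - 3/2) * v i) = B (T v) (T (\<lambda>i. (real i - 3/2) * v i)) + l * (v h)^2 * (real h - 3/2)"
        by (simp add: B'_def power2_eq_square algebra_simps)
      ultimately have "c / 2 * ?X^2 + (v h)^2 \<le> B' v (\<lambda>i. (real i - 3/2) * v i)"
        using cd[of "T v"] by linarith
      then show ?thesis using fin[of v] by linarith
    qed
  next
    fix f v assume "f \<in> {obs_op n h a a' G' | a a'. (\<forall>i\<in>{h..<n}. c1 \<le> a i \<and> a i \<le> c2) \<and> c1 \<le> a' \<and> a' \<le> c2}"
    then obtain a a' where f: "f = obs_op n h a a' G'" and a: "\<forall>i\<in>{h..<n}. c1 \<le> a i \<and> a i \<le> c2"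
      and a': "c1 \<le> a'" "a' \<le> c2" by blast
    let ?X = "L2_set (T v) ?I"
    define b where "b i = (if i < n then a i * G (i + 1) else 0) - a h * G i * G (Suc h)" for i
    have ah: "c1 \<le> a h" "a h \<le> c2" using a step.hyps by auto
    have bb: "L2_set b ?I \<le> \<beta>" unfolding \<beta>_def
    proof (rule L2_set_abs_mono)
      fix i assume i: "i \<in> ?I"
      have "\<bar>b i\<bar> \<le> (if i < n then \<bar>a i * G (i + 1)\<bar> else 0) + \<bar>a h * G i * G (Suc h)\<bar>"
        unfolding b_def by (intro order_trans[OF abs_triangle_ineq4]) auto
      also have "(if i < n then \<bar>a i * G (i + 1)\<bar> else 0) \<le> c2 * \<bar>G (i+1)\<bar>"
      proof -
        have "i < n ==> c1 \<le> a i \<and> a i \<le> c2" using a i by simp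
        then show ?thesis using c by (auto simp: abs_mult intro!: mult_right_mono)
      qed
      also have "\<bar>a h * G i * G (Suc h)\<bar> \<le> c2 * \<bar>G i\<bar> * \<bar>G (Suc h)\<bar>"
        using ah c by (auto simp: abs_mult intro!: mult_right_mono)
      finally show "\<bar>b i\<bar> \<le> c2 * \<bar>G (i + 1)\<bar> + c2 * \<bar>G i\<bar> * \<bar>G (Suc h)\<bar>" by simp
    qed
    have "B (T v) (T (f v)) = B (T v) (\<lambda>i. obs_op n (Suc h) a (a h) G (T v) i + v h * b i)"
      by (rule bform_cong[OF B]) (use step.hyps in \<open>auto simp: f T_def obs_op_def G'_def b_def algebra_simps\<close>)
    also have "... = B (T v) (obs_op n (Suc h) a (a h) G (T v)) + v h * B (T v) b"
      by (simp add: bform_add[OF B] bform_scale[OF B])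
    also have "... \<le> - c * ?X^2 + C * \<beta> * ?X * \<bar>v h\<bar>"
    proof (rule add_mono)
      show "B (T v) (obs_op n (Suc h) a (a h) G (T v)) \<le> - c * ?X^2" by (rule cf) (use a ah in auto)
      have "v h * B (T v) b \<le> \<bar>v h\<bar> * \<bar>B (T v) b\<bar>" by (metis abs_ge_self abs_mult)
      also have "... \<le> \<bar>v h\<bar> * (C * ?X * \<beta>)"
        using C bb by (intro mult_left_mono order_trans[OF C(2)]) (auto intro: mult_left_mono)
      finally show "v h * B (T v) b \<le> C * \<beta> * ?X * \<bar>v h\<bar>" by (simp add: mult_ac)
    qed
    finally have 1: "B (T v) (T (f v)) \<le> - c * ?X^2 + C * \<beta> * ?X * \<bar>v h\<bar>" .
    have fvh: "f v h = a h * T v (Suc h) + a h * G (Suc h) * v h - a' * L * v h"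
      using step.hyps by (simp add: f obs_op_def G'_def T_def algebra_simps)
    have "v h * f v h = a h * (v h * T v (Suc h)) + a h * G (Suc h) * (v h)^2 - a' * L * (v h)^2"
      unfolding fvh by (simp add: algebra_simps power2_eq_square)
    also have "... \<le> c2 * (\<bar>v h\<bar> * ?X) + c2 * \<bar>G (Suc h)\<bar> * (v h)^2 - c1 * L * (v h)^2"
    proof (intro add_mono diff_mono)
      have "a h * (v h * T v (Suc h)) \<le> \<bar>a h\<bar> * (\<bar>v h\<bar> * \<bar>T v (Suc h)\<bar>)"
        using abs_ge_self[of "a h * (v h * T v (Suc h))"] by (simp only: abs_mult)
      also have "... \<le> c2 * (\<bar>v h\<bar> * ?X)"
        using ah c step.hyps by (intro mult_mono mult_left_mono abs_le_L2_set) auto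
      finally show "a h * (v h * T v (Suc h)) \<le> c2 * (\<bar>v h\<bar> * ?X)" .
      have "a h * G (Suc h) \<le> c2 * \<bar>G (Suc h)\<bar>"
      proof -
        have "a h * G (Suc h) \<le> a h * \<bar>G (Suc h)\<bar>" using ah c by (intro mult_left_mono) auto
        also have "... \<le> c2 * \<bar>G (Suc h)\<bar>" using ah by (intro mult_right_mono) auto
        finally show ?thesis .
      qed
      then show "a h * G (Suc h) * (v h)^2 \<le> c2 * \<bar>G (Suc h)\<bar> * (v h)^2" by (intro mult_right_mono) auto
      show "c1 * L * (v h)^2 \<le> a' * L * (v h)^2" using a' L0 by (intro mult_right_mono) auto
    qed
    finally have 2: "l * (v h * f v h) \<le> l * (c2 * (\<bar>v h\<bar> * ?X) + c2 * \<bar>G (Suc h)\<bar> * (v h)^2 - c1 * L * (v h)^2)"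
      using l1 by (intro mult_left_mono) auto
    have 3: "l * c1 * L = A^2 / (2 * c) + l * c2 * \<bar>G (Suc h)\<bar> + 1" using l1 c by (simp add: L_def)
    have "B' v (f v) \<le> - c * ?X^2 + A * ?X * \<bar>v h\<bar> + l * c2 * \<bar>G (Suc h)\<bar> * (v h)^2 - (l * c1 * L) * (v h)^2"
      using 1 2 unfolding B'_def by (simp add: A_def algebra_simps)
    also have "... \<le> - (c / 2) * ?X^2 - (v h)^2"
      using quad_bound[OF c0, of A ?X "\<bar>v h\<bar>"] unfolding 3 by (simp add: algebra_simps)
    finally show "B' v (f v) \<le> - c' * (L2_set v {h..n})^2" using fin[of v] by simp
  qed
  then show ?case by blast
qed

text \<open>
  Backstepping in the other direction: \<open>W v = v (k + 1) + \<Sum>\<kappa>\<^sub>j v\<^sub>j\<close> is the deviation of the next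
  state from the feedback found for the shorter chain. The input coefficient need only be bounded
  below, because a larger one makes the damping of \<open>W v\<close> stronger.
\<close>

lemma feedback_lyapunov_exists:
  assumes c: "0 < c1" "c1 \<le> 1" "1 \<le> (c2::real)" and n: "2 \<le> n"
  shows "\<exists>\<kappa> B c. robust_lyapunov {2..n} c B
    {fb_op n a b \<kappa> | a b. (\<forall>i\<in>{2..<n}. c1 \<le> a i \<and> a i \<le> c2) \<and> c1 \<le> b}"
  using n
proof (induction rule: dec_induct)
  case base
  have "bform {2..2} (\<lambda>v w. v 2 * w 2)"
    unfolding bform_def by (auto simp: algebra_simps abs_mult intro: exI[of _ 1])
  then have "robust_lyapunov {2..2} (min c1 (1/2)) (\<lambda>v w. v 2 * w 2)
    {fb_op 2 a b (\<lambda>_. 1) | a b. (\<forall>i\<in>{2..<2}. c1 \<le> a i \<and> a i \<le> c2) \<and> c1 \<le> b}"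
    unfolding robust_lyapunov_def
  proof (intro conjI allI ballI)
    fix v :: "nat => real"
    have N: "(L2_set v {2..2})^2 = (v 2)^2" by (simp add: L2_set_sq)
    have m: "min c1 (1/2) * (v 2)^2 \<le> d * (v 2)^2" if "c1 \<le> d \<or> 1/2 \<le> d" for d
      using that by (intro mult_right_mono) auto
    show "min c1 (1/2) * (L2_set v {2..2})^2 \<le> v 2 * v 2"
      using m[of 1] by (simp add: N power2_eq_square)
    show "min c1 (1/2) * (L2_set v {2..2})^2 \<le> v 2 * ((real 2 - 3/2) * v 2)"
      using m[of "real 2 - 3/2"] n by (simp add: N power2_eq_square algebra_simps)
    fix f assume "f \<in> {fb_op 2 a b (\<lambda>_. 1) | a b. (\<forall>i\<in>{2..<2}. c1 \<le> a i \<and> a i \<le> c2) \<and> c1 \<le> b}"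
    then obtain a b where f: "f = fb_op 2 a b (\<lambda>_. 1)" "c1 \<le> b" by blast
    show "v 2 * f v 2 \<le> - min c1 (1/2) * (L2_set v {2..2})^2"
      using m[of b] f by (simp add: N fb_op_def power2_eq_square algebra_simps)
  qed (use c in auto)
  then show ?case by blast
next
  case (step k)
  let ?I = "{2..k}"
  have I': "{2..Suc k} = insert (Suc k) ?I" using step.hyps by auto
  obtain \<kappa> B c where RL: "robust_lyapunov ?I c B
    {fb_op k a b \<kappa> | a b. (\<forall>i\<in>{2..<k}. c1 \<le> a i \<and> a i \<le> c2) \<and> c1 \<le> b}"
    using step.IH by blast
  then have c0: "0 < c" and B: "bform ?I B" and co: "\<And>v. c * (L2_set v ?I)^2 \<le> B v v"
    and cd: "\<And>v. c * (L2_set v ?I)^2 \<le> B v (\<lambda>i. (real i - 3/2) * v i)"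
    and cf: "\<And>a b v. (\<forall>i\<in>{2..<k}. c1 \<le> a i \<and> a i \<le> c2) ==> c1 \<le> b ==>
       B v (fb_op k a b \<kappa> v) \<le> - c * (L2_set v ?I)^2"
    unfolding robust_lyapunov_def by blast+
  obtain C where C: "0 \<le> C" "\<And>v w. \<bar>B v w\<bar> \<le> C * L2_set v ?I * L2_set w ?I"
    using B by (auto simp: bform_def)
  define W where "W v = v (Suc k) + (\<Sum>j\<in>?I. \<kappa> j * v j)" for v :: "nat => real"
  define \<gamma> where "\<gamma> = L2_set \<kappa> ?I"
  define \<gamma>2 where "\<gamma>2 = L2_set (\<lambda>j. \<kappa> j * (real j - real (Suc k))) ?I"
  define d where "d = real (Suc k) - 3/2"
  \<comment> \<open>l is small enough for the condition on i - 3/2; then L is chosen large enough for the decrease\<close>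
  define l where "l = c * d / (1 + \<gamma>2^2)"
  define \<Gamma> where "\<Gamma> = c2 * (\<Sum>j\<in>?I. \<bar>\<kappa> j\<bar>) * (1 + \<gamma>)"
  define A where "A = C * c2 + l * \<Gamma>"
  define L where "L = (A^2 / (2 * c) + l * \<Gamma> + l * d / 2) / (l * c1)"
  define B' where "B' v w = B v w + l * (W v * W w)" for v w
  define \<kappa>' where "\<kappa>' i = (if i = Suc k then L else L * \<kappa> i)" for i
  define K where "K = 2 + 2 * \<gamma>^2"
  define e where "e = min l (l * d / 2)"
  define c' where "c' = min (c / 2) e / K"
  have d: "1/2 \<le> d" using step.hyps by (simp add: d_def)
  have g0: "0 \<le> \<gamma>" "0 \<le> \<gamma>2" "0 \<le> \<Gamma>" using c by (auto simp: \<gamma>_def \<gamma>2_def \<Gamma>_def sum_nonneg)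
  have gp: "0 < 1 + \<gamma>2^2" by (rule add_pos_nonneg) auto
  have l0: "0 < l" using c0 d gp by (auto simp: l_def)
  have A0: "0 \<le> A" using g0 C l0 c by (auto simp: A_def)
  have L0: "0 \<le> L" using c0 l0 c g0 d by (auto simp: L_def)
  have K: "2 \<le> K" by (simp add: K_def)
  have Wadd: "W (\<lambda>i. v i + w i) = W v + W w" "W (\<lambda>i. a * v i) = a * W v" for v w a
    by (auto simp: W_def algebra_simps sum.distrib sum_distrib_left)
  have N': "(L2_set v {2..Suc k})^2 = (v (Suc k))^2 + (L2_set v ?I)^2" for v
    unfolding I' by (simp add: L2_set_sq sum_nonneg)
  have vle: "\<bar>v (Suc k)\<bar> \<le> \<bar>W v\<bar> + \<gamma> * L2_set v ?I" and Wle: "\<bar>W v\<bar> \<le> \<bar>v (Suc k)\<bar> + \<gamma> * L2_set v ?I" for v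
    using abs_sum_mult_le_L2[of \<kappa> v ?I] by (auto simp: W_def \<gamma>_def)
  have le': "L2_set v ?I \<le> L2_set v {2..Suc k}" "\<bar>v (Suc k)\<bar> \<le> L2_set v {2..Suc k}" for v
  proof -
    show "L2_set v ?I \<le> L2_set v {2..Suc k}"
      by (rule power2_le_imp_le[OF _ L2_set_nonneg]) (simp add: N')
    show "\<bar>v (Suc k)\<bar> \<le> L2_set v {2..Suc k}" using step.hyps by (intro abs_le_L2_set) auto
  qed
  have fin: "c' * (L2_set v {2..Suc k})^2 \<le> c / 2 * (L2_set v ?I)^2 + e * (W v)^2" for v
  proof -
    have "0 < e" using l0 d by (simp add: e_def)
    then show ?thesis using split_square_lower[OF _ _ abs_ge_zero vle[of v], of e "c / 2"] c0
      by (simp add: N' c'_def K_def add.commute min.commute)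
  qed
  have bf: "bform {2..Suc k} B'"
    unfolding bform_def
  proof (intro conjI allI)
    show "B' v w = B' w v" for v w by (simp add: B'_def bform_sym[OF B, of v] mult.commute)
    show "B' u (\<lambda>i. v i + w i) = B' u v + B' u w" for u v w
      by (simp add: B'_def Wadd bform_add[OF B] algebra_simps)
    show "B' u (\<lambda>i. a * v i) = a * B' u v" for a u v
      by (simp add: B'_def Wadd bform_scale[OF B] algebra_simps)
    have "\<bar>B' v w\<bar> \<le> (C + l * (1 + \<gamma>)^2) * L2_set v {2..Suc k} * L2_set w {2..Suc k}" for v w
    proof -
      have t: "\<bar>W v\<bar> \<le> (1 + \<gamma>) * L2_set v {2..Suc k}" for v
        using Wle[of v] le'[of v] mult_left_mono[OF le'(1)[of v] g0(1)] by (simp add: algebra_simps)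
      have "\<bar>B v w\<bar> \<le> C * (L2_set v ?I * L2_set w ?I)" using C(2)[of v w] by (simp add: mult.assoc)
      also have "... \<le> C * (L2_set v {2..Suc k} * L2_set w {2..Suc k})"
        using C by (intro mult_left_mono mult_mono le') auto
      finally have 1: "\<bar>B v w\<bar> \<le> C * L2_set v {2..Suc k} * L2_set w {2..Suc k}" by simp
      have "\<bar>l * (W v * W w)\<bar> = l * (\<bar>W v\<bar> * \<bar>W w\<bar>)" using l0 by (simp add: abs_mult)
      also have "... \<le> l * (((1 + \<gamma>) * L2_set v {2..Suc k}) * ((1 + \<gamma>) * L2_set w {2..Suc k}))"
        using l0 g0 by (intro mult_left_mono mult_mono t) auto
      finally have "\<bar>l * (W v * W w)\<bar> \<le> l * (1 + \<gamma>)^2 * L2_set v {2..Suc k} * L2_set w {2..Suc k}"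
        by (simp add: power2_eq_square mult_ac)
      then show ?thesis using 1 unfolding B'_def
        by (intro order_trans[OF abs_triangle_ineq]) (simp add: algebra_simps)
    qed
    then show "\<exists>C\<ge>0. \<forall>v w. \<bar>B' v w\<bar> \<le> C * L2_set v {2..Suc k} * L2_set w {2..Suc k}"
      using C l0 by (intro exI[of _ "C + l * (1 + \<gamma>)^2"]) auto
  qed
  have "robust_lyapunov {2..Suc k} c' B'
    {fb_op (Suc k) a b \<kappa>' | a b. (\<forall>i\<in>{2..<Suc k}. c1 \<le> a i \<and> a i \<le> c2) \<and> c1 \<le> b}"
    unfolding robust_lyapunov_def
  proof (intro conjI allI ballI bf)
    show "0 < c'" using c0 K l0 d by (simp add: c'_def e_def)
    fix v
    have el: "e * (W v)^2 \<le> l * (W v)^2" "e * (W v)^2 \<le> l * d / 2 * (W v)^2" for v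
      by (intro mult_right_mono; simp add: e_def)+
    let ?X = "L2_set v ?I"
    have ld: "l * d / 2 \<le> l * d - l^2 * \<gamma>2^2 / (2 * c)" "l * d / 2 \<le> l * (2 * d)"
    proof -
      have "l * \<gamma>2^2 \<le> l * (1 + \<gamma>2^2)" using l0 by (intro mult_left_mono) auto
      also have "... = c * d" using gp by (simp add: l_def)
      finally have "l * (l * \<gamma>2^2) \<le> l * (c * d)" using l0 by (intro mult_left_mono) auto
      then have "l^2 * \<gamma>2^2 / (2 * c) \<le> l * d / 2" using c0 by (simp add: field_simps power2_eq_square)
      then show "l * d / 2 \<le> l * d - l^2 * \<gamma>2^2 / (2 * c)" by (simp add: mult.commute)
      show "l * d / 2 \<le> l * (2 * d)" using l0 d by simp
    qed
    show "c' * (L2_set v {2..Suc k})^2 \<le> B' v (\<lambda>i. (real i - 3/2) * v i)"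
    proof -
      let ?s = "\<Sum>j\<in>?I. (\<kappa> j * (real j - real (Suc k))) * v j"
      have "W (\<lambda>i. (real i - 3/2) * v i) = d * W v + ?s"
      proof -
        have "(\<Sum>j\<in>?I. \<kappa> j * ((real j - 3/2) * v j)) =
            (\<Sum>j\<in>?I. d * (\<kappa> j * v j) + (\<kappa> j * (real j - real (Suc k))) * v j)"
          by (intro sum.cong) (auto simp: d_def algebra_simps)
        also have "... = d * (\<Sum>j\<in>?I. \<kappa> j * v j) + ?s"
          by (simp only: sum.distrib sum_distrib_left[symmetric])
        finally have "W (\<lambda>i. (real i - 3/2) * v i) = d * v (Suc k) + (d * (\<Sum>j\<in>?I. \<kappa> j * v j) + ?s)"
          by (simp only: W_def d_def)
        then show ?thesis by (simp only: W_def distrib_left add.assoc)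
      qed
      then have "B' v (\<lambda>i. (real i - 3/2) * v i) =
          B v (\<lambda>i. (real i - 3/2) * v i) + l * d * (W v)^2 + l * (W v * ?s)"
        by (simp add: B'_def algebra_simps power2_eq_square)
      moreover have "\<bar>l * (W v * ?s)\<bar> \<le> (l * \<gamma>2) * ?X * \<bar>W v\<bar>"
      proof -
        have "\<bar>W v * ?s\<bar> \<le> \<bar>W v\<bar> * (\<gamma>2 * ?X)" unfolding abs_mult \<gamma>2_def
          by (intro mult_left_mono abs_sum_mult_le_L2) auto
        from mult_left_mono[OF this, of l] show ?thesis using l0 by (simp add: abs_mult mult_ac)
      qed
      moreover have "(l * \<gamma>2) * ?X * \<bar>W v\<bar> \<le> c / 2 * ?X^2 + l^2 * \<gamma>2^2 / (2 * c) * (W v)^2"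
        using quad_bound[OF c0, of "l * \<gamma>2" ?X "\<bar>W v\<bar>"] by (simp add: power_mult_distrib)
      moreover have "l * d / 2 * (W v)^2 \<le> l * d * (W v)^2 - l^2 * \<gamma>2^2 / (2 * c) * (W v)^2"
        unfolding left_diff_distrib[symmetric] by (intro mult_right_mono ld) auto
      ultimately have "c / 2 * ?X^2 + l * d / 2 * (W v)^2 \<le> B' v (\<lambda>i. (real i - 3/2) * v i)"
        using cd[of v] by linarith
      then show ?thesis using fin[of v] el(2)[of v] by linarith
    qed
    have "c / 2 * ?X^2 \<le> c * ?X^2" using c0 by (intro mult_right_mono) auto
    then show "c' * (L2_set v {2..Suc k})^2 \<le> B' v v"
      using fin[of v] el(1)[of v] co[of v] by (simp add: B'_def power2_eq_square)
  next
    fix f v assume "f \<in> {fb_op (Suc k) a b \<kappa>' | a b. (\<forall>i\<in>{2..<Suc k}. c1 \<le> a i \<and> a i \<le> c2) \<and> c1 \<le> b}"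
    then obtain a b where f: "f = fb_op (Suc k) a b \<kappa>'" and a: "\<forall>i\<in>{2..<Suc k}. c1 \<le> a i \<and> a i \<le> c2"
      and b: "c1 \<le> b" by blast
    let ?X = "L2_set v ?I"
    have ak: "c1 \<le> a k" "a k \<le> c2" using a step.hyps by auto
    have kI: "k \<in> ?I" using step.hyps by auto
    let ?e = "\<lambda>i. if i = k then 1 else (0::real)"
    have e1: "L2_set ?e ?I = 1"
    proof -
      have "(\<Sum>i\<in>?I. (?e i)^2) = (\<Sum>i\<in>?I. if i = k then 1 else 0)" by (intro sum.cong) auto
      then show ?thesis using kI by (simp add: L2_set_def)
    qed
    have vS: "v (Suc k) = W v - (\<Sum>j\<in>?I. \<kappa> j * v j)" by (simp add: W_def)
    have "B v (f v) = B v (\<lambda>i. fb_op k a (a k) \<kappa> v i + (a k * W v) * ?e i)"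
      by (rule bform_cong[OF B]) (auto simp: f fb_op_def vS algebra_simps)
    also have "... = B v (fb_op k a (a k) \<kappa> v) + (a k * W v) * B v ?e"
      by (simp only: bform_add[OF B] bform_scale[OF B])
    also have "... \<le> - c * ?X^2 + C * c2 * ?X * \<bar>W v\<bar>"
    proof (rule add_mono)
      show "B v (fb_op k a (a k) \<kappa> v) \<le> - c * ?X^2" by (rule cf) (use a ak in auto)
      have "(a k * W v) * B v ?e \<le> \<bar>a k\<bar> * \<bar>W v\<bar> * \<bar>B v ?e\<bar>"
        using abs_ge_self[of "(a k * W v) * B v ?e"] by (simp only: abs_mult)
      also have "... \<le> c2 * \<bar>W v\<bar> * (C * ?X)"
        using ak c C(2)[of v ?e] e1 by (intro mult_mono) auto
      finally show "(a k * W v) * B v ?e \<le> C * c2 * ?X * \<bar>W v\<bar>" by (simp add: mult_ac)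
    qed
    finally have 1: "B v (f v) \<le> - c * ?X^2 + C * c2 * ?X * \<bar>W v\<bar>" .
    have fS: "f v (Suc k) = - b * L * W v"
    proof -
      have "(\<Sum>j=2..Suc k. \<kappa>' j * v j) = L * v (Suc k) + (\<Sum>j\<in>?I. L * \<kappa> j * v j)"
        unfolding I' by (simp add: \<kappa>'_def)
      also have "... = L * W v" by (simp add: W_def algebra_simps sum_distrib_left)
      finally show ?thesis by (simp add: f fb_op_def)
    qed
    have sb: "\<bar>\<Sum>j\<in>?I. \<kappa> j * f v j\<bar> \<le> \<Gamma> * (?X + \<bar>W v\<bar>)"
    proof -
      have "\<bar>\<Sum>j\<in>?I. \<kappa> j * f v j\<bar> \<le> (\<Sum>j\<in>?I. \<bar>\<kappa> j\<bar> * (c2 * ((1 + \<gamma>) * (?X + \<bar>W v\<bar>))))"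
      proof (rule order_trans[OF sum_abs], rule sum_mono)
        fix j assume j: "j \<in> ?I"
        have "\<bar>v (j + 1)\<bar> \<le> (1 + \<gamma>) * (?X + \<bar>W v\<bar>)"
        proof (cases "j = k")
          case True
          have "\<bar>v (Suc k)\<bar> \<le> \<bar>W v\<bar> + \<gamma> * ?X" by (rule vle)
          also have "... \<le> (1 + \<gamma>) * (?X + \<bar>W v\<bar>)"
            using mult_nonneg_nonneg[OF g0(1), of "\<bar>W v\<bar>"] L2_set_nonneg[of v ?I]
            unfolding distrib_left distrib_right by linarith
          finally show ?thesis using True by simp
        next
          case False
          then have "\<bar>v (j + 1)\<bar> \<le> ?X" using j by (intro abs_le_L2_set) auto
          also have "... \<le> 1 * (?X + \<bar>W v\<bar>)" by simp
          also have "... \<le> (1 + \<gamma>) * (?X + \<bar>W v\<bar>)" using g0 by (intro mult_right_mono) auto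
          finally show ?thesis .
        qed
        moreover have "f v j = a j * v (j + 1)" using j by (simp add: f fb_op_def)
        moreover have "0 \<le> a j" "a j \<le> c2" using bspec[OF a, of j] j c by auto
        ultimately show "\<bar>\<kappa> j * f v j\<bar> \<le> \<bar>\<kappa> j\<bar> * (c2 * ((1 + \<gamma>) * (?X + \<bar>W v\<bar>)))"
          using c unfolding abs_mult by (auto intro!: mult_left_mono mult_mono simp: abs_mult)
      qed
      then show ?thesis unfolding sum_distrib_right[symmetric] by (simp add: \<Gamma>_def mult_ac)
    qed
    have "W v * W (f v) = - b * L * (W v)^2 + W v * (\<Sum>j\<in>?I. \<kappa> j * f v j)"
      unfolding W_def[of "f v"] fS by (simp add: algebra_simps power2_eq_square)
    also have "... \<le> - c1 * L * (W v)^2 + \<bar>W v\<bar> * (\<Gamma> * (?X + \<bar>W v\<bar>))"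
    proof (rule add_mono)
      show "- b * L * (W v)^2 \<le> - c1 * L * (W v)^2" using b L0 by (intro mult_right_mono) auto
      have "W v * (\<Sum>j\<in>?I. \<kappa> j * f v j) \<le> \<bar>W v\<bar> * \<bar>\<Sum>j\<in>?I. \<kappa> j * f v j\<bar>" by (metis abs_ge_self abs_mult)
      also have "... \<le> \<bar>W v\<bar> * (\<Gamma> * (?X + \<bar>W v\<bar>))" by (intro mult_left_mono sb) auto
      finally show "W v * (\<Sum>j\<in>?I. \<kappa> j * f v j) \<le> \<bar>W v\<bar> * (\<Gamma> * (?X + \<bar>W v\<bar>))" .
    qed
    finally have 2: "l * (W v * W (f v)) \<le> l * (- c1 * L * (W v)^2 + \<bar>W v\<bar> * (\<Gamma> * (?X + \<bar>W v\<bar>)))"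
      using l0 by (intro mult_left_mono) auto
    have 3: "l * c1 * L = A^2 / (2 * c) + l * \<Gamma> + l * d / 2" using l0 c by (simp add: L_def)
    have "B' v (f v) \<le> - c * ?X^2 + A * ?X * \<bar>W v\<bar> + l * \<Gamma> * \<bar>W v\<bar>^2 - (l * c1 * L) * (W v)^2"
      using 1 2 unfolding B'_def by (simp add: A_def algebra_simps power2_eq_square del: abs_mult_self_eq power2_abs)
    also have "... \<le> - (c / 2) * ?X^2 - l * d / 2 * (W v)^2"
      using quad_bound[OF c0, of A ?X "\<bar>W v\<bar>"] unfolding 3 by (simp add: algebra_simps)
    finally have "B' v (f v) \<le> - (c / 2) * ?X^2 - l * d / 2 * (W v)^2" .
    moreover have "e * (W v)^2 \<le> l * d / 2 * (W v)^2" by (intro mult_right_mono) (auto simp: e_def)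
    ultimately show "B' v (f v) \<le> - c' * (L2_set v {2..Suc k})^2" using fin[of v] by simp
  qed
  then show ?case by blast
qed

section \<open>Scalar estimates behind the energy inequality\<close>

lemma young: fixes a b k :: real assumes "0 < k" shows "a * b \<le> k * a^2 + b^2 / (4 * k)"
proof -
  have "0 \<le> (2 * k * a - b)^2 / (4 * k)" using assms by simp
  also have "... = k * a^2 + b^2 / (4 * k) - a * b"
    using assms by (simp add: field_simps power2_eq_square)
  finally show ?thesis by simp
qed

text \<open>
  The cross term by which the observer error drives the feedback chain is absorbed by giving the
  observer form the weight \<open>M ^ 8\<close>. The mixed products are split by Young's inequality so that half
  of the dissipation of order \<open>r\<^sup>2\<close> survives. The coefficient of \<open>X\<^sup>2\<close> must
  depend on \<open>x\<^sub>1\<close> and \<open>\<theta>\<close> alone (through \<open>B\<close>, not \<open>B1\<close>), for it is cancelled by \<open>\<vartheta>\<^sub>1\<close>; terms in which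
  \<open>\<theta>hat\<close> occurs are therefore charged to \<open>r Z\<close>. The powers of \<open>M\<close> are not optimized.
\<close>

lemma core_estimate:
  fixes M r p e w X \<theta> B B1 s dVo dVc dVx \<delta>e \<delta>w N :: real
  assumes M: "1 \<le> M" and r: "1 \<le> r" and B: "1 \<le> B" "B \<le> B1" and p: "1 / M \<le> p"
    and nn: "0 \<le> e" "0 \<le> w" "0 \<le> X" "0 \<le> \<theta>"
    and dVo: "dVo \<le> - (2 / M) * r^2 * p * e^2 + 2 * M * r * e * \<delta>e"
    and dVc: "dVc \<le> - (2 / M) * r^2 * p * w^2 + 2 * M * r * w * (M^2 * r * p * e + \<delta>w)"
    and \<delta>e: "\<delta>e \<le> M^4 * (B^2 * \<theta> * X + B * (e + w) + B1^3 * X / r + \<bar>s\<bar>)"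
    and \<delta>w: "\<delta>w \<le> M^4 * (B^2 * \<theta> * X + (2 * B1^5 * X + B1^3 * r * (e + w) + B1^3 * \<theta> * X) / r)"
    and dVx: "dVx \<le> - N + B * r * X * (e + w) + B * \<theta> * X^2"
  shows "dVx + M^8 * dVo + dVc \<le> - (1 / (2 * M^2)) * r^2 * (e^2 + w^2)
     + 100 * M^28 * B1^10 * r * (e^2 + w^2) + 100 * M^28 * B^4 * (1 + \<theta>^2) * X^2 + 100 * M^28 * s^2 - N"
proof -
  define y where "y = e + w"
  define Z where "Z = e^2 + w^2"
  have B1: "1 \<le> B1" using B by simp
  have y0: "0 \<le> y" and yZ: "y^2 \<le> 2 * Z"
    using nn sum_squares_bound[of e w] by (auto simp: y_def Z_def power2_sum)
  have Z0: "0 \<le> Z" by (simp add: Z_def)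
  have p0: "0 < p" using p M by (meson dual_order.strict_trans1 less_le_trans zero_less_divide_1_iff zero_less_one)
  have diss: "M^8 * (- (2 / M) * r^2 * p * e^2) + (- (2 / M) * r^2 * p * w^2 + 2 * M * r * w * (M^2 * r * p * e))
      \<le> - (1 / M^2) * r^2 * Z"
  proof -
    have a: "M^8 * (2 / M) = 2 * M^7" using M by (simp add: power_eq_if)
    have "(M^4 * e - w)^2 / M \<ge> 0" using M by simp
    moreover have "(M^4 * e - w)^2 / M = M^7 * e^2 - 2 * M^3 * e * w + w^2 / M"
    proof -
      have "(M^4 * e - w)^2 = M * (M^7 * e^2 - 2 * M^3 * e * w) + w^2" by algebra
      then show ?thesis using M by (simp add: add_divide_distrib)
    qed
    ultimately have 1: "2 * M^3 * e * w \<le> M^7 * e^2 + w^2 / M" by linarith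
    have "M * (1/M) \<le> M^7 * M" using M mult_mono[OF one_le_power[OF M, of 7] M] by simp
    then have 2: "1 / M \<le> M^7" using M by (simp add: field_simps)
    have "- (2 * M^7) * e^2 - (2 / M) * w^2 + 2 * M^3 * e * w \<le> - (1 / M) * Z"
      using 1 mult_right_mono[OF 2, of "e^2"] by (simp add: Z_def algebra_simps add_divide_distrib)
    then have "(r^2 * p) * (- (2 * M^7) * e^2 - (2 / M) * w^2 + 2 * M^3 * e * w) \<le> (r^2 * p) * (- (1 / M) * Z)"
      using p0 by (intro mult_left_mono) auto
    also have "... = - (r^2 * Z / M) * p" by simp
    also have "... \<le> - (r^2 * Z / M) * (1 / M)" using p M Z0 by (intro mult_left_mono_neg) auto
    finally have "(r^2 * p) * (- (2 * M^7) * e^2 - (2 / M) * w^2 + 2 * M^3 * e * w) \<le> - (1 / M^2) * r^2 * Z"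
      by (simp add: power2_eq_square)
    moreover have "M^8 * (- (2 / M) * r^2 * p * e^2) + (- (2 / M) * r^2 * p * w^2 + 2 * M * r * w * (M^2 * r * p * e))
      = (r^2 * p) * (- (M^8 * (2 / M)) * e^2 - (2 / M) * w^2 + 2 * M^3 * e * w)"
      by (simp add: algebra_simps power2_eq_square power3_eq_cube)
    ultimately show ?thesis unfolding a by linarith
  qed
  define D where "D = 2 * M^13"
  have D0: "0 \<le> D" using M by (simp add: D_def)
  define Re where "Re = B^2 * \<theta> * X + B * y + B1^3 * X / r + \<bar>s\<bar>"
  define Rw where "Rw = B^2 * \<theta> * X + (2 * B1^5 * X + B1^3 * r * y + B1^3 * \<theta> * X) / r"
  have Re0: "0 \<le> Re" and Rw0: "0 \<le> Rw" using nn y0 B B1 r by (auto simp: Re_def Rw_def)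
  have rest: "M^8 * (2 * M * r * e * \<delta>e) + 2 * M * r * w * \<delta>w \<le> D * (r * y * (Re + Rw))"
  proof -
    have "M^8 * (2 * M * r * e * \<delta>e) \<le> M^8 * (2 * M * r * e * (M^4 * Re))"
      using \<delta>e M r nn by (intro mult_left_mono) (auto simp: Re_def y_def)
    also have "... = D * (r * e * Re)" by (simp add: D_def mult_ac flip: power_add power_Suc)
    finally have 1: "M^8 * (2 * M * r * e * \<delta>e) \<le> D * (r * e * Re)" .
    have "2 * M * r * w * \<delta>w \<le> 2 * M * r * w * (M^4 * Rw)"
      using \<delta>w M r nn by (intro mult_left_mono) (auto simp: Rw_def y_def)
    also have "... = (2 * M^5) * (r * w * Rw)" by (simp add: mult_ac flip: power_add power_Suc)
    also have "... \<le> D * (r * w * Rw)" unfolding D_def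
      using M r nn Rw0 by (intro mult_right_mono mult_left_mono power_increasing) auto
    finally have 2: "2 * M * r * w * \<delta>w \<le> D * (r * w * Rw)" .
    have "r * e * Re + r * w * Rw \<le> r * y * (Re + Rw)"
    proof -
      have "0 \<le> r * w * Re + r * e * Rw" using Re0 Rw0 nn r by simp
      then show ?thesis by (simp add: y_def algebra_simps)
    qed
    from mult_left_mono[OF this D0] 1 2 show ?thesis by (simp add: distrib_left)
  qed
  have B3: "B \<le> B1^3" "B1^3 \<le> B1^5"
  proof -
    have "B \<le> B1 * 1" using B by simp
    also have "... \<le> B1 * B1^2" using B1 by (intro mult_left_mono) auto
    finally show "B \<le> B1^3" by (simp add: power_eq_if)
    show "B1^3 \<le> B1^5" using B1 by (intro power_increasing) auto
  qed
  have expand: "r * y * (Re + Rw) \<le> 2 * (r * y) * (B^2 * \<theta> * X) + 2 * r * B1^3 * y^2 + 3 * y * (B1^5 * X)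
      + (r * y) * \<bar>s\<bar> + y * (B1^3 * \<theta> * X)"
  proof -
    have "r * y * (Re + Rw) = 2 * (r * y) * (B^2 * \<theta> * X) + r * y^2 * (B + B1^3) + y * X * (B1^3 + 2 * B1^5)
      + (r * y) * \<bar>s\<bar> + y * (B1^3 * \<theta> * X)"
      using r by (simp add: Re_def Rw_def field_simps power2_eq_square)
    moreover have "r * y^2 * (B + B1^3) \<le> r * y^2 * (2 * B1^3)" using B3 r by (intro mult_left_mono) auto
    moreover have "y * X * (B1^3 + 2 * B1^5) \<le> y * X * (3 * B1^5)" using B3 y0 nn by (intro mult_left_mono) auto
    ultimately show ?thesis by (simp add: algebra_simps)
  qed
  have M2: "0 < 1 / (16 * M^2)" using M by simp
  have Y: "(r * y) * b \<le> (1 / (8 * M^2)) * r^2 * Z + 4 * M^2 * b^2" for b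
  proof -
    have "(r * y) * b \<le> (1 / (16 * M^2)) * (r * y)^2 + b^2 / (4 * (1 / (16 * M^2)))" by (rule young[OF M2])
    also have "b^2 / (4 * (1 / (16 * M^2))) = 4 * M^2 * b^2" by simp
    also have "(1 / (16 * M^2)) * (r * y)^2 = (1 / (16 * M^2)) * r^2 * y^2" by (simp add: power_mult_distrib)
    also have "... \<le> (1 / (16 * M^2)) * r^2 * (2 * Z)" using yZ M by (intro mult_left_mono) auto
    finally show ?thesis by (simp add: mult_ac)
  qed
  have rZ: "Z \<le> r * Z" using r Z0 mult_right_mono[of 1 r Z] by simp
  have X1: "X^2 \<le> B^4 * (1 + \<theta>^2) * X^2" "\<theta>^2 * X^2 \<le> B^4 * (1 + \<theta>^2) * X^2" "B^2 * X^2 \<le> B^4 * (1 + \<theta>^2) * X^2"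
    "B^4 * \<theta>^2 * X^2 \<le> B^4 * (1 + \<theta>^2) * X^2" "B * \<theta> * X^2 \<le> B^4 * (1 + \<theta>^2) * X^2"
  proof -
    have b4: "1 \<le> B^4" "B^2 \<le> B^4" "B \<le> B^4" using B self_le_power[of B 4] power_increasing[of 2 4 B] by auto
    have t: "\<theta> \<le> 1 + \<theta>^2" using sum_squares_bound[of 1 \<theta>] nn by (simp; linarith)
    have g: "u * v \<le> B^4 * (1 + \<theta>^2)" if "u \<le> B^4" "v \<le> 1 + \<theta>^2" "0 \<le> v" for u v
      using that b4 by (intro mult_mono) auto
    show "X^2 \<le> B^4 * (1 + \<theta>^2) * X^2" "\<theta>^2 * X^2 \<le> B^4 * (1 + \<theta>^2) * X^2" "B^2 * X^2 \<le> B^4 * (1 + \<theta>^2) * X^2"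
      "B^4 * \<theta>^2 * X^2 \<le> B^4 * (1 + \<theta>^2) * X^2" "B * \<theta> * X^2 \<le> B^4 * (1 + \<theta>^2) * X^2"
      using mult_right_mono[OF g[of 1 1], of "X^2"] mult_right_mono[OF g[of 1 "\<theta>^2"], of "X^2"]
        mult_right_mono[OF g[of "B^2" 1], of "X^2"] mult_right_mono[OF g[of "B^4" "\<theta>^2"], of "X^2"]
        mult_right_mono[OF g[of B \<theta>], of "X^2"] b4 t nn by auto
  qed
  have B10: "1 \<le> B1^10" "B1^3 \<le> B1^10" "(B1^5)^2 = B1^10" "(B1^3)^2 \<le> B1^10"
    using B1 power_increasing[of 3 10 B1] power_increasing[of 6 10 B1] by (auto simp flip: power_mult)
  have Mp: "M^13 \<le> M^28" "M^26 \<le> M^28" "M^2 \<le> M^28" "1 \<le> M^28"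
    using M by (auto intro!: power_increasing)
  let ?P = "B^4 * (1 + \<theta>^2) * X^2"
  let ?Q = "B1^10 * r * Z"
  have P0: "0 \<le> ?P" and Q0: "0 \<le> ?Q" using B B1 r Z0 by auto
  have t1: "D * (2 * (r * y) * (B^2 * \<theta> * X)) \<le> (1 / (8 * M^2)) * r^2 * Z + 64 * M^28 * ?P"
  proof -
    have "D * (2 * (r * y) * (B^2 * \<theta> * X)) = (r * y) * (4 * M^13 * (B^2 * \<theta> * X))" by (simp add: D_def)
    also have "... \<le> (1 / (8 * M^2)) * r^2 * Z + 4 * M^2 * (4 * M^13 * (B^2 * \<theta> * X))^2" by (rule Y)
    also have "4 * M^2 * (4 * M^13 * (B^2 * \<theta> * X))^2 = 64 * M^28 * (B^4 * \<theta>^2 * X^2)"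
      by (simp add: power_mult_distrib mult_ac flip: power_mult power_add)
    also have "... \<le> 64 * M^28 * ?P" using M by (intro mult_left_mono X1) auto
    finally show ?thesis by simp
  qed
  have t2: "D * (2 * r * B1^3 * y^2) \<le> 8 * M^28 * ?Q"
  proof -
    have "D * (2 * r * B1^3 * y^2) \<le> D * (2 * r * B1^3 * (2 * Z))"
      using D0 r B1 yZ by (intro mult_left_mono) auto
    also have "... = 8 * M^13 * (r * B1^3 * Z)" by (simp add: D_def)
    also have "... \<le> 8 * M^28 * (r * B1^10 * Z)"
      using M r B1 B10 Mp Z0 by (intro mult_mono) auto
    finally show ?thesis by (simp add: mult_ac)
  qed
  have y2: "k * (b * y)^2 \<le> 2 * k * ?Q" if "0 \<le> k" "b^2 \<le> B1^10" for k b
  proof -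
    have "(b * y)^2 \<le> B1^10 * (2 * (r * Z))" unfolding power_mult_distrib
      using that yZ rZ B1 Z0 r by (intro mult_mono) auto
    from mult_left_mono[OF this that(1)] show ?thesis by (simp add: mult_ac)
  qed
  have t3: "D * (3 * y * (B1^5 * X)) \<le> ?P + 18 * M^28 * ?Q"
  proof -
    have "D * (3 * y * (B1^5 * X)) = X * (6 * M^13 * (B1^5 * y))" by (simp add: D_def)
    also have "... \<le> 1 * X^2 + (6 * M^13 * (B1^5 * y))^2 / (4 * 1)" by (rule young) simp
    also have "(6 * M^13 * (B1^5 * y))^2 / (4 * 1) = 9 * M^26 * (B1^5 * y)^2"
      by (simp add: power_mult_distrib flip: power_mult)
    also have "... \<le> 2 * (9 * M^26) * ?Q" by (rule y2) (use M B10 in auto)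
    also have "... \<le> 2 * (9 * M^28) * ?Q" using Mp Q0 by (intro mult_right_mono) auto
    finally show ?thesis using X1(1) by simp
  qed
  have t4: "D * ((r * y) * \<bar>s\<bar>) \<le> (1 / (8 * M^2)) * r^2 * Z + 16 * M^28 * s^2"
  proof -
    have "D * ((r * y) * \<bar>s\<bar>) = (r * y) * (2 * M^13 * \<bar>s\<bar>)" by (simp add: D_def)
    also have "... \<le> (1 / (8 * M^2)) * r^2 * Z + 4 * M^2 * (2 * M^13 * \<bar>s\<bar>)^2" by (rule Y)
    also have "4 * M^2 * (2 * M^13 * \<bar>s\<bar>)^2 = 16 * M^28 * s^2"
      by (simp add: power_mult_distrib flip: power_mult power_add)
    finally show ?thesis .
  qed
  have t5: "D * (y * (B1^3 * \<theta> * X)) \<le> ?P + 2 * M^28 * ?Q"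
  proof -
    have "D * (y * (B1^3 * \<theta> * X)) = (\<theta> * X) * (2 * M^13 * (B1^3 * y))" by (simp add: D_def)
    also have "... \<le> 1 * (\<theta> * X)^2 + (2 * M^13 * (B1^3 * y))^2 / (4 * 1)" by (rule young) simp
    also have "(2 * M^13 * (B1^3 * y))^2 / (4 * 1) = M^26 * (B1^3 * y)^2"
      by (simp add: power_mult_distrib flip: power_mult)
    also have "... \<le> 2 * M^26 * ?Q" by (rule y2) (use M B10 in auto)
    also have "... \<le> 2 * M^28 * ?Q" using Mp Q0 by (intro mult_right_mono) auto
    finally show ?thesis using X1(2) by (simp add: power_mult_distrib)
  qed
  have t6: "B * r * X * (e + w) \<le> (1 / (8 * M^2)) * r^2 * Z + 4 * M^28 * ?P"
  proof -
    have "B * r * X * (e + w) = (r * y) * (B * X)" by (simp add: y_def)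
    also have "... \<le> (1 / (8 * M^2)) * r^2 * Z + 4 * M^2 * (B * X)^2" by (rule Y)
    also have "4 * M^2 * (B * X)^2 \<le> 4 * M^28 * ?P"
      using X1(3) Mp by (intro mult_mono) (auto simp: power_mult_distrib)
    finally show ?thesis by simp
  qed
  have PP: "?P \<le> M^28 * ?P" using mult_right_mono[OF Mp(4) P0] by simp
  have "M^8 * dVo + dVc \<le> - (1 / M^2) * r^2 * Z + D * (r * y * (Re + Rw))"
  proof -
    have "M^8 * dVo \<le> M^8 * (- (2 / M) * r^2 * p * e^2 + 2 * M * r * e * \<delta>e)"
      using M by (intro mult_left_mono dVo) auto
    then have "M^8 * dVo \<le> M^8 * (- (2 / M) * r^2 * p * e^2) + M^8 * (2 * M * r * e * \<delta>e)"
      by (simp only: distrib_left)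
    moreover have "2 * M * r * w * (M^2 * r * p * e + \<delta>w) = 2 * M * r * w * (M^2 * r * p * e) + 2 * M * r * w * \<delta>w"
      by (simp only: distrib_left)
    ultimately show ?thesis using dVc diss rest by linarith
  qed
  also have "D * (r * y * (Re + Rw)) \<le> D * (2 * (r * y) * (B^2 * \<theta> * X) + 2 * r * B1^3 * y^2 + 3 * y * (B1^5 * X)
      + (r * y) * \<bar>s\<bar> + y * (B1^3 * \<theta> * X))" by (rule mult_left_mono[OF expand D0])
  finally have "dVx + M^8 * dVo + dVc \<le> - (1 / M^2) * r^2 * Z + 3 * ((1 / (8 * M^2)) * r^2 * Z)
     + (68 * M^28 * ?P + 2 * ?P + ?P) + 28 * M^28 * ?Q + 16 * M^28 * s^2 - N"
    using t1 t2 t3 t4 t5 t6 dVx X1(5) unfolding distrib_left by linarith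
  moreover have "- (1 / M^2) * r^2 * Z + 3 * ((1 / (8 * M^2)) * r^2 * Z) \<le> - (1 / (2 * M^2)) * r^2 * Z"
  proof -
    have "0 \<le> (1 / M^2) * r^2 * Z" using Z0 by simp
    then show ?thesis by (simp add: field_simps)
  qed
  moreover have "28 * M^28 * ?Q \<le> 100 * M^28 * ?Q" using M Q0 by (intro mult_right_mono) auto
  moreover have "16 * M^28 * s^2 \<le> 100 * M^28 * s^2" using M by (intro mult_right_mono) auto
  moreover have "68 * M^28 * ?P + 2 * ?P + ?P \<le> 100 * M^28 * ?P"
  proof -
    have "68 * M^28 * ?P = 68 * (M^28 * ?P)" by (simp only: mult.assoc)
    then have "68 * M^28 * ?P + 2 * ?P + ?P \<le> 71 * (M^28 * ?P)" using PP by linarith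
    also have "... \<le> 100 * (M^28 * ?P)" using M P0 by (intro mult_right_mono) auto
    finally show ?thesis by simp
  qed
  ultimately have "dVx + M^8 * dVo + dVc \<le> - (1 / (2 * M^2)) * r^2 * Z + 100 * M^28 * ?P + 100 * M^28 * ?Q
    + 100 * M^28 * s^2 - N" by linarith
  then show ?thesis unfolding Z_def[symmetric] by (simp add: mult_ac)
qed

text \<open>
  The factor \<open>1 / sqrt ru\<close> is given to the terms in \<open>e\<close>, \<open>w\<close> and \<open>X\<close>, which thereby carry
  \<open>1 / ru\<close>, while \<open>s\<^sup>2\<close> carries no power of \<open>ru\<close>. Either part is then small relative to
  the dissipation when \<open>ru\<close> is large.
\<close>

lemma tracking_estimate:
  fixes M Wp Rn ru s D \<theta> X e w m1 m1t m2 Ed Y \<alpha> :: real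
  assumes M: "1 \<le> M" and Wp: "1 \<le> Wp" and Rn: "1 \<le> Rn" and ru: "1 \<le> ru"
    and nn: "0 \<le> e" "0 \<le> w" "0 \<le> X" "0 \<le> \<theta>" "0 \<le> m1" "0 \<le> m1t" "0 \<le> m2" "0 \<le> Ed"
    and Y: "Y = (1 + \<theta>) * X + e + w"
    and D: "\<bar>D\<bar> \<le> Wp * (Y + \<bar>s\<bar> + m1 + m1t + Ed + m2 * Y + m2)"
    and s: "\<bar>s\<bar> \<le> Wp" and ms: "m1^2 + m1t^2 + m2^2 \<le> M * \<alpha>"
  shows "\<bar>s\<bar> * \<bar>D\<bar> / sqrt ru \<le> 30 * M^2 * Rn * Wp^4 * s^2
     + 30 * M^2 * Rn * Wp^4 / ru * (e^2 + w^2 + (1 + \<theta>^2) * X^2)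
     + \<alpha> / (4 * Rn) + Ed^2 / (8 * M^2 * Rn)"
proof -
  define T where "T = e^2 + w^2 + (1 + \<theta>^2) * X^2"
  define q where "q = sqrt ru"
  have q: "1 \<le> q" "q^2 = ru" using ru by (auto simp: q_def)
  have T0: "0 \<le> T" by (simp add: T_def)
  have Y0: "0 \<le> Y" using nn Y by simp
  have YT: "Y^2 \<le> 6 * T"
  proof -
    have "Y^2 \<le> 3 * (((1 + \<theta>) * X)^2 + e^2 + w^2)"
      using sum_squares_bound[of "(1+\<theta>)*X" e] sum_squares_bound[of "(1+\<theta>)*X" w] sum_squares_bound[of e w]
      unfolding Y by (simp add: power2_sum algebra_simps)
    also have "((1 + \<theta>) * X)^2 \<le> 2 * (1 + \<theta>^2) * X^2" unfolding power_mult_distrib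
      using sum_squares_bound[of 1 \<theta>] by (intro mult_right_mono) (auto simp: power2_sum)
    finally have "Y^2 \<le> 3 * (2 * ((1 + \<theta>^2) * X^2) + e^2 + w^2)" by (simp add: algebra_simps)
    also have "... = 6 * T - 3 * e^2 - 3 * w^2" by (simp add: T_def)
    also have "... \<le> 6 * T" by simp
    finally show ?thesis .
  qed
  let ?a = "\<bar>s\<bar> * Wp"
  have a2: "?a^2 = Wp^2 * s^2" by (simp add: power_mult_distrib)
  have Wp4: "Wp \<le> Wp^4" "Wp^2 \<le> Wp^4" "1 \<le> Wp^4" "Wp \<le> Wp^2"
    using Wp self_le_power[of Wp 4] power_increasing[of 2 4 Wp] self_le_power[of Wp 2] by auto
  let ?K = "M^2 * Rn * Wp^4"
  have Mle: "1 \<le> M^2" "M \<le> M^2" using M self_le_power[of M 2] by auto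
  have MR: "1 \<le> M^2 * Rn" "M * Rn \<le> M^2 * Rn"
    using mult_mono[OF Mle(1) Rn] Mle Rn by (auto intro: mult_right_mono)
  have K: "Wp^2 \<le> ?K" "M * Rn * Wp^2 \<le> ?K" "M^2 * Rn * Wp^2 \<le> ?K" "M * Rn * Wp^4 \<le> ?K" "1 \<le> ?K"
    using mult_mono[OF MR(1) Wp4(2)] mult_mono[OF MR(2) Wp4(2)] mult_mono[OF MR(2) order_refl[of "Wp^4"]]
      mult_mono[OF MR(1) Wp4(3)] mult_left_mono[OF Wp4(2), of "M^2 * Rn"] MR M Rn Wp by auto
  have s0: "0 \<le> s^2" by simp
  have t1: "?a * Y / q \<le> ?K * s^2 + 2 * (?K / ru * T)"
  proof -
    have "?a * Y / q = ?a * (Y / q)" by simp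
    also have "... \<le> 1 * ?a^2 + (Y / q)^2 / (4 * 1)" by (rule young) simp
    also have "(Y / q)^2 / (4 * 1) = Y^2 / (4 * ru)" by (simp add: power_divide q)
    also have "... \<le> (6 * T) / (4 * ru)" using YT ru by (intro divide_right_mono) auto
    also have "... \<le> 2 * (?K / ru * T)"
    proof -
      have "1 * (T / ru) \<le> ?K * (T / ru)" using K T0 ru by (intro mult_right_mono) auto
      moreover have "0 \<le> T / ru" using T0 ru by simp
      ultimately show ?thesis by (simp add: field_simps)
    qed
    finally show ?thesis unfolding a2 using mult_right_mono[OF K(1) s0] by simp
  qed
  have t2: "?a * \<bar>s\<bar> / q \<le> ?K * s^2"
  proof -
    have "?a * \<bar>s\<bar> / q \<le> ?a * \<bar>s\<bar> / 1" using q Wp by (intro divide_left_mono) auto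
    also have "... = Wp * s^2" by (simp add: power2_eq_square)
    also have "... \<le> ?K * s^2" using Wp4 K by (intro mult_right_mono) auto
    finally show ?thesis .
  qed
  have t3: "?a * (m1 + m1t + m2) / q \<le> 6 * (?K * s^2) + \<alpha> / (8 * Rn)"
  proof -
    have "?a * (m1 + m1t + m2) / q \<le> ?a * (m1 + m1t + m2) / 1" using q Wp nn by (intro divide_left_mono) auto
    also have "... \<le> (6 * M * Rn) * ?a^2 + (m1 + m1t + m2)^2 / (4 * (6 * M * Rn))"
      using young[of "6 * M * Rn" ?a "m1 + m1t + m2"] M Rn by simp
    also have "(m1 + m1t + m2)^2 \<le> 3 * (M * \<alpha>)"
      using sum_squares_bound[of m1 m1t] sum_squares_bound[of m1 m2] sum_squares_bound[of m1t m2] ms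
      by (simp add: power2_sum algebra_simps)
    then have "(m1 + m1t + m2)^2 / (4 * (6 * M * Rn)) \<le> 3 * (M * \<alpha>) / (4 * (6 * M * Rn))"
      using M Rn by (intro divide_right_mono) auto
    also have "... = \<alpha> / (8 * Rn)" using M Rn by simp
    also have "(6 * M * Rn) * ?a^2 \<le> 6 * (?K * s^2)"
      unfolding a2 using mult_right_mono[OF K(2) s0] by simp
    finally show ?thesis by simp
  qed
  have t4: "?a * Ed / q \<le> 2 * (?K * s^2) + Ed^2 / (8 * M^2 * Rn)"
  proof -
    have "?a * Ed / q \<le> ?a * Ed / 1" using q Wp nn by (intro divide_left_mono) auto
    also have "... \<le> (2 * M^2 * Rn) * ?a^2 + Ed^2 / (4 * (2 * M^2 * Rn))"
      using young[of "2 * M^2 * Rn" ?a Ed] M Rn by simp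
    also have "(2 * M^2 * Rn) * ?a^2 \<le> 2 * (?K * s^2)"
      unfolding a2 using mult_right_mono[OF K(3) s0] by simp
    finally show ?thesis by simp
  qed
  have t5: "?a * (m2 * Y) / q \<le> 12 * (?K / ru * T) + \<alpha> / (8 * Rn)"
  proof -
    have "?a * (m2 * Y) / q = (?a * Y / q) * m2" by simp
    also have "... \<le> (2 * M * Rn) * (?a * Y / q)^2 + m2^2 / (4 * (2 * M * Rn))"
      using young[of "2 * M * Rn" "?a * Y / q" m2] M Rn by simp
    also have "m2^2 / (4 * (2 * M * Rn)) \<le> (M * \<alpha>) / (4 * (2 * M * Rn))"
    proof -
      have "m2^2 \<le> M * \<alpha>" using ms zero_le_power2[of m1] zero_le_power2[of m1t] by linarith
      then show ?thesis using M Rn by (intro divide_right_mono) auto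
    qed
    also have "... = \<alpha> / (8 * Rn)" using M Rn by simp
    also have "(2 * M * Rn) * (?a * Y / q)^2 \<le> 12 * (?K / ru * T)"
    proof -
      have "(?a * Y)^2 \<le> Wp^4 * (6 * T)"
      proof -
        have "?a^2 \<le> (Wp * Wp)^2" using s Wp by (intro power_mono mult_right_mono) auto
        also have "... = Wp^4" by (simp add: power_mult_distrib flip: power_add)
        finally show ?thesis unfolding power_mult_distrib[of ?a] using YT Wp by (intro mult_mono) auto
      qed
      then have "(2 * M * Rn) * ((?a * Y)^2 / ru) \<le> (2 * M * Rn) * (Wp^4 * (6 * T) / ru)"
        using M Rn ru by (intro mult_left_mono divide_right_mono) auto
      also have "... = 12 * ((M * Rn * Wp^4) / ru * T)" by simp
      also have "... \<le> 12 * (?K / ru * T)"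
        by (rule mult_left_mono[OF mult_right_mono[OF divide_right_mono[OF K(4)]]]) (use ru T0 in auto)
      finally show ?thesis by (simp add: power_divide q)
    qed
    finally show ?thesis by simp
  qed
  have "\<bar>s\<bar> * \<bar>D\<bar> / q \<le> \<bar>s\<bar> * (Wp * (Y + \<bar>s\<bar> + m1 + m1t + Ed + m2 * Y + m2)) / q"
    using D q by (intro divide_right_mono mult_left_mono) auto
  also have "... = ?a * Y / q + ?a * \<bar>s\<bar> / q + ?a * (m1 + m1t + m2) / q + ?a * Ed / q + ?a * (m2 * Y) / q"
    by (simp add: algebra_simps add_divide_distrib)
  also have "... \<le> 10 * (?K * s^2) + 14 * (?K / ru * T) + \<alpha> / (8 * Rn) + \<alpha> / (8 * Rn) + Ed^2 / (8 * M^2 * Rn)"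
  proof -
    have gen: "x1 + x2 + x3 + x4 + x5 \<le> 10 * a + 14 * b + c + c + d"
      if "x1 \<le> a + 2 * b" "x2 \<le> a" "x3 \<le> 6 * a + c" "x4 \<le> 2 * a + d" "x5 \<le> 12 * b + c"
      for x1 x2 x3 x4 x5 a b c d :: real using that by linarith
    show ?thesis by (rule gen[OF t1 t2 t3 t4 t5])
  qed
  also have "... \<le> 30 * (?K * s^2) + 30 * (?K / ru * T) + \<alpha> / (4 * Rn) + Ed^2 / (8 * M^2 * Rn)"
  proof -
    have "0 \<le> ?K * s^2" "0 \<le> ?K / ru * T" using K T0 ru by auto
    moreover have "\<alpha> / (8 * Rn) + \<alpha> / (8 * Rn) = \<alpha> / (4 * Rn)" using Rn by (simp add: field_simps)
    moreover have "10 * a + 14 * b + c + c + d \<le> 30 * a + 30 * b + c' + d"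
      if "0 \<le> a" "0 \<le> b" "c + c = c'" for a b c c' d :: real using that by linarith
    ultimately show ?thesis by blast
  qed
  finally show ?thesis unfolding T_def q_def by (simp add: mult.assoc)
qed

text \<open>
  The quantity bounded here is what the present state will feed, through the delay, into
  \<open>\<psi>\<close> and \<open>s\<close>, enlarged by the Jacobian bound \<open>M\<close> of the time substitution.
\<close>

lemma emission_estimate:
  fixes M B B1 \<theta> X Z Sx \<mu> s r ri \<alpha> :: real
  assumes M: "1 \<le> M" and B: "1 \<le> B" "B \<le> B1" and r: "1 \<le> r" and nn: "0 \<le> Z" "0 \<le> ri" "ri \<le> 1"
    and Sx: "ri * Sx \<le> 3 * Z + 3 * B1^4 * X^2 / r"
    and \<mu>: "ri * \<mu>^2 \<le> 2 * s^2 + 2 * M^4 * B1^2 * Z"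
  shows "M * (5 * M * B^2 * ri * ((1 + \<theta>^2) * X^2 + Sx + \<mu>^2) + ri * \<alpha> / (4 * M))
    \<le> 5 * M^2 * B^4 * (1 + \<theta>^2) * X^2 + 25 * M^6 * B1^10 * r * Z + 15 * M^2 * B1^10 * X^2 / r
      + 10 * M^2 * B1^2 * s^2 + ri * \<alpha> / 4"
proof -
  have B1: "1 \<le> B1" using B by simp
  have BB: "B^2 \<le> B^4" "B^2 \<le> B1^2" using B by (auto intro: power_increasing power_mono)
  have "ri * ((1 + \<theta>^2) * X^2 + Sx + \<mu>^2)
      \<le> (1 + \<theta>^2) * X^2 + (3 * Z + 3 * B1^4 * X^2 / r) + (2 * s^2 + 2 * M^4 * B1^2 * Z)"
    unfolding distrib_left[of ri] using nn Sx \<mu> by (intro add_mono mult_left_le_one_le) auto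
  from mult_left_mono[OF this, of "5 * M^2 * B^2"]
  have 1: "5 * M^2 * B^2 * (ri * ((1 + \<theta>^2) * X^2 + Sx + \<mu>^2)) \<le> 5 * M^2 * B^2 * ((1 + \<theta>^2) * X^2)
     + 5 * M^2 * (B^2 * (3 * Z + 2 * M^4 * B1^2 * Z)) + 15 * M^2 * (B^2 * B1^4) * (X^2 / r) + 10 * M^2 * B^2 * s^2"
    by (simp add: algebra_simps)
  have 2: "5 * M^2 * B^2 * ((1 + \<theta>^2) * X^2) \<le> 5 * M^2 * B^4 * ((1 + \<theta>^2) * X^2)"
    using BB by (intro mult_right_mono mult_left_mono) auto
  have 3: "B^2 * (3 * Z + 2 * M^4 * B1^2 * Z) \<le> B1^10 * (5 * M^4 * (r * Z))"
  proof -
    have "Z * 1 \<le> r * Z" using r nn mult_right_mono[of 1 r Z] by simp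
    moreover have "3 * Z + 2 * M^4 * B1^2 * Z \<le> M^4 * (B1^2 * 5 * Z)"
    proof -
      have "1 \<le> M^4 * B1^2" using mult_mono[of 1 "M^4" 1 "B1^2"] M B1 by simp
      from mult_right_mono[OF this nn(1)] show ?thesis by (simp add: mult_ac)
    qed
    ultimately have "3 * Z + 2 * M^4 * B1^2 * Z \<le> M^4 * (B1^2 * 5 * (r * Z))"
      using M B1 by (smt (verit) mult_left_mono mult_nonneg_nonneg zero_le_power zero_le_power2)
    then have "B^2 * (3 * Z + 2 * M^4 * B1^2 * Z) \<le> B1^2 * (M^4 * (B1^2 * 5 * (r * Z)))"
      using BB M B1 nn r by (intro mult_mono) auto
    also have "... = B1^4 * (5 * M^4 * (r * Z))" by (simp add: mult_ac flip: power_add)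
    also have "... \<le> B1^10 * (5 * M^4 * (r * Z))"
      using B1 M r nn by (intro mult_right_mono power_increasing) auto
    finally show ?thesis .
  qed
  have 4: "15 * M^2 * (B^2 * B1^4) * (X^2 / r) \<le> 15 * M^2 * B1^10 * (X^2 / r)"
  proof -
    have "B^2 * B1^4 \<le> B1^2 * B1^4" using BB by (intro mult_right_mono) auto
    also have "... = B1^6" by (simp flip: power_add)
    also have "... \<le> B1^10" using B1 by (intro power_increasing) auto
    finally show ?thesis using M r by (intro mult_right_mono mult_left_mono) auto
  qed
  have 5: "10 * M^2 * B^2 * s^2 \<le> 10 * M^2 * B1^2 * s^2"
    using BB by (intro mult_right_mono mult_left_mono) auto
  have "5 * M^2 * (B^2 * (3 * Z + 2 * M^4 * B1^2 * Z)) \<le> 5 * M^2 * (B1^10 * (5 * M^4 * (r * Z)))"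
    using 3 by (intro mult_left_mono) auto
  also have "... = 25 * M^6 * B1^10 * r * Z" by (simp add: mult_ac flip: power_add)
  finally have 6: "5 * M^2 * (B^2 * (3 * Z + 2 * M^4 * B1^2 * Z)) \<le> 25 * M^6 * B1^10 * r * Z" .
  have "M * (5 * M * B^2 * ri * ((1 + \<theta>^2) * X^2 + Sx + \<mu>^2) + ri * \<alpha> / (4 * M))
    = 5 * M^2 * B^2 * (ri * ((1 + \<theta>^2) * X^2 + Sx + \<mu>^2)) + ri * \<alpha> / 4"
    using M by (simp add: field_simps power2_eq_square)
  moreover have "5 * M^2 * B^4 * (1 + \<theta>^2) * X^2 = 5 * M^2 * B^4 * ((1 + \<theta>^2) * X^2)"
    "15 * M^2 * B1^10 * X^2 / r = 15 * M^2 * B1^10 * (X^2 / r)"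
    by (simp_all only: mult.assoc times_divide_eq_right)
  ultimately show ?thesis using 1 2 4 5 6 by linarith
qed

text \<open>
  All contributions to the derivative of the storage function. The products with \<open>W1\<close> and \<open>W2'\<close>
  are compared either with the dissipation (if \<open>r \<ge> R\<close> resp. \<open>ru \<ge> Ru\<close>) or with the derivative of
  the weight \<open>exp (2 M / r + 2 M (1 + \<theta>\<^sup>2) / ru)\<close> (otherwise), which is the last term on the left.
\<close>

lemma total_estimate:
  fixes M r B B1 X \<theta> Z s ri \<alpha> ru mlo th N q W1 W2 W2' V rd rud dcore d\<psi> d\<theta> ds MF F Ed R Ru :: real
  assumes M: "1 \<le> M" and r: "1 \<le> r" and ru: "1 \<le> ru" and B: "1 \<le> B" "B \<le> B1"
    and nn: "0 \<le> Z" "0 \<le> ri" "0 \<le> \<alpha>" "0 \<le> th" "0 < mlo" "0 \<le> W2"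
    and core: "dcore \<le> - (1 / (2 * M^2)) * r^2 * Z
     + 100 * M^28 * B1^10 * r * Z + 100 * M^28 * B^4 * (1 + \<theta>^2) * X^2 + 100 * M^28 * s^2 - N"
    and F: "0 \<le> F" "M * F \<le> 5 * M^2 * B^4 * (1 + \<theta>^2) * X^2 + 25 * M^6 * B1^10 * r * Z + 15 * M^2 * B1^10 * X^2 / r
      + 10 * M^2 * B1^2 * s^2 + ri * \<alpha> / 4"
    and d\<psi>: "d\<psi> \<le> - ri * \<alpha> + F + Ed"
    and d\<theta>: "d\<theta> = (th - (2 + \<theta>^2)) * (q * X^2)"
    and ds: "ds \<le> - sqrt ru * mlo * s^2 + W2 * s^2 + W2 / ru * (Z + (1 + \<theta>^2) * X^2) + ri * \<alpha> / 4 + Es"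
    and N: "th * q * X^2 \<le> N" and q: "q = 200 * M^28 * B^4"
    and W1: "W1 = 200 * M^28 * B1^10" and W2': "W2' = W2 + 200 * M^28 * B1^2"
    and V: "X^2 / 2 + r * Z / M + s^2 / (2 * sqrt ru) \<le> V"
    and R: "R = 8 * M^2 * W1" and Ru: "Ru = (2 * W2' / mlo)^2 + 8 * M^2 * W2'"
    and rd: "0 \<le> rd" "r < R ==> rd = r^2 * W1"
    and rud: "0 \<le> rud" "ru < Ru ==> rud = ru^3 * W2'"
  shows "dcore + d\<psi> + d\<theta> + ds + M * F - (Ed + Es) - (2 * M * (rd / r^2) + 2 * M * (1 + \<theta>^2) * (rud / ru^2)) * V
     \<le> - (1 / (4 * M^2)) * r^2 * Z - ri * \<alpha> / 4 - X^2 - sqrt ru * mlo * s^2 / 2"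
proof -
  have B1: "1 \<le> B1" using B by simp
  have M0: "0 < M" using M by simp
  have V0: "0 \<le> V"
    using V r nn(1) M0 ru by (smt (verit) divide_nonneg_nonneg mult_nonneg_nonneg real_sqrt_ge_zero zero_le_power2)
  let ?T = "(1 + \<theta>^2) * X^2"
  have T0: "X^2 \<le> ?T" "0 \<le> ?T"
    using mult_right_mono[of 1 "1 + \<theta>^2" "X^2"] by auto
  have Mp: "1 \<le> M^28" "M^2 \<le> M^28" "M^6 \<le> M^28" using M by (auto intro!: power_increasing)
  have B4: "1 \<le> B^4" "1 \<le> B1^10" "1 \<le> B1^2" using B B1 by auto
  have W1p: "0 < W1" "200 \<le> W1" using Mp B4 mult_mono[OF Mp(1) B4(2)] M B1 by (auto simp: W1)
  have W2p: "200 \<le> W2'" using nn mult_mono[OF Mp(1) B4(3)] by (auto simp: W2')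
  have s0: "0 \<le> s^2" by simp
  have X0: "0 \<le> X^2 / r" using r by simp
  have rZ: "0 \<le> r * Z" using r nn by simp
  have F1: "F \<le> M * F" using mult_right_mono[OF M F(1)] by simp
  have a: "100 * M^28 * B^4 * (1 + \<theta>^2) * X^2 + 2 * (5 * M^2 * B^4 * (1 + \<theta>^2) * X^2) \<le> 110 * M^28 * B^4 * ?T"
  proof -
    have "M^2 * (B^4 * ?T) \<le> M^28 * (B^4 * ?T)" using Mp T0 B4 by (intro mult_right_mono) auto
    moreover have "100 * M^28 * B^4 * (1 + \<theta>^2) * X^2 = 100 * (M^28 * (B^4 * ?T))"
      "5 * M^2 * B^4 * (1 + \<theta>^2) * X^2 = 5 * (M^2 * (B^4 * ?T))"
      "110 * M^28 * B^4 * ?T = 110 * (M^28 * (B^4 * ?T))" by (simp_all only: mult.assoc)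
    ultimately show ?thesis by linarith
  qed
  have b: "100 * M^28 * B1^10 * r * Z + 2 * (25 * M^6 * B1^10 * r * Z) \<le> W1 * (r * Z)"
  proof -
    have "M^6 * (B1^10 * (r * Z)) \<le> M^28 * (B1^10 * (r * Z))" using Mp rZ B4 by (intro mult_right_mono) auto
    moreover have "0 \<le> M^28 * (B1^10 * (r * Z))" using Mp rZ B4 by auto
    moreover have "100 * M^28 * B1^10 * r * Z = 100 * (M^28 * (B1^10 * (r * Z)))"
      "25 * M^6 * B1^10 * r * Z = 25 * (M^6 * (B1^10 * (r * Z)))"
      "W1 * (r * Z) = 200 * (M^28 * (B1^10 * (r * Z)))" by (simp_all only: mult.assoc W1)
    ultimately show ?thesis by linarith
  qed
  have c: "2 * (15 * M^2 * B1^10 * X^2 / r) \<le> W1 * (X^2 / r)"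
  proof -
    have "M^2 * (B1^10 * (X^2 / r)) \<le> M^28 * (B1^10 * (X^2 / r))"
      by (rule mult_right_mono[OF Mp(2) mult_nonneg_nonneg[OF _ X0]]) (use B1 in auto)
    moreover have "0 \<le> M^28 * (B1^10 * (X^2 / r))"
      by (rule mult_nonneg_nonneg[OF _ mult_nonneg_nonneg[OF _ X0]]) (use M B1 in auto)
    moreover have "15 * M^2 * B1^10 * X^2 / r = 15 * (M^2 * (B1^10 * (X^2 / r)))"
      "W1 * (X^2 / r) = 200 * (M^28 * (B1^10 * (X^2 / r)))"
      by (simp_all only: mult.assoc W1 times_divide_eq_right)
    ultimately show ?thesis by linarith
  qed
  have d: "100 * M^28 * s^2 + 2 * (10 * M^2 * B1^2 * s^2) + W2 * s^2 \<le> W2' * s^2"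
  proof -
    have "M^2 * (B1^2 * s^2) \<le> M^28 * (B1^2 * s^2)" using Mp B4 by (intro mult_right_mono) auto
    moreover have "M^28 * (1 * s^2) \<le> M^28 * (B1^2 * s^2)" using Mp B4 by (intro mult_left_mono mult_right_mono) auto
    moreover have "0 \<le> M^28 * (B1^2 * s^2)" using Mp B4 by auto
    moreover have "10 * M^2 * B1^2 * s^2 = 10 * (M^2 * (B1^2 * s^2))" "100 * M^28 * s^2 = 100 * (M^28 * (1 * s^2))"
      "W2' * s^2 = W2 * s^2 + 200 * (M^28 * (B1^2 * s^2))"
      by (simp_all only: mult.assoc W2' distrib_right mult_1)
    ultimately show ?thesis by linarith
  qed
  have e: "W2 / ru * (Z + ?T) \<le> W2' / ru * (Z + ?T)"
    using ru nn T0 Mp B4 by (intro mult_right_mono divide_right_mono) (auto simp: W2')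
  have f: "d\<theta> - N \<le> - ((2 + \<theta>^2) * (q * X^2))" using N by (simp add: d\<theta> algebra_simps)
  have g: "110 * M^28 * B^4 * ?T - (2 + \<theta>^2) * (q * X^2) \<le> - 2 * ?T"
  proof -
    have "1 \<le> M^28 * B^4" using mult_mono[OF Mp(1) B4(1)] by simp
    then have "?T \<le> M^28 * B^4 * ?T" using T0 mult_right_mono[of 1 "M^28 * B^4" ?T] by simp
    moreover have "200 * (M^28 * B^4 * ?T) \<le> (2 + \<theta>^2) * (q * X^2)"
    proof -
      have "0 \<le> 200 * M^28 * B^4 * X^2" using M B by simp
      then show ?thesis by (simp add: q algebra_simps)
    qed
    moreover have "110 * M^28 * B^4 * ?T = 110 * (M^28 * B^4 * ?T)" by simp
    moreover have "x - b \<le> - 2 * T" if "T \<le> a" "200 * a \<le> b" "x = 110 * a" "0 \<le> T" for a b x T :: real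
      using that by linarith
    ultimately show ?thesis using T0(2) by blast
  qed
  have S: "dcore + d\<psi> + d\<theta> + ds + M * F - (Ed + Es) \<le> - (1 / (2 * M^2)) * r^2 * Z - ri * \<alpha> / 4 - 2 * ?T
     - sqrt ru * mlo * s^2 + W1 * (r * Z) + W1 * (X^2 / r) + W2' * s^2 + W2' / ru * (Z + ?T)"
  proof -
    have gen: "dcore + d\<psi> + d\<theta> + ds + MF - (Ed + Es) \<le> - DZ - ra4 - 2 * T - sm + wz + wx + ws + w2u"
      if "dcore \<le> - DZ + cz + cx + cs - N" "MF \<le> fx + fz + fr + fs + ra4" "F \<le> MF" "d\<psi> \<le> - ra + F + Ed"
        "ds \<le> - sm + w2s + w2t + ra4 + Es" "cx + 2 * fx \<le> p" "cz + 2 * fz \<le> wz" "2 * fr \<le> wx"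
        "cs + 2 * fs + w2s \<le> ws" "w2t \<le> w2u" "d\<theta> - N \<le> - qq" "p - qq \<le> - 2 * T" "ra4 = ra / 4"
      for DZ cz cx cs MF fx fz fr fs ra4 ra sm w2s w2t p wz wx ws w2u qq T :: real
      using that by linarith
    have core': "dcore \<le> - (1 / (2 * M^2) * r^2 * Z) + 100 * M^28 * B1^10 * r * Z
      + 100 * M^28 * B^4 * (1 + \<theta>^2) * X^2 + 100 * M^28 * s^2 - N" using core by simp
    have ds': "ds \<le> - (sqrt ru * mlo * s^2) + W2 * s^2 + W2 / ru * (Z + ?T) + ri * \<alpha> / 4 + Es" using ds by simp
    have d\<psi>': "d\<psi> \<le> - (ri * \<alpha>) + F + Ed" using d\<psi> by simp
    show ?thesis using gen[OF core' F(2) F1 d\<psi>' ds' a b c d e f g refl] by simp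
  qed
  have k1: "W1 * (r * Z) + W1 * (X^2 / r) \<le> (1 / (8 * M^2)) * r^2 * Z + X^2 / 8 + 2 * M * (rd / r^2) * V"
  proof (cases "r < R")
    case True
    have "2 * M * (rd / r^2) * V = W1 * (2 * M * V)" using rd(2)[OF True] r by simp
    moreover have "r * Z + X^2 / r \<le> 2 * M * V"
    proof -
      have "M * (X^2 / 2 + r * Z / M) \<le> M * V"
        using V s0 ru M0 by (intro mult_left_mono) (auto intro: order_trans[rotated])
      moreover have "X^2 / r \<le> X^2 / 1" using r by (intro divide_left_mono) auto
      moreover have "1 * X^2 \<le> M * X^2" using M by (intro mult_right_mono) auto
      ultimately show ?thesis using M0 rZ by (simp add: distrib_left)
    qed
    ultimately have "W1 * (r * Z) + W1 * (X^2 / r) \<le> 2 * M * (rd / r^2) * V"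
      using mult_left_mono[of "r * Z + X^2 / r" "2 * M * V" W1] W1p by (simp add: distrib_left)
    moreover have "0 \<le> (1 / (8 * M^2)) * r^2 * Z + X^2 / 8" using nn by simp
    ultimately show ?thesis by linarith
  next
    case False
    then have *: "8 * M^2 * W1 \<le> r" by (simp add: R)
    then have "W1 \<le> r / (8 * M^2)" using M0 by (simp add: field_simps)
    then have "W1 * (r * Z) \<le> r / (8 * M^2) * (r * Z)" using rZ by (intro mult_right_mono) auto
    also have "... = (1 / (8 * M^2)) * r^2 * Z" by (simp add: power2_eq_square)
    finally have 1: "W1 * (r * Z) \<le> (1 / (8 * M^2)) * r^2 * Z" .
    have "1 * W1 \<le> M^2 * W1" using M W1p by (intro mult_right_mono) auto
    then have "W1 \<le> r / 8" using * by simp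
    then have "W1 / r \<le> 1 / 8" using r by (simp add: field_simps)
    then have "W1 / r * X^2 \<le> 1 / 8 * X^2" by (intro mult_right_mono) auto
    moreover have "W1 / r * X^2 = W1 * (X^2 / r)" "1 / 8 * X^2 = X^2 / 8" by simp_all
    moreover have "0 \<le> 2 * M * (rd / r^2) * V" using M0 rd V0 by simp
    moreover have "a + b \<le> a' + b' + v" if "a \<le> a'" "b1 \<le> b2" "b1 = b" "b2 = b'" "0 \<le> v" for a b a' b' b1 b2 v :: real
      using that by linarith
    ultimately show ?thesis using 1 by blast
  qed
  have k2: "W2' * s^2 + W2' / ru * (Z + ?T) \<le> sqrt ru * mlo * s^2 / 2 + (1 / (8 * M^2)) * r^2 * Z + ?T / 8
     + 2 * M * (1 + \<theta>^2) * (rud / ru^2) * V"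
  proof (cases "ru < Ru")
    case True
    have sq: "1 \<le> sqrt ru" "sqrt ru \<le> ru"
      using ru by (auto intro!: real_le_lsqrt simp: power2_eq_square)
    have p: "0 \<le> 2 * M * (1 + \<theta>^2) * ru" using M0 ru by simp
    have ru3: "ru^3 * W2' / ru^2 = ru * W2'" using ru by (simp add: power2_eq_square power3_eq_cube)
    have "2 * M * (1 + \<theta>^2) * (rud / ru^2) * V = W2' * (2 * M * (1 + \<theta>^2) * ru * V)"
      unfolding rud(2)[OF True] ru3 by simp
    moreover have "s^2 + 1 / ru * (Z + ?T) \<le> 2 * M * (1 + \<theta>^2) * ru * V"
    proof -
      have 1: "2 * M * (1 + \<theta>^2) * ru * (X^2 / 2 + r * Z / M + s^2 / (2 * sqrt ru)) \<le> 2 * M * (1 + \<theta>^2) * ru * V"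
        by (rule mult_left_mono[OF V p])
      have m: "1 \<le> M * (1 + \<theta>^2)" using mult_mono[of 1 M 1 "1 + \<theta>^2"] M by simp
      have "1 * ru \<le> M * (1 + \<theta>^2) * ru" using m ru by (intro mult_right_mono) auto
      have "s^2 \<le> 2 * M * (1 + \<theta>^2) * ru * (s^2 / (2 * sqrt ru))"
      proof -
        have "1 \<le> ru / sqrt ru" using sq by simp
        then have "1 * 1 \<le> (M * (1 + \<theta>^2)) * (ru / sqrt ru)" using m by (intro mult_mono) auto
        from mult_right_mono[OF this s0] show ?thesis by simp
      qed
      moreover have "1 / ru * ?T \<le> 2 * M * (1 + \<theta>^2) * ru * (X^2 / 2)"
      proof -
        have "1 / ru * ?T \<le> 1 * ?T" using ru T0 by (intro mult_right_mono) auto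
        also have "... \<le> (M * ru) * ?T" using T0 mult_mono[of 1 M 1 ru] M ru by (intro mult_right_mono) auto
        also have "... = 2 * M * (1 + \<theta>^2) * ru * (X^2 / 2)" by simp
        finally show ?thesis .
      qed
      moreover have "1 / ru * Z \<le> 2 * M * (1 + \<theta>^2) * ru * (r * Z / M)"
      proof -
        have "1 / ru * Z \<le> 1 * Z" using ru nn by (intro mult_right_mono) auto
        also have "... \<le> (2 * (1 + \<theta>^2) * ru * r) * Z"
        proof (intro mult_right_mono)
          have "1 * 1 * 1 \<le> (2 * (1 + \<theta>^2)) * ru * r" using ru r by (intro mult_mono) auto
          then show "1 \<le> 2 * (1 + \<theta>^2) * ru * r" by simp
        qed (use nn in auto)
        finally show ?thesis using M0 by (simp add: mult_ac)
      qed
      ultimately show ?thesis using 1 unfolding distrib_left by linarith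
    qed
    ultimately have "W2' * s^2 + W2' / ru * (Z + ?T) \<le> 2 * M * (1 + \<theta>^2) * (rud / ru^2) * V"
      using mult_left_mono[of "s^2 + 1 / ru * (Z + ?T)" "2 * M * (1 + \<theta>^2) * ru * V" W2'] W2p by (simp add: distrib_left)
    moreover have "0 \<le> sqrt ru * mlo * s^2 / 2 + (1 / (8 * M^2)) * r^2 * Z + ?T / 8" using nn T0 ru by simp
    ultimately show ?thesis by linarith
  next
    case False
    then have *: "(2 * W2' / mlo)^2 + 8 * M^2 * W2' \<le> ru" by (simp add: Ru)
    have "0 \<le> 8 * M^2 * W2'" using M W2p by simp
    then have "(2 * W2' / mlo)^2 \<le> ru" using * by linarith
    then have "2 * W2' / mlo \<le> sqrt ru" by (rule real_le_rsqrt)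
    then have "W2' \<le> sqrt ru * mlo / 2" using nn by (simp add: field_simps)
    then have 1: "W2' * s^2 \<le> sqrt ru * mlo / 2 * s^2" by (intro mult_right_mono) auto
    have "8 * M^2 * W2' \<le> ru" using * zero_le_power2[of "2 * W2' / mlo"] by linarith
    then have "W2' / ru \<le> 1 / (8 * M^2)" using M0 ru by (simp add: field_simps)
    then have "W2' / ru * (Z + ?T) \<le> 1 / (8 * M^2) * (Z + ?T)" using nn T0 by (intro mult_right_mono) auto
    also have "... \<le> (1 / (8 * M^2)) * r^2 * Z + ?T / 8"
    proof -
      have "1 / (8 * M^2) * Z \<le> 1 / (8 * M^2) * (r^2 * Z)"
        using r nn mult_right_mono[of 1 "r^2" Z] by (intro mult_left_mono) auto
      moreover have "1 / (8 * M^2) * ?T \<le> 1 / 8 * ?T"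
        using M T0 by (intro mult_right_mono) (auto simp: field_simps)
      ultimately show ?thesis by (simp add: distrib_left)
    qed
    finally have "W2' / ru * (Z + ?T) \<le> (1 / (8 * M^2)) * r^2 * Z + ?T / 8" .
    moreover have "0 \<le> 2 * M * (1 + \<theta>^2) * (rud / ru^2) * V" using M0 rud V0 by simp
    moreover have "sqrt ru * mlo / 2 * s^2 = sqrt ru * mlo * s^2 / 2" by simp
    moreover have "a + b \<le> a' + c + d + v" if "a \<le> a1" "b \<le> c + d" "a1 = a'" "0 \<le> v" for a b a' a1 c d v :: real
      using that by linarith
    ultimately show ?thesis using 1 by blast
  qed
  have eq: "- (1 / (2 * M^2)) * r^2 * Z + 2 * ((1 / (8 * M^2)) * r^2 * Z) = - (1 / (4 * M^2)) * r^2 * Z"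
    using M0 by (simp add: field_simps)
  have gen: "S - (v1 + v2) \<le> e - x4 - x - y"
    if "S \<le> a - x4 - 2 * T - m + k + k' + l + l'" "k + k' \<le> c + x / 8 + v1" "l + l' \<le> y + c + T / 8 + v2"
      "a + 2 * c = e" "x \<le> T" "0 \<le> T" "m = 2 * y" for S a x4 T m k k' l l' c x v1 v2 y e :: real
    using that by linarith
  have "sqrt ru * mlo * s^2 = 2 * (sqrt ru * mlo * s^2 / 2)" by simp
  from gen[OF S k1 k2 eq T0 this] show ?thesis unfolding distrib_right[of _ _ V] .
qed

section \<open>The controller\<close>

text \<open>
  The data from which the controller is built. A single constant \<open>M\<close> serves for all
  bounds; \<open>p\<close> is the common factor of the two chains, later \<open>\<phi>\<^bsub>(2,3)\<^esub>\<close> (\<open>\<phi>\<^bsub>(1,2)\<^esub>\<close> if \<open>n = 2\<close>).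
  The function \<open>bh\<close> is a differentiable majorant of \<open>p\<close>: the feedback gain has to be differentiated
  in time, while \<open>p\<close> is merely continuous. The choice of \<open>q\<close> and \<open>v1\<close> gives
  \<open>x\<^sub>1\<close> the damping \<open>\<theta>hat q(x\<^sub>1) x\<^sub>1\<^sup>2\<close>, and \<open>q\<close> dominates the terms in
  \<open>x\<^sub>1\<^sup>2\<close> that the estimates leave over.
\<close>

locale design =
  fixes n :: nat and ix :: "nat => 'n::finite" and jx :: "nat => 'm::finite" and K :: "'p::finite known"
    and M :: real and G \<kappa> :: "nat => real" and Bo Bc :: "(nat => real) => (nat => real) => real"
    and p q Bx bh bh' v1 v1' :: "real => real"
  assumes n2: "2 \<le> n" and ix: "bij_betw ix {1..n} UNIV" and jx: "bij_betw jx {2..n} UNIV"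
    and reg: "known_regular n K"
    and nM: "real n \<le> M" and LM: "1 / (1 - Delta_bar K) \<le> M" and kM: "k_bar K \<le> M"
    and phi_lo: "\<And>i s. i \<in> {1..n-1} ==> 1 / M \<le> phi K i s"
    and p_lo: "\<And>s. 1 / M \<le> p s" and p_cont: "continuous_on UNIV p"
    and GM: "\<And>i. i \<in> {2..n} ==> \<bar>G i\<bar> \<le> M" and \<kappa>M: "\<And>i. i \<in> {2..n} ==> \<bar>\<kappa> i\<bar> \<le> M"
    and Bo: "bform {2..n} Bo" and Bc: "bform {2..n} Bc"
    and Bo_hi: "\<And>v w. \<bar>Bo v w\<bar> \<le> M * L2_set v {2..n} * L2_set w {2..n}"
    and Bc_hi: "\<And>v w. \<bar>Bc v w\<bar> \<le> M * L2_set v {2..n} * L2_set w {2..n}"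
    and Bo_lo: "\<And>v. 1 / M * (L2_set v {2..n})^2 \<le> Bo v v"
    and Bc_lo: "\<And>v. 1 / M * (L2_set v {2..n})^2 \<le> Bc v v"
    and Bo_D: "\<And>v. 0 \<le> Bo v (\<lambda>i. (real i - 3/2) * v i)"
    and Bc_D: "\<And>v. 0 \<le> Bc v (\<lambda>i. (real i - 3/2) * v i)"
    and Bo_neg: "\<And>v s. Bo v (obs_op n 2 (\<lambda>i. phi K i s / p s) 1 G v) \<le> - (1 / M) * (L2_set v {2..n})^2"
    and Bc_neg: "\<And>v s. Bc v (fb_op n (\<lambda>i. phi K i s / p s) (bh s / p s) \<kappa> v) \<le> - (1 / M) * (L2_set v {2..n})^2"
    and bh: "\<And>s. (bh has_real_derivative bh' s) (at s)" "continuous_on UNIV bh'" "\<And>s. 0 \<le> bh s"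
    and Bx: "Bx = (\<lambda>s. 1 + p s + (\<Sum>i\<in>{1..n-1}. phi K i s) + Gam K s + Gam2 K s + gam_s_bar K s + mu1a_bar K s)"
    and q: "q = (\<lambda>s. 200 * M^28 * (Bx s)^4)"
    and v1: "\<And>s. (v1 has_real_derivative v1' s) (at s)" "continuous_on UNIV v1'" "\<And>s. 0 \<le> v1 s"
      "\<And>s. q s \<le> phi K 1 s * v1 s"
begin

lemma M2: "2 \<le> M" using nM n2 by linarith
lemma M1: "1 \<le> M" using M2 by simp

text \<open>
  \<open>B1\<close> dominates the known functions of \<open>x\<^sub>1\<close> and \<open>\<theta>hat\<close>, \<open>B2\<close> those of all signals that are available to the
  controller; \<open>W1\<close> and \<open>W2'\<close> are the coefficients that the dissipation or the weight have to absorb. The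
  two summands of \<open>Ruf\<close> let \<open>sqrt r\<^sub>u\<close> absorb \<open>W2' s\<^sup>2\<close> and make \<open>W2' / r\<^sub>u\<close> small.
\<close>

definition B1 where "B1 s th = Bx s + v1 s + \<bar>v1 s + s * v1' s\<bar> + bh s + \<bar>bh' s\<bar> + \<bar>th\<bar> + q s * s^2"
definition B2 :: "real \<times> real => real => real => real => real => real ^ 'm => real" where
  "B2 y u r rd th w = B1 (fst y) th + \<bar>r\<bar> + \<bar>rd\<bar> + mu_bar K y u + mu1_bar K y u + mu1_tilde K y u
     + mu2_bar K y u + norm w"
definition Wp where "Wp y u r rd th w = 30 * M^6 * B2 y u r rd th w ^ (n + 6)"
definition W1 where "W1 s th = 200 * M^28 * B1 s th ^ 10"
definition W2 where "W2 y u r rd th w = 30 * M^2 * r^(2 * n) * Wp y u r rd th w ^ 4"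
definition W2' where "W2' y u r rd th w = W2 y u r rd th w + 200 * M^28 * (B1 (fst y) th)^2"
definition Ruf where "Ruf y u r rd th w = (2 * W2' y u r rd th w / mu_lo K)^2 + 8 * M^2 * W2' y u r rd th w"
text \<open>
  Equal to 1 on \<open>[0, \<infinity>)\<close> and to 0 on \<open>(-\<infinity>, -1]\<close>; so \<open>r\<close> grows at its full rate
  while \<open>r \<le> R\<close> and stops at \<open>R + 1\<close>.
\<close>

definition gate :: "real => real" where "gate s = max 0 (min 1 (s + 1))"

definition Ctl :: "'m ctrl" where
  "Ctl = \<lparr> a_theta = 1, g_gain = (\<lambda>i s. G i * p s), k_gain = (\<lambda>i s. \<kappa> i * bh s), theta1 = v1,
     lam = gate, R_fun = (\<lambda>s th thd. 8 * M^2 * W1 s th), Om_fun = (\<lambda>s th thd r. r^2 * W1 s th),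
     Ru_fun = (\<lambda>y u r rd th thd w. Ruf y u r rd th w),
     Omu_fun = (\<lambda>y u r rd th thd w ru. \<bar>ru\<bar>^3 * W2' y u r rd th w),
     Q_theta = (\<lambda>s. q s * s^2) \<rparr>"

lemma Ctl_sel [simp]:
  "a_theta Ctl = 1" "g_gain Ctl i s = G i * p s" "k_gain Ctl i s = \<kappa> i * bh s" "theta1 Ctl s = v1 s"
  "lam Ctl s = gate s" "R_fun Ctl s th thd = 8 * M^2 * W1 s th" "Om_fun Ctl s th thd r = r^2 * W1 s th"
  "Ru_fun Ctl y u r rd th thd w = Ruf y u r rd th w"
  "Omu_fun Ctl y u r rd th thd w ru = \<bar>ru\<bar>^3 * W2' y u r rd th w" "Q_theta Ctl s = q s * s^2"
  by (simp_all add: Ctl_def)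

lemma p_pos: "0 < p s" using p_lo[of s] M1 by (meson less_le_trans zero_less_divide_1_iff zero_less_one)
lemma phi_pos: "i \<in> {1..n-1} ==> 0 < phi K i s"
  using phi_lo[of i s] M1 by (meson less_le_trans zero_less_divide_1_iff zero_less_one)
lemma one_in: "1 \<in> {1..n-1}" using n2 by auto

lemma known_nonneg: "0 \<le> Gam K s" "0 \<le> Gam2 K s" "0 \<le> gam_s_bar K s" "0 \<le> mu1a_bar K s" "0 \<le> gam_s K y u"
  "0 \<le> mu_bar K y u" "0 \<le> mu1_bar K y u" "0 \<le> mu1_tilde K y u" "0 \<le> mu2_bar K y u" "0 < mu_lo K"
  "0 < V_lo K" "0 < k_bar K" "0 < Delta_bar K" "Delta_bar K < 1"
  using reg by (auto simp: known_regular_def simp del: split_paired_All)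

lemma Bx_ge: "1 \<le> Bx s" "p s \<le> Bx s" "i \<in> {1..n-1} ==> phi K i s \<le> Bx s" "Gam K s \<le> Bx s" "Gam2 K s \<le> Bx s"
  "gam_s_bar K s \<le> Bx s" "mu1a_bar K s \<le> Bx s"
proof -
  have s: "0 \<le> (\<Sum>i\<in>{1..n-1}. phi K i s)" using phi_pos by (intro sum_nonneg) (auto intro: less_imp_le)
  show "1 \<le> Bx s" "p s \<le> Bx s" "Gam K s \<le> Bx s" "Gam2 K s \<le> Bx s" "gam_s_bar K s \<le> Bx s" "mu1a_bar K s \<le> Bx s"
    using s p_pos[of s] known_nonneg(1-4)[of s] unfolding Bx by linarith+
  assume "i \<in> {1..n-1}"
  then have "phi K i s \<le> (\<Sum>i\<in>{1..n-1}. phi K i s)"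
    using phi_pos by (intro member_le_sum) (auto intro: less_imp_le)
  then show "phi K i s \<le> Bx s" using p_pos[of s] known_nonneg(1-4)[of s] unfolding Bx by linarith
qed

lemma q_pos: "0 < q s" using Bx_ge(1)[of s] M1 by (simp add: q)

lemma B1_ge: "Bx s \<le> B1 s th" "v1 s \<le> B1 s th" "\<bar>v1 s + s * v1' s\<bar> \<le> B1 s th" "bh s \<le> B1 s th"
  "\<bar>bh' s\<bar> \<le> B1 s th" "\<bar>th\<bar> \<le> B1 s th" "q s * s^2 \<le> B1 s th" "1 \<le> B1 s th"
  using Bx_ge(1)[of s] v1(3)[of s] bh(3)[of s] mult_nonneg_nonneg[OF less_imp_le[OF q_pos[of s]], of "s^2"]
  by (auto simp: B1_def)

lemma B2_ge: "B1 (fst y) th \<le> B2 y u r rd th w" "\<bar>r\<bar> \<le> B2 y u r rd th w" "\<bar>rd\<bar> \<le> B2 y u r rd th w"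
  "mu_bar K y u \<le> B2 y u r rd th w" "mu1_bar K y u \<le> B2 y u r rd th w" "mu1_tilde K y u \<le> B2 y u r rd th w"
  "mu2_bar K y u \<le> B2 y u r rd th w" "norm w \<le> B2 y u r rd th w" "1 \<le> B2 y u r rd th w"
  using B1_ge(8)[of "fst y" th] known_nonneg(6-9)[of y u] norm_ge_zero[of w] abs_ge_zero[of r] abs_ge_zero[of rd]
  unfolding B2_def by linarith+

lemma W1_ge: "200 \<le> W1 s th"
  using mult_mono[OF one_le_power[OF M1, of 28] one_le_power[OF B1_ge(8)[of s th], of 10]] M1 by (simp add: W1_def)

lemma Wp_ge: "1 \<le> Wp y u r rd th w"
  using mult_mono[OF one_le_power[OF M1, of 6] one_le_power[OF B2_ge(9)[of y u r rd th w], of "n+6"]] M1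
  by (simp add: Wp_def)

lemma W2_nonneg: "0 \<le> W2 y u r rd th w"
  using Wp_ge[of y u r rd th w] by (simp add: W2_def)

lemma W2'_ge: "200 \<le> W2' y u r rd th w" "W2 y u r rd th w \<le> W2' y u r rd th w"
  using mult_mono[OF one_le_power[OF M1, of 28] one_le_power[OF B1_ge(8)[of "fst y" th], of 2]] M1
    W2_nonneg[of y u r rd th w] by (simp_all add: W2'_def)

lemma Ruf_nonneg: "0 \<le> Ruf y u r rd th w"
  using W2'_ge(1)[of y u r rd th w] by (simp add: Ruf_def)

lemma gate_props: "0 \<le> gate s" "gate s \<le> 1" "0 \<le> s ==> gate s = 1" "s \<le> -1 ==> gate s = 0"
  by (auto simp: gate_def)

lemma cont_phi: "i \<in> {1..n-1} ==> continuous_on UNIV (phi K i)"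
  using reg by (auto simp: known_regular_def)

lemma cont_Bx: "continuous_on UNIV Bx"
  unfolding Bx using reg by (auto simp: known_regular_def intro!: continuous_intros p_cont)

lemma cont_q: "continuous_on UNIV q" unfolding q by (intro continuous_intros cont_Bx)

lemma cont_bh: "continuous_on UNIV bh" and cont_v1: "continuous_on UNIV v1"
  by (rule DERIV_continuous_on, rule has_field_derivative_at_within, rule bh(1) v1(1))+

lemma cont_compose1: "continuous_on UNIV f ==> continuous_on A g ==> continuous_on A (\<lambda>x. f (g x))"
  for f :: "'a::topological_space => 'b::topological_space" and g :: "'c::topological_space => 'a"
  by (rule continuous_on_compose2[of UNIV f]) auto

lemma cont_B1 [continuous_intros]:
  "continuous_on A f ==> continuous_on A g ==> continuous_on A (\<lambda>x. B1 (f x) (g x))"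
  for f g :: "'c::topological_space => real"
  unfolding B1_def by (intro continuous_intros cont_compose1[OF cont_Bx] cont_compose1[OF cont_v1]
    cont_compose1[OF v1(2)] cont_compose1[OF cont_bh] cont_compose1[OF bh(2)] cont_compose1[OF cont_q])

lemma cont_W1 [continuous_intros]:
  "continuous_on A f ==> continuous_on A g ==> continuous_on A (\<lambda>x. W1 (f x) (g x))"
  for f g :: "'c::topological_space => real"
  unfolding W1_def by (intro continuous_intros)

lemma cont_known2:
  "continuous_on UNIV (\<lambda>(y, u). f y u) ==> continuous_on A g ==> continuous_on A h ==> continuous_on A (\<lambda>x. f (g x) (h x))"
  for f :: "real \<times> real => real => real" and h :: "'c::topological_space => real"
  using continuous_on_compose2[of UNIV "\<lambda>(y, u). f y u" A "\<lambda>x. (g x, h x)"]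
  by (auto intro: continuous_on_Pair)

lemma cont_B2 [continuous_intros]:
  fixes y :: "'c::topological_space => real \<times> real"
  assumes "continuous_on A y" "continuous_on A u" "continuous_on A r" "continuous_on A rd" "continuous_on A th" "continuous_on A w"
  shows "continuous_on A (\<lambda>x. B2 (y x) (u x) (r x) (rd x) (th x) (w x))"
proof -
  have k: "continuous_on UNIV (\<lambda>(y, u). mu_bar K y u)" "continuous_on UNIV (\<lambda>(y, u). mu1_bar K y u)"
    "continuous_on UNIV (\<lambda>(y, u). mu1_tilde K y u)" "continuous_on UNIV (\<lambda>(y, u). mu2_bar K y u)"
    using reg by (auto simp: known_regular_def)
  show ?thesis unfolding B2_def
    by (intro continuous_intros assms cont_known2[OF k(1)] cont_known2[OF k(2)] cont_known2[OF k(3)] cont_known2[OF k(4)])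
qed

lemma cont_W2' [continuous_intros]:
  fixes y :: "'c::topological_space => real \<times> real"
  assumes "continuous_on A y" "continuous_on A u" "continuous_on A r" "continuous_on A rd" "continuous_on A th" "continuous_on A w"
  shows "continuous_on A (\<lambda>x. W2' (y x) (u x) (r x) (rd x) (th x) (w x))"
  unfolding W2'_def W2_def Wp_def by (intro continuous_intros assms)

lemma cont_Ruf [continuous_intros]:
  fixes y :: "'c::topological_space => real \<times> real"
  assumes "continuous_on A y" "continuous_on A u" "continuous_on A r" "continuous_on A rd" "continuous_on A th" "continuous_on A w"
  shows "continuous_on A (\<lambda>x. Ruf (y x) (u x) (r x) (rd x) (th x) (w x))"
  unfolding Ruf_def using known_nonneg(10) by (intro continuous_intros assms) auto

lemma cont_gate [continuous_intros]: "continuous_on A f ==> continuous_on A (\<lambda>x. gate (f x))"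
  for f :: "'c::topological_space => real"
  unfolding gate_def by (intro continuous_intros)

lemma controller_regular_Ctl: "controller_regular n Ctl"
  unfolding controller_regular_def
proof (intro conjI allI ballI)
  show "continuous_on UNIV (g_gain Ctl i)" "continuous_on UNIV (k_gain Ctl i)" for i
    by (auto simp: Ctl_def intro!: continuous_intros p_cont cont_bh)
  show "continuous_on UNIV (theta1 Ctl)" "continuous_on UNIV (lam Ctl)" "continuous_on UNIV (Q_theta Ctl)"
    by (auto simp: Ctl_def intro!: continuous_intros cont_v1 cont_q cont_gate[OF continuous_on_id])
  show "continuous_on UNIV (\<lambda>(x1, th, thd). R_fun Ctl x1 th thd)"
    "continuous_on UNIV (\<lambda>(x1, th, thd, r). Om_fun Ctl x1 th thd r)"
    "continuous_on UNIV (\<lambda>(y, u, r, rd, th, thd, w). Ru_fun Ctl y u r rd th thd w)"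
    "continuous_on UNIV (\<lambda>(y, u, r, rd, th, thd, w, ru). Omu_fun Ctl y u r rd th thd w ru)"
    unfolding Ctl_sel split_def by (intro continuous_intros)+
  show "0 \<le> R_fun Ctl s th thd" "0 \<le> Om_fun Ctl s th thd r" for s th thd r
    using W1_ge[of s th] by simp_all
  show "0 \<le> Ru_fun Ctl y u r rd th thd w" "0 \<le> Omu_fun Ctl y u r rd th thd w ru" for y u r rd th thd w ru
    using Ruf_nonneg W2'_ge(1)[of y u r rd th w] by simp_all
  show "0 \<le> theta1 Ctl s" "0 \<le> lam Ctl s" "0 \<le> Q_theta Ctl s" for s
    using v1(3) gate_props(1) q_pos[of s] by simp_all
qed simp

lemma f_obs_deriv:
  assumes "i \<in> {2..n}"
  shows "((f_obs K Ctl i) has_real_derivative G i * p s / phi K 1 s) (at s)"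
proof -
  have c: "continuous_on UNIV (\<lambda>s. G i * p s / phi K 1 s)"
    using phi_pos[OF one_in] by (intro continuous_intros p_cont cont_phi one_in) (auto simp: less_le)
  let ?a = "min 0 s - 1" and ?b = "max 0 s + 1"
  have "((\<lambda>u. LBINT y=ereal 0..ereal u. G i * p y / phi K 1 y) has_vector_derivative G i * p s / phi K 1 s) (at s within {?a..?b})"
    by (rule interval_integral_FTC2) (use continuous_on_subset[OF c] in auto)
  then have "((f_obs K Ctl i) has_vector_derivative G i * p s / phi K 1 s) (at s within {?a..?b})"
    by (simp add: f_obs_def[abs_def])
  moreover have "at s within {?a..?b} = at s" by (rule at_within_interior) (auto simp: interior_atLeastAtMost_real)
  ultimately show ?thesis by (simp add: has_real_derivative_iff_has_vector_derivative)
qed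

lemma f_obs_0: "f_obs K Ctl i 0 = 0" by (simp add: f_obs_def)

lemma cont_f_obs: "i \<in> {2..n} ==> continuous_on UNIV (f_obs K Ctl i)"
  using f_obs_deriv by (intro DERIV_continuous_on) (auto intro: has_field_derivative_at_within)

lemma jx_inv: "i \<in> {2..n} ==> inv_into {2..n} jx (jx i) = i"
  using jx by (auto simp: bij_betw_def)

lemma varpi_jx: "i \<in> {2..n} ==> varpi jx n K Ctl s xh r th $ jx i =
   (if i = 2 then (xh $ jx 2 + r * f_obs K Ctl 2 s + th * s * v1 s) / r else (xh $ jx i + r^(i-1) * f_obs K Ctl i s) / r^(i-1))"
  unfolding varpi_def by (simp add: jx_inv Let_def vartheta_def)

lemma sum_jx: "(\<Sum>j\<in>UNIV. f j) = (\<Sum>i\<in>{2..n}. f (jx i))" for f :: "'m => real"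
  using sum.reindex_bij_betw[OF jx, of f] by simp
lemma sum_ix: "(\<Sum>j\<in>UNIV. f j) = (\<Sum>i\<in>{1..n}. f (ix i))" for f :: "'n => real"
  using sum.reindex_bij_betw[OF ix, of f] by simp

lemma norm_jx: "norm (w :: real ^ 'm) = L2_set (\<lambda>i. w $ jx i) {2..n}"
  by (simp add: norm_vec_def L2_set_def sum_jx)
lemma norm_ix_le: "norm (w :: real ^ 'n) \<le> (\<Sum>i\<in>{1..n}. \<bar>w $ ix i\<bar>)"
  using norm_le_l1_cart[of w] by (simp add: sum_ix)

lemma u_tilde_eq: "u_tilde jx n K Ctl s xh r th = - (r^n) * (bh s * (\<Sum>i=2..n. \<kappa> i * varpi jx n K Ctl s xh r th $ jx i))"
  by (simp add: u_tilde_def sum_distrib_left mult_ac)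

lemma r_dot_eq: "r_dot Ctl s r th = gate (8 * M^2 * W1 s th - r) * (r^2 * W1 s th)" by (simp add: r_dot_def)

lemma ru_dot_eq: "ru_dot jx n K Ctl y u xh r ru th =
  gate (Ruf y u r (r_dot Ctl (fst y) r th) th (varpi jx n K Ctl (fst y) xh r th) - ru)
   * (\<bar>ru\<bar>^3 * W2' y u r (r_dot Ctl (fst y) r th) th (varpi jx n K Ctl (fst y) xh r th))"
  by (simp add: ru_dot_def Let_def)

end

section \<open>Scaled coordinates of the closed loop\<close>

lemma has_real_derivative_scaled:
  fixes f r :: "real => real"
  assumes "(f has_real_derivative f') (at t)" "(r has_real_derivative r') (at t)" "r t \<noteq> 0"
  shows "((\<lambda>t. f t / r t ^ k) has_real_derivative f' / r t ^ k - real k * (r' / r t) * (f t / r t ^ k)) (at t)"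
proof -
  have "((\<lambda>t. f t / r t ^ k) has_real_derivative
      (f' * r t ^ k - f t * (real k * r t ^ (k - 1) * r')) / (r t ^ k * r t ^ k)) (at t)"
    using DERIV_divide[OF assms(1) DERIV_power[OF assms(2), of k]] assms(3) by (simp add: mult_ac)
  moreover have "(f' * r t ^ k - f t * (real k * r t ^ (k - 1) * r')) / (r t ^ k * r t ^ k)
      = f' / r t ^ k - real k * (r' / r t) * (f t / r t ^ k)"
    using assms(3) by (cases k) (simp_all add: field_simps)
  ultimately show ?thesis by simp
qed

lemma horizon_sub: "t \<in> horizon T ==> 0 \<le> s ==> s \<le> t ==> s \<in> horizon T"
  unfolding horizon_def by (auto intro: order.strict_trans1[of "ereal s" "ereal t"])

lemma at_within_nonneg: "0 < t ==> at t within {0..} = at (t::real)"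
  by (rule at_within_interior) (simp add: interior_real_atLeast)

context design begin

text \<open>
  The common derivative computation for the two chains; the term with \<open>rd\<close> has the right sign by
  the choice of the forms.
\<close>

lemma form_scaled_derivative:
  assumes B: "bform {2..n} B" and hi: "\<And>v w. \<bar>B v w\<bar> \<le> M * L2_set v {2..n} * L2_set w {2..n}"
    and BD: "\<And>v. 0 \<le> B v (\<lambda>i. (real i - 3/2) * v i)"
    and neg: "B (v t) F \<le> - (1 / M) * (L2_set (v t) {2..n})^2"
    and r: "(r has_real_derivative rd) (at t)" "0 \<le> rd" "1 \<le> r t" and pp: "0 < pp"
    and v: "\<And>i. i \<in> {2..n} ==> ((\<lambda>t. v t i) has_real_derivative
        r t * pp * F i + \<delta> i - real (i - 1) * (rd / r t) * v t i) (at t)"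
  shows "\<exists>D. ((\<lambda>t. r t * B (v t) (v t)) has_real_derivative D) (at t) \<and>
    D \<le> - (2 / M) * (r t)^2 * pp * (L2_set (v t) {2..n})^2 + 2 * M * r t * L2_set (v t) {2..n} * L2_set \<delta> {2..n}"
proof -
  define v' where "v' i = r t * pp * F i + (\<delta> i + (- (rd / r t)) * ((real i - 3/2) * v t i + 1/2 * v t i))" for i
  have v'e: "v' i = r t * pp * F i + \<delta> i - real (i - 1) * (rd / r t) * v t i" if "i \<in> {2..n}" for i
  proof -
    have "(real i - 3/2) * v t i + 1/2 * v t i = real (i - 1) * v t i"
      using that by (simp add: of_nat_diff algebra_simps)
    then show ?thesis unfolding v'_def by simp
  qed
  have "((\<lambda>t. B (v t) (v t)) has_real_derivative 2 * B (v t) v') (at t)"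
    by (rule bform_has_real_derivative[OF B]) (use v v'e in auto)
  from DERIV_mult[OF r(1) this]
  have 1: "((\<lambda>t. r t * B (v t) (v t)) has_real_derivative rd * B (v t) (v t) + 2 * B (v t) v' * r t) (at t)" .
  have a: "(\<lambda>i. (real i - 3/2) * v t i + 1/2 * v t i) = (\<lambda>i. (\<lambda>i. (real i - 3/2) * v t i) i + (\<lambda>i. 1/2 * v t i) i)" by simp
  have "B (v t) v' = r t * pp * B (v t) F + (B (v t) \<delta> + (- (rd / r t)) *
      (B (v t) (\<lambda>i. (real i - 3/2) * v t i) + 1/2 * B (v t) (v t)))"
    unfolding v'_def bform_add[OF B] bform_scale[OF B] by simp
  then have "rd * B (v t) (v t) + 2 * B (v t) v' * r t =
      2 * (r t)^2 * pp * B (v t) F + 2 * r t * B (v t) \<delta> - 2 * rd * B (v t) (\<lambda>i. (real i - 3/2) * v t i)"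
    using r(3) by (simp add: field_simps power2_eq_square)
  also have "... \<le> 2 * (r t)^2 * pp * (- (1 / M) * (L2_set (v t) {2..n})^2)
      + 2 * r t * (M * L2_set (v t) {2..n} * L2_set \<delta> {2..n}) - 0"
  proof (intro diff_mono add_mono mult_left_mono neg)
    show "B (v t) \<delta> \<le> M * L2_set (v t) {2..n} * L2_set \<delta> {2..n}" using hi[of "v t" \<delta>] by linarith
    show "0 \<le> 2 * rd * B (v t) (\<lambda>i. (real i - 3/2) * v t i)" using r(2) BD by simp
  qed (use pp r in auto)
  finally show ?thesis using 1 by (intro exI[of _ "rd * B (v t) (v t) + 2 * B (v t) v' * r t"]) (simp add: mult_ac)
qed

end

locale plant_data = design n ix jx K M G \<kappa> Bo Bc p q Bx bh bh' v1 v1'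
  for n :: nat and ix :: "nat => 'n::finite" and jx :: "nat => 'm::finite" and K :: "'p::finite known"
    and M :: real and G \<kappa> :: "nat => real" and Bo Bc :: "(nat => real) => (nat => real) => real"
    and p q Bx bh bh' v1 v1' :: "real => real" +
  fixes P :: "('n::finite, 'p::finite) plant" and H :: "(real ^ 'p::finite) set" and \<theta> :: real
    and m1 m1t m2 :: "real ^ 'p::finite => real" and V :: "real ^ 'p::finite => real"
  assumes \<theta>0: "0 \<le> \<theta>" and pc: "plant_continuous n P" and dlb: "delay_bound K P"
    and db: "drift_bound ix n K P \<theta>"
    and mb: "mu_bounds ix n K P (psi_values ix n K P H) H \<theta> m1 m1t m2"
    and Vc: "lyapunov_candidate V"
    and Vd: "\<And>t x u \<psi> D xd \<psi>d ud. 0 \<le> t ==> \<psi> \<in> psi_values ix n K P H ==> GDERIV V \<psi> :> D ==>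
       \<psi>d \<in> psi_values ix n K P H \<union> H ==>
       D \<bullet> q_psi P t x \<psi> u xd \<psi>d ud \<le> - alpha_psi K (norm \<psi>) +
                (Gam2 K (x $ ix 1) * (\<theta> * (x $ ix 1)^2 + (\<Sum>j=2..n. (x $ ix j)^2) +
                    gam_s K (outp ix n x) u) +
                 Gam2 K (xd $ ix 1) * (\<theta> * (xd $ ix 1)^2 + (\<Sum>j=2..n. (xd $ ix j)^2) +
                    gam_s K (outp ix n xd) ud))"
    and Vlo: "\<And>\<psi>. V_lo K * V \<psi> \<le> alpha_psi K (norm \<psi>)"
    and gs: "\<And>t x u \<psi>. 0 \<le> t ==> \<psi> \<in> psi_values ix n K P H ==>
       gam_s K (outp ix n x) u \<le> gam_s_bar K (x $ ix 1) * \<bar>mu P t x \<psi> u\<bar>^2"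
    and ms: "\<And>\<psi>. (m1 \<psi>)^2 + (m1t \<psi>)^2 + (m2 \<psi>)^2 \<le> k_bar K * alpha_psi K (norm \<psi>)"

text \<open>
  A solution of the closed loop on \<open>[0, T)\<close>. In its coordinates, \<open>xc\<close> are the numbered components
  of \<open>x\<close> with derivatives \<open>xd\<close>, \<open>zc\<close> is the estimate of \<open>xc\<close> that the observer provides, \<open>ep\<close> and
  \<open>om\<close> are the scaled observer error and \<open>\<varpi>\<close>, \<open>eN\<close> and \<open>oN\<close> their norms; \<open>muc\<close>, \<open>ut\<close> and
  \<open>ss\<close> are \<open>\<mu>\<close>, the virtual input and their difference; \<open>dr\<close> is the drift, \<open>rd\<close>, \<open>rud\<close> and \<open>vtd\<close>
  are the rates of \<open>r\<close>, \<open>r\<^sub>u\<close> and \<open>vt = \<vartheta>\<close>; \<open>\<delta>e\<close> and \<open>\<delta>w\<close>, defined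
  below, are the perturbations of the two chains.
\<close>

locale loop = plant_data n ix jx K M G \<kappa> Bo Bc p q Bx bh bh' v1 v1' P H \<theta> m1 m1t m2 V
  for n :: nat and ix :: "nat => 'n::finite" and jx :: "nat => 'm::finite" and K :: "'p::finite known"
    and M :: real and G \<kappa> :: "nat => real" and Bo Bc :: "(nat => real) => (nat => real) => real"
    and p q Bx bh bh' v1 v1' :: "real => real" and P :: "('n::finite, 'p::finite) plant" and H \<theta> m1 m1t m2 V +
  fixes T :: ereal and w :: "('n::finite, 'p::finite, 'm::finite) signals"
  assumes sol: "closed_loop_solution ix jx n K Ctl P H T w"
begin

abbreviation "HT \<equiv> horizon T"
abbreviation "II \<equiv> {2..n}"
definition "xc t i = x_sig w t $ ix i"
definition "x1 t = x_sig w t $ ix 1"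
abbreviation "psi \<equiv> psi_sig w"
abbreviation "uu \<equiv> u_sig w"
abbreviation "rr \<equiv> r_sig w"
abbreviation "rru \<equiv> ru_sig w"
abbreviation "tth \<equiv> th_sig w"
definition "yy t = outp ix n (x_sig w t)"
definition "rd t = r_dot Ctl (x1 t) (rr t) (tth t)"
definition "vp t = varpi jx n K Ctl (x1 t) (xh_sig w t) (rr t) (tth t)"
definition "rud t = ru_dot jx n K Ctl (yy t) (uu t) (xh_sig w t) (rr t) (rru t) (tth t)"
definition "zc t i = xh_sig w t $ jx i + rr t ^ (i-1) * f_obs K Ctl i (x1 t)"
definition "ep t i = (zc t i - xc t i) / rr t ^ (i-1)"
definition "om t i = vp t $ jx i"
definition "muc t = mu P t (x_sig w t) (psi t) (uu t)"
definition "ut t = u_tilde jx n K Ctl (x1 t) (xh_sig w t) (rr t) (tth t)"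
definition "ss t = muc t - ut t"
definition "dr t i = drift P i t (x_sig w t)"
definition "xd t i = (if i < n then phi K i (x1 t) * xc t (i+1) + dr t i else muc t)"
definition "vt t = tth t * x1 t * v1 (x1 t)"
definition "vtd t = q (x1 t) * (x1 t)^2 * (x1 t * v1 (x1 t)) + tth t * (v1 (x1 t) + x1 t * v1' (x1 t)) * xd t 1"
definition "eN t = L2_set (ep t) II"
definition "oN t = L2_set (om t) II"
abbreviation "Sb \<equiv> psi_values ix n K P H"

lemma psol: "plant_solution ix n K P H T (x_sig w) psi uu"
  and init: "admissible_initial K Ctl H w"
  using sol unfolding closed_loop_solution_def by blast+

lemma past: "admissible_past K H (x_sig w) psi uu" using init by (simp add: admissible_initial_def)

lemma HT_nonneg: "t \<in> HT ==> 0 \<le> t" by (simp add: horizon_def)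

lemma HT_open_right: "t \<in> HT ==> \<exists>t'>t. t' \<in> HT"
proof -
  assume t: "t \<in> HT"
  then have "ereal t < T" by (simp add: horizon_def)
  from ereal_dense2[OF this] obtain z where z: "ereal t < ereal z" "ereal z < T" by blast
  have "t < z" "0 \<le> t" using z(1) t by (simp_all add: horizon_def)
  then have "z \<in> HT" using z(2) unfolding horizon_def by simp
  then show ?thesis using \<open>t < z\<close> by (rule_tac exI[of _ z], rule_tac conjI)
qed

lemma loop_eqs:
  assumes t: "t \<in> HT"
  shows "uu t = zeta_sig w t - rru t * xc t n"
    and "i \<in> {2..n} ==> ((\<lambda>s. xh_sig w s $ jx i) has_real_derivative
        (if i < n then phi K i (x1 t) * zc t (i+1) else ut t)
        - rr t ^ (i-1) * (G i * p (x1 t)) * zc t 2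
        - real (i-1) * rd t * rr t ^ (i-2) * f_obs K Ctl i (x1 t)) (at t within {0..})"
    and "(zeta_sig w has_real_derivative rud t * xc t n + rru t * ut t) (at t within {0..})"
    and "(rr has_real_derivative rd t) (at t within {0..})"
    and "(rru has_real_derivative rud t) (at t within {0..})"
    and "(tth has_real_derivative q (x1 t) * (x1 t)^2) (at t within {0..})"
    and "i \<in> {1..n} ==> ((\<lambda>s. xc s i) has_real_derivative xd t i) (at t within {0..})"
    and "t - delay P t \<noteq> 0 ==> (psi has_vector_derivative q_psi P t (x_sig w t) (psi t) (uu t)
        (x_sig w (t - delay P t)) (psi (t - delay P t)) (uu (t - delay P t))) (at t within {0..})"
proof -
  note E = sol[unfolded closed_loop_solution_def Let_def, THEN conjunct2, THEN conjunct2, THEN bspec, OF t]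
  show "uu t = zeta_sig w t - rru t * xc t n" using E by (simp add: xc_def)
  show "(zeta_sig w has_real_derivative rud t * xc t n + rru t * ut t) (at t within {0..})"
    using E unfolding rud_def xc_def ut_def yy_def x1_def by blast
  show "(rr has_real_derivative rd t) (at t within {0..})"
    "(rru has_real_derivative rud t) (at t within {0..})"
    "(tth has_real_derivative q (x1 t) * (x1 t)^2) (at t within {0..})"
    using E unfolding rud_def rd_def yy_def x1_def Ctl_sel by blast+
  show "((\<lambda>s. xh_sig w s $ jx i) has_real_derivative
        (if i < n then phi K i (x1 t) * zc t (i+1) else ut t)
        - rr t ^ (i-1) * (G i * p (x1 t)) * zc t 2
        - real (i-1) * rd t * rr t ^ (i-2) * f_obs K Ctl i (x1 t)) (at t within {0..})" if "i \<in> {2..n}"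
  proof (cases "i < n")
    case True
    then have "i \<in> {2..n-1}" using that by auto
    with E True show ?thesis by (simp add: zc_def x1_def rd_def numeral_2_eq_2)
  next
    case False
    then have "i = n" using that by auto
    with E False show ?thesis by (simp add: zc_def x1_def rd_def ut_def numeral_2_eq_2)
  qed
  note F = psol[unfolded plant_solution_def Let_def, THEN conjunct2, THEN conjunct2, THEN conjunct2, THEN bspec, OF t]
  show "((\<lambda>s. xc s i) has_real_derivative xd t i) (at t within {0..})" if "i \<in> {1..n}"
  proof (cases "i < n")
    case True
    then have "i \<in> {1..n-1}" using that by auto
    with F True show ?thesis by (simp add: xc_def x1_def xd_def dr_def)
  next
    case False
    then have "i = n" using that by auto
    with F False show ?thesis by (simp add: xc_def xd_def muc_def)
  qed
  show "t - delay P t \<noteq> 0 ==> (psi has_vector_derivative q_psi P t (x_sig w t) (psi t) (uu t)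
        (x_sig w (t - delay P t)) (psi (t - delay P t)) (uu (t - delay P t))) (at t within {0..})"
    using F by simp
qed

lemma continuous_on_HT_I:
  assumes "\<And>t. t \<in> HT ==> (f has_real_derivative f' t) (at t within {0..})"
  shows "continuous_on HT f"
  unfolding continuous_on_eq_continuous_within
proof
  fix t assume "t \<in> HT"
  then have "continuous (at t within {0..}) f" using assms by (meson DERIV_continuous)
  then show "continuous (at t within HT) f" by (rule continuous_within_subset) (auto simp: horizon_def)
qed

lemma cont_sig:
  "continuous_on HT rr" "continuous_on HT rru" "continuous_on HT tth" "continuous_on HT (zeta_sig w)"
  "continuous_on HT psi" "continuous_on HT uu" "continuous_on HT (x_sig w)" "continuous_on HT (xh_sig w)"
proof -
  show "continuous_on HT rr" "continuous_on HT rru" "continuous_on HT tth" "continuous_on HT (zeta_sig w)"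
    by (rule continuous_on_HT_I, erule loop_eqs)+
  show "continuous_on HT psi" "continuous_on HT uu" using psol by (auto simp: plant_solution_def)
  have "continuous_on HT (\<lambda>s. x_sig w s $ j)" for j
  proof -
    obtain i where i: "i \<in> {1..n}" "j = ix i" using ix unfolding bij_betw_def by (metis UNIV_I imageE)
    have "continuous_on HT (\<lambda>s. xc s i)" by (rule continuous_on_HT_I) (rule loop_eqs(7)[OF _ i(1)])
    then show ?thesis using i by (simp add: xc_def)
  qed
  then show "continuous_on HT (x_sig w)" by (simp add: continuous_on_vec_lambda[of HT "\<lambda>i x. x_sig w x $ i", simplified])
  have "continuous_on HT (\<lambda>s. xh_sig w s $ j)" for j
  proof -
    obtain i where i: "i \<in> {2..n}" "j = jx i" using jx unfolding bij_betw_def by (metis UNIV_I imageE)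
    have "continuous_on HT (\<lambda>s. xh_sig w s $ jx i)" by (rule continuous_on_HT_I) (rule loop_eqs(2)[OF _ i(1)])
    then show ?thesis using i by simp
  qed
  then show "continuous_on HT (xh_sig w)" by (simp add: continuous_on_vec_lambda[of HT "\<lambda>i x. xh_sig w x $ i", simplified])
qed

lemma rd_nonneg: "0 \<le> rd t" "0 \<le> rud t"
proof -
  have a: "0 \<le> W1 s th" for s th using W1_ge[of s th] by linarith
  have b: "0 \<le> W2' y u r rd th w" for y u r rd th w using W2'_ge(1)[of y u r rd th w] by linarith
  show "0 \<le> rd t" "0 \<le> rud t"
    unfolding rd_def rud_def r_dot_eq ru_dot_eq
    by (intro mult_nonneg_nonneg gate_props(1) a b zero_le_power abs_ge_zero zero_le_power2)+
qed

lemma mono_from_deriv: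
  assumes "\<And>t. t \<in> HT ==> (f has_real_derivative f' t) (at t within {0..})" "\<And>t. 0 \<le> f' t" "t \<in> HT" "0 \<le> s" "s \<le> t"
  shows "f s \<le> f t"
proof -
  have "- f t \<le> - f s"
  proof (rule nonincreasing_except_one[where f="\<lambda>t. - f t" and e="-1"])
    show "continuous_on {s..t} (\<lambda>t. - f t)" using continuous_on_HT_I[OF assms(1)] assms(3-5)
      by (intro continuous_intros) (auto elim!: continuous_on_subset intro: horizon_sub)
    fix v assume v: "s < v" "v < t" "v \<noteq> -1"
    then have "v \<in> HT" using assms(3-5) by (auto intro: horizon_sub)
    from assms(1)[OF this] have "(f has_real_derivative f' v) (at v)" using v assms(4) at_within_nonneg[of v] by simp
    from DERIV_minus[OF this] show "\<exists>D\<le>0. ((\<lambda>t. - f t) has_real_derivative D) (at v)"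
      using assms(2)[of v] by (intro exI[of _ "- f' v"]) simp
  qed (use assms in auto)
  then show ?thesis by simp
qed

lemma r_mono: "t \<in> HT ==> 0 \<le> s ==> s \<le> t ==> rr s \<le> rr t"
  by (rule mono_from_deriv[OF loop_eqs(4) rd_nonneg(1)])
lemma ru_mono: "t \<in> HT ==> 0 \<le> s ==> s \<le> t ==> rru s \<le> rru t"
  by (rule mono_from_deriv[OF loop_eqs(5) rd_nonneg(2)])
lemma th_mono: "t \<in> HT ==> 0 \<le> s ==> s \<le> t ==> tth s \<le> tth t"
  by (rule mono_from_deriv[OF loop_eqs(6)]) (use mult_nonneg_nonneg[OF less_imp_le[OF q_pos] zero_le_power2] in auto)

lemma ge1: "t \<in> HT ==> 1 \<le> rr t" "t \<in> HT ==> 1 \<le> rru t" "t \<in> HT ==> 1 \<le> tth t"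
proof -
  assume t: "t \<in> HT"
  have "1 \<le> rr 0" "1 \<le> rru 0" "1 \<le> tth 0" using init by (auto simp: admissible_initial_def)
  then show "1 \<le> rr t" "1 \<le> rru t" "1 \<le> tth t"
    using r_mono[OF t, of 0] ru_mono[OF t, of 0] th_mono[OF t, of 0] HT_nonneg[OF t] by auto
qed

lemma psi_in: "t \<in> HT ==> psi t \<in> Sb" using psol unfolding psi_values_def by blast

lemma om_eq: "t \<in> HT ==> i \<in> {2..n} ==> om t i = (zc t i + (if i = 2 then vt t else 0)) / rr t ^ (i-1)"
  unfolding om_def vp_def by (simp add: varpi_jx zc_def vt_def algebra_simps)

lemma ut_eq: "ut t = - (rr t ^ n) * (bh (x1 t) * (\<Sum>i=2..n. \<kappa> i * om t i))"
  by (simp add: ut_def u_tilde_eq om_def vp_def)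

lemma xc_eq: "t \<in> HT ==> xc t i = zc t i - rr t ^ (i-1) * ep t i"
  using ge1(1)[of t] by (simp add: ep_def)

lemma zc_eq: "t \<in> HT ==> i \<in> {2..n} ==> zc t i = rr t ^ (i-1) * om t i - (if i = 2 then vt t else 0)"
  using ge1(1)[of t] om_eq[of t i] by (simp add: field_simps)

definition "\<delta>e t i = G i * p (x1 t) / phi K 1 (x1 t) * dr t 1 - (if i < n then dr t i else ss t) / rr t ^ (i-1)"
definition "\<delta>w t i = G i * p (x1 t) / phi K 1 (x1 t) * dr t 1 + (if i = 2 then vtd t / rr t else 0)"

lemma xd1: "xd t 1 = phi K 1 (x1 t) * xc t 2 + dr t 1"
  using n2 by (simp add: xd_def numeral_2_eq_2)

lemma deriv_at:
  assumes t: "t \<in> HT" "0 < t"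
  shows "(rr has_real_derivative rd t) (at t)" "(rru has_real_derivative rud t) (at t)"
    "(tth has_real_derivative q (x1 t) * (x1 t)^2) (at t)"
    "i \<in> {1..n} ==> ((\<lambda>s. xc s i) has_real_derivative xd t i) (at t)"
    "(x1 has_real_derivative xd t 1) (at t)"
    "(vt has_real_derivative vtd t) (at t)"
proof -
  show a: "(rr has_real_derivative rd t) (at t)" "(rru has_real_derivative rud t) (at t)"
    "(tth has_real_derivative q (x1 t) * (x1 t)^2) (at t)"
    "\<And>i. i \<in> {1..n} ==> ((\<lambda>s. xc s i) has_real_derivative xd t i) (at t)"
    using loop_eqs(4-7)[OF t(1)] at_within_nonneg[OF t(2)] by auto
  from a(4)[of 1] n2 show b: "(x1 has_real_derivative xd t 1) (at t)" by (simp add: xc_def x1_def[abs_def])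
  have c: "((\<lambda>s. v1 (x1 s)) has_real_derivative v1' (x1 t) * xd t 1) (at t)" by (rule DERIV_chain2[OF v1(1) b])
  have "((\<lambda>s. tth s * x1 s * v1 (x1 s)) has_real_derivative vtd t) (at t)"
    using DERIV_mult[OF DERIV_mult[OF a(3) b] c] by (simp add: vtd_def algebra_simps)
  then show "(vt has_real_derivative vtd t) (at t)" by (simp add: vt_def[abs_def])
qed

lemma zc_deriv:
  assumes t: "t \<in> HT" "0 < t" and i: "i \<in> {2..n}"
  shows "((\<lambda>s. zc s i) has_real_derivative (if i < n then phi K i (x1 t) * zc t (i+1) else ut t)
     + rr t ^ (i-1) * (G i * p (x1 t)) * (xc t 2 - zc t 2)
     + rr t ^ (i-1) * (G i * p (x1 t) / phi K 1 (x1 t) * dr t 1)) (at t)"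
proof -
  note d = deriv_at[OF t]
  have ph: "phi K 1 (x1 t) \<noteq> 0" using phi_pos[OF one_in, of "x1 t"] by simp
  have 1: "((\<lambda>s. xh_sig w s $ jx i) has_real_derivative
        (if i < n then phi K i (x1 t) * zc t (i+1) else ut t)
        - rr t ^ (i-1) * (G i * p (x1 t)) * zc t 2
        - real (i-1) * rd t * rr t ^ (i-2) * f_obs K Ctl i (x1 t)) (at t)"
    using loop_eqs(2)[OF t(1) i] at_within_nonneg[OF t(2)] by simp
  have 2: "((\<lambda>s. rr s ^ (i-1)) has_real_derivative real (i-1) * (rd t * rr t ^ (i-2))) (at t)"
    using DERIV_power[OF d(1), of "i-1"] by (simp add: numeral_2_eq_2)
  have 3: "((\<lambda>s. f_obs K Ctl i (x1 s)) has_real_derivative G i * p (x1 t) / phi K 1 (x1 t) * xd t 1) (at t)"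
    by (rule DERIV_chain2[OF f_obs_deriv[OF i] d(5)])
  have 4: "G i * p (x1 t) / phi K 1 (x1 t) * xd t 1 = G i * p (x1 t) * xc t 2 + G i * p (x1 t) / phi K 1 (x1 t) * dr t 1"
    unfolding xd1 using ph by (simp add: field_simps)
  have "((\<lambda>s. zc s i) has_real_derivative
      ((if i < n then phi K i (x1 t) * zc t (i+1) else ut t)
        - rr t ^ (i-1) * (G i * p (x1 t)) * zc t 2
        - real (i-1) * rd t * rr t ^ (i-2) * f_obs K Ctl i (x1 t))
      + (real (i-1) * (rd t * rr t ^ (i-2)) * f_obs K Ctl i (x1 t)
         + (G i * p (x1 t) * xc t 2 + G i * p (x1 t) / phi K 1 (x1 t) * dr t 1) * rr t ^ (i-1))) (at t)"
    using DERIV_add[OF 1 DERIV_mult[OF 2 3]] unfolding 4 zc_def .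
  moreover have "((if i < n then phi K i (x1 t) * zc t (i+1) else ut t)
        - rr t ^ (i-1) * (G i * p (x1 t)) * zc t 2
        - real (i-1) * rd t * rr t ^ (i-2) * f_obs K Ctl i (x1 t))
      + (real (i-1) * (rd t * rr t ^ (i-2)) * f_obs K Ctl i (x1 t)
         + (G i * p (x1 t) * xc t 2 + G i * p (x1 t) / phi K 1 (x1 t) * dr t 1) * rr t ^ (i-1))
    = (if i < n then phi K i (x1 t) * zc t (i+1) else ut t)
     + rr t ^ (i-1) * (G i * p (x1 t)) * (xc t 2 - zc t 2)
     + rr t ^ (i-1) * (G i * p (x1 t) / phi K 1 (x1 t) * dr t 1)"
    by (simp add: algebra_simps)
  ultimately show ?thesis by (rule DERIV_cong)
qed

lemma ep_deriv:
  assumes t: "t \<in> HT" "0 < t" and i: "i \<in> {2..n}"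
  shows "((\<lambda>s. ep s i) has_real_derivative rr t * p (x1 t) * obs_op n 2 (\<lambda>i. phi K i (x1 t) / p (x1 t)) 1 G (ep t) i
    + \<delta>e t i - real (i-1) * (rd t / rr t) * ep t i) (at t)"
proof -
  have r0: "rr t \<noteq> 0" using ge1(1)[OF t(1)] by simp
  have p0: "p (x1 t) \<noteq> 0" using p_pos[of "x1 t"] by simp
  note d = deriv_at[OF t]
  define zd where "zd = (if i < n then phi K i (x1 t) * zc t (i+1) else ut t)
     + rr t ^ (i-1) * (G i * p (x1 t)) * (xc t 2 - zc t 2)
     + rr t ^ (i-1) * (G i * p (x1 t) / phi K 1 (x1 t) * dr t 1)"
  have "((\<lambda>s. zc s i - xc s i) has_real_derivative zd - xd t i) (at t)"
    unfolding zd_def using i by (intro DERIV_diff zc_deriv[OF t] d(4)) auto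
  from has_real_derivative_scaled[OF this d(1) r0, of "i-1"]
  have "((\<lambda>s. ep s i) has_real_derivative (zd - xd t i) / rr t ^ (i-1) - real (i-1) * (rd t / rr t) * ep t i) (at t)"
    by (simp add: ep_def)
  moreover have "(zd - xd t i) / rr t ^ (i-1) = rr t * p (x1 t) * obs_op n 2 (\<lambda>i. phi K i (x1 t) / p (x1 t)) 1 G (ep t) i + \<delta>e t i"
  proof -
    have x2: "xc t 2 - zc t 2 = - (rr t * ep t 2)" using xc_eq[OF t(1), of 2] by simp
    show ?thesis
    proof (cases "i < n")
      case True
      have "zc t (i+1) - xc t (i+1) = rr t * rr t ^ (i-1) * ep t (i+1)"
        using xc_eq[OF t(1), of "i+1"] i by (simp add: power_eq_if[of _ i])
      moreover have "zd - xd t i = phi K i (x1 t) * (zc t (i+1) - xc t (i+1)) - dr t i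
         - rr t ^ (i-1) * (G i * p (x1 t)) * (rr t * ep t 2)
         + rr t ^ (i-1) * (G i * p (x1 t) / phi K 1 (x1 t) * dr t 1)"
        using True unfolding zd_def x2 xd_def by (simp add: algebra_simps)
      ultimately have zdx: "zd - xd t i = phi K i (x1 t) * (rr t * rr t ^ (i-1) * ep t (i+1)) - dr t i
         - rr t ^ (i-1) * (G i * p (x1 t)) * (rr t * ep t 2)
         + rr t ^ (i-1) * (G i * p (x1 t) / phi K 1 (x1 t) * dr t 1)" by simp
      have R0: "rr t ^ (i-1) \<noteq> 0" using r0 by simp
      have alg: "(a * (r * R * E) - d - R * (g * b) * (r * e) + R * c) / R
          = r * b * (a / b * E - 1 * g * e) + (c - d / R)" if "R \<noteq> 0" "b \<noteq> 0" for a r R E d g b e c :: real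
        using that by (simp add: field_simps)
      show ?thesis unfolding zdx obs_op_def \<delta>e_def if_P[OF True] by (rule alg[OF R0 p0])
    next
      case False
      then have zdx: "zd - xd t i = - ss t - rr t ^ (i-1) * (G i * p (x1 t)) * (rr t * ep t 2)
         + rr t ^ (i-1) * (G i * p (x1 t) / phi K 1 (x1 t) * dr t 1)"
        unfolding zd_def x2 xd_def ss_def by (simp add: algebra_simps)
      have R0: "rr t ^ (i-1) \<noteq> 0" using r0 by simp
      have alg: "(- d - R * (g * b) * (r * e) + R * c) / R
          = r * b * (0 - 1 * g * e) + (c - d / R)" if "R \<noteq> 0" for r R d g b e c :: real
        using that by (simp add: field_simps)
      show ?thesis unfolding zdx obs_op_def \<delta>e_def if_not_P[OF False] by (rule alg[OF R0])
    qed
  qed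
  ultimately show ?thesis by simp
qed

lemma om_deriv:
  assumes t: "t \<in> HT" "0 < t" and i: "i \<in> {2..n}"
  shows "((\<lambda>s. om s i) has_real_derivative
    rr t * p (x1 t) * fb_op n (\<lambda>i. phi K i (x1 t) / p (x1 t)) (bh (x1 t) / p (x1 t)) \<kappa> (om t) i
    + (- (rr t * p (x1 t) * ep t 2) * G i + \<delta>w t i) - real (i-1) * (rd t / rr t) * om t i) (at t)"
proof -
  have r0: "rr t \<noteq> 0" using ge1(1)[OF t(1)] by simp
  have p0: "p (x1 t) \<noteq> 0" using p_pos[of "x1 t"] by simp
  note d = deriv_at[OF t]
  define zd where "zd = (if i < n then phi K i (x1 t) * zc t (i+1) else ut t)
     + rr t ^ (i-1) * (G i * p (x1 t)) * (xc t 2 - zc t 2)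
     + rr t ^ (i-1) * (G i * p (x1 t) / phi K 1 (x1 t) * dr t 1)"
  define vd where "vd = (if i = 2 then vtd t else 0)"
  have "((\<lambda>s. if i = 2 then vt s else 0) has_real_derivative vd) (at t)" using d(6) by (simp add: vd_def)
  then have "((\<lambda>s. zc s i + (if i = 2 then vt s else 0)) has_real_derivative zd + vd) (at t)"
    unfolding zd_def by (intro DERIV_add zc_deriv[OF t i])
  from has_real_derivative_scaled[OF this d(1) r0, of "i-1"]
  have der: "((\<lambda>s. (zc s i + (if i = 2 then vt s else 0)) / rr s ^ (i-1)) has_real_derivative
      (zd + vd) / rr t ^ (i-1) - real (i-1) * (rd t / rr t) * om t i) (at t)"
    using om_eq[OF t(1) i] by simp
  have ev: "\<forall>\<^sub>F s in nhds t. om s i = (zc s i + (if i = 2 then vt s else 0)) / rr s ^ (i-1)"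
  proof -
    obtain t' where t': "t < t'" "t' \<in> HT" using HT_open_right[OF t(1)] by blast
    have "s \<in> {0<..<t'} ==> s \<in> HT" for s using horizon_sub[OF t'(2), of s] by auto
    then show ?thesis unfolding eventually_nhds using t t' om_eq[OF _ i]
      by (intro exI[of _ "{0<..<t'}"]) auto
  qed
  have 1: "((\<lambda>s. om s i) has_real_derivative
      (zd + vd) / rr t ^ (i-1) - real (i-1) * (rd t / rr t) * om t i) (at t)"
    by (rule iffD2[OF DERIV_cong_ev[OF refl ev refl] der])
  have "(zd + vd) / rr t ^ (i-1) = rr t * p (x1 t) * fb_op n (\<lambda>i. phi K i (x1 t) / p (x1 t)) (bh (x1 t) / p (x1 t)) \<kappa> (om t) i
    + (- (rr t * p (x1 t) * ep t 2) * G i + \<delta>w t i)"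
  proof -
    have x2: "xc t 2 - zc t 2 = - (rr t * ep t 2)" using xc_eq[OF t(1), of 2] by simp
    have vdr: "vd / rr t ^ (i-1) = (if i = 2 then vtd t / rr t else 0)" by (simp add: vd_def)
    have main: "(if i < n then phi K i (x1 t) * zc t (i+1) else ut t) / rr t ^ (i-1) =
        rr t * p (x1 t) * fb_op n (\<lambda>i. phi K i (x1 t) / p (x1 t)) (bh (x1 t) / p (x1 t)) \<kappa> (om t) i"
    proof (cases "i < n")
      case True
      have "zc t (i+1) = rr t * rr t ^ (i-1) * om t (i+1)"
        using zc_eq[OF t(1), of "i+1"] i True by (simp add: power_eq_if[of _ i])
      then show ?thesis using True r0 p0 by (simp add: fb_op_def)
    next
      case False
      then have "i = n" using i by auto
      moreover have "rr t ^ n = rr t * rr t ^ (n-1)" using n2 by (simp add: power_eq_if[of _ n])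
      ultimately show ?thesis using r0 p0 by (simp add: fb_op_def ut_eq)
    qed
    have "(zd + vd) / rr t ^ (i-1) = (if i < n then phi K i (x1 t) * zc t (i+1) else ut t) / rr t ^ (i-1)
       + (- (G i * p (x1 t)) * (rr t * ep t 2)) + G i * p (x1 t) / phi K 1 (x1 t) * dr t 1 + vd / rr t ^ (i-1)"
      unfolding zd_def x2 using r0 by (simp add: field_simps)
    then show ?thesis unfolding main vdr by (simp add: \<delta>w_def)
  qed
  then show ?thesis using 1 by simp
qed

end

section \<open>Perturbations of the observer and feedback chains\<close>

context loop begin

abbreviation "BB t \<equiv> Bx (x1 t)"
abbreviation "BB1 t \<equiv> B1 (x1 t) (tth t)"
abbreviation "BB2 t \<equiv> B2 (yy t) (uu t) (rr t) (rd t) (tth t) (vp t)"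
abbreviation "WP t \<equiv> Wp (yy t) (uu t) (rr t) (rd t) (tth t) (vp t)"
abbreviation "XX t \<equiv> \<bar>x1 t\<bar>"
definition "Sx t = (\<Sum>j=2..n. \<bar>xc t j\<bar>)"
definition "Sq t = (\<Sum>j=2..n. (xc t j)^2)"
definition "ZZ t = (eN t)^2 + (oN t)^2"
definition "YY t = (1 + \<theta>) * XX t + eN t + oN t"

lemma eN_nonneg: "0 \<le> eN t" "0 \<le> oN t" by (auto simp: eN_def oN_def)
lemma ZZ_nonneg: "0 \<le> ZZ t" by (simp add: ZZ_def)
lemma YY_props: "0 \<le> YY t" "\<theta> * XX t \<le> YY t" "XX t \<le> YY t" "eN t + oN t \<le> YY t" "oN t \<le> YY t" "eN t \<le> YY t"
  using eN_nonneg[of t] \<theta>0 mult_nonneg_nonneg[OF \<theta>0 abs_ge_zero[of "x1 t"]] by (auto simp: YY_def algebra_simps)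

lemma yy_fst: "fst (yy t) = x1 t" by (simp add: yy_def outp_def x1_def)
lemma yy_outp: "yy t = outp ix n (x_sig w t)" by (simp add: yy_def)

lemma BB_ge: "1 \<le> BB t" "BB t \<le> BB1 t" "1 \<le> BB1 t" "BB1 t \<le> BB2 t" "1 \<le> BB2 t" "BB t \<le> BB2 t"
  using Bx_ge(1)[of "x1 t"] B1_ge(1,8)[of "x1 t" "tth t"] B2_ge(1,9)[of "yy t" "tth t" "uu t" "rr t" "rd t" "vp t"]
  by (auto simp: yy_fst)

lemma BB0: "0 \<le> BB t" "0 \<le> BB1 t" "0 \<le> BB2 t"
  using BB_ge(1,3,5)[of t] by linarith+

lemma dr_bound:
  assumes t: "t \<in> HT" and i: "i \<in> {1..n-1}"
  shows "\<bar>dr t i\<bar> \<le> BB t * (\<theta> * XX t + (\<Sum>j=2..i. \<bar>xc t j\<bar>))"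
proof -
  have "\<bar>dr t i\<bar> \<le> Gam K (x1 t) * (\<theta> * XX t + (\<Sum>j=2..i. \<bar>xc t j\<bar>))"
    using db HT_nonneg[OF t] i unfolding drift_bound_def dr_def x1_def xc_def by blast
  also have "... \<le> BB t * (\<theta> * XX t + (\<Sum>j=2..i. \<bar>xc t j\<bar>))"
    using \<theta>0 by (intro mult_right_mono Bx_ge) (auto simp: sum_nonneg)
  finally show ?thesis .
qed

lemma dr1_bound: "t \<in> HT ==> \<bar>dr t 1\<bar> \<le> BB t * \<theta> * XX t"
  using dr_bound[of t 1] one_in by simp

lemma ep_om_abs: "i \<in> II ==> \<bar>ep t i\<bar> \<le> eN t" "i \<in> II ==> \<bar>om t i\<bar> \<le> oN t"
  by (auto simp: eN_def oN_def intro!: abs_le_L2_set)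

lemma vt_bound: "t \<in> HT ==> \<bar>vt t\<bar> \<le> (BB1 t)^2 * XX t"
proof -
  have "\<bar>vt t\<bar> = (\<bar>tth t\<bar> * v1 (x1 t)) * XX t" using v1(3) by (simp add: vt_def abs_mult)
  also have "... \<le> (BB1 t * BB1 t) * XX t"
    using v1(3) by (intro mult_right_mono mult_mono B1_ge BB0) auto
  finally show ?thesis by (simp add: power2_eq_square)
qed

lemma xc_bound:
  assumes t: "t \<in> HT" and j: "j \<in> II"
  shows "\<bar>xc t j\<bar> \<le> rr t ^ (j-1) * (eN t + oN t) + (if j = 2 then (BB1 t)^2 * XX t else 0)"
proof -
  have "xc t j = rr t ^ (j-1) * (om t j - ep t j) - (if j = 2 then vt t else 0)"
    using xc_eq[OF t, of j] zc_eq[OF t j] by (simp add: algebra_simps)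
  then have "\<bar>xc t j\<bar> \<le> \<bar>rr t ^ (j-1) * (om t j - ep t j)\<bar> + \<bar>if j = 2 then vt t else 0\<bar>" by linarith
  also have "... \<le> rr t ^ (j-1) * (eN t + oN t) + (if j = 2 then (BB1 t)^2 * XX t else 0)"
  proof (rule add_mono)
    have "\<bar>rr t ^ (j-1) * (om t j - ep t j)\<bar> = rr t ^ (j-1) * \<bar>om t j - ep t j\<bar>"
      using ge1(1)[OF t] by (simp add: abs_mult)
    also have "... \<le> rr t ^ (j-1) * (eN t + oN t)"
      using ep_om_abs[OF j, of t] ge1(1)[OF t] by (intro mult_left_mono) auto
    finally show "\<bar>rr t ^ (j-1) * (om t j - ep t j)\<bar> \<le> rr t ^ (j-1) * (eN t + oN t)" .
  qed (use vt_bound[OF t] in auto)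
  finally show ?thesis .
qed

lemma x2_bound: "t \<in> HT ==> \<bar>xc t 2\<bar> \<le> rr t * (eN t + oN t) + (BB1 t)^2 * XX t"
  using xc_bound[of t 2] n2 by simp

lemma xd1_bound:
  assumes t: "t \<in> HT"
  shows "\<bar>xd t 1\<bar> \<le> BB1 t * (rr t * (eN t + oN t)) + BB1 t ^ 3 * XX t + BB1 t * \<theta> * XX t"
proof -
  have "\<bar>xd t 1\<bar> \<le> \<bar>phi K 1 (x1 t)\<bar> * \<bar>xc t 2\<bar> + \<bar>dr t 1\<bar>"
    unfolding xd1 using abs_triangle_ineq[of "phi K 1 (x1 t) * xc t 2" "dr t 1"] by (simp add: abs_mult)
  also have "... \<le> BB1 t * (rr t * (eN t + oN t) + (BB1 t)^2 * XX t) + BB1 t * \<theta> * XX t"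
  proof (rule add_mono)
    show "\<bar>phi K 1 (x1 t)\<bar> * \<bar>xc t 2\<bar> \<le> BB1 t * (rr t * (eN t + oN t) + (BB1 t)^2 * XX t)"
      using phi_pos[OF one_in, of "x1 t"] Bx_ge(3)[OF one_in, of "x1 t"] BB_ge[of t]
      by (intro mult_mono x2_bound[OF t]) auto
    have "BB t * \<theta> * XX t \<le> BB1 t * \<theta> * XX t" using BB_ge[of t] \<theta>0 by (intro mult_right_mono) auto
    then show "\<bar>dr t 1\<bar> \<le> BB1 t * \<theta> * XX t" using dr1_bound[OF t] by linarith
  qed
  also have "... = BB1 t * (rr t * (eN t + oN t)) + BB1 t ^ 3 * XX t + BB1 t * \<theta> * XX t"
    by (simp add: distrib_left power3_eq_cube power2_eq_square)
  finally show ?thesis .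
qed

lemma vtd_bound:
  assumes t: "t \<in> HT"
  shows "\<bar>vtd t\<bar> \<le> 2 * BB1 t ^ 5 * XX t + BB1 t ^ 3 * rr t * (eN t + oN t) + BB1 t ^ 3 * \<theta> * XX t"
proof -
  let ?b = "BB1 t"
  have b: "1 \<le> ?b" by (rule BB_ge)
  have "\<bar>vtd t\<bar> \<le> \<bar>q (x1 t) * (x1 t)^2 * (x1 t * v1 (x1 t))\<bar> + \<bar>tth t * (v1 (x1 t) + x1 t * v1' (x1 t)) * xd t 1\<bar>"
    unfolding vtd_def by (rule abs_triangle_ineq)
  also have "\<bar>q (x1 t) * (x1 t)^2 * (x1 t * v1 (x1 t))\<bar> \<le> ?b^5 * XX t"
  proof -
    have "\<bar>q (x1 t) * (x1 t)^2 * (x1 t * v1 (x1 t))\<bar> = (q (x1 t) * (x1 t)^2) * v1 (x1 t) * XX t"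
      using q_pos[of "x1 t"] v1(3)[of "x1 t"] by (simp add: abs_mult)
    also have "... \<le> ?b * ?b * XX t"
      using q_pos[of "x1 t"] v1(3)[of "x1 t"] by (intro mult_right_mono mult_mono B1_ge BB0) auto
    also have "... \<le> ?b^5 * XX t"
      using b power_increasing[of 2 5 ?b] by (intro mult_right_mono) (auto simp: power2_eq_square)
    finally show ?thesis .
  qed
  also have "\<bar>tth t * (v1 (x1 t) + x1 t * v1' (x1 t)) * xd t 1\<bar> \<le> ?b * ?b *
      (?b * (rr t * (eN t + oN t)) + ?b ^ 3 * XX t + ?b * \<theta> * XX t)"
    unfolding abs_mult by (intro mult_mono xd1_bound[OF t] B1_ge BB0 mult_nonneg_nonneg) auto
  also have "?b * ?b * (?b * (rr t * (eN t + oN t)) + ?b ^ 3 * XX t + ?b * \<theta> * XX t)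
     = ?b^3 * rr t * (eN t + oN t) + ?b^5 * XX t + ?b^3 * \<theta> * XX t"
    by (simp add: algebra_simps power3_eq_cube eval_nat_numeral)
  finally show ?thesis by (simp add: algebra_simps)
qed

lemma gain_dr_bound:
  assumes t: "t \<in> HT" and i: "i \<in> II"
  shows "\<bar>G i * p (x1 t) / phi K 1 (x1 t) * dr t 1\<bar> \<le> M^2 * ((BB t)^2 * \<theta> * XX t)"
proof -
  have ph: "1 / phi K 1 (x1 t) \<le> M"
    using phi_lo[OF one_in, of "x1 t"] phi_pos[OF one_in, of "x1 t"] M1 by (simp add: field_simps)
  have "\<bar>G i * p (x1 t) / phi K 1 (x1 t) * dr t 1\<bar> = \<bar>G i\<bar> * (1 / phi K 1 (x1 t)) * (p (x1 t) * \<bar>dr t 1\<bar>)"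
    using p_pos[of "x1 t"] phi_pos[OF one_in, of "x1 t"] by (simp add: abs_mult)
  also have "... \<le> M * M * (BB t * (BB t * \<theta> * XX t))"
    using GM[OF i] ph M1 p_pos[of "x1 t"] phi_pos[OF one_in, of "x1 t"] Bx_ge(1,2)[of "x1 t"] dr1_bound[OF t] \<theta>0
    by (intro mult_mono) auto
  finally show ?thesis by (simp add: power2_eq_square mult_ac)
qed

lemma card_II: "real (card II) \<le> M" using nM n2 by simp

lemma L2_le_M: "(\<And>i. i \<in> II ==> \<bar>f i\<bar> \<le> c) ==> 0 \<le> c ==> L2_set f II \<le> M * c"
proof -
  assume f: "\<And>i. i \<in> II ==> \<bar>f i\<bar> \<le> c" and c: "0 \<le> c"
  have "L2_set f II \<le> (\<Sum>i\<in>II. \<bar>f i\<bar>)" by (rule L2_set_le_sum_abs)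
  also have "... \<le> real (card II) * c" using f by (rule sum_bounded_above)
  also have "... \<le> M * c" using card_II c by (rule mult_right_mono)
  finally show ?thesis .
qed

text \<open>
  The triangular form of the drift bound is used here: the bound on \<open>\<phi>\<^sub>i\<close> contains \<open>x\<^sub>j\<close> with \<open>j \<le> i\<close> only, so division by
  \<open>r ^ (i-1)\<close> leaves terms that are bounded in \<open>r\<close>.
\<close>

lemma dr_scaled_bound:
  assumes t: "t \<in> HT" and i: "i \<in> {2..<n}"
  shows "\<bar>dr t i\<bar> / rr t ^ (i-1) \<le> BB t * \<theta> * XX t + M * (BB t * (eN t + oN t)) + BB1 t ^ 3 * XX t / rr t"
proof -
  let ?r = "rr t" and ?y = "eN t + oN t"
  have r: "1 \<le> ?r" using ge1(1)[OF t] .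
  have ri: "?r \<le> ?r ^ (i-1)" using r i self_le_power[of ?r "i-1"] by auto
  have y0: "0 \<le> ?y" using eN_nonneg[of t] by simp
  have "(\<Sum>j=2..i. \<bar>xc t j\<bar>) \<le> (\<Sum>j=2..i. ?r^(i-1) * ?y + (if j = 2 then (BB1 t)^2 * XX t else 0))"
  proof (rule sum_mono)
    fix j assume j: "j \<in> {2..i}"
    have "?r^(j-1) * ?y \<le> ?r^(i-1) * ?y" using j r y0 by (intro mult_right_mono power_increasing) auto
    then show "\<bar>xc t j\<bar> \<le> ?r^(i-1) * ?y + (if j = 2 then (BB1 t)^2 * XX t else 0)"
      using xc_bound[OF t, of j] j i by auto
  qed
  also have "... = real (i-1) * (?r^(i-1) * ?y) + (BB1 t)^2 * XX t"
    using i by (simp add: sum.distrib of_nat_diff)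
  also have "... \<le> M * (?r^(i-1) * ?y) + (BB1 t)^2 * XX t"
  proof -
    have "real (i-1) \<le> M" using nM i by simp
    then show ?thesis using r y0 by (intro add_right_mono mult_right_mono) auto
  qed
  finally have S: "(\<Sum>j=2..i. \<bar>xc t j\<bar>) \<le> M * (?r^(i-1) * ?y) + (BB1 t)^2 * XX t" .
  have "\<bar>dr t i\<bar> \<le> BB t * (\<theta> * XX t + (M * (?r^(i-1) * ?y) + (BB1 t)^2 * XX t))"
    by (rule order_trans[OF dr_bound[OF t]]) (use i S BB_ge(1)[of t] in \<open>auto intro!: mult_left_mono\<close>)
  then have "\<bar>dr t i\<bar> / ?r^(i-1) \<le> BB t * (\<theta> * XX t + (M * (?r^(i-1) * ?y) + (BB1 t)^2 * XX t)) / ?r^(i-1)"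
    using r by (intro divide_right_mono) auto
  also have "... = BB t * \<theta> * XX t / ?r^(i-1) + M * (BB t * ?y) + BB t * (BB1 t)^2 * XX t / ?r^(i-1)"
    using r by (simp add: field_simps)
  also have "... \<le> BB t * \<theta> * XX t + M * (BB t * ?y) + BB1 t ^ 3 * XX t / ?r"
  proof (intro add_mono)
    have "BB t * \<theta> * XX t / ?r^(i-1) \<le> BB t * \<theta> * XX t / 1"
      using r \<theta>0 BB_ge(1)[of t] by (intro divide_left_mono) auto
    then show "BB t * \<theta> * XX t / ?r^(i-1) \<le> BB t * \<theta> * XX t" by simp
    have "BB t * (BB1 t)^2 * XX t \<le> BB1 t * (BB1 t)^2 * XX t" using BB_ge[of t] by (intro mult_right_mono) auto
    then show "BB t * (BB1 t)^2 * XX t / ?r^(i-1) \<le> BB1 t ^ 3 * XX t / ?r"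
      using ri r BB_ge[of t] by (intro frac_le) (auto simp: power3_eq_cube power2_eq_square)
  qed simp
  finally show ?thesis .
qed

lemma M_le: "M \<le> M^4" "M^2 \<le> M^4" "M^3 \<le> M^4" "2 * M^3 \<le> M^4" "1 \<le> M^4"
proof -
  show "M \<le> M^4" "M^2 \<le> M^4" "M^3 \<le> M^4" "1 \<le> M^4"
    using M1 self_le_power[of M 4] power_increasing[of 2 4 M] power_increasing[of 3 4 M] by auto
  have "2 * M^3 \<le> M * M^3" using M2 M1 by (intro mult_right_mono) auto
  also have "... = M^4" by (simp add: eval_nat_numeral)
  finally show "2 * M^3 \<le> M^4" .
qed

lemma \<delta>e_bound:
  assumes t: "t \<in> HT"
  shows "L2_set (\<delta>e t) II \<le> M^4 * ((BB t)^2 * \<theta> * XX t + BB t * (eN t + oN t) + BB1 t ^ 3 * XX t / rr t + \<bar>ss t\<bar>)"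
proof -
  let ?r = "rr t" and ?y = "eN t + oN t" and ?a = "(BB t)^2 * \<theta> * XX t"
  let ?b = "BB1 t ^ 3 * XX t / rr t"
  have r: "1 \<le> ?r" using ge1(1)[OF t] .
  have y0: "0 \<le> BB t * ?y" using eN_nonneg[of t] BB_ge(1)[of t] by simp
  have a0: "0 \<le> ?a" "0 \<le> ?b" using \<theta>0 r BB_ge[of t] by auto
  have aB: "BB t * \<theta> * XX t \<le> ?a"
    using \<theta>0 BB_ge(1)[of t] self_le_power[of "BB t" 2] by (intro mult_right_mono) auto
  have Mm: "1 \<le> M^2" using M1 by simp
  have one: "\<bar>\<delta>e t i\<bar> \<le> 2 * M^2 * ?a + M * (BB t * ?y) + ?b + \<bar>ss t\<bar>" if i: "i \<in> II" for i
  proof -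
    have 1: "\<bar>if i < n then dr t i else ss t\<bar> / ?r^(i-1) \<le> ?a + M * (BB t * ?y) + ?b + \<bar>ss t\<bar>"
    proof (cases "i < n")
      case True
      then have i': "i \<in> {2..<n}" using i by simp
      show ?thesis using dr_scaled_bound[OF t i'] aB abs_ge_zero[of "ss t"] unfolding if_P[OF True] by linarith
    next
      case False
      have "\<bar>ss t\<bar> / ?r^(i-1) \<le> \<bar>ss t\<bar> / 1" using r by (intro divide_left_mono) auto
      moreover have "0 \<le> M * (BB t * ?y)" using y0 M1 by simp
      ultimately show ?thesis using False a0 by auto
    qed
    have "\<bar>\<delta>e t i\<bar> \<le> \<bar>G i * p (x1 t) / phi K 1 (x1 t) * dr t 1\<bar> + \<bar>if i < n then dr t i else ss t\<bar> / ?r^(i-1)"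
      unfolding \<delta>e_def using r by (intro order_trans[OF abs_triangle_ineq4]) (simp add: abs_mult)
    moreover have "1 * ?a \<le> M^2 * ?a" using Mm a0 by (intro mult_right_mono) auto
    ultimately show ?thesis using 1 gain_dr_bound[OF t i] by linarith
  qed
  have "L2_set (\<delta>e t) II \<le> M * (2 * M^2 * ?a + M * (BB t * ?y) + ?b + \<bar>ss t\<bar>)"
    by (rule L2_le_M[OF one]) (use a0 y0 M1 in auto)
  also have "... = (2 * M^3) * ?a + M^2 * (BB t * ?y) + M * ?b + M * \<bar>ss t\<bar>"
    by (simp add: algebra_simps power3_eq_cube power2_eq_square)
  also have "... \<le> M^4 * ?a + M^4 * (BB t * ?y) + M^4 * ?b + M^4 * \<bar>ss t\<bar>"
    using M_le a0 y0 by (intro add_mono mult_right_mono) auto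
  finally show ?thesis by (simp add: algebra_simps)
qed

lemma \<delta>w_bound:
  assumes t: "t \<in> HT"
  shows "L2_set (\<delta>w t) II \<le> M^4 * ((BB t)^2 * \<theta> * XX t + (2 * BB1 t ^ 5 * XX t + BB1 t ^ 3 * rr t * (eN t + oN t)
     + BB1 t ^ 3 * \<theta> * XX t) / rr t)"
proof -
  let ?r = "rr t" and ?a = "(BB t)^2 * \<theta> * XX t"
  let ?v = "2 * BB1 t ^ 5 * XX t + BB1 t ^ 3 * rr t * (eN t + oN t) + BB1 t ^ 3 * \<theta> * XX t"
  have r: "1 \<le> ?r" using ge1(1)[OF t] .
  have a0: "0 \<le> ?a" using \<theta>0 by auto
  have v0: "0 \<le> ?v" using vtd_bound[OF t] abs_ge_zero[of "vtd t"] by linarith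
  have one: "\<bar>\<delta>w t i\<bar> \<le> M^2 * ?a + ?v / ?r" if i: "i \<in> II" for i
  proof -
    have "\<bar>\<delta>w t i\<bar> \<le> \<bar>G i * p (x1 t) / phi K 1 (x1 t) * dr t 1\<bar> + \<bar>if i = 2 then vtd t / rr t else 0\<bar>"
      unfolding \<delta>w_def by (rule abs_triangle_ineq)
    moreover have "\<bar>if i = 2 then vtd t / rr t else 0\<bar> \<le> ?v / ?r"
      using vtd_bound[OF t] r v0 by (auto simp: divide_right_mono)
    ultimately show ?thesis using gain_dr_bound[OF t i] by linarith
  qed
  have "L2_set (\<delta>w t) II \<le> M * (M^2 * ?a + ?v / ?r)"
    by (rule L2_le_M[OF one]) (use a0 v0 r M1 in auto)
  also have "... = M^3 * ?a + M * (?v / ?r)" by (simp add: distrib_left power3_eq_cube power2_eq_square)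
  also have "... \<le> M^4 * ?a + M^4 * (?v / ?r)"
    using M_le a0 v0 r by (intro add_mono mult_right_mono) auto
  finally show ?thesis by (simp add: distrib_left)
qed

lemma L2G: "L2_set G II \<le> M^2" "L2_set \<kappa> II \<le> M^2"
  using L2_le_M[of G M] L2_le_M[of \<kappa> M] GM \<kappa>M M1 by (auto simp: power2_eq_square)

definition "NN t = tth t * phi K 1 (x1 t) * v1 (x1 t) * (x1 t)^2"

definition "coreV t = (x1 t)^2 / 2 + M^8 * (rr t * Bo (ep t) (ep t)) + rr t * Bc (om t) (om t)"

lemma core_deriv:
  assumes t: "t \<in> HT" "0 < t"
  shows "\<exists>D. (coreV has_real_derivative D) (at t) \<and> D \<le> - (1 / (2 * M^2)) * (rr t)^2 * ZZ t
     + 100 * M^28 * BB1 t ^10 * rr t * ZZ t + 100 * M^28 * BB t ^4 * (1 + \<theta>^2) * (XX t)^2 + 100 * M^28 * (ss t)^2 - NN t"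
proof -
  note d = deriv_at[OF t]
  have r: "1 \<le> rr t" using ge1(1)[OF t(1)] .
  obtain Do where Do: "((\<lambda>t. rr t * Bo (ep t) (ep t)) has_real_derivative Do) (at t)"
    "Do \<le> - (2 / M) * (rr t)^2 * p (x1 t) * (L2_set (ep t) II)^2 + 2 * M * rr t * L2_set (ep t) II * L2_set (\<delta>e t) II"
    using form_scaled_derivative[OF Bo Bo_hi Bo_D Bo_neg d(1) rd_nonneg(1) r p_pos ep_deriv[OF t]] by blast
  define \<delta> where "\<delta> i = - (rr t * p (x1 t) * ep t 2) * G i + \<delta>w t i" for i
  have od: "((\<lambda>s. om s i) has_real_derivative
    rr t * p (x1 t) * fb_op n (\<lambda>i. phi K i (x1 t) / p (x1 t)) (bh (x1 t) / p (x1 t)) \<kappa> (om t) i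
    + \<delta> i - real (i-1) * (rd t / rr t) * om t i) (at t)" if "i \<in> II" for i
    unfolding \<delta>_def by (rule om_deriv[OF t that])
  obtain Dc where Dc: "((\<lambda>t. rr t * Bc (om t) (om t)) has_real_derivative Dc) (at t)"
    "Dc \<le> - (2 / M) * (rr t)^2 * p (x1 t) * (L2_set (om t) II)^2 + 2 * M * rr t * L2_set (om t) II * L2_set \<delta> II"
    using form_scaled_derivative[OF Bc Bc_hi Bc_D Bc_neg d(1) rd_nonneg(1) r p_pos od] by blast
  have \<delta>le: "L2_set \<delta> II \<le> M^2 * rr t * p (x1 t) * eN t + L2_set (\<delta>w t) II"
  proof -
    have "L2_set \<delta> II \<le> L2_set (\<lambda>i. - (rr t * p (x1 t) * ep t 2) * G i) II + L2_set (\<delta>w t) II"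
      unfolding \<delta>_def by (rule L2_set_triangle_ineq)
    also have "L2_set (\<lambda>i. - (rr t * p (x1 t) * ep t 2) * G i) II = rr t * p (x1 t) * \<bar>ep t 2\<bar> * L2_set G II"
      unfolding L2_set_scale using r p_pos[of "x1 t"] by (simp add: abs_mult)
    also have "... \<le> rr t * p (x1 t) * eN t * M^2"
      using r p_pos[of "x1 t"] ep_om_abs(1)[of 2 t] n2 L2G(1) eN_nonneg[of t] by (intro mult_mono mult_left_mono) auto
    finally show ?thesis by (simp add: mult_ac)
  qed
  have Dc': "Dc \<le> - (2 / M) * (rr t)^2 * p (x1 t) * (oN t)^2 + 2 * M * rr t * oN t * (M^2 * rr t * p (x1 t) * eN t + L2_set (\<delta>w t) II)"
    by (rule order_trans[OF Dc(2)], unfold oN_def[symmetric], rule add_left_mono, rule mult_left_mono[OF \<delta>le])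
       (use r M1 eN_nonneg[of t] in auto)
  define Dx where "Dx = x1 t * xd t 1"
  have Dx: "((\<lambda>t. (x1 t)^2 / 2) has_real_derivative Dx) (at t)"
    using DERIV_cdivide[OF DERIV_power[OF d(5), of 2], of 2] by (simp add: Dx_def mult_ac)
  have Dxle: "Dx \<le> - NN t + BB t * rr t * XX t * (eN t + oN t) + BB t * \<theta> * (XX t)^2"
  proof -
    have "xc t 2 = rr t * (om t 2 - ep t 2) - vt t"
      using xc_eq[OF t(1), of 2] zc_eq[OF t(1), of 2] n2 by (simp add: algebra_simps)
    then have "Dx = - NN t + phi K 1 (x1 t) * rr t * (x1 t * (om t 2 - ep t 2)) + x1 t * dr t 1"
      unfolding Dx_def xd1 vt_def NN_def by algebra
    moreover have "phi K 1 (x1 t) * rr t * (x1 t * (om t 2 - ep t 2)) \<le> BB t * rr t * (XX t * (eN t + oN t))"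
    proof -
      have "x1 t * (om t 2 - ep t 2) \<le> XX t * \<bar>om t 2 - ep t 2\<bar>" by (metis abs_ge_self abs_mult)
      also have "... \<le> XX t * (eN t + oN t)" using ep_om_abs[of 2 t] n2 by (intro mult_left_mono) auto
      finally have "phi K 1 (x1 t) * rr t * (x1 t * (om t 2 - ep t 2)) \<le> phi K 1 (x1 t) * rr t * (XX t * (eN t + oN t))"
        using phi_pos[OF one_in, of "x1 t"] r by (intro mult_left_mono) auto
      also have "... \<le> BB t * rr t * (XX t * (eN t + oN t))"
        using Bx_ge(3)[OF one_in, of "x1 t"] r eN_nonneg[of t] by (intro mult_right_mono) auto
      finally show ?thesis .
    qed
    moreover have "x1 t * dr t 1 \<le> XX t * (BB t * \<theta> * XX t)"
    proof -
      have "x1 t * dr t 1 \<le> XX t * \<bar>dr t 1\<bar>" by (metis abs_ge_self abs_mult)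
      also have "... \<le> XX t * (BB t * \<theta> * XX t)" by (intro mult_left_mono dr1_bound t) auto
      finally show ?thesis .
    qed
    ultimately show ?thesis by (simp add: power2_eq_square mult_ac)
  qed
  have "(coreV has_real_derivative Dx + M^8 * Do + Dc) (at t)"
    unfolding coreV_def[abs_def] by (intro DERIV_add DERIV_cmult Dx Do(1) Dc(1))
  moreover have "Dx + M^8 * Do + Dc \<le> - (1 / (2 * M^2)) * (rr t)^2 * ((eN t)^2 + (oN t)^2)
     + 100 * M^28 * BB1 t ^10 * rr t * ((eN t)^2 + (oN t)^2) + 100 * M^28 * BB t ^4 * (1 + \<theta>^2) * (XX t)^2
     + 100 * M^28 * (ss t)^2 - NN t"
    by (rule core_estimate[OF M1 r BB_ge(1,2) p_lo eN_nonneg abs_ge_zero \<theta>0 Do(2)[folded eN_def] Dc'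
          \<delta>e_bound[OF t(1)] \<delta>w_bound[OF t(1)] Dxle])
  ultimately show ?thesis unfolding ZZ_def by blast
qed

text \<open>
  This inequality is what \<open>v1\<close> was chosen for.
\<close>

lemma NN_ge: "t \<in> HT ==> tth t * q (x1 t) * (XX t)^2 \<le> NN t"
proof -
  assume t: "t \<in> HT"
  have "tth t * q (x1 t) * (x1 t)^2 \<le> tth t * (phi K 1 (x1 t) * v1 (x1 t)) * (x1 t)^2"
    using ge1(3)[OF t] by (intro mult_right_mono mult_left_mono v1(4)) auto
  then show ?thesis by (simp add: NN_def mult.assoc)
qed

text \<open>
  This and \<open>mu_bound\<close> explain the weight \<open>1 / r ^ (2n)\<close> of \<open>V(\<psi>)\<close>.
\<close>

lemma Sq_bound:
  assumes t: "t \<in> HT"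
  shows "1 / rr t ^ (2*n) * Sq t \<le> 3 * ZZ t + 3 * BB1 t ^ 4 * (XX t)^2 / rr t"
proof -
  let ?r = "rr t"
  have r: "1 \<le> ?r" using ge1(1)[OF t] .
  define b where "b = BB1 t ^ 4 * (XX t)^2"
  have one: "(xc t j)^2 \<le> 3 * ?r^(2*n-2) * ((ep t j)^2 + (om t j)^2) + (if j = 2 then 3 * b else 0)" if j: "j \<in> II" for j
  proof -
    let ?v = "if j = 2 then vt t else 0" and ?R = "?r^(j-1)"
    have e: "xc t j = ?R * om t j - ?R * ep t j - ?v"
      using xc_eq[OF t, of j] zc_eq[OF t j] by (simp add: algebra_simps)
    have "(xc t j)^2 \<le> 3 * ((?R * om t j)^2 + (?R * ep t j)^2 + ?v^2)"
    proof -
      have "(a - b - c)^2 \<le> 3 * (a^2 + b^2 + c^2)" for a b c :: real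
        using zero_le_power2[of "a + b"] zero_le_power2[of "a + c"] zero_le_power2[of "b - c"]
        by (simp add: power2_eq_square algebra_simps)
      then show ?thesis unfolding e .
    qed
    also have "... = 3 * (?R^2 * ((ep t j)^2 + (om t j)^2)) + 3 * ?v^2" by (simp add: power_mult_distrib algebra_simps)
    also have "... \<le> 3 * (?r^(2*n-2) * ((ep t j)^2 + (om t j)^2)) + (if j = 2 then 3 * b else 0)"
    proof (intro add_mono mult_left_mono mult_right_mono)
      have "?R^2 = ?r^(2*(j-1))" by (simp add: power_mult[symmetric] mult.commute)
      also have "... \<le> ?r^(2*n-2)" using r j by (intro power_increasing) auto
      finally show "?R^2 \<le> ?r^(2*n-2)" .
      have "(vt t)^2 \<le> ((BB1 t)^2 * XX t)^2" using power_mono[OF vt_bound[OF t], of 2] by simp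
      then show "3 * ?v^2 \<le> (if j = 2 then 3 * b else 0)" by (simp add: b_def power_mult_distrib flip: power_mult)
    qed auto
    finally show ?thesis by simp
  qed
  have "Sq t \<le> (\<Sum>j\<in>II. 3 * ?r^(2*n-2) * ((ep t j)^2 + (om t j)^2) + (if j = 2 then 3 * b else 0))"
    unfolding Sq_def by (rule sum_mono[OF one])
  also have "... = 3 * ?r^(2*n-2) * ZZ t + 3 * b"
    using n2 by (simp add: sum.distrib sum_distrib_left[symmetric] ZZ_def eN_def oN_def L2_set_sq)
  finally have "1 / ?r^(2*n) * Sq t \<le> 1 / ?r^(2*n) * (3 * ?r^(2*n-2) * ZZ t + 3 * b)" using r by (intro mult_left_mono) auto
  also have "... = (?r^(2*n-2) / ?r^(2*n)) * (3 * ZZ t) + 3 * (b / ?r^(2*n))" by (simp add: distrib_left)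
  also have "... \<le> 1 * (3 * ZZ t) + 3 * (b / ?r)"
  proof (intro add_mono mult_right_mono mult_left_mono)
    show "?r^(2*n-2) / ?r^(2*n) \<le> 1" using r by (simp add: divide_le_eq_1 power_increasing)
    show "b / ?r^(2*n) \<le> b / ?r" using r n2 self_le_power[of ?r "2*n"] by (intro divide_left_mono) (auto simp: b_def)
  qed (use ZZ_nonneg in auto)
  finally show ?thesis by (simp add: b_def)
qed

lemma ut_abs: "t \<in> HT ==> \<bar>ut t\<bar> \<le> rr t ^ n * (BB1 t * (M^2 * oN t))"
proof -
  assume t: "t \<in> HT"
  have "\<bar>\<Sum>i=2..n. \<kappa> i * om t i\<bar> \<le> L2_set \<kappa> II * L2_set (om t) II" by (rule abs_sum_mult_le_L2)
  also have "... \<le> M^2 * oN t" unfolding oN_def by (intro mult_right_mono L2G) auto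
  finally have 1: "\<bar>\<Sum>i=2..n. \<kappa> i * om t i\<bar> \<le> M^2 * oN t" .
  have "\<bar>ut t\<bar> = rr t ^ n * (bh (x1 t) * \<bar>\<Sum>i=2..n. \<kappa> i * om t i\<bar>)"
    unfolding ut_eq using ge1(1)[OF t] bh(3) by (simp add: abs_mult)
  also have "... \<le> rr t ^ n * (BB1 t * (M^2 * oN t))"
    using ge1(1)[OF t] bh(3) 1 B1_ge(4)[of "x1 t" "tth t"] BB_ge(3)[of t] by (intro mult_left_mono mult_mono) auto
  finally show ?thesis .
qed

lemma mu_bound:
  assumes t: "t \<in> HT"
  shows "1 / rr t ^ (2*n) * (muc t)^2 \<le> 2 * (ss t)^2 + 2 * M^4 * (BB1 t)^2 * ZZ t"
proof -
  let ?R = "rr t ^ (2*n)"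
  have r: "1 \<le> rr t" using ge1(1)[OF t] .
  have R: "1 \<le> ?R" using r by simp
  have "(ut t)^2 \<le> (rr t ^ n * (BB1 t * (M^2 * oN t)))^2" using power_mono[OF ut_abs[OF t], of 2] by simp
  also have "... = ?R * (M^4 * (BB1 t)^2 * (oN t)^2)" by (simp add: power_mult_distrib mult_ac flip: power_mult)
  also have "... \<le> ?R * (M^4 * (BB1 t)^2 * ZZ t)" using r M1 by (intro mult_left_mono) (auto simp: ZZ_def)
  finally have u: "1 / ?R * (ut t)^2 \<le> M^4 * (BB1 t)^2 * ZZ t" using R by (simp add: field_simps)
  have "(muc t)^2 \<le> 2 * (ss t)^2 + 2 * (ut t)^2"
    using sum_squares_bound[of "ss t" "ut t"] by (simp add: ss_def power2_diff) (simp add: power2_eq_square algebra_simps)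
  then have "1 / ?R * (muc t)^2 \<le> 1 / ?R * (2 * (ss t)^2 + 2 * (ut t)^2)" using R by (intro mult_left_mono) auto
  also have "... \<le> 1 * (2 * (ss t)^2) + 2 * (1 / ?R * (ut t)^2)"
  proof -
    have "1 / ?R * (2 * (ss t)^2) \<le> 1 * (2 * (ss t)^2)" using R by (intro mult_right_mono) auto
    then show ?thesis by (simp add: distrib_left)
  qed
  finally show ?thesis using u by simp
qed

end

section \<open>The input tracking error\<close>

lemma has_vector_derivative_vec:
  fixes f :: "real => real ^ 'n::finite"
  assumes "\<And>j. ((\<lambda>s. f s $ j) has_real_derivative f' $ j) (at t within S)"
  shows "(f has_vector_derivative f') (at t within S)"
  unfolding has_vector_derivative_def
proof (subst has_derivative_componentwise_within, rule ballI)
  fix b :: "real ^ 'n" assume "b \<in> Basis"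
  then obtain j where b: "b = axis j 1" by (auto simp: Basis_vec_def)
  show "((\<lambda>x. f x \<bullet> b) has_derivative (\<lambda>x. x *\<^sub>R f' \<bullet> b)) (at t within S)"
  proof -
    have "(\<lambda>x. f x \<bullet> b) = (\<lambda>x. f x $ j)" "(\<lambda>x. x *\<^sub>R f' \<bullet> b) = (\<lambda>x. f' $ j * x)"
      by (auto simp: b inner_axis)
    then show ?thesis using assms[of j] unfolding has_field_derivative_def by simp
  qed
qed

context loop begin

lemma HT_nbhd:
  assumes t: "t \<in> HT" "0 < t"
  obtains t' where "t < t'" "t \<in> {0<..<t'}" "{0<..<t'} \<subseteq> HT"
proof -
  obtain t' where t': "t < t'" "t' \<in> HT" using HT_open_right[OF t(1)] by blast
  have "{0<..<t'} \<subseteq> HT" using horizon_sub[OF t'(2)] by auto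
  then show ?thesis using that[of t'] t t' by simp
qed

lemma BB2_le: "\<bar>rr t\<bar> \<le> BB2 t" "\<bar>rd t\<bar> \<le> BB2 t" "mu_bar K (yy t) (uu t) \<le> BB2 t" "mu1_bar K (yy t) (uu t) \<le> BB2 t"
  "mu1_tilde K (yy t) (uu t) \<le> BB2 t" "mu2_bar K (yy t) (uu t) \<le> BB2 t" "oN t \<le> BB2 t"
  using B2_ge[where y="yy t" and th="tth t" and u="uu t" and r="rr t" and rd="rd t" and w="vp t"]
  by (auto simp: oN_def om_def[abs_def] norm_jx[symmetric])

lemma Q1:
  assumes t: "t \<in> HT"
  shows "\<theta> * XX t + Sx t \<le> 3 * M * BB2 t ^ n * YY t"
proof -
  let ?r = "rr t" and ?b = "BB2 t" and ?y = "eN t + oN t"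
  have r: "1 \<le> ?r" "?r \<le> ?b" using ge1(1)[OF t] BB2_le(1)[of t] by auto
  have b: "1 \<le> ?b" by (rule BB_ge)
  have y: "0 \<le> ?y" using eN_nonneg[of t] by simp
  have "Sx t \<le> (\<Sum>j=2..n. ?r^(n-1) * ?y + (if j = 2 then (BB1 t)^2 * XX t else 0))"
    unfolding Sx_def
  proof (rule sum_mono)
    fix j assume j: "j \<in> II"
    have "?r^(j-1) * ?y \<le> ?r^(n-1) * ?y" using j r y by (intro mult_right_mono power_increasing) auto
    then show "\<bar>xc t j\<bar> \<le> ?r^(n-1) * ?y + (if j = 2 then (BB1 t)^2 * XX t else 0)"
      using xc_bound[OF t j] by linarith
  qed
  also have "... = real (card II) * (?r^(n-1) * ?y) + (BB1 t)^2 * XX t"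
    using n2 by (simp add: sum.distrib)
  also have "... \<le> M * (?b^n * YY t) + ?b^n * YY t"
  proof (intro add_mono mult_mono card_II)
    have "?r^(n-1) \<le> ?b^(n-1)" using r by (intro power_mono) auto
    also have "... \<le> ?b^n" using b by (intro power_increasing) auto
    finally show "?r^(n-1) \<le> ?b^n" .
    have "(BB1 t)^2 \<le> ?b^2" using BB_ge[of t] by (intro power_mono) auto
    also have "... \<le> ?b^n" using b n2 by (intro power_increasing) auto
    finally show "(BB1 t)^2 \<le> ?b^n" .
  qed (use M1 y r b YY_props[of t] in auto)
  finally have 1: "Sx t \<le> (M + 1) * (?b^n * YY t)" by (simp add: distrib_right)
  have "1 * YY t \<le> ?b^n * YY t" using b YY_props(1)[of t] by (intro mult_right_mono one_le_power) auto
  then have "\<theta> * XX t + Sx t \<le> (M + 2) * (?b^n * YY t)" using 1 YY_props(2)[of t] by (simp add: distrib_right)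
  also have "... \<le> (3 * M) * (?b^n * YY t)" using M1 b YY_props(1)[of t] by (intro mult_right_mono) auto
  finally show ?thesis by (simp add: mult.assoc)
qed

definition "omd t i = rr t * p (x1 t) * fb_op n (\<lambda>i. phi K i (x1 t) / p (x1 t)) (bh (x1 t) / p (x1 t)) \<kappa> (om t) i
    + (- (rr t * p (x1 t) * ep t 2) * G i + \<delta>w t i) - real (i-1) * (rd t / rr t) * om t i"

lemma kom_bound: "\<bar>\<Sum>i=2..n. \<kappa> i * om t i\<bar> \<le> M^2 * oN t"
proof -
  have "\<bar>\<Sum>i=2..n. \<kappa> i * om t i\<bar> \<le> L2_set \<kappa> II * L2_set (om t) II" by (rule abs_sum_mult_le_L2)
  also have "... \<le> M^2 * oN t" unfolding oN_def by (intro mult_right_mono L2G) auto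
  finally show ?thesis .
qed

lemma bpow: "k \<le> l ==> BB2 t ^ k \<le> BB2 t ^ l"
  using BB_ge(5)[of t] by (rule power_increasing[rotated])

lemma BB1_pow: "BB1 t ^ k \<le> BB2 t ^ k" using BB_ge[of t] by (intro power_mono) auto

lemma omd_bound:
  assumes t: "t \<in> HT" and i: "i \<in> II"
  shows "\<bar>omd t i\<bar> \<le> 8 * M^4 * BB2 t ^ 5 * YY t"
proof -
  let ?r = "rr t" and ?b = "BB2 t" and ?Y = "YY t" and ?p = "p (x1 t)"
  have r: "1 \<le> ?r" "?r \<le> ?b" using ge1(1)[OF t] BB2_le(1)[of t] by auto
  have b: "1 \<le> ?b" by (rule BB_ge)
  have Y0: "0 \<le> ?Y" by (rule YY_props)
  have p: "0 < ?p" "?p \<le> ?b" using p_pos[of "x1 t"] Bx_ge(2)[of "x1 t"] BB_ge(6)[of t] by auto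
  have o: "0 \<le> oN t" "oN t \<le> ?Y" "eN t \<le> ?Y" "0 \<le> eN t" using eN_nonneg YY_props by auto
  have M4: "M^2 \<le> M^4" "M \<le> M^4" by (rule M_le)+
  have b5: "?b * ?b \<le> ?b^5" "?b \<le> ?b^5" using bpow[of 2 5] bpow[of 1 5] by (auto simp: power2_eq_square)
  have P0: "0 \<le> ?b * ?b * ?Y" "0 \<le> ?b^5 * ?Y" using b Y0 by auto
  have f: "\<bar>?p * fb_op n (\<lambda>i. phi K i (x1 t) / ?p) (bh (x1 t) / ?p) \<kappa> (om t) i\<bar> \<le> ?b * (M^2 * ?Y)"
  proof (cases "i < n")
    case True
    have i1: "i \<in> {1..n-1}" "i + 1 \<in> II" using i True by auto
    have "\<bar>?p * fb_op n (\<lambda>i. phi K i (x1 t) / ?p) (bh (x1 t) / ?p) \<kappa> (om t) i\<bar> = phi K i (x1 t) * \<bar>om t (i+1)\<bar>"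
      using True p phi_pos[OF i1(1), of "x1 t"] by (simp add: fb_op_def abs_mult)
    also have "... \<le> ?b * (1 * ?Y)"
      using Bx_ge(3)[OF i1(1), of "x1 t"] BB_ge(6)[of t] ep_om_abs(2)[OF i1(2), of t] o phi_pos[OF i1(1), of "x1 t"] b Y0
      by (intro mult_mono) auto
    also have "... \<le> ?b * (M^2 * ?Y)" using M1 b Y0 by (intro mult_left_mono mult_right_mono) auto
    finally show ?thesis .
  next
    case False
    have "\<bar>?p * fb_op n (\<lambda>i. phi K i (x1 t) / ?p) (bh (x1 t) / ?p) \<kappa> (om t) i\<bar> = bh (x1 t) * \<bar>\<Sum>i=2..n. \<kappa> i * om t i\<bar>"
      using False p bh(3)[of "x1 t"] by (simp add: fb_op_def abs_mult)
    also have "... \<le> ?b * (M^2 * ?Y)"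
      using B1_ge(4)[of "x1 t" "tth t"] BB_ge(4)[of t] bh(3)[of "x1 t"] b
      by (intro mult_mono order_trans[OF kom_bound] mult_left_mono o) auto
    finally show ?thesis .
  qed
  have 1: "\<bar>?r * ?p * fb_op n (\<lambda>i. phi K i (x1 t) / ?p) (bh (x1 t) / ?p) \<kappa> (om t) i\<bar> \<le> M^4 * (?b^5 * ?Y)"
  proof -
    have "\<bar>?r * ?p * fb_op n (\<lambda>i. phi K i (x1 t) / ?p) (bh (x1 t) / ?p) \<kappa> (om t) i\<bar>
        = ?r * \<bar>?p * fb_op n (\<lambda>i. phi K i (x1 t) / ?p) (bh (x1 t) / ?p) \<kappa> (om t) i\<bar>"
      using r by (simp add: abs_mult mult.assoc)
    also have "... \<le> ?b * (?b * (M^2 * ?Y))" using r f by (intro mult_mono) auto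
    also have "... = M^2 * (?b * ?b * ?Y)" by simp
    also have "... \<le> M^4 * (?b^5 * ?Y)" using M4 b5 M1 P0 Y0 by (intro mult_mono mult_right_mono) auto
    finally show ?thesis .
  qed
  have 2: "\<bar>- (?r * ?p * ep t 2) * G i\<bar> \<le> M^4 * (?b^5 * ?Y)"
  proof -
    have "\<bar>- (?r * ?p * ep t 2) * G i\<bar> = ?r * ?p * \<bar>ep t 2\<bar> * \<bar>G i\<bar>" using r p by (simp add: abs_mult)
    also have "... \<le> ?b * ?b * ?Y * M"
      using r p GM[OF i] ep_om_abs(1)[of 2 t] n2 o b Y0 by (intro mult_mono) auto
    also have "... = M * (?b * ?b * ?Y)" by simp
    also have "... \<le> M^4 * (?b^5 * ?Y)" using M4 b5 M1 P0 Y0 by (intro mult_mono mult_right_mono) auto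
    finally show ?thesis .
  qed
  have 3: "\<bar>\<delta>w t i\<bar> \<le> 5 * (M^4 * (?b^5 * ?Y))"
  proof -
    have "\<bar>\<delta>w t i\<bar> \<le> L2_set (\<delta>w t) II" using i by (intro abs_le_L2_set) auto
    also have "... \<le> M^4 * ((BB t)^2 * \<theta> * XX t + (2 * BB1 t ^ 5 * XX t + BB1 t ^ 3 * rr t * (eN t + oN t)
     + BB1 t ^ 3 * \<theta> * XX t) / rr t)" by (rule \<delta>w_bound[OF t])
    also have "... \<le> M^4 * (5 * (?b^5 * ?Y))"
    proof (rule mult_left_mono)
      have a1: "(BB t)^2 * \<theta> * XX t \<le> ?b^5 * ?Y"
      proof -
        have "(BB t)^2 \<le> ?b^2" using BB_ge[of t] by (intro power_mono) auto
        also have "... \<le> ?b^5" by (rule bpow) simp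
        finally have "(BB t)^2 * (\<theta> * XX t) \<le> ?b^5 * ?Y" using YY_props[of t] \<theta>0 b by (intro mult_mono) auto
        then show ?thesis by (simp add: mult.assoc)
      qed
      have b3: "BB1 t ^ 3 \<le> ?b^5" using BB1_pow[of t 3] bpow[of 3 5 t] by linarith
      have "(2 * BB1 t ^ 5 * XX t + BB1 t ^ 3 * rr t * (eN t + oN t) + BB1 t ^ 3 * \<theta> * XX t) / rr t
          = 2 * (BB1 t ^ 5 * XX t) / ?r + BB1 t ^ 3 * (eN t + oN t) + BB1 t ^ 3 * (\<theta> * XX t) / ?r"
        using r by (simp add: field_simps)
      also have "... \<le> 2 * (?b^5 * ?Y) + ?b^5 * ?Y + ?b^5 * ?Y"
      proof (intro add_mono)
        have "2 * (BB1 t ^ 5 * XX t) / ?r \<le> 2 * (BB1 t ^ 5 * XX t) / 1" using r BB0(2)[of t] by (intro divide_left_mono) auto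
        also have "... \<le> 2 * (?b^5 * ?Y)" using BB1_pow[of t 5] YY_props[of t] b by (simp add: mult_mono)
        finally show "2 * (BB1 t ^ 5 * XX t) / ?r \<le> 2 * (?b^5 * ?Y)" .
        show "BB1 t ^ 3 * (eN t + oN t) \<le> ?b^5 * ?Y" using b3 YY_props[of t] o b by (intro mult_mono) auto
        have "BB1 t ^ 3 * (\<theta> * XX t) / ?r \<le> BB1 t ^ 3 * (\<theta> * XX t) / 1" using r BB0(2)[of t] \<theta>0 by (intro divide_left_mono) auto
        also have "... \<le> ?b^5 * ?Y" using b3 YY_props[of t] \<theta>0 b by (simp add: mult_mono)
        finally show "BB1 t ^ 3 * (\<theta> * XX t) / ?r \<le> ?b^5 * ?Y" .
      qed
      finally show "(BB t)^2 * \<theta> * XX t + (2 * BB1 t ^ 5 * XX t + BB1 t ^ 3 * rr t * (eN t + oN t)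
         + BB1 t ^ 3 * \<theta> * XX t) / rr t \<le> 5 * (?b^5 * ?Y)" using a1 by linarith
    qed (use M1 in auto)
    finally show ?thesis by (simp add: mult_ac)
  qed
  have 4: "\<bar>real (i-1) * (rd t / ?r) * om t i\<bar> \<le> M^4 * (?b^5 * ?Y)"
  proof -
    have "\<bar>rd t\<bar> / ?r \<le> ?b / 1" using BB2_le(2)[of t] r by (intro frac_le) auto
    moreover have "real (i-1) \<le> M" using i nM by simp
    ultimately have "real (i-1) * (\<bar>rd t\<bar> / ?r) * \<bar>om t i\<bar> \<le> M * ?b * ?Y"
      using ep_om_abs(2)[OF i, of t] o r M1 b by (intro mult_mono) auto
    also have "... = M * (?b * ?Y)" by simp
    also have "... \<le> M^4 * (?b^5 * ?Y)" using M4 b5 M1 b Y0 by (intro mult_mono mult_right_mono) auto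
    finally show ?thesis using r by (simp add: abs_mult)
  qed
  have "\<bar>omd t i\<bar> \<le> \<bar>?r * ?p * fb_op n (\<lambda>i. phi K i (x1 t) / ?p) (bh (x1 t) / ?p) \<kappa> (om t) i\<bar>
     + (\<bar>- (?r * ?p * ep t 2) * G i\<bar> + \<bar>\<delta>w t i\<bar>) + \<bar>real (i-1) * (rd t / ?r) * om t i\<bar>"
  proof -
    have g: "\<bar>a + (b + c) - d\<bar> \<le> \<bar>a\<bar> + (\<bar>b\<bar> + \<bar>c\<bar>) + \<bar>d\<bar>" for a b c d :: real by linarith
    show ?thesis unfolding omd_def by (rule g)
  qed
  also have "... \<le> 8 * (M^4 * (?b^5 * ?Y))" using 1 2 3 4 by linarith
  finally show ?thesis by (simp add: mult.assoc)
qed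

definition "utd t = - (real n * (rd t * rr t ^ (n-1))) * (bh (x1 t) * (\<Sum>i=2..n. \<kappa> i * om t i))
   + - (rr t ^ n) * (bh' (x1 t) * xd t 1 * (\<Sum>i=2..n. \<kappa> i * om t i) + bh (x1 t) * (\<Sum>i=2..n. \<kappa> i * omd t i))"

lemma ut_deriv:
  assumes t: "t \<in> HT" "0 < t"
  shows "(ut has_real_derivative utd t) (at t)"
proof -
  note d = deriv_at[OF t]
  have a: "((\<lambda>s. \<Sum>i=2..n. \<kappa> i * om s i) has_real_derivative (\<Sum>i=2..n. \<kappa> i * omd t i)) (at t)"
    unfolding omd_def by (intro DERIV_sum DERIV_cmult om_deriv[OF t])
  have b: "((\<lambda>s. bh (x1 s)) has_real_derivative bh' (x1 t) * xd t 1) (at t)" by (rule DERIV_chain2[OF bh(1) d(5)])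
  have c: "((\<lambda>s. - (rr s ^ n)) has_real_derivative - (real n * (rd t * rr t ^ (n-1)))) (at t)"
    using DERIV_minus[OF DERIV_power[OF d(1), of n]] by simp
  have "((\<lambda>s. - (rr s ^ n) * (bh (x1 s) * (\<Sum>i=2..n. \<kappa> i * om s i))) has_real_derivative utd t) (at t)"
    by (rule DERIV_cong[OF DERIV_mult[OF c DERIV_mult[OF b a]]]) (simp add: utd_def algebra_simps)
  then show ?thesis by (simp add: ut_eq[abs_def])
qed

lemma utd_bound:
  assumes t: "t \<in> HT"
  shows "\<bar>utd t\<bar> \<le> 12 * M^6 * BB2 t ^ (n+6) * YY t"
proof -
  let ?r = "rr t" and ?b = "BB2 t" and ?Y = "YY t"
  let ?a = "\<Sum>i=2..n. \<kappa> i * om t i" and ?a' = "\<Sum>i=2..n. \<kappa> i * omd t i"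
  have r: "1 \<le> ?r" "?r \<le> ?b" using ge1(1)[OF t] BB2_le(1)[of t] by auto
  have b: "1 \<le> ?b" by (rule BB_ge)
  have Y0: "0 \<le> ?Y" by (rule YY_props)
  have o: "0 \<le> oN t" "oN t \<le> ?Y" "oN t \<le> ?b" using eN_nonneg YY_props BB2_le by auto
  have h: "0 \<le> bh (x1 t)" "bh (x1 t) \<le> ?b" "\<bar>bh' (x1 t)\<bar> \<le> ?b"
    using bh(3)[of "x1 t"] B1_ge(4,5)[of "x1 t" "tth t"] BB_ge(4)[of t] by auto
  have M6: "M^3 \<le> M^6" "M^2 \<le> M^6" using M1 by (auto intro: power_increasing)
  have rn: "?r^(n-1) \<le> ?b^(n-1)" "?r^n \<le> ?b^n" using r by (auto intro: power_mono)
  have 1: "\<bar>- (real n * (rd t * ?r ^ (n-1))) * (bh (x1 t) * ?a)\<bar> \<le> M^6 * (?b^(n+6) * ?Y)"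
  proof -
    have "\<bar>- (real n * (rd t * ?r ^ (n-1))) * (bh (x1 t) * ?a)\<bar> = real n * (\<bar>rd t\<bar> * ?r^(n-1)) * (bh (x1 t) * \<bar>?a\<bar>)"
      using r h by (simp add: abs_mult)
    also have "... \<le> M * (?b * ?b^(n-1)) * (?b * (M^2 * ?Y))"
    proof (intro mult_mono)
      show "\<bar>?a\<bar> \<le> M^2 * ?Y" using kom_bound[of t] mult_left_mono[OF o(2), of "M^2"] by simp
    qed (use nM BB2_le(2)[of t] rn h r b M1 Y0 in auto)
    also have "... = M^3 * ((?b * ?b^(n-1) * ?b) * ?Y)" by (simp add: power3_eq_cube power2_eq_square)
    also have "?b * ?b^(n-1) * ?b = ?b^(n+1)" using n2 by (simp add: power_eq_if[of _ n])
    also have "M^3 * (?b^(n+1) * ?Y) \<le> M^6 * (?b^(n+6) * ?Y)"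
      using M6 M1 b Y0 by (intro mult_mono mult_right_mono bpow) auto
    finally show ?thesis .
  qed
  have x: "\<bar>xd t 1\<bar> \<le> 3 * (?b^4 * ?Y)"
  proof -
    have y0: "0 \<le> eN t + oN t" using eN_nonneg[of t] by simp
    have "BB1 t * (?r * (eN t + oN t)) \<le> ?b^1 * (?b * ?Y)"
      using BB_ge[of t] r y0 YY_props[of t] b by (intro mult_mono) auto
    also have "... = ?b^2 * ?Y" by (simp add: power2_eq_square)
    also have "... \<le> ?b^4 * ?Y" using Y0 by (intro mult_right_mono bpow) auto
    finally have a: "BB1 t * (?r * (eN t + oN t)) \<le> ?b^4 * ?Y" .
    have "BB1 t ^ 3 \<le> ?b^4" using BB1_pow[of t 3] bpow[of 3 4 t] by linarith
    then have c: "BB1 t ^ 3 * XX t \<le> ?b^4 * ?Y" using YY_props[of t] b by (intro mult_mono) auto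
    have "BB1 t \<le> ?b^4" using BB1_pow[of t 1] bpow[of 1 4 t] by simp
    then have "BB1 t * (\<theta> * XX t) \<le> ?b^4 * ?Y" using YY_props[of t] b \<theta>0 by (intro mult_mono) auto
    then show ?thesis using xd1_bound[OF t] a c by (simp add: mult.assoc)
  qed
  have 2: "\<bar>bh' (x1 t) * xd t 1 * ?a\<bar> \<le> 3 * (M^6 * (?b^6 * ?Y))"
  proof -
    have "\<bar>bh' (x1 t) * xd t 1 * ?a\<bar> = \<bar>bh' (x1 t)\<bar> * \<bar>xd t 1\<bar> * \<bar>?a\<bar>" by (simp add: abs_mult)
    also have "... \<le> ?b * (3 * (?b^4 * ?Y)) * (M^2 * ?b)"
    proof (intro mult_mono h x)
      show "\<bar>?a\<bar> \<le> M^2 * ?b" using kom_bound[of t] mult_left_mono[OF o(3), of "M^2"] by simp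
    qed (use b Y0 in auto)
    also have "... = 3 * (M^2 * (?b^6 * ?Y))" by (simp add: eval_nat_numeral)
    also have "... \<le> 3 * (M^6 * (?b^6 * ?Y))" using M6 b Y0 by (intro mult_left_mono mult_right_mono) auto
    finally show ?thesis .
  qed
  have 3: "\<bar>bh (x1 t) * ?a'\<bar> \<le> 8 * (M^6 * (?b^6 * ?Y))"
  proof -
    have "\<bar>?a'\<bar> \<le> (\<Sum>i=2..n. \<bar>\<kappa> i * omd t i\<bar>)" by (rule sum_abs)
    also have "... \<le> (\<Sum>i=2..n. M * (8 * M^4 * ?b^5 * ?Y))"
      unfolding abs_mult using \<kappa>M omd_bound[OF t] M1 by (intro sum_mono mult_mono) auto
    also have "... = real (card II) * (M * (8 * M^4 * ?b^5 * ?Y))" by simp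
    also have "... \<le> M * (M * (8 * M^4 * ?b^5 * ?Y))" using card_II M1 b Y0 by (intro mult_right_mono) auto
    finally have "\<bar>?a'\<bar> \<le> 8 * (M^6 * (?b^5 * ?Y))" by (simp add: eval_nat_numeral mult_ac)
    then have "bh (x1 t) * \<bar>?a'\<bar> \<le> ?b * (8 * (M^6 * (?b^5 * ?Y)))" using h b by (intro mult_mono) auto
    then show ?thesis using h by (simp add: abs_mult eval_nat_numeral mult_ac)
  qed
  have "\<bar>- (?r^n) * (bh' (x1 t) * xd t 1 * ?a + bh (x1 t) * ?a')\<bar> = ?r^n * \<bar>bh' (x1 t) * xd t 1 * ?a + bh (x1 t) * ?a'\<bar>"
    using r by (simp add: abs_mult)
  also have "... \<le> ?b^n * (11 * (M^6 * (?b^6 * ?Y)))"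
    using 2 3 rn r b by (intro mult_mono) auto
  also have "... = 11 * (M^6 * (?b^(n+6) * ?Y))" by (simp add: power_add)
  finally have 4: "\<bar>- (?r^n) * (bh' (x1 t) * xd t 1 * ?a + bh (x1 t) * ?a')\<bar> \<le> 11 * (M^6 * (?b^(n+6) * ?Y))" .
  have "\<bar>utd t\<bar> \<le> 12 * (M^6 * (?b^(n+6) * ?Y))"
    unfolding utd_def using 1 4 by (intro order_trans[OF abs_triangle_ineq]) linarith
  then show ?thesis by (simp add: mult.assoc)
qed

definition "dd t = t - delay P t"
definition "Ed0 t = mu1a_bar K (x1 t) * (\<theta> * XX t + Sx t) + m1 (psi t)"

lemma delay_props:
  assumes "0 \<le> t"
  shows "0 \<le> delay P t" "dd t \<le> t" "\<exists>D. (delay P has_real_derivative D) (at t within {0..}) \<and> \<bar>D\<bar> \<le> Delta_bar K"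
  using dlb assms by (auto simp: delay_bound_def dd_def)

lemma psi_dd: "t \<in> HT ==> psi (dd t) \<in> Sb \<union> H"
  using delay_props[of t] HT_nonneg[of t] psi_in[of "dd t"] horizon_sub[of t T "dd t"] past
  by (cases "dd t < 0") (auto simp: admissible_past_def)

lemma m_nonneg: "0 \<le> m1 \<psi>" "0 \<le> m1t \<psi>" "0 \<le> m2 \<psi>"
  using mb by (auto simp: mu_bounds_def)

lemma Sx_nonneg: "0 \<le> Sx t" by (simp add: Sx_def sum_nonneg)

lemma Ed0_nonneg: "0 \<le> Ed0 t"
  unfolding Ed0_def using \<theta>0 known_nonneg(4) m_nonneg Sx_nonneg[of t] by (intro add_nonneg_nonneg mult_nonneg_nonneg) auto

lemma ss_abs: "t \<in> HT ==> \<bar>ss t\<bar> \<le> WP t"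
proof -
  assume t: "t \<in> HT"
  let ?b = "BB2 t"
  have b: "1 \<le> ?b" by (rule BB_ge)
  have "\<bar>muc t\<bar> \<le> mu_bar K (yy t) (uu t)"
    using mb psi_in[OF t] unfolding mu_bounds_def muc_def yy_outp by blast
  then have m: "\<bar>muc t\<bar> \<le> ?b" using BB2_le(3)[of t] by linarith
  have "\<bar>ut t\<bar> \<le> rr t ^ n * (BB1 t * (M^2 * oN t))" by (rule ut_abs[OF t])
  also have "... \<le> ?b^n * (?b * (M^2 * ?b))"
    using ge1(1)[OF t] BB2_le[of t] BB_ge[of t] eN_nonneg[of t] M1 by (intro mult_mono power_mono) auto
  also have "... = M^2 * ?b^(n+2)" by (simp add: power2_eq_square)
  also have "... \<le> M^6 * ?b^(n+6)" using M1 b by (intro mult_mono power_increasing) auto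
  finally have u: "\<bar>ut t\<bar> \<le> M^6 * ?b^(n+6)" .
  have "1 * ?b^1 \<le> M^6 * ?b^(n+6)" using M1 b by (intro mult_mono power_increasing one_le_power) auto
  then have "\<bar>ss t\<bar> \<le> 2 * (M^6 * ?b^(n+6))" using u m unfolding ss_def by simp
  also have "... \<le> 30 * (M^6 * ?b^(n+6))" using M1 b by (intro mult_right_mono) auto
  finally show "\<bar>ss t\<bar> \<le> WP t" by (simp add: Wp_def mult.assoc)
qed

text \<open>
  The terms with the derivative of \<open>r\<^sub>u\<close> cancel; this is the purpose of the controller state \<open>\<zeta>\<close>.
\<close>

lemma uu_deriv:
  assumes t: "t \<in> HT" "0 < t"
  shows "(uu has_real_derivative - rru t * ss t) (at t)"
proof -
  note d = deriv_at[OF t]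
  obtain t' where t': "t < t'" "t \<in> {0<..<t'}" "{0<..<t'} \<subseteq> HT" using HT_nbhd[OF t] by blast
  have z: "(zeta_sig w has_real_derivative rud t * xc t n + rru t * ut t) (at t)"
    using loop_eqs(3)[OF t(1)] at_within_nonneg[OF t(2)] by simp
  have "((\<lambda>s. zeta_sig w s - rru s * xc s n) has_real_derivative
      (rud t * xc t n + rru t * ut t) - (rud t * xc t n + xd t n * rru t)) (at t)"
    using n2 by (intro DERIV_diff z DERIV_mult d) auto
  then have "((\<lambda>s. zeta_sig w s - rru s * xc s n) has_real_derivative - rru t * ss t) (at t)"
    by (rule DERIV_cong) (simp add: xd_def ss_def algebra_simps)
  then show ?thesis
    by (rule has_field_derivative_transform_within_open[of _ _ _ "{0<..<t'}"]) (use t' loop_eqs(1) in auto)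
qed

definition "xv t = (\<chi> j. xd t (inv_into {1..n} ix j))"

lemma xv_ix: "i \<in> {1..n} ==> xv t $ ix i = xd t i"
  using ix by (simp add: xv_def bij_betw_def)

lemma x_sig_deriv:
  assumes t: "t \<in> HT" "0 < t"
  shows "(x_sig w has_vector_derivative xv t) (at t)"
proof (rule has_vector_derivative_vec)
  fix j
  obtain i where i: "i \<in> {1..n}" "j = ix i" using ix unfolding bij_betw_def by (metis UNIV_I imageE)
  show "((\<lambda>s. x_sig w s $ j) has_real_derivative xv t $ j) (at t)"
    using deriv_at(4)[OF t i(1)] by (simp add: i(2) xv_ix[OF i(1)] xc_def)
qed

lemma xv_norm:
  assumes t: "t \<in> HT"
  shows "norm (xv t) \<le> 6 * M^2 * BB2 t ^ (n+1) * YY t + \<bar>muc t\<bar>"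
proof -
  let ?b = "BB2 t"
  have b: "1 \<le> ?b" by (rule BB_ge)
  let ?q = "3 * M * ?b ^ n * YY t"
  have one: "\<bar>xd t i\<bar> \<le> 2 * (?b * ?q)" if i: "i \<in> {1..n-1}" for i
  proof -
    have in1: "i + 1 \<in> II" "i < n" using i by auto
    have "\<bar>xc t (i+1)\<bar> \<le> Sx t" unfolding Sx_def by (rule member_le_sum[OF in1(1)]) auto
    also have "... \<le> ?q" using Q1[OF t] \<theta>0 mult_nonneg_nonneg[OF \<theta>0 abs_ge_zero[of "x1 t"]] by linarith
    finally have a: "\<bar>xc t (i+1)\<bar> \<le> ?q" .
    have "(\<Sum>j=2..i. \<bar>xc t j\<bar>) \<le> Sx t" unfolding Sx_def using in1 by (intro sum_mono2) auto
    then have "BB t * (\<theta> * XX t + (\<Sum>j=2..i. \<bar>xc t j\<bar>)) \<le> ?b * ?q"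
      using Q1[OF t] BB_ge[of t] \<theta>0 by (intro mult_mono) (auto simp: sum_nonneg)
    then have c: "\<bar>dr t i\<bar> \<le> ?b * ?q" using dr_bound[OF t i] by linarith
    have "phi K i (x1 t) \<le> ?b" using Bx_ge(3)[OF i, of "x1 t"] BB_ge(6)[of t] by linarith
    then have "phi K i (x1 t) * \<bar>xc t (i+1)\<bar> \<le> ?b * ?q" using a b phi_pos[OF i, of "x1 t"] by (intro mult_mono) auto
    then have "\<bar>phi K i (x1 t) * xc t (i+1)\<bar> \<le> ?b * ?q" using phi_pos[OF i, of "x1 t"] by (simp add: abs_mult)
    then show ?thesis using c in1 unfolding xd_def by simp
  qed
  have "norm (xv t) \<le> (\<Sum>i\<in>{1..n}. \<bar>xd t i\<bar>)"
  proof -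
    have "(\<Sum>i\<in>{1..n}. \<bar>xv t $ ix i\<bar>) = (\<Sum>i\<in>{1..n}. \<bar>xd t i\<bar>)"
      by (intro sum.cong refl arg_cong[where f=abs] xv_ix)
    then show ?thesis using norm_ix_le[of "xv t"] by linarith
  qed
  also have "{1..n} = insert n {1..n-1}" using n2 by auto
  also have "(\<Sum>i\<in>insert n {1..n-1}. \<bar>xd t i\<bar>) = \<bar>muc t\<bar> + (\<Sum>i\<in>{1..n-1}. \<bar>xd t i\<bar>)"
    using n2 by (subst sum.insert) (auto simp: xd_def)
  also have "(\<Sum>i\<in>{1..n-1}. \<bar>xd t i\<bar>) \<le> real (card {1..n-1}) * (2 * (?b * ?q))" using one by (rule sum_bounded_above)
  also have "... \<le> M * (2 * (?b * ?q))"
    using nM b M1 YY_props(1)[of t] by (intro mult_right_mono) auto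
  also have "... = 6 * M^2 * ?b^(n+1) * YY t" by (simp add: power2_eq_square)
  finally show ?thesis by simp
qed

text \<open>
  The chain rule for \<open>\<mu>\<close>: the partial derivative in \<open>u\<close> gives the damping, all others are
  controlled by \<open>mu_bounds\<close> in terms of the state, of \<open>\<psi>\<close> and of the delayed quantity \<open>Ed0\<close>.
\<close>

lemma ss_deriv:
  assumes t: "t \<in> HT" "0 < t" "dd t \<noteq> 0"
  shows "\<exists>D m. (ss has_real_derivative D - m * rru t * ss t) (at t) \<and> mu_lo K \<le> m \<and>
    \<bar>D\<bar> \<le> WP t * (YY t + \<bar>ss t\<bar> + m1 (psi t) + m1t (psi t) + Ed0 (dd t) + m2 (psi t) * YY t + m2 (psi t))"
proof -
  let ?b = "BB2 t" and ?Y = "YY t" and ?\<psi> = "psi t"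
  let ?qp = "q_psi P t (x_sig w t) (psi t) (uu t) (x_sig w (dd t)) (psi (dd t)) (uu (dd t))"
  have b: "1 \<le> ?b" by (rule BB_ge)
  have Y0: "0 \<le> ?Y" by (rule YY_props)
  obtain Dt Dx D\<psi> Du where
    der: "((\<lambda>(t, x, \<psi>, u). mu P t x \<psi> u) has_derivative
               (\<lambda>(ht, hx, h\<psi>, hu). Dt * ht + Dx \<bullet> hx + D\<psi> \<bullet> h\<psi> + Du * hu)) (at (t, x_sig w t, psi t, uu t))"
    and Du: "mu_lo K \<le> Du"
    and Dq: "\<bar>D\<psi> \<bullet> ?qp\<bar> \<le> mu1_bar K (yy t) (uu t) *
                 ((mu1a_bar K (x1 t) * (\<theta> * XX t + Sx t) + m1 ?\<psi>) + Ed0 (dd t))"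
    and Dt: "\<bar>Dt\<bar> \<le> mu1_tilde K (yy t) (uu t) * (\<theta> * XX t + Sx t + m1t ?\<psi>)"
    and Dx: "norm Dx \<le> mu2_bar K (yy t) (uu t) + m2 ?\<psi>"
    and mu0: "\<bar>muc t\<bar> \<le> mu_bar K (yy t) (uu t)"
  proof -
    from mb psi_in[OF t(1)] psi_dd[OF t(1)] that show thesis
      unfolding mu_bounds_def muc_def yy_outp Ed0_def Sx_def x1_def xc_def by blast
  qed
  have psid: "(psi has_vector_derivative ?qp) (at t)"
    using loop_eqs(8)[OF t(1)] t(3) at_within_nonneg[OF t(2)] by (simp add: dd_def)
  have ud: "(uu has_vector_derivative - rru t * ss t) (at t)"
    using uu_deriv[OF t(1,2)] by (simp add: has_real_derivative_iff_has_vector_derivative)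
  have "((\<lambda>s. (s, x_sig w s, psi s, uu s)) has_vector_derivative (1, xv t, ?qp, - rru t * ss t)) (at t)"
    by (intro has_vector_derivative_Pair x_sig_deriv[OF t(1,2)] psid ud) (auto intro!: derivative_eq_intros)
  from vector_derivative_diff_chain_within[OF this has_derivative_at_withinI[OF der]]
  have "((\<lambda>s. muc s) has_vector_derivative Dt * 1 + Dx \<bullet> xv t + D\<psi> \<bullet> ?qp + Du * (- rru t * ss t)) (at t)"
    by (simp add: o_def muc_def[abs_def])
  then have mud: "(muc has_real_derivative Dt + Dx \<bullet> xv t + D\<psi> \<bullet> ?qp - Du * rru t * ss t) (at t)"
    by (simp add: has_real_derivative_iff_has_vector_derivative algebra_simps)
  define D where "D = Dt + Dx \<bullet> xv t + D\<psi> \<bullet> ?qp - utd t"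
  have "((\<lambda>s. muc s - ut s) has_real_derivative (Dt + Dx \<bullet> xv t + D\<psi> \<bullet> ?qp - Du * rru t * ss t) - utd t) (at t)"
    by (rule DERIV_diff[OF mud ut_deriv[OF t(1,2)]])
  then have 1: "(ss has_real_derivative D - Du * rru t * ss t) (at t)"
    by (simp add: ss_def[abs_def] D_def algebra_simps)
  let ?q = "3 * M * ?b ^ n * ?Y" and ?E = "Ed0 (dd t)"
  have Q: "\<theta> * XX t + Sx t \<le> ?q" by (rule Q1[OF t(1)])
  have Q0: "0 \<le> \<theta> * XX t + Sx t" using \<theta>0 Sx_nonneg[of t] by simp
  have q0: "0 \<le> ?q" using Q Q0 by linarith
  note mn = m_nonneg[of ?\<psi>] Ed0_nonneg[of "dd t"]
  have d1: "\<bar>Dt\<bar> \<le> ?b * (?q + m1t ?\<psi>)"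
    by (rule order_trans[OF Dt]) (use BB2_le[of t] Q Q0 mn b in \<open>auto intro!: mult_mono\<close>)
  have d2: "\<bar>D\<psi> \<bullet> ?qp\<bar> \<le> ?b * (?b * ?q + m1 ?\<psi> + ?E)"
  proof (rule order_trans[OF Dq], rule mult_mono)
    have "mu1a_bar K (x1 t) * (\<theta> * XX t + Sx t) \<le> ?b * ?q"
      using Bx_ge(7)[of "x1 t"] BB_ge(6)[of t] Q Q0 b by (intro mult_mono) auto
    then show "mu1a_bar K (x1 t) * (\<theta> * XX t + Sx t) + m1 ?\<psi> + ?E \<le> ?b * ?q + m1 ?\<psi> + ?E" by simp
    show "0 \<le> mu1a_bar K (x1 t) * (\<theta> * XX t + Sx t) + m1 ?\<psi> + ?E"
      using mn mult_nonneg_nonneg[OF known_nonneg(4) Q0, of "x1 t"] by linarith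
  qed (use BB2_le[of t] b in auto)
  let ?n = "6 * M^2 * ?b ^ (n+1) * ?Y"
  have n0: "0 \<le> ?n" using M1 b Y0 by simp
  have d3: "\<bar>Dx \<bullet> xv t\<bar> \<le> (?b + m2 ?\<psi>) * ?n + ?b * (\<bar>ss t\<bar> + \<bar>ut t\<bar>) + m2 ?\<psi> * ?b"
  proof -
    have "\<bar>Dx \<bullet> xv t\<bar> \<le> norm Dx * norm (xv t)" by (rule Cauchy_Schwarz_ineq2)
    also have "... \<le> (?b + m2 ?\<psi>) * (?n + \<bar>muc t\<bar>)"
      using Dx BB2_le[of t] mn b n0 by (intro mult_mono xv_norm[OF t(1)]) auto
    also have "... = (?b + m2 ?\<psi>) * ?n + ?b * \<bar>muc t\<bar> + m2 ?\<psi> * \<bar>muc t\<bar>" by (simp add: algebra_simps)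
    also have "... \<le> (?b + m2 ?\<psi>) * ?n + ?b * (\<bar>ss t\<bar> + \<bar>ut t\<bar>) + m2 ?\<psi> * ?b"
      using mu0 BB2_le[of t] mn b by (intro add_mono mult_left_mono) (auto simp: ss_def)
    finally show ?thesis .
  qed
  have d4: "?b * \<bar>ut t\<bar> \<le> M^6 * (?b^(n+6) * ?Y)"
  proof -
    have "\<bar>ut t\<bar> \<le> ?b^n * (?b * (M^2 * ?Y))"
      by (rule order_trans[OF ut_abs[OF t(1)]])
        (use ge1(1)[OF t(1)] BB2_le[of t] BB_ge[of t] eN_nonneg[of t] YY_props[of t] in \<open>auto intro!: mult_mono power_mono\<close>)
    then have "?b * \<bar>ut t\<bar> \<le> ?b * (?b^n * (?b * (M^2 * ?Y)))" using b by (intro mult_left_mono) auto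
    also have "... = M^2 * (?b^(n+2) * ?Y)" by (simp add: power2_eq_square)
    also have "... \<le> M^6 * (?b^(n+6) * ?Y)" using M1 b Y0 by (intro mult_mono mult_right_mono power_increasing) auto
    finally show ?thesis .
  qed
  let ?W = "M^6 * ?b^(n+6)"
  have W: "?b \<le> ?W" "1 \<le> ?W"
  proof -
    have "1 * ?b^1 \<le> ?W" using M1 b by (intro mult_mono power_increasing one_le_power) auto
    then show "?b \<le> ?W" "1 \<le> ?W" using b by auto
  qed
  have nW: "?n \<le> 6 * (?W * ?Y)" "?b * ?n \<le> 6 * (?W * ?Y)" "?b * ?q \<le> 3 * (?W * ?Y)" "?b * (?b * ?q) \<le> 3 * (?W * ?Y)"
  proof -
    have g: "M^k * (?b^l * ?Y) \<le> ?W * ?Y" if "k \<le> 6" "l \<le> n+6" for k l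
      unfolding mult.assoc using M1 b Y0 that by (intro mult_mono mult_right_mono power_increasing) auto
    show "?n \<le> 6 * (?W * ?Y)" using g[of 2 "n+1"] by (simp add: mult.assoc)
    show "?b * ?n \<le> 6 * (?W * ?Y)" using g[of 2 "n+2"] by (simp add: mult_ac)
    show "?b * ?q \<le> 3 * (?W * ?Y)" using g[of 1 "n+1"] by (simp add: mult_ac)
    show "?b * (?b * ?q) \<le> 3 * (?W * ?Y)" using g[of 1 "n+2"] by (simp add: mult_ac)
  qed
  have mW: "?b * c \<le> ?W * c" if "0 \<le> c" for c using W that by (intro mult_right_mono) auto
  have "\<bar>D\<bar> \<le> \<bar>Dt\<bar> + \<bar>Dx \<bullet> xv t\<bar> + \<bar>D\<psi> \<bullet> ?qp\<bar> + \<bar>utd t\<bar>" unfolding D_def by linarith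
  also have "... \<le> ?W * (30 * ?Y + 30 * \<bar>ss t\<bar> + 30 * m1 ?\<psi> + 30 * m1t ?\<psi> + 30 * ?E + 30 * (m2 ?\<psi> * ?Y) + 30 * m2 ?\<psi>)"
  proof -
    have "\<bar>Dt\<bar> \<le> 3 * (?W * ?Y) + ?W * m1t ?\<psi>" using d1 nW(3) mW[OF mn(2)] by (simp add: distrib_left)
    moreover have "\<bar>D\<psi> \<bullet> ?qp\<bar> \<le> 3 * (?W * ?Y) + ?W * m1 ?\<psi> + ?W * ?E"
      using d2 nW(4) mW[OF mn(1)] mW[OF mn(4)] by (simp add: distrib_left)
    moreover have "\<bar>Dx \<bullet> xv t\<bar> \<le> 6 * (?W * ?Y) + 6 * (?W * (m2 ?\<psi> * ?Y)) + ?W * \<bar>ss t\<bar> + ?W * ?Y + ?W * m2 ?\<psi>"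
    proof -
      have "m2 ?\<psi> * ?n \<le> m2 ?\<psi> * (6 * (?W * ?Y))" using nW(1) mn by (intro mult_left_mono) auto
      then have a: "(?b + m2 ?\<psi>) * ?n \<le> 6 * (?W * ?Y) + 6 * (?W * (m2 ?\<psi> * ?Y))"
      proof -
        have "(?b + m2 ?\<psi>) * ?n = ?b * ?n + m2 ?\<psi> * ?n" by (rule distrib_right)
        moreover have "m2 ?\<psi> * (6 * (?W * ?Y)) = 6 * (?W * (m2 ?\<psi> * ?Y))" by simp
        ultimately show ?thesis using nW(2) \<open>m2 ?\<psi> * ?n \<le> m2 ?\<psi> * (6 * (?W * ?Y))\<close> by linarith
      qed
      have "?b * (\<bar>ss t\<bar> + \<bar>ut t\<bar>) \<le> ?W * \<bar>ss t\<bar> + ?W * ?Y"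
        using mW[of "\<bar>ss t\<bar>"] d4 by (simp add: distrib_left mult.assoc)
      moreover have "m2 ?\<psi> * ?b \<le> ?W * m2 ?\<psi>" using mW[OF mn(3)] by (simp add: mult.commute)
      ultimately show ?thesis using d3 a by linarith
    qed
    moreover have "\<bar>utd t\<bar> \<le> 12 * (?W * ?Y)" using utd_bound[OF t(1)] by (simp add: mult.assoc)
    moreover have "0 \<le> ?W * \<bar>ss t\<bar>" "0 \<le> ?W * m1 ?\<psi>" "0 \<le> ?W * m1t ?\<psi>" "0 \<le> ?W * ?E" "0 \<le> ?W * (m2 ?\<psi> * ?Y)"
      "0 \<le> ?W * m2 ?\<psi>" "0 \<le> ?W * ?Y" using W(2) mn Y0 by auto
    moreover have dq: "?W * (30 * a1 + 30 * a2 + 30 * a3 + 30 * a4 + 30 * a5 + 30 * a6 + 30 * a7)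
       = 30 * (?W * a1) + 30 * (?W * a2) + 30 * (?W * a3) + 30 * (?W * a4) + 30 * (?W * a5) + 30 * (?W * a6) + 30 * (?W * a7)"
      for a1 a2 a3 a4 a5 a6 a7 by (simp add: distrib_left)
    ultimately show ?thesis unfolding dq by linarith
  qed
  also have "... = WP t * (?Y + \<bar>ss t\<bar> + m1 ?\<psi> + m1t ?\<psi> + ?E + m2 ?\<psi> * ?Y + m2 ?\<psi>)"
    unfolding Wp_def by (simp add: algebra_simps)
  finally show ?thesis using 1 Du by blast
qed

end

section \<open>The storage function\<close>

context loop begin

text \<open>
  \<open>FF\<close> dominates what the state at time \<open>t\<close> emits into later derivatives of the storage function,
  \<open>Emis\<close> is what is received at time \<open>t\<close> from the delayed time, \<open>VV\<close> is the storage function, \<open>wt\<close>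
  its weight and \<open>Diss\<close> the dissipation.
\<close>

definition "al t = alpha_psi K (norm (psi t))"
definition "ri t = 1 / rr t ^ (2*n)"
definition "FF t = 5 * M * (BB t)^2 * ri t * ((1 + \<theta>^2) * (XX t)^2 + Sq t + (muc t)^2) + ri t * al t / (4 * M)"
definition "Es0 t = Gam2 K (x1 t) * (\<theta> * (XX t)^2 + Sq t + gam_s K (yy t) (uu t))"
definition "Emis t = ri t * Es0 (dd t) + (Ed0 (dd t))^2 / (8 * M^2 * rr t ^ (2*n))"
definition "VV t = coreV t + (tth t - (2 + \<theta>^2))^2 / 2 + V (psi t) / rr t ^ (2*n) + (ss t)^2 / (2 * sqrt (rru t))"
definition "wt t = exp (2 * M / rr t + 2 * M * (1 + \<theta>^2) / rru t)"
definition "Diss t = 1 / (4 * M^2) * (rr t)^2 * ZZ t + ri t * al t / 4 + (XX t)^2 + sqrt (rru t) * mu_lo K * (ss t)^2 / 2"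
abbreviation "WW2 t \<equiv> W2 (yy t) (uu t) (rr t) (rd t) (tth t) (vp t)"
abbreviation "WW2' t \<equiv> W2' (yy t) (uu t) (rr t) (rd t) (tth t) (vp t)"
abbreviation "RRu t \<equiv> Ruf (yy t) (uu t) (rr t) (rd t) (tth t) (vp t)"

lemma alpha_nonneg: "0 \<le> s ==> 0 \<le> alpha_psi K s"
proof -
  have "class_K_infinity (alpha_psi K)" using reg by (simp add: known_regular_def)
  then have a: "strict_mono_on {0..} (alpha_psi K)" "alpha_psi K 0 = 0" by (auto simp: class_K_infinity_def)
  show "0 \<le> s ==> 0 \<le> alpha_psi K s"
    using strict_mono_onD[OF a(1), of 0 s] a(2) by (cases "s = 0") auto
qed

lemma al_nonneg: "0 \<le> al t" by (simp add: al_def alpha_nonneg)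

lemma V_nonneg: "0 \<le> V \<psi>" using Vc by (cases "\<psi> = 0") (auto simp: lyapunov_candidate_def less_imp_le)

lemma ms_al: "(m1 (psi t))^2 + (m1t (psi t))^2 + (m2 (psi t))^2 \<le> M * al t"
  using ms[of "psi t"] mult_right_mono[OF kM al_nonneg[of t]] by (simp add: al_def)

lemma ri_props: "t \<in> HT ==> 0 < ri t" "t \<in> HT ==> ri t \<le> 1"
  using ge1(1)[of t] by (auto simp: ri_def)

lemma Sq_nonneg: "0 \<le> Sq t" by (simp add: Sq_def sum_nonneg)

lemma FF_nonneg: "t \<in> HT ==> 0 \<le> FF t"
  using M1 ri_props[of t] al_nonneg[of t] Sq_nonneg[of t] by (simp add: FF_def)

lemma Ed0_sq:
  shows "(Ed0 t)^2 / (8 * M^2) \<le> M * (BB t)^2 * ((1 + \<theta>^2) * (XX t)^2 + Sq t) + al t / (4 * M)"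
proof -
  let ?T = "(1 + \<theta>^2) * (XX t)^2 + Sq t"
  have T0: "0 \<le> ?T" using Sq_nonneg[of t] by simp
  have Sx2: "(Sx t)^2 \<le> M * Sq t"
  proof -
    have "(Sx t)^2 = (\<Sum>j=2..n. \<bar>xc t j\<bar> * 1)^2" by (simp add: Sx_def)
    also have "... \<le> (\<Sum>j=2..n. \<bar>xc t j\<bar>^2) * (\<Sum>j=2..n. 1^2)" by (rule Cauchy_Schwarz_ineq_sum)
    also have "... = Sq t * real (card II)" by (simp add: Sq_def)
    also have "... \<le> Sq t * M" using card_II Sq_nonneg[of t] by (intro mult_left_mono) auto
    finally show ?thesis by (simp add: mult.commute)
  qed
  have a: "Ed0 t \<le> BB t * (\<theta> * XX t + Sx t) + m1 (psi t)"
    unfolding Ed0_def using Bx_ge(7)[of "x1 t"] \<theta>0 Sx_nonneg[of t] by (intro add_right_mono mult_right_mono) auto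
  have sq: "(u + v)^2 \<le> 2 * u^2 + 2 * v^2" for u v :: real
    using sum_squares_bound[of u v] by (simp add: power2_sum)
  have "(\<theta> * XX t + Sx t)^2 \<le> 2 * (\<theta> * XX t)^2 + 2 * (M * Sq t)" using sq[of "\<theta> * XX t" "Sx t"] Sx2 by linarith
  also have "... = 2 * (1 * (\<theta>^2 * (XX t)^2)) + 2 * (M * Sq t)" by (simp add: power_mult_distrib)
  also have "... \<le> 2 * (M * ((1 + \<theta>^2) * (XX t)^2)) + 2 * (M * Sq t)"
    using M1 by (intro add_right_mono mult_left_mono mult_mono mult_right_mono) auto
  finally have b: "(\<theta> * XX t + Sx t)^2 \<le> 2 * M * ?T" by (simp add: algebra_simps)
  have "(Ed0 t)^2 \<le> (BB t * (\<theta> * XX t + Sx t) + m1 (psi t))^2" by (rule power_mono[OF a Ed0_nonneg])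
  also have "... \<le> 2 * ((BB t)^2 * (\<theta> * XX t + Sx t)^2) + 2 * (m1 (psi t))^2"
    using sq[of "BB t * (\<theta> * XX t + Sx t)" "m1 (psi t)"] by (simp add: power_mult_distrib)
  also have "... \<le> 2 * ((BB t)^2 * (2 * M * ?T)) + 2 * (M * al t)"
  proof (intro add_mono mult_left_mono b)
    show "(m1 (psi t))^2 \<le> M * al t" using ms_al[of t] zero_le_power2[of "m1t (psi t)"] zero_le_power2[of "m2 (psi t)"] by linarith
  qed auto
  finally have "(Ed0 t)^2 / (8 * M^2) \<le> (2 * ((BB t)^2 * (2 * M * ?T)) + 2 * (M * al t)) / (8 * M^2)"
    using M1 by (intro divide_right_mono) auto
  also have "... = ((BB t)^2 * ?T) / (2 * M) + al t / (4 * M)"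
    using M1 by (simp add: field_simps power2_eq_square)
  also have "((BB t)^2 * ?T) / (2 * M) \<le> M * ((BB t)^2 * ?T)"
  proof -
    have "1 * 1 \<le> M * (2 * M)" using M1 by (intro mult_mono) auto
    then have "1 / (2 * M) \<le> M" using M1 by (simp add: field_simps)
    from mult_right_mono[OF this, of "(BB t)^2 * ?T"] T0 show ?thesis by simp
  qed
  finally show ?thesis by (simp add: mult.assoc)
qed

lemma Es0_le:
  assumes t: "t \<in> HT"
  shows "Es0 t \<le> (BB t)^2 * ((1 + \<theta>^2) * (XX t)^2 + Sq t + (muc t)^2)"
proof -
  have g: "gam_s K (yy t) (uu t) \<le> gam_s_bar K (x1 t) * (muc t)^2"
    using gs[OF HT_nonneg[OF t] psi_in[OF t], of "x_sig w t" "uu t"] by (simp add: yy_outp x1_def muc_def)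
  also have "... \<le> BB t * (muc t)^2" by (intro mult_right_mono Bx_ge) auto
  finally have g: "gam_s K (yy t) (uu t) \<le> BB t * (muc t)^2" .
  have th: "\<theta> \<le> 1 + \<theta>^2" using sum_squares_bound[of 1 \<theta>] \<theta>0 by (simp; linarith)
  have "\<theta> * (XX t)^2 + Sq t + gam_s K (yy t) (uu t) \<le> BB t * ((1 + \<theta>^2) * (XX t)^2 + Sq t + (muc t)^2)"
  proof -
    have "\<theta> * (XX t)^2 \<le> (1 + \<theta>^2) * (XX t)^2" using th by (intro mult_right_mono) auto
    then have "1 * (\<theta> * (XX t)^2 + Sq t) \<le> BB t * ((1 + \<theta>^2) * (XX t)^2 + Sq t)"
      using BB_ge(1)[of t] Sq_nonneg[of t] \<theta>0 by (intro mult_mono) auto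
    then show ?thesis using g by (simp add: distrib_left)
  qed
  then have "Es0 t \<le> BB t * (BB t * ((1 + \<theta>^2) * (XX t)^2 + Sq t + (muc t)^2))"
    unfolding Es0_def using Bx_ge(5)[of "x1 t"] known_nonneg(2,5) BB0(1)[of t] \<theta>0 Sq_nonneg[of t]
    by (intro mult_mono) auto
  then show ?thesis by (simp add: power2_eq_square)
qed

lemma emission_le_FF:
  assumes t: "t \<in> HT" and c: "0 \<le> c" "c \<le> ri t"
  shows "c * (Es0 t + (Ed0 t)^2 / (8 * M^2)) \<le> FF t"
proof -
  let ?T = "(1 + \<theta>^2) * (XX t)^2 + Sq t + (muc t)^2"
  have T0: "0 \<le> ?T" using Sq_nonneg[of t] by simp
  have "M * (BB t)^2 * ((1 + \<theta>^2) * (XX t)^2 + Sq t) \<le> M * (BB t)^2 * ?T" using M1 by (intro mult_left_mono) auto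
  moreover have "1 * ((BB t)^2 * ?T) \<le> M * ((BB t)^2 * ?T)" using M1 T0 by (intro mult_right_mono) auto
  ultimately have "Es0 t + (Ed0 t)^2 / (8 * M^2) \<le> 2 * (M * ((BB t)^2 * ?T)) + al t / (4 * M)"
    using Es0_le[OF t] Ed0_sq[of t] by simp
  also have "... \<le> 5 * (M * ((BB t)^2 * ?T)) + al t / (4 * M)" using M1 T0 by (intro add_right_mono mult_right_mono) auto
  finally have "c * (Es0 t + (Ed0 t)^2 / (8 * M^2)) \<le> c * (5 * (M * ((BB t)^2 * ?T)) + al t / (4 * M))"
    using c by (intro mult_left_mono) auto
  also have "... \<le> ri t * (5 * (M * ((BB t)^2 * ?T)) + al t / (4 * M))"
    using c M1 T0 al_nonneg[of t] by (intro mult_right_mono) auto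
  also have "... = FF t" by (simp add: FF_def algebra_simps)
  finally show ?thesis .
qed

lemma Es0_ri_le: "t \<in> HT ==> ri t * Es0 t \<le> FF t"
proof -
  assume t: "t \<in> HT"
  have "ri t * Es0 t \<le> ri t * (Es0 t + (Ed0 t)^2 / (8 * M^2))" using ri_props[OF t] by (intro mult_left_mono) auto
  also have "... \<le> FF t" using ri_props[OF t] by (intro emission_le_FF[OF t]) auto
  finally show ?thesis .
qed

lemma Emis_eq: "Emis t = ri t * (Es0 (dd t) + (Ed0 (dd t))^2 / (8 * M^2))"
  by (simp add: Emis_def ri_def distrib_left)

lemma psi_part:
  assumes t: "t \<in> HT" "0 < t" "dd t \<noteq> 0"
  shows "\<exists>D. ((\<lambda>s. V (psi s) / rr s ^ (2*n)) has_real_derivative D) (at t) \<and> D \<le> - ri t * al t + FF t + ri t * Es0 (dd t)"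
proof -
  let ?qp = "q_psi P t (x_sig w t) (psi t) (uu t) (x_sig w (dd t)) (psi (dd t)) (uu (dd t))"
  have r: "1 \<le> rr t" using ge1(1)[OF t(1)] .
  have psid: "(psi has_vector_derivative ?qp) (at t)"
    using loop_eqs(8)[OF t(1)] t(3) at_within_nonneg[OF t(2)] by (simp add: dd_def)
  obtain D where D: "GDERIV V (psi t) :> D" using Vc by (auto simp: lyapunov_candidate_def)
  then have "(V has_derivative (\<lambda>h. h \<bullet> D)) (at (psi t))" by (simp add: gderiv_def)
  from vector_derivative_diff_chain_within[OF psid has_derivative_at_withinI[OF this]]
  have "((\<lambda>s. V (psi s)) has_real_derivative D \<bullet> ?qp) (at t)"
    by (simp add: o_def has_real_derivative_iff_has_vector_derivative inner_commute)
  from has_real_derivative_scaled[OF this deriv_at(1)[OF t(1,2)], of "2*n"] r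
  have 1: "((\<lambda>s. V (psi s) / rr s ^ (2*n)) has_real_derivative
     D \<bullet> ?qp / rr t ^ (2*n) - real (2*n) * (rd t / rr t) * (V (psi t) / rr t ^ (2*n))) (at t)" by simp
  have "D \<bullet> ?qp \<le> - al t + (Es0 t + Es0 (dd t))"
    using Vd[OF HT_nonneg[OF t(1)] psi_in[OF t(1)] D psi_dd[OF t(1)], of "x_sig w t" "uu t" "x_sig w (dd t)" "uu (dd t)"]
    by (simp add: Es0_def al_def Sq_def x1_def xc_def yy_outp)
  then have "ri t * (D \<bullet> ?qp) \<le> ri t * (- al t + (Es0 t + Es0 (dd t)))" using ri_props[OF t(1)] by (intro mult_left_mono) auto
  then have "ri t * (D \<bullet> ?qp) \<le> - ri t * al t + ri t * Es0 t + ri t * Es0 (dd t)" by (simp add: algebra_simps)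
  moreover have "0 \<le> real (2*n) * (rd t / rr t) * (V (psi t) / rr t ^ (2*n))"
    using rd_nonneg(1)[of t] r V_nonneg by (intro mult_nonneg_nonneg divide_nonneg_nonneg) auto
  ultimately have "D \<bullet> ?qp / rr t ^ (2*n) - real (2*n) * (rd t / rr t) * (V (psi t) / rr t ^ (2*n))
     \<le> - ri t * al t + FF t + ri t * Es0 (dd t)"
    using Es0_ri_le[OF t(1)] by (simp add: ri_def)
  then show ?thesis using 1 by blast
qed

lemma tracking_part:
  assumes t: "t \<in> HT" "0 < t" "dd t \<noteq> 0"
  shows "\<exists>D. ((\<lambda>s. (ss s)^2 / (2 * sqrt (rru s))) has_real_derivative D) (at t) \<and>
    D \<le> - sqrt (rru t) * mu_lo K * (ss t)^2 + WW2 t * (ss t)^2 + WW2 t / rru t * (ZZ t + (1 + \<theta>^2) * (XX t)^2)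
       + ri t * al t / 4 + (Ed0 (dd t))^2 / (8 * M^2 * rr t ^ (2*n))"
proof -
  have r: "1 \<le> rr t" and ru: "1 \<le> rru t" using ge1[OF t(1)] by auto
  define \<rho> where "\<rho> = sqrt (rru t)"
  have \<rho>: "1 \<le> \<rho>" "\<rho> * \<rho> = rru t" using ru by (auto simp: \<rho>_def)
  obtain D m where D: "(ss has_real_derivative D - m * rru t * ss t) (at t)" "mu_lo K \<le> m"
    "\<bar>D\<bar> \<le> WP t * (YY t + \<bar>ss t\<bar> + m1 (psi t) + m1t (psi t) + Ed0 (dd t) + m2 (psi t) * YY t + m2 (psi t))"
    using ss_deriv[OF t] by blast
  have sd: "((\<lambda>s. sqrt (rru s)) has_real_derivative rud t * (inverse \<rho> / 2)) (at t)"
    using DERIV_chain2[OF DERIV_real_sqrt deriv_at(2)[OF t(1,2)]] ru by (simp add: \<rho>_def mult.commute)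
  have s2: "((\<lambda>s. (ss s)^2) has_real_derivative 2 * ss t * (D - m * rru t * ss t)) (at t)"
    using DERIV_power[OF D(1), of 2] by (simp add: mult_ac)
  have "((\<lambda>s. (ss s)^2 / (2 * sqrt (rru s))) has_real_derivative
     (2 * ss t * (D - m * rru t * ss t) * (2 * \<rho>) - (ss t)^2 * (2 * (rud t * (inverse \<rho> / 2)))) / ((2 * \<rho>) * (2 * \<rho>))) (at t)"
    using DERIV_divide[OF s2 DERIV_cmult[OF sd, of 2]] \<rho> by (simp add: \<rho>_def)
  moreover have "(2 * ss t * (D - m * rru t * ss t) * (2 * \<rho>) - (ss t)^2 * (2 * (rud t * (inverse \<rho> / 2)))) / ((2 * \<rho>) * (2 * \<rho>))
     \<le> - \<rho> * mu_lo K * (ss t)^2 + \<bar>ss t\<bar> * \<bar>D\<bar> / \<rho>"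
  proof -
    have p: "0 < \<rho>" using \<rho> by simp
    have "(2 * ss t * (D - m * rru t * ss t) * (2 * \<rho>) - (ss t)^2 * (2 * (rud t * (inverse \<rho> / 2)))) / ((2 * \<rho>) * (2 * \<rho>))
      = ss t * D / \<rho> - m * \<rho> * (ss t)^2 - (ss t)^2 * rud t * inverse \<rho> / (4 * \<rho> * \<rho>)"
      using p unfolding \<rho>(2)[symmetric] by (simp add: field_simps power2_eq_square)
    moreover have "0 \<le> (ss t)^2 * rud t * inverse \<rho> / (4 * \<rho> * \<rho>)" using p rd_nonneg(2)[of t] by simp
    moreover have "ss t * D / \<rho> \<le> \<bar>ss t\<bar> * \<bar>D\<bar> / \<rho>" using p abs_ge_self[of "ss t * D"] by (simp add: abs_mult divide_right_mono)
    moreover have "mu_lo K * (\<rho> * (ss t)^2) \<le> m * (\<rho> * (ss t)^2)" using D(2) p by (intro mult_right_mono) auto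
    ultimately show ?thesis by (simp add: mult_ac)
  qed
  moreover have "\<bar>ss t\<bar> * \<bar>D\<bar> / sqrt (rru t) \<le> 30 * M^2 * rr t ^ (2*n) * WP t ^ 4 * (ss t)^2
     + 30 * M^2 * rr t ^ (2*n) * WP t ^ 4 / rru t * ((eN t)^2 + (oN t)^2 + (1 + \<theta>^2) * (XX t)^2)
     + al t / (4 * rr t ^ (2*n)) + (Ed0 (dd t))^2 / (8 * M^2 * rr t ^ (2*n))"
    by (rule tracking_estimate[OF M1 Wp_ge _ ru eN_nonneg abs_ge_zero \<theta>0 m_nonneg Ed0_nonneg YY_def D(3) ss_abs[OF t(1)] ms_al])
       (use r in auto)
  ultimately show ?thesis unfolding W2_def ZZ_def ri_def \<rho>_def[symmetric]
    by (intro exI[of _ "(2 * ss t * (D - m * rru t * ss t) * (2 * \<rho>) - (ss t)^2 * (2 * (rud t * (inverse \<rho> / 2)))) / ((2 * \<rho>) * (2 * \<rho>))"])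
       (simp add: \<rho>_def[symmetric])
qed

lemma core_lower: "t \<in> HT ==> (XX t)^2 / 2 + rr t * ZZ t / M \<le> coreV t"
proof -
  assume t: "t \<in> HT"
  have r: "1 \<le> rr t" using ge1(1)[OF t] .
  have "1 * (1 / M * (eN t)^2) \<le> M^8 * Bo (ep t) (ep t)"
    using M1 Bo_lo[of "ep t"] by (intro mult_mono) (auto simp: eN_def)
  then have "1 / M * (eN t)^2 + 1 / M * (oN t)^2 \<le> M^8 * Bo (ep t) (ep t) + Bc (om t) (om t)"
    using Bc_lo[of "om t"] by (simp add: oN_def)
  from mult_left_mono[OF this, of "rr t"] r show ?thesis
    by (simp add: coreV_def ZZ_def algebra_simps add_divide_distrib)
qed

lemma VV_lower: "t \<in> HT ==> (XX t)^2 / 2 + rr t * ZZ t / M + (ss t)^2 / (2 * sqrt (rru t)) \<le> VV t"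
proof -
  assume t: "t \<in> HT"
  have "0 \<le> V (psi t) / rr t ^ (2*n)" using V_nonneg[of "psi t"] ge1(1)[OF t] by (intro divide_nonneg_nonneg) auto
  then show ?thesis using core_lower[OF t] unfolding VV_def by (smt (verit) divide_nonneg_nonneg zero_le_power2)
qed

lemma rud_eq: "rud t = gate (RRu t - rru t) * (\<bar>rru t\<bar>^3 * WW2' t)"
  unfolding rud_def ru_dot_eq yy_fst rd_def[symmetric] vp_def[symmetric] ..

lemma rd_eq: "rd t = gate (8 * M^2 * W1 (x1 t) (tth t) - rr t) * ((rr t)^2 * W1 (x1 t) (tth t))"
  unfolding rd_def r_dot_eq ..

lemma VV_deriv:
  assumes t: "t \<in> HT" "0 < t" "dd t \<noteq> 0"
  shows "\<exists>D. (VV has_real_derivative D) (at t) \<and>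
    D + M * FF t - Emis t - (2 * M * (rd t / (rr t)^2) + 2 * M * (1 + \<theta>^2) * (rud t / (rru t)^2)) * VV t \<le> - Diss t"
proof -
  have r: "1 \<le> rr t" and ru: "1 \<le> rru t" and th: "1 \<le> tth t" using ge1[OF t(1)] by auto
  obtain D1 where D1: "(coreV has_real_derivative D1) (at t)" "D1 \<le> - (1 / (2 * M^2)) * (rr t)^2 * ZZ t
     + 100 * M^28 * BB1 t ^10 * rr t * ZZ t + 100 * M^28 * BB t ^4 * (1 + \<theta>^2) * (XX t)^2 + 100 * M^28 * (ss t)^2 - NN t"
    using core_deriv[OF t(1,2)] by blast
  obtain D2 where D2: "((\<lambda>s. V (psi s) / rr s ^ (2*n)) has_real_derivative D2) (at t)"
     "D2 \<le> - ri t * al t + FF t + ri t * Es0 (dd t)" using psi_part[OF t] by blast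
  obtain D3 where D3: "((\<lambda>s. (ss s)^2 / (2 * sqrt (rru s))) has_real_derivative D3) (at t)"
    "D3 \<le> - sqrt (rru t) * mu_lo K * (ss t)^2 + WW2 t * (ss t)^2 + WW2 t / rru t * (ZZ t + (1 + \<theta>^2) * (XX t)^2)
       + ri t * al t / 4 + (Ed0 (dd t))^2 / (8 * M^2 * rr t ^ (2*n))" using tracking_part[OF t] by blast
  define D4 where "D4 = (tth t - (2 + \<theta>^2)) * (q (x1 t) * (XX t)^2)"
  have D4: "((\<lambda>s. (tth s - (2 + \<theta>^2))^2 / 2) has_real_derivative D4) (at t)"
    using DERIV_cdivide[OF DERIV_power[OF DERIV_diff[OF deriv_at(3)[OF t(1,2)] DERIV_const[of "2 + \<theta>^2"]], of 2], of 2]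
    by (simp add: D4_def mult_ac)
  have "(VV has_real_derivative D1 + D4 + D2 + D3) (at t)"
    unfolding VV_def[abs_def] by (intro DERIV_add D1 D2 D3 D4)
  moreover have "D1 + D2 + D4 + D3 + M * FF t - (ri t * Es0 (dd t) + (Ed0 (dd t))^2 / (8 * M^2 * rr t ^ (2*n)))
      - (2 * M * (rd t / (rr t)^2) + 2 * M * (1 + \<theta>^2) * (rud t / (rru t)^2)) * VV t
     \<le> - (1 / (4 * M^2)) * (rr t)^2 * ZZ t - ri t * al t / 4 - (XX t)^2 - sqrt (rru t) * mu_lo K * (ss t)^2 / 2"
  proof (rule total_estimate[OF M1 r ru BB_ge(1,2) ZZ_nonneg _ al_nonneg _ known_nonneg(10) W2_nonneg D1(2) FF_nonneg[OF t(1)]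
        _ D2(2) D4_def D3(2) NN_ge[OF t(1)] _ W1_def _ VV_lower[OF t(1)] refl _ rd_nonneg(1) _ rd_nonneg(2)])
    show "0 \<le> ri t" using ri_props[OF t(1)] by simp
    show "0 \<le> tth t" using th by simp
    show "M * FF t \<le> 5 * M^2 * BB t ^ 4 * (1 + \<theta>^2) * (XX t)^2 + 25 * M ^ 6 * BB1 t ^ 10 * rr t * ZZ t
       + 15 * M^2 * BB1 t ^ 10 * (XX t)^2 / rr t + 10 * M^2 * (BB1 t)^2 * (ss t)^2 + ri t * al t / 4"
      unfolding FF_def
      by (rule emission_estimate[OF M1 BB_ge(1,2) r ZZ_nonneg _ ri_props(2)[OF t(1)] Sq_bound[OF t(1), folded ri_def] mu_bound[OF t(1), folded ri_def]])
         (use ri_props[OF t(1)] in simp)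
    show "q (x1 t) = 200 * M^28 * BB t ^ 4" by (simp add: q)
    show "WW2' t = WW2 t + 200 * M^28 * (BB1 t)^2" by (simp add: W2'_def yy_fst)
    show "RRu t = (2 * WW2' t / mu_lo K)^2 + 8 * M^2 * WW2' t" by (rule Ruf_def)
    show "rd t = (rr t)^2 * W1 (x1 t) (tth t)" if "rr t < 8 * M^2 * W1 (x1 t) (tth t)"
      unfolding rd_eq using gate_props(3)[of "8 * M^2 * W1 (x1 t) (tth t) - rr t"] that by simp
    show "rud t = rru t ^ 3 * WW2' t" if "rru t < RRu t"
      unfolding rud_eq using gate_props(3)[of "RRu t - rru t"] that ru by simp
  qed
  ultimately show ?thesis unfolding Diss_def Emis_def by (intro exI[of _ "D1 + D4 + D2 + D3"]) (simp add: algebra_simps)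
qed

end

section \<open>Energy balance over the delay\<close>

lemma bounded_on_cball:
  fixes f :: "'a::euclidean_space => real"
  assumes "continuous_on UNIV f"
  shows "\<exists>c. \<forall>z. norm z \<le> R \<longrightarrow> \<bar>f z\<bar> \<le> c"
proof -
  have "compact (f ` cball 0 R)" using assms by (intro compact_continuous_image) (auto intro: continuous_on_subset)
  then obtain c where "\<forall>y\<in>f ` cball 0 R. norm y \<le> c" using compact_imp_bounded bounded_iff by blast
  then show ?thesis by (intro exI[of _ c]) auto
qed

context loop begin

lemma cont_x1: "continuous_on HT x1" "continuous_on HT (\<lambda>t. xc t i)"
  unfolding x1_def[abs_def] xc_def by (intro continuous_intros cont_sig)+

lemma cont_zc: "i \<in> II ==> continuous_on HT (\<lambda>t. zc t i)"
  unfolding zc_def by (intro continuous_intros cont_sig cont_x1 cont_compose1[OF cont_f_obs])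

lemma cont_vt: "continuous_on HT vt"
  unfolding vt_def[abs_def] by (intro continuous_intros cont_sig cont_x1 cont_compose1[OF cont_v1])

lemma cont_ep: "i \<in> II ==> continuous_on HT (\<lambda>t. ep t i)"
  unfolding ep_def using ge1(1) by (intro continuous_intros cont_zc cont_x1 cont_sig) fastforce+

lemma cont_om: "i \<in> II ==> continuous_on HT (\<lambda>t. om t i)"
proof -
  assume i: "i \<in> II"
  have "continuous_on HT (\<lambda>t. (zc t i + (if i = 2 then vt t else 0)) / rr t ^ (i-1))"
    using ge1(1) i by (cases "i = 2") (auto intro!: continuous_intros cont_zc cont_vt cont_sig, fastforce+)
  then show ?thesis using om_eq[OF _ i] by (simp cong: continuous_on_cong)
qed

lemma cont_muc: "continuous_on HT muc"
proof -
  have c: "continuous_on UNIV (\<lambda>(t, x, \<psi>, u). mu P t x \<psi> u)" using pc by (simp add: plant_continuous_def)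
  have "continuous_on HT (\<lambda>t. (t, x_sig w t, psi t, uu t))" by (intro continuous_intros cont_sig)
  from continuous_on_compose2[OF c this] show ?thesis by (simp add: muc_def[abs_def])
qed

lemma cont_ss: "continuous_on HT ss"
  unfolding ss_def[abs_def] ut_eq by (intro continuous_intros cont_muc cont_sig cont_compose1[OF cont_bh] cont_x1 cont_om) auto

lemma cont_al: "continuous_on HT al"
proof -
  have "continuous_on {0..} (alpha_psi K)" using reg by (simp add: known_regular_def class_K_infinity_def)
  then show ?thesis unfolding al_def[abs_def]
    by (rule continuous_on_compose2) (auto intro!: continuous_intros cont_sig)
qed

lemma cont_ri: "continuous_on HT ri"
  unfolding ri_def[abs_def] using ge1(1) by (intro continuous_intros cont_sig) fastforce

lemma cont_FF: "continuous_on HT FF"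
  unfolding FF_def[abs_def] Sq_def using M1
  by (intro continuous_intros cont_compose1[OF cont_Bx] cont_x1 cont_ri cont_muc cont_al) auto

lemma cont_ZZ: "continuous_on HT ZZ"
  unfolding ZZ_def[abs_def] eN_def oN_def L2_set_sq[OF finite_atLeastAtMost]
  by (intro continuous_on_add continuous_on_sum continuous_on_power cont_ep cont_om)

lemma cont_Diss: "continuous_on HT Diss"
  unfolding Diss_def[abs_def]
  by (intro continuous_on_add continuous_on_mult continuous_on_divide continuous_on_power continuous_on_const
      continuous_on_rabs continuous_on_real_sqrt cont_sig cont_ZZ cont_ri cont_al cont_x1 cont_ss) (use M1 in auto)

lemma cont_form:
  assumes B: "bform II B" and v: "\<And>i. i \<in> II ==> continuous_on HT (\<lambda>t. v t i)"
  shows "continuous_on HT (\<lambda>t. B (v t) (v t))"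
proof -
  define c where "c i j = B (\<lambda>k. if k = i then 1 else 0) (\<lambda>k. if k = j then 1 else 0)" for i j
  have e: "B (v t) (v t) = (\<Sum>i\<in>II. \<Sum>j\<in>II. v t i * v t j * c i j)" for t
    unfolding c_def by (rule bform_expand[OF B finite_atLeastAtMost])
  show ?thesis unfolding e by (intro continuous_on_sum continuous_on_mult continuous_on_const v)
qed

lemma cont_coreV: "continuous_on HT coreV"
  unfolding coreV_def[abs_def]
  by (intro cont_form[OF Bo] cont_form[OF Bc] continuous_on_add continuous_on_mult continuous_on_sum continuous_on_divide continuous_on_power continuous_on_const
      cont_sig cont_x1 cont_ep cont_om) auto

lemma cont_Vpsi: "continuous_on HT (\<lambda>t. V (psi t))"
proof -
  have "continuous_on UNIV V"
  proof (intro continuous_at_imp_continuous_on ballI)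
    fix \<psi>
    obtain D where "GDERIV V \<psi> :> D" using Vc unfolding lyapunov_candidate_def by blast
    then show "isCont V \<psi>" unfolding gderiv_def by (rule has_derivative_continuous)
  qed
  then show ?thesis by (rule cont_compose1) (rule cont_sig)
qed

lemma cont_VV: "continuous_on HT VV"
  unfolding VV_def[abs_def] using ge1 by (intro continuous_intros cont_coreV cont_sig cont_Vpsi cont_ss) fastforce+

lemma cont_wt: "continuous_on HT wt"
  unfolding wt_def[abs_def] using ge1 by (intro continuous_intros cont_sig) fastforce+

lemma wt_ge: "t \<in> HT ==> 1 \<le> wt t"
  using ge1[of t] M1 by (simp add: wt_def)

lemma wt_anti: "t \<in> HT ==> 0 \<le> s ==> s \<le> t ==> wt t \<le> wt s"
proof -
  assume t: "t \<in> HT" "0 \<le> s" "s \<le> t"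
  have s: "s \<in> HT" using horizon_sub t by blast
  have "2 * M / rr t \<le> 2 * M / rr s" using r_mono[OF t] ge1(1)[OF s] ge1(1)[OF t(1)] M1 by (intro divide_left_mono) auto
  moreover have "2 * M * (1 + \<theta>^2) / rru t \<le> 2 * M * (1 + \<theta>^2) / rru s"
    using ru_mono[OF t] ge1(2)[OF s] ge1(2)[OF t(1)] M1 by (intro divide_left_mono) auto
  ultimately show "wt t \<le> wt s" by (simp add: wt_def)
qed

lemma VV_nonneg: "t \<in> HT ==> 0 \<le> VV t"
  using VV_lower[of t] ge1[of t] ZZ_nonneg[of t] M1
  by (smt (verit) divide_nonneg_nonneg mult_nonneg_nonneg real_sqrt_ge_zero zero_le_power2)

lemma Diss_nonneg: "t \<in> HT ==> 0 \<le> Diss t"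
  unfolding Diss_def using ge1[of t] ZZ_nonneg[of t] ri_props[of t] al_nonneg[of t] known_nonneg(10) by auto

lemma delay_at: "0 < t ==> \<exists>D. (delay P has_real_derivative D) (at t) \<and> \<bar>D\<bar> \<le> Delta_bar K"
  using delay_props(3)[of t] at_within_nonneg[of t] by auto

lemma dd_deriv: "0 < t ==> \<exists>D. (dd has_real_derivative D) (at t) \<and> 1 - Delta_bar K \<le> D"
proof -
  assume "0 < t"
  then obtain D where D: "(delay P has_real_derivative D) (at t)" "\<bar>D\<bar> \<le> Delta_bar K" using delay_at by blast
  have "(dd has_real_derivative 1 - D) (at t)" unfolding dd_def[abs_def] by (intro DERIV_diff DERIV_ident D)
  then show ?thesis using D(2) by (intro exI[of _ "1 - D"]) auto
qed

lemma cont_dd: "continuous_on {0..} dd"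
proof -
  have "continuous_on {0..} (delay P)" unfolding continuous_on_eq_continuous_within
  proof
    fix t :: real assume "t \<in> {0..}"
    then obtain D where "(delay P has_real_derivative D) (at t within {0..})" using delay_props(3)[of t] by auto
    then show "continuous (at t within {0..}) (delay P)" by (rule DERIV_continuous)
  qed
  then show ?thesis unfolding dd_def[abs_def] by (intro continuous_intros)
qed

lemma dd_strict: "0 \<le> s ==> s < t ==> dd s < dd t"
proof (rule DERIV_pos_imp_increasing_open[of s t dd])
  show "\<exists>y. (dd has_real_derivative y) (at x) \<and> 0 < y" if "0 \<le> s" "s < t" "s < x" "x < t" for x
    using dd_deriv[of x] that known_nonneg(14) by force
  show "continuous_on {s..t} dd" if "0 \<le> s" by (rule continuous_on_subset[OF cont_dd]) (use that in auto)
qed auto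

text \<open>
  Since \<open>\<bar>\<Delta>'\<bar> < 1\<close>, the delayed time is strictly increasing and passes 0 at most once.
\<close>

lemma crossing: "\<exists>e. \<forall>t\<ge>0. dd t = 0 \<longrightarrow> t = e"
  using dd_strict by (metis linorder_neqE_linordered_idom order_less_irrefl)

text \<open>
  \<open>Gx c\<close> is a primitive of the weighted emission, continued to the past with the constant rate
  \<open>c\<close>, an upper bound of what the initial history emits.
\<close>

definition "gg t = wt t * FF t"
definition "Gx c s = c * min s 0 + integral {0..max 0 s} gg"

lemma cont_gg: "continuous_on HT gg" unfolding gg_def[abs_def] by (intro continuous_intros cont_wt cont_FF)

lemma gg_nonneg: "t \<in> HT ==> 0 \<le> gg t" using wt_ge[of t] FF_nonneg[of t] by (simp add: gg_def)

lemma sub_HT: "b \<in> HT ==> {0..b} \<subseteq> HT" using horizon_sub by auto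

lemma Gx_neg: "s < 0 ==> (Gx c has_real_derivative c) (at s)"
proof -
  assume s: "s < 0"
  have "((\<lambda>s. c * s + integral {0..0} gg) has_real_derivative c) (at s)" by (auto intro!: derivative_eq_intros)
  then show ?thesis
    by (rule has_field_derivative_transform_within_open[of _ _ _ "{..<0}"]) (use s in \<open>auto simp: Gx_def\<close>)
qed

lemma Gx_pos: "s \<in> HT ==> 0 < s ==> (Gx c has_real_derivative gg s) (at s)"
proof -
  assume s: "s \<in> HT" "0 < s"
  obtain s' where s': "s < s'" "s' \<in> HT" using HT_open_right[OF s(1)] by blast
  have "((\<lambda>x. integral {0..x} gg) has_real_derivative gg s) (at s within {0..s'})"
    by (rule integral_has_real_derivative) (use s s' continuous_on_subset[OF cont_gg sub_HT] in auto)
  moreover have "at s within {0..s'} = at s" using s s' by (intro at_within_interior) (simp add: interior_atLeastAtMost_real)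
  ultimately have "((\<lambda>x. integral {0..x} gg) has_real_derivative gg s) (at s)" by simp
  then show ?thesis
    by (rule has_field_derivative_transform_within_open[of _ _ _ "{0<..}"]) (use s in \<open>auto simp: Gx_def\<close>)
qed

lemma Gx_cont: "b \<in> HT ==> continuous_on {..b} (Gx c)"
proof -
  assume b: "b \<in> HT"
  have i: "continuous_on {0..b} (\<lambda>x. integral {0..x} gg)"
    by (intro indefinite_integral_continuous_1 integrable_continuous_interval continuous_on_subset[OF cont_gg sub_HT[OF b]])
  have "continuous_on {..b} (\<lambda>s. integral {0..max 0 s} gg)"
    by (rule continuous_on_compose2[OF i]) (use HT_nonneg[OF b] in \<open>auto intro!: continuous_intros\<close>)
  then show ?thesis unfolding Gx_def[abs_def] by (intro continuous_intros)
qed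

lemma Gx_mono: "0 \<le> c ==> t \<in> HT ==> s \<le> t ==> Gx c s \<le> Gx c t"
proof -
  assume a: "0 \<le> c" "t \<in> HT" "s \<le> t"
  have t0: "0 \<le> t" using HT_nonneg a by auto
  have io: "gg integrable_on {u..t}" if "0 \<le> u" for u
    using that by (intro integrable_continuous_interval continuous_on_subset[OF cont_gg] order_trans[OF _ sub_HT[OF a(2)]]) auto
  have "integral {0..max 0 s} gg \<le> integral {0..t} gg"
    by (rule integral_subset_le) (use a t0 io[of 0] integrable_on_subinterval[OF io[of 0], of 0 "max 0 s"] gg_nonneg sub_HT[OF a(2)] in auto)
  moreover have "c * min s 0 \<le> c * min t 0" using a by (intro mult_left_mono) auto
  ultimately show ?thesis using t0 by (simp add: Gx_def max_def)
qed

lemma wt_deriv: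
  assumes t: "t \<in> HT" "0 < t"
  shows "(wt has_real_derivative - wt t * (2 * M * (rd t / (rr t)^2) + 2 * M * (1 + \<theta>^2) * (rud t / (rru t)^2))) (at t)"
proof -
  note d = deriv_at[OF t]
  have r: "rr t \<noteq> 0" "rru t \<noteq> 0" using ge1[OF t(1)] by auto
  have "((\<lambda>t. 2 * M / rr t + 2 * M * (1 + \<theta>^2) / rru t) has_real_derivative
      (0 * rr t - 2 * M * rd t) / (rr t * rr t) + (0 * rru t - 2 * M * (1 + \<theta>^2) * rud t) / (rru t * rru t)) (at t)"
    by (intro DERIV_add DERIV_divide DERIV_const d r)
  from DERIV_chain2[OF DERIV_exp this] show ?thesis
    unfolding wt_def[abs_def] by (rule DERIV_cong) (use r in \<open>simp add: field_simps power2_eq_square\<close>)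
qed

text \<open>
  Both the weight and \<open>1 / r ^ (2n)\<close> are non-increasing, hence larger at the time of emission than at
  the time of reception.
\<close>

lemma emission_future:
  assumes t: "t \<in> HT" and d: "0 \<le> dd t"
  shows "wt t * Emis t \<le> gg (dd t)"
proof -
  have s: "dd t \<in> HT" using horizon_sub[OF t d] delay_props(2)[of t] HT_nonneg[OF t] by auto
  have le: "dd t \<le> t" using delay_props(2)[of t] HT_nonneg[OF t] by auto
  have "ri t \<le> ri (dd t)"
    unfolding ri_def using r_mono[OF t d le] ge1(1)[OF s] by (intro divide_left_mono power_mono) auto
  then have "Emis t \<le> FF (dd t)" unfolding Emis_eq using ri_props[OF t] by (intro emission_le_FF[OF s]) auto
  then have "wt t * Emis t \<le> wt t * FF (dd t)" using wt_ge[OF t] by (intro mult_left_mono) auto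
  also have "... \<le> wt (dd t) * FF (dd t)" using wt_anti[OF t d le] FF_nonneg[OF s] by (intro mult_right_mono) auto
  finally show ?thesis by (simp add: gg_def)
qed

lemma emission_past:
  assumes t: "t \<in> HT" and d: "dd t < 0" and c: "0 \<le> c0"
    "\<And>\<sigma>. dd 0 \<le> \<sigma> ==> \<sigma> < 0 ==> Es0 \<sigma> + (Ed0 \<sigma>)^2 / (8 * M^2) \<le> c0"
  shows "wt t * Emis t \<le> wt 0 * c0"
proof -
  have t0: "0 \<le> t" using HT_nonneg[OF t] .
  have "dd 0 \<le> dd t" using dd_strict[of 0 t] t0 by (cases "t = 0") auto
  then have "Es0 (dd t) + (Ed0 (dd t))^2 / (8 * M^2) \<le> c0" using c(2) d by blast
  then have "Emis t \<le> ri t * c0" unfolding Emis_eq using ri_props[OF t] by (intro mult_left_mono) auto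
  also have "... \<le> 1 * c0" using ri_props[OF t] c by (intro mult_right_mono) auto
  finally have "wt t * Emis t \<le> wt t * c0" using wt_ge[OF t] by (intro mult_left_mono) auto
  also have "... \<le> wt 0 * c0" using wt_anti[OF t] t0 c by (intro mult_right_mono) auto
  finally show ?thesis .
qed

text \<open>
  The functional \<open>U\<close> in the proof adds to the weighted storage function the emissions that are
  under way, \<open>M (Gx t - Gx (t - \<Delta>))\<close>. Its derivative pays \<open>M FF\<close> at emission and
  returns at least the amount received, because \<open>M (1 - \<Delta>') \<ge> 1\<close>.
\<close>

theorem energy_bound:
  assumes c: "0 \<le> c0" "\<And>\<sigma>. dd 0 \<le> \<sigma> ==> \<sigma> < 0 ==> Es0 \<sigma> + (Ed0 \<sigma>)^2 / (8 * M^2) \<le> c0"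
    and b: "b \<in> HT"
  shows "VV b + integral {0..b} Diss \<le> wt 0 * VV 0 + M * (wt 0 * c0 * delay P 0)"
proof -
  define c' where "c' = wt 0 * c0"
  have b0: "0 \<le> b" using HT_nonneg[OF b] .
  have z: "0 \<in> HT" using horizon_sub[OF b, of 0] b0 by simp
  have c'0: "0 \<le> c'" using wt_ge[OF z] c by (simp add: c'_def)
  define U where "U t = wt t * VV t + M * (Gx c' t - Gx c' (dd t)) + integral {0..t} Diss" for t
  obtain e where e: "\<And>t. 0 \<le> t ==> dd t = 0 ==> t = e" using crossing by blast
  have sub: "{0..b} \<subseteq> HT" by (rule sub_HT[OF b])
  have "U b \<le> U 0"
  proof (rule nonincreasing_except_one[where f=U and e=e])
    show "continuous_on {0..b} U" unfolding U_def[abs_def]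
    proof (intro continuous_intros continuous_on_subset[OF cont_wt sub] continuous_on_subset[OF cont_VV sub])
      show "continuous_on {0..b} (Gx c')" by (rule continuous_on_subset[OF Gx_cont[OF b]]) auto
      show "continuous_on {0..b} (\<lambda>x. Gx c' (dd x))"
        by (rule continuous_on_compose2[OF Gx_cont[OF b] continuous_on_subset[OF cont_dd]])
           (use delay_props(2) in fastforce)+
      show "continuous_on {0..b} (\<lambda>x. integral {0..x} Diss)"
        by (intro indefinite_integral_continuous_1 integrable_continuous_interval continuous_on_subset[OF cont_Diss sub])
    qed
    fix t assume t: "0 < t" "t < b" "t \<noteq> e"
    have tH: "t \<in> HT" using t sub by auto
    have dn: "dd t \<noteq> 0" using e[of t] t by auto
    obtain D where D: "(VV has_real_derivative D) (at t)"
      "D + M * FF t - Emis t - (2 * M * (rd t / (rr t)^2) + 2 * M * (1 + \<theta>^2) * (rud t / (rru t)^2)) * VV t \<le> - Diss t"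
      using VV_deriv[OF tH t(1) dn] by blast
    define kl where "kl = 2 * M * (rd t / (rr t)^2) + 2 * M * (1 + \<theta>^2) * (rud t / (rru t)^2)"
    obtain D' where D': "(dd has_real_derivative D') (at t)" "1 - Delta_bar K \<le> D'" using dd_deriv[OF t(1)] by blast
    define g' where "g' = (if dd t < 0 then c' else gg (dd t))"
    have dle: "dd t \<le> t" using delay_props(2)[of t] t by auto
    have g'd: "(Gx c' has_real_derivative g') (at (dd t))"
    proof (cases "dd t < 0")
      case True then show ?thesis using Gx_neg by (simp add: g'_def)
    next
      case False
      then have "0 < dd t" using dn by simp
      moreover have "dd t \<in> HT" using horizon_sub[OF tH] False dle by auto
      ultimately show ?thesis using Gx_pos False by (simp add: g'_def)
    qed
    have em: "wt t * Emis t \<le> g'"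
    proof (cases "dd t < 0")
      case True
      then show ?thesis using emission_past[OF tH True c] by (simp add: g'_def c'_def)
    next
      case False
      then show ?thesis using emission_future[OF tH] by (simp add: g'_def)
    qed
    have g'0: "0 \<le> g'"
      using c'0 gg_nonneg[of "dd t"] horizon_sub[OF tH, of "dd t"] dle by (auto simp: g'_def)
    have Dd: "((\<lambda>x. integral {0..x} Diss) has_real_derivative Diss t) (at t)"
    proof -
      have "((\<lambda>x. integral {0..x} Diss) has_real_derivative Diss t) (at t within {0..b})"
        by (rule integral_has_real_derivative) (use t continuous_on_subset[OF cont_Diss sub] in auto)
      moreover have "at t within {0..b} = at t" using t by (intro at_within_interior) (simp add: interior_atLeastAtMost_real)
      ultimately show ?thesis by simp
    qed
    have "(U has_real_derivative (- wt t * kl) * VV t + D * wt t + M * (gg t - g' * D') + Diss t) (at t)"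
      unfolding U_def[abs_def] kl_def
      by (intro DERIV_add DERIV_mult DERIV_cmult DERIV_diff wt_deriv[OF tH t(1)] D(1) Gx_pos[OF tH t(1)]
            DERIV_chain2[OF g'd D'(1)] Dd)
    moreover have "(- wt t * kl) * VV t + D * wt t + M * (gg t - g' * D') + Diss t \<le> 0"
    proof -
      have w1: "1 \<le> wt t" by (rule wt_ge[OF tH])
      have "wt t * (D + M * FF t - Emis t - kl * VV t) \<le> wt t * (- Diss t)"
        using D(2) w1 unfolding kl_def by (intro mult_left_mono) auto
      then have "(- wt t * kl) * VV t + D * wt t + M * gg t \<le> wt t * Emis t - wt t * Diss t"
        by (simp add: gg_def algebra_simps)
      moreover have "1 * Diss t \<le> wt t * Diss t" using w1 Diss_nonneg[OF tH] by (intro mult_right_mono) auto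
      moreover have "g' \<le> M * (g' * D')"
      proof -
        have "1 \<le> M * (1 - Delta_bar K)" using LM known_nonneg(14) by (simp add: field_simps)
        also have "... \<le> M * D'" using D'(2) M1 by (intro mult_left_mono) auto
        finally have "1 * g' \<le> (M * D') * g'" using g'0 by (intro mult_right_mono) auto
        then show ?thesis by (simp add: mult_ac)
      qed
      ultimately show ?thesis using em by (simp add: right_diff_distrib)
    qed
    ultimately show "\<exists>D\<le>0. (U has_real_derivative D) (at t)" by blast
  qed (rule b0)
  moreover have "U 0 = wt 0 * VV 0 + M * (c' * delay P 0)"
    using delay_props(1)[of 0] by (simp add: U_def Gx_def dd_def min_def max_def)
  moreover have "VV b + integral {0..b} Diss \<le> U b"
  proof -
    have "Gx c' (dd b) \<le> Gx c' b" by (rule Gx_mono[OF c'0 b]) (use delay_props(2)[OF b0] in auto)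
    then have "0 \<le> M * (Gx c' b - Gx c' (dd b))" using M1 by simp
    moreover have "1 * VV b \<le> wt b * VV b" using wt_ge[OF b] VV_nonneg[OF b] by (intro mult_right_mono) auto
    ultimately show ?thesis by (simp add: U_def)
  qed
  ultimately show ?thesis by (simp add: c'_def)
qed

lemma r_bound:
  assumes w1: "\<And>t. t \<in> HT ==> 8 * M^2 * W1 (x1 t) (tth t) \<le> w1" and b: "b \<in> HT"
  shows "rr b \<le> max (rr 0) (w1 + 1)"
proof (rule stays_below[where f=rr and e="-1"])
  show "0 \<le> b" by (rule HT_nonneg[OF b])
  show "continuous_on {0..b} rr" by (rule continuous_on_subset[OF cont_sig(1) sub_HT[OF b]])
  fix t assume t: "0 < t" "t < b" "max (rr 0) (w1 + 1) < rr t"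
  have tH: "t \<in> HT" using sub_HT[OF b] t by auto
  have "rd t = 0" unfolding rd_eq using gate_props(4)[of "8 * M^2 * W1 (x1 t) (tth t) - rr t"] w1[OF tH] t by simp
  then show "\<exists>D\<le>0. (rr has_real_derivative D) (at t)" using deriv_at(1)[OF tH t(1)] by auto
qed simp

lemma ru_bound:
  assumes w1: "\<And>t. t \<in> HT ==> RRu t \<le> w1" and b: "b \<in> HT"
  shows "rru b \<le> max (rru 0) (w1 + 1)"
proof (rule stays_below[where f=rru and e="-1"])
  show "0 \<le> b" by (rule HT_nonneg[OF b])
  show "continuous_on {0..b} rru" by (rule continuous_on_subset[OF cont_sig(2) sub_HT[OF b]])
  fix t assume t: "0 < t" "t < b" "max (rru 0) (w1 + 1) < rru t"
  have tH: "t \<in> HT" using sub_HT[OF b] t by auto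
  have "rud t = 0" unfolding rud_eq using gate_props(4)[of "RRu t - rru t"] w1[OF tH] t by simp
  then show "\<exists>D\<le>0. (rru has_real_derivative D) (at t)" using deriv_at(2)[OF tH t(1)] by auto
qed simp

text \<open>
  The storage function controls \<open>s\<^sup>2\<close> only relative to \<open>sqrt r\<^sub>u\<close>. Here \<open>s\<^sup>2 / 2 + E / r\<^sub>u\<close> is shown
  to stay bounded: as long as \<open>r\<^sub>u < R\<^sub>u\<close>, the growth of \<open>s\<^sup>2\<close> is paid for by the decrease of
  \<open>E / r\<^sub>u\<close>; once \<open>r\<^sub>u \<ge> R\<^sub>u\<close>, the damping wins whenever \<open>s\<close> is not small. The crude bound
  \<open>\<bar>s\<bar> \<le> Wp\<close> by a known function is what makes the first case work.
\<close>

lemma tracking_error_bound: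
  assumes C: "0 \<le> C" "\<And>t. t \<in> HT ==> 0 < t ==>
      YY t + m1 (psi t) + m1t (psi t) + Ed0 (dd t) + m2 (psi t) * YY t + m2 (psi t) \<le> C" and b: "b \<in> HT"
  shows "(ss b)^2 \<le> (ss 0)^2 + 2 * (1 + C) + ((1 + C) / mu_lo K)^2"
proof -
  define E where "E = 1 + C"
  have E: "1 \<le> E" using C by (simp add: E_def)
  have ml: "0 < mu_lo K" by (rule known_nonneg)
  define Yf where "Yf t = (ss t)^2 / 2 + E / rru t" for t
  obtain e where e: "\<And>t. 0 \<le> t ==> dd t = 0 ==> t = e" using crossing by blast
  have b0: "0 \<le> b" using HT_nonneg[OF b] .
  have z: "0 \<in> HT" using horizon_sub[OF b, of 0] b0 by simp
  let ?m = "(ss 0)^2 / 2 + E + (E / mu_lo K)^2 / 2"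
  have "Yf b \<le> ?m"
  proof (rule stays_below[where f=Yf and e=e])
    show "continuous_on {0..b} Yf" unfolding Yf_def[abs_def]
      using ge1(2) sub_HT[OF b] by (intro continuous_intros continuous_on_subset[OF cont_ss] continuous_on_subset[OF cont_sig(2)]) fastforce+
    have "E / rru 0 \<le> E / 1" using ge1(2)[OF z] E by (intro divide_left_mono) auto
    then show "Yf 0 \<le> ?m" by (simp add: Yf_def add_increasing2)
    fix t assume t: "0 < t" "t < b" "t \<noteq> e" "?m < Yf t"
    have tH: "t \<in> HT" using sub_HT[OF b] t by auto
    have ru: "1 \<le> rru t" and r: "1 \<le> rr t" using ge1[OF tH] by auto
    have dn: "dd t \<noteq> 0" using e[of t] t by auto
    obtain D m where D: "(ss has_real_derivative D - m * rru t * ss t) (at t)" "mu_lo K \<le> m"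
      "\<bar>D\<bar> \<le> WP t * (YY t + \<bar>ss t\<bar> + m1 (psi t) + m1t (psi t) + Ed0 (dd t) + m2 (psi t) * YY t + m2 (psi t))"
      using ss_deriv[OF tH t(1) dn] by blast
    have Wp1: "1 \<le> WP t" by (rule Wp_ge)
    have Db: "\<bar>D\<bar> \<le> E * (WP t)^2"
    proof -
      have "YY t + \<bar>ss t\<bar> + m1 (psi t) + m1t (psi t) + Ed0 (dd t) + m2 (psi t) * YY t + m2 (psi t) \<le> C + WP t"
        using C(2)[OF tH t(1)] ss_abs[OF tH] by linarith
      also have "... \<le> E * WP t" using C(1) Wp1 mult_left_mono[OF Wp1 C(1)] by (simp add: E_def distrib_right)
      finally have "\<bar>D\<bar> \<le> WP t * (E * WP t)" using D(3) Wp1 by (meson mult_left_mono order_trans zero_le_one)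
      then show ?thesis by (simp add: power2_eq_square mult_ac)
    qed
    have W4: "WP t ^ 4 \<le> WW2' t"
    proof -
      have "1 * 1 \<le> M^2 * rr t ^ (2*n)" using M1 r by (intro mult_mono one_le_power) auto
      then have "1 * WP t ^ 4 \<le> (30 * M^2 * rr t ^ (2*n)) * WP t ^ 4" using Wp1 by (intro mult_right_mono) auto
      also have "... = WW2 t" by (simp add: W2_def)
      also have "... \<le> WW2' t" by (rule W2'_ge)
      finally show ?thesis by simp
    qed
    have DY: "(Yf has_real_derivative ss t * (D - m * rru t * ss t) - E * rud t / (rru t)^2) (at t)"
    proof -
      have "((\<lambda>s. (ss s)^2 / 2) has_real_derivative ss t * (D - m * rru t * ss t)) (at t)"
        using DERIV_cdivide[OF DERIV_power[OF D(1), of 2], of 2] by (simp add: mult_ac)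
      moreover have "((\<lambda>s. E / rru s) has_real_derivative - (E * rud t / (rru t)^2)) (at t)"
        using DERIV_divide[OF DERIV_const[of E] deriv_at(2)[OF tH t(1)]] ru by (simp add: power2_eq_square)
      ultimately show ?thesis unfolding Yf_def[abs_def] using DERIV_add by fastforce
    qed
    have big: "(E / mu_lo K)^2 \<le> (ss t)^2"
    proof -
      have "E / rru t \<le> E / 1" using ru E by (intro divide_left_mono) auto
      moreover have "b \<le> s" if "y / 1 = E" "x \<le> y / 1" "a / 2 + E + b / 2 < s / 2 + x" "0 \<le> a" for a b s x y :: real
        using that by linarith
      ultimately show ?thesis using t(4) zero_le_power2[of "ss 0"] unfolding Yf_def by (metis div_by_1)
    qed
    have sD: "ss t * (D - m * rru t * ss t) \<le> \<bar>ss t\<bar> * \<bar>D\<bar> - mu_lo K * rru t * (ss t)^2"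
    proof -
      have "ss t * D \<le> \<bar>ss t\<bar> * \<bar>D\<bar>" by (metis abs_ge_self abs_mult)
      moreover have "mu_lo K * (rru t * (ss t)^2) \<le> m * (rru t * (ss t)^2)" using D(2) ru by (intro mult_right_mono) auto
      ultimately show ?thesis by (simp add: algebra_simps power2_eq_square)
    qed
    have "ss t * (D - m * rru t * ss t) - E * rud t / (rru t)^2 \<le> 0"
    proof (cases "rru t < RRu t")
      case True
      then have "rud t = rru t ^ 3 * WW2' t"
        unfolding rud_eq using gate_props(3)[of "RRu t - rru t"] ru by simp
      then have e1: "E * rud t / (rru t)^2 = rru t * (E * WW2' t)"
        using ru by (simp add: field_simps power2_eq_square power3_eq_cube)
      have "\<bar>ss t\<bar> * \<bar>D\<bar> \<le> WP t * (E * (WP t)^2)" using ss_abs[OF tH] Db E by (intro mult_mono) auto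
      also have "... = E * WP t ^ 3" by (simp add: eval_nat_numeral)
      also have "... \<le> E * WP t ^ 4" using E Wp1 by (intro mult_left_mono power_increasing) auto
      also have "... \<le> 1 * (E * WW2' t)" using W4 E by simp
      also have "... \<le> rru t * (E * WW2' t)" using ru E W2'_ge(1)[of "yy t" "uu t" "rr t" "rd t" "tth t" "vp t"]
        by (intro mult_right_mono mult_nonneg_nonneg) auto
      finally show ?thesis using sD e1 ml ru by (smt (verit) mult_nonneg_nonneg zero_le_power2)
    next
      case False
      have "WP t ^ 4 \<le> rru t"
      proof -
        have m8: "1 \<le> 8 * M^2" using one_le_power[OF M1, of 2] by linarith
        have "1 * WW2' t \<le> 8 * M^2 * WW2' t"
          using m8 W2'_ge(1)[of "yy t" "uu t" "rr t" "rd t" "tth t" "vp t"] by (intro mult_right_mono) auto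
        also have "... \<le> RRu t" unfolding Ruf_def by simp
        finally show ?thesis using W4 False by simp
      qed
      then have "(E * (WP t)^2)^2 \<le> E^2 * rru t" by (simp add: power_mult_distrib mult_left_mono flip: power_mult)
      moreover have "D^2 \<le> (E * (WP t)^2)^2" using power_mono[OF Db, of 2] by simp
      ultimately have D2: "D^2 \<le> E^2 * rru t" by linarith
      have k: "0 < mu_lo K * rru t / 2" using ml ru by simp
      have "\<bar>ss t\<bar> * \<bar>D\<bar> \<le> (mu_lo K * rru t / 2) * \<bar>ss t\<bar>^2 + \<bar>D\<bar>^2 / (4 * (mu_lo K * rru t / 2))" by (rule young[OF k])
      also have "\<bar>D\<bar>^2 / (4 * (mu_lo K * rru t / 2)) \<le> (E^2 * rru t) / (4 * (mu_lo K * rru t / 2))"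
        using D2 k by (intro divide_right_mono) auto
      also have "... = mu_lo K / 2 * (E / mu_lo K)^2" using ml ru by (simp add: field_simps power2_eq_square)
      also have "... \<le> mu_lo K / 2 * (rru t * (ss t)^2)"
      proof (rule mult_left_mono)
        have "1 * (ss t)^2 \<le> rru t * (ss t)^2" using ru by (intro mult_right_mono) auto
        then show "(E / mu_lo K)^2 \<le> rru t * (ss t)^2" using big by linarith
      qed (use ml in auto)
      finally have "\<bar>ss t\<bar> * \<bar>D\<bar> \<le> mu_lo K * rru t * (ss t)^2" by simp
      moreover have "0 \<le> E * rud t / (rru t)^2" using E rd_nonneg(2)[of t] by simp
      ultimately show ?thesis using sD by linarith
    qed
    then show "\<exists>D\<le>0. (Yf has_real_derivative D) (at t)" using DY by blast
  qed (rule b0)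
  moreover have "0 \<le> E / rru b" using E ge1(2)[OF b] by simp
  ultimately have "(ss b)^2 / 2 \<le> ?m" unfolding Yf_def by linarith
  then show ?thesis by (simp add: E_def)
qed

text \<open>
  The slope of \<open>\<mu>\<close> in \<open>u\<close> is at least \<open>mu_lo\<close>, so \<open>\<bar>u\<bar>\<close> is controlled by the change of \<open>\<mu>\<close> between
  the inputs 0 and \<open>u\<close>.
\<close>

lemma uu_bound:
  assumes t: "t \<in> HT"
  shows "mu_lo K * \<bar>uu t\<bar> \<le> \<bar>muc t\<bar> + mu_bar K (yy t) 0"
proof -
  define g where "g v = mu P t (x_sig w t) (psi t) v" for v
  have dg: "\<exists>D. (g has_real_derivative D) (at v) \<and> mu_lo K \<le> D" for v
  proof -
    obtain Dt Dx D\<psi> Du where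
      der: "((\<lambda>(t, x, \<psi>, u). mu P t x \<psi> u) has_derivative
               (\<lambda>(ht, hx, h\<psi>, hu). Dt * ht + Dx \<bullet> hx + D\<psi> \<bullet> h\<psi> + Du * hu)) (at (t, x_sig w t, psi t, v))"
      and Du: "mu_lo K \<le> Du"
      using mb psi_in[OF t] unfolding mu_bounds_def by blast
    have "((\<lambda>s. (t, x_sig w t, psi t, s)) has_vector_derivative (0, 0, 0, 1)) (at v)"
      by (intro has_vector_derivative_Pair) (auto intro!: derivative_eq_intros)
    from vector_derivative_diff_chain_within[OF this has_derivative_at_withinI[OF der]]
    have "(g has_real_derivative Du) (at v)"
      by (simp add: o_def g_def[abs_def] has_real_derivative_iff_has_vector_derivative)
    then show ?thesis using Du by blast
  qed
  have cg: "continuous_on A g" for A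
    using dg by (meson DERIV_continuous continuous_at_imp_continuous_on)
  have inc: "mu_lo K * (v - u) \<le> g v - g u" if "u \<le> v" for u v
  proof -
    have "\<exists>z. u \<le> z" by auto
    have "mu_lo K * v - g v \<le> mu_lo K * u - g u"
    proof (rule nonincreasing_except_one[where f="\<lambda>v. mu_lo K * v - g v" and e=u])
      show "continuous_on {u..v} (\<lambda>v. mu_lo K * v - g v)" by (intro continuous_intros cg)
      fix s assume "u < s" "s < v"
      obtain D where D: "(g has_real_derivative D) (at s)" "mu_lo K \<le> D" using dg by blast
      have "((\<lambda>v. mu_lo K * v - g v) has_real_derivative mu_lo K - D) (at s)"
        by (auto intro!: derivative_eq_intros D)
      then show "\<exists>D\<le>0. ((\<lambda>v. mu_lo K * v - g v) has_real_derivative D) (at s)" using D(2) by (intro exI[of _ "mu_lo K - D"]) auto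
    qed (rule that)
    then show ?thesis by (simp add: algebra_simps)
  qed
  have "\<bar>g 0\<bar> \<le> mu_bar K (yy t) 0"
    using mb psi_in[OF t] unfolding mu_bounds_def g_def yy_outp by blast
  moreover have "mu_lo K * \<bar>uu t\<bar> \<le> \<bar>g (uu t)\<bar> + \<bar>g 0\<bar>"
  proof (cases "0 \<le> uu t")
    case True then show ?thesis using inc[OF True] by simp
  next
    case False
    then show ?thesis using inc[of "uu t" 0] by simp
  qed
  ultimately show ?thesis by (simp add: g_def muc_def)
qed

end

section \<open>Bounds that depend on the initial data only\<close>

definition signals_within :: "real => ('n::finite, 'p::finite, 'm::finite) signals => real => bool" where
  "signals_within Bd w t \<longleftrightarrow> norm (x_sig w t) \<le> Bd \<and> norm (psi_sig w t) \<le> Bd \<and>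
     \<bar>u_sig w t\<bar> \<le> Bd \<and> norm (xh_sig w t) \<le> Bd \<and> \<bar>zeta_sig w t\<bar> \<le> Bd \<and> \<bar>r_sig w t\<bar> \<le> Bd \<and> \<bar>ru_sig w t\<bar> \<le> Bd \<and> \<bar>th_sig w t\<bar> \<le> Bd"

text \<open>
  The limit at 0 from the left continues \<open>u\<close> to a continuous function on a compact interval.
\<close>

lemma past_u_bounded:
  assumes "continuous_on {..<0::real} u" "(u \<longlongrightarrow> (L::real)) (at_left 0)"
  shows "\<exists>B. \<forall>s. a \<le> s \<and> s < 0 \<longrightarrow> \<bar>u s\<bar> \<le> B"
proof -
  define u' where "u' s = (if s < 0 then u s else L)" for s
  have "continuous_on {a..0} u'" unfolding continuous_on_eq_continuous_within
  proof
    fix s assume s: "s \<in> {a..0}"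
    show "continuous (at s within {a..0}) u'"
    proof (cases "s < 0")
      case True
      have "isCont u s" using assms(1) True by (simp add: continuous_on_eq_continuous_at)
      moreover have "\<forall>\<^sub>F x in nhds s. u' x = u x"
        unfolding eventually_nhds using True by (intro exI[of _ "{..<0}"]) (auto simp: u'_def)
      ultimately have "isCont u' s" by (simp add: isCont_cong)
      then show ?thesis by (rule continuous_at_imp_continuous_at_within)
    next
      case False
      then have s0: "s = 0" using s by auto
      have ev: "\<forall>\<^sub>F x in at_left 0. u x = u' x" by (auto simp: eventually_at_filter u'_def)
      have "u' 0 = L" by (simp add: u'_def)
      then have "(u' \<longlongrightarrow> u' 0) (at_left 0)" using Lim_transform_eventually[OF assms(2) ev] by simp
      then have "(u' \<longlongrightarrow> u' 0) (at 0 within {a..0})"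
        unfolding tendsto_def eventually_at_filter by (auto elim!: eventually_mono simp: less_le)
      then show ?thesis by (simp add: continuous_within s0)
    qed
  qed
  then have "compact (u' ` {a..0})" by (intro compact_continuous_image) auto
  then obtain B where "\<forall>y\<in>u' ` {a..0}. norm y \<le> B" using compact_imp_bounded bounded_iff by blast
  then show ?thesis by (intro exI[of _ B]) (auto simp: u'_def dest: bspec)
qed

context loop begin

lemma alpha_mono: "0 \<le> a ==> a \<le> b ==> alpha_psi K a \<le> alpha_psi K b"
proof -
  have "strict_mono_on {0..} (alpha_psi K)" using reg by (simp add: known_regular_def class_K_infinity_def)
  then show "0 \<le> a ==> a \<le> b ==> alpha_psi K a \<le> alpha_psi K b"
    by (cases "a = b") (auto dest: strict_mono_onD[of _ _ a b])
qed

lemma m_le: "norm (psi t) \<le> a ==> m1 (psi t) \<le> sqrt (M * alpha_psi K a) \<and> m1t (psi t) \<le> sqrt (M * alpha_psi K a)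
   \<and> m2 (psi t) \<le> sqrt (M * alpha_psi K a)"
proof -
  assume a: "norm (psi t) \<le> a"
  have "M * al t \<le> M * alpha_psi K a" using alpha_mono[OF norm_ge_zero a] M1 by (simp add: al_def)
  then have "(m1 (psi t))^2 \<le> M * alpha_psi K a \<and> (m1t (psi t))^2 \<le> M * alpha_psi K a \<and> (m2 (psi t))^2 \<le> M * alpha_psi K a"
    using ms_al[of t] zero_le_power2[of "m1 (psi t)"] zero_le_power2[of "m1t (psi t)"] zero_le_power2[of "m2 (psi t)"] by linarith
  then show ?thesis by (auto intro: real_le_rsqrt)
qed

lemma history_bounds:
  assumes z: "0 \<in> HT"
  shows "\<exists>c0 c1. 0 \<le> c0 \<and> (\<forall>\<sigma>. dd 0 \<le> \<sigma> \<and> \<sigma> < 0 \<longrightarrow> Es0 \<sigma> + (Ed0 \<sigma>)^2 / (8 * M^2) \<le> c0 \<and> Ed0 \<sigma> \<le> c1)"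
proof -
  have "compact (x_sig w ` {dd 0..0})" "compact (psi ` {dd 0..0})"
    using past by (auto intro!: compact_continuous_image elim!: continuous_on_subset simp: admissible_past_def)
  then obtain bx bp where bx: "\<forall>y\<in>x_sig w ` {dd 0..0}. norm y \<le> bx" and bp: "\<forall>y\<in>psi ` {dd 0..0}. norm y \<le> bp"
    using compact_imp_bounded bounded_iff by meson
  obtain bu where bu: "\<And>s. dd 0 \<le> s ==> s < 0 ==> \<bar>uu s\<bar> \<le> bu"
    using past past_u_bounded[of uu _ "dd 0"] unfolding admissible_past_def by blast
  define f where "f z = (case z of (x :: real ^ 'n, u) => Gam2 K (x $ ix 1) * (\<theta> * (x $ ix 1)^2 + (\<Sum>j=2..n. (x $ ix j)^2)
      + gam_s_bar K (x $ ix 1) * (mu_bar K (outp ix n x) u)^2))" for z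
  define g where "g z = (case z of (x :: real ^ 'n, u::real) => mu1a_bar K (x $ ix 1) * (\<theta> * \<bar>x $ ix 1\<bar> + (\<Sum>j=2..n. \<bar>x $ ix j\<bar>)))" for z
  have k: "continuous_on UNIV (Gam2 K)" "continuous_on UNIV (gam_s_bar K)" "continuous_on UNIV (mu1a_bar K)"
    "continuous_on UNIV (\<lambda>(y, u). mu_bar K y u)" using reg by (auto simp: known_regular_def)
  have "continuous_on UNIV f" unfolding f_def split_def outp_def
    by (intro continuous_intros cont_compose1[OF k(1)] cont_compose1[OF k(2)] cont_known2[OF k(4)])
  moreover have "continuous_on UNIV g" unfolding g_def split_def
    by (intro continuous_intros cont_compose1[OF k(3)])
  ultimately obtain cf cg where cf: "\<And>z. norm z \<le> bx + bu ==> \<bar>f z\<bar> \<le> cf" and cg: "\<And>z. norm z \<le> bx + bu ==> \<bar>g z\<bar> \<le> cg"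
    using bounded_on_cball[of f "bx + bu"] bounded_on_cball[of g "bx + bu"] by blast
  define c1 where "c1 = cg + sqrt (M * alpha_psi K bp)"
  have key: "Es0 \<sigma> \<le> cf \<and> Ed0 \<sigma> \<le> c1" if s: "dd 0 \<le> \<sigma>" "\<sigma> < 0" for \<sigma>
  proof -
    have n: "norm (x_sig w \<sigma>, uu \<sigma>) \<le> bx + bu"
    proof -
      have "norm (x_sig w \<sigma>) \<le> bx" using bx s by auto
      then show ?thesis using norm_Pair_le[of "x_sig w \<sigma>" "uu \<sigma>"] bu[OF s] by simp
    qed
    have "gam_s K (yy \<sigma>) (uu \<sigma>) \<le> gam_s_bar K (x1 \<sigma>) * \<bar>mu P 0 (x_sig w \<sigma>) (psi 0) (uu \<sigma>)\<bar>^2"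
      using gs[of 0 "psi 0" "x_sig w \<sigma>" "uu \<sigma>"] psi_in[OF z] by (simp add: yy_outp x1_def)
    also have "... \<le> gam_s_bar K (x1 \<sigma>) * (mu_bar K (yy \<sigma>) (uu \<sigma>))^2"
      using mb psi_in[OF z] known_nonneg(3) unfolding mu_bounds_def yy_outp by (intro mult_left_mono power_mono) auto
    finally have "Es0 \<sigma> \<le> f (x_sig w \<sigma>, uu \<sigma>)"
      unfolding Es0_def f_def using known_nonneg(2) by (auto intro!: mult_left_mono simp: Sq_def xc_def x1_def yy_outp)
    then have "Es0 \<sigma> \<le> cf" using cf[OF n] by linarith
    moreover have "norm (psi \<sigma>) \<le> bp" using bp s by auto
    then have "Ed0 \<sigma> \<le> c1"
      using m_le[of \<sigma> bp] cg[OF n] by (auto simp: Ed0_def g_def c1_def Sx_def xc_def x1_def)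
    ultimately show ?thesis by blast
  qed
  define c0 where "c0 = max 0 (cf + c1^2 / (8 * M^2))"
  have "Es0 \<sigma> + (Ed0 \<sigma>)^2 / (8 * M^2) \<le> c0" if s: "dd 0 \<le> \<sigma>" "\<sigma> < 0" for \<sigma>
  proof -
    have "(Ed0 \<sigma>)^2 / (8 * M^2) \<le> c1^2 / (8 * M^2)"
      using key[OF s] Ed0_nonneg[of \<sigma>] by (intro divide_right_mono power_mono) auto
    then show ?thesis using key[OF s] unfolding c0_def by linarith
  qed
  then show ?thesis using key by (intro exI[of _ c0] exI[of _ c1]) (auto simp: c0_def)
qed

end

context plant_data begin

abbreviation "sol T w \<equiv> closed_loop_solution ix jx n K Ctl P H T w"

text \<open>
  The bound must not depend on the solution: it is fixed from one solution with the given initial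
  data, whose value of the storage function at time 0 is shared by all the others. The constants
  \<open>a1, a2, ...\<close> bound the signals one after the other, in the order \<open>x\<^sub>1\<close>, \<open>\<theta>hat\<close>, \<open>r\<close>, \<open>\<psi>\<close>, scaled
  errors, \<open>x\<close>, \<open>s\<close>, \<open>\<mu>\<close>, \<open>u\<close>, \<open>r\<^sub>u\<close>, \<open>xhat\<close>, \<open>\<zeta>\<close>; each uses continuous known functions of the
  earlier ones.
\<close>

lemma uniform_bound:
  "\<exists>Bd. \<forall>T w. sol T w \<and> same_initial w0 w \<longrightarrow> (\<forall>t\<in>horizon T. signals_within Bd w t)"
proof (cases "\<exists>T w. sol T w \<and> same_initial w0 w \<and> 0 \<in> horizon T")
  case False
  then have "horizon T = {}" if "sol T w" "same_initial w0 w" for T w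
    using that horizon_sub[of _ T 0] by (fastforce simp: horizon_def)
  then show ?thesis by auto
next
  case True
  then obtain TR wR where R: "sol TR wR" "same_initial w0 wR" "0 \<in> horizon TR" by blast
  interpret R: loop n ix jx K M G \<kappa> Bo Bc p q Bx bh bh' v1 v1' P H \<theta> m1 m1t m2 V TR wR
    by unfold_locales (rule R)
  obtain c0 c1 where c: "0 \<le> c0"
    "\<And>\<sigma>. R.dd 0 \<le> \<sigma> ==> \<sigma> < 0 ==> R.Es0 \<sigma> + (R.Ed0 \<sigma>)^2 / (8 * M^2) \<le> c0"
    "\<And>\<sigma>. R.dd 0 \<le> \<sigma> ==> \<sigma> < 0 ==> R.Ed0 \<sigma> \<le> c1"
    using R.history_bounds[OF R(3)] by blast
  define U0 where "U0 = R.wt 0 * R.VV 0 + M * (R.wt 0 * c0 * delay P 0)"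
  \<comment> \<open>U0 is the right-hand side of the energy bound for the initial data w0\<close>
  define a1 where "a1 = sqrt (2 * U0)"
  define a2 where "a2 = 2 + \<theta>^2 + a1"
  have bnd2: "\<exists>b. \<forall>s th. \<bar>s\<bar> \<le> a1 \<and> \<bar>th\<bar> \<le> a2 \<longrightarrow> \<bar>f s th\<bar> \<le> b"
    if cf: "continuous_on UNIV (\<lambda>z. f (fst z) (snd z))" for f :: "real => real => real"
  proof -
    obtain b where b: "\<And>z. norm z \<le> a1 + a2 ==> \<bar>f (fst z) (snd z)\<bar> \<le> b" using bounded_on_cball[OF cf] by blast
    have "\<bar>f s th\<bar> \<le> b" if "\<bar>s\<bar> \<le> a1" "\<bar>th\<bar> \<le> a2" for s th
      using b[of "(s, th)"] norm_Pair_le[of s th] that by simp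
    then show ?thesis by blast
  qed
  have "continuous_on UNIV (\<lambda>z. 8 * M^2 * W1 (fst z) (snd z))" "continuous_on UNIV (\<lambda>z. B1 (fst z) (snd z))"
    by (intro continuous_intros)+
  then obtain w1 a6 where w1: "\<And>s th. \<bar>s\<bar> \<le> a1 ==> \<bar>th\<bar> \<le> a2 ==> \<bar>8 * M^2 * W1 s th\<bar> \<le> w1"
    and a6: "\<And>s th. \<bar>s\<bar> \<le> a1 ==> \<bar>th\<bar> \<le> a2 ==> \<bar>B1 s th\<bar> \<le> a6"
    using bnd2[of "\<lambda>s th. 8 * M^2 * W1 s th"] bnd2[of B1] by metis
  define a3 where "a3 = max (r_sig wR 0) (w1 + 1)"
  obtain a4 where a4: "\<And>\<psi>. V \<psi> \<le> U0 * a3 ^ (2*n) ==> norm \<psi> \<le> a4"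
  proof -
    have "filterlim V at_top at_infinity" using Vc by (simp add: lyapunov_candidate_def)
    then have "\<forall>\<^sub>F \<psi> in at_infinity. U0 * a3 ^ (2*n) < V \<psi>" by (simp add: filterlim_at_top_dense)
    then obtain b where "\<forall>\<psi>. b \<le> norm \<psi> \<longrightarrow> U0 * a3 ^ (2*n) < V \<psi>" unfolding eventually_at_infinity by blast
    then show thesis using that[of b] by (meson linorder_not_le nle_le)
  qed
  define mm where "mm = sqrt (M * alpha_psi K a4)"
  define a7 where "a7 = sqrt (M * U0)"
  define a8 where "a8 = a3 ^ n * (2 * a7) + a6^2 * a1"
  define a9 where "a9 = max c1 (a6 * (\<theta> * a1 + M * a8) + mm)"
  define Ym where "Ym = (1 + \<theta>) * a1 + 2 * a7"
  define C where "C = max 0 (Ym + mm + mm + a9 + mm * Ym + mm)"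
  define a10 where "a10 = sqrt ((R.ss 0)^2 + 2 * (1 + C) + ((1 + C) / mu_lo K)^2)"
  define a11 where "a11 = a10 + a3 ^ n * (a6 * (M^2 * a7))"
  have kc: "continuous_on UNIV (\<lambda>(y, u). mu_bar K y u)" using reg by (auto simp: known_regular_def)
  have "continuous_on UNIV (\<lambda>y :: real \<times> real. mu_bar K y 0)" by (intro cont_known2[OF kc] continuous_intros)
  from bounded_on_cball[OF this] obtain b0 where b0: "\<And>y. norm y \<le> a1 + max a1 a8 ==> \<bar>mu_bar K y 0\<bar> \<le> b0" by metis
  define a12 where "a12 = (a11 + b0) / mu_lo K"
  define a13 where "a13 = a3^2 * w1"
  have "continuous_on UNIV (\<lambda>(y :: real \<times> real, u :: real, r :: real, rd :: real, th :: real, w :: real ^ 'm). Ruf y u r rd th w)"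
    unfolding split_def by (intro continuous_intros)
  from bounded_on_cball[OF this, of "(a1 + max a1 a8) + (a12 + (a3 + (a13 + (a2 + a7))))"] obtain b1 where
    b1: "\<And>z. norm z \<le> (a1 + max a1 a8) + (a12 + (a3 + (a13 + (a2 + a7)))) ==> \<bar>case z of (y, u, r, rd, th, w) => Ruf y u r rd th w\<bar> \<le> b1"
    by metis
  define a14 where "a14 = max (ru_sig wR 0) (b1 + 1)"
  have "\<exists>b. \<forall>i\<in>{2..n}. \<forall>s. \<bar>s\<bar> \<le> a1 \<longrightarrow> \<bar>f_obs K Ctl i s\<bar> \<le> b"
  proof -
    have "\<forall>i\<in>{2..n}. \<exists>b. \<forall>s. \<bar>s\<bar> \<le> a1 \<longrightarrow> \<bar>f_obs K Ctl i s\<bar> \<le> b" using bounded_on_cball[OF cont_f_obs] by fastforce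
    then obtain b where b: "\<And>i s. i \<in> {2..n} ==> \<bar>s\<bar> \<le> a1 ==> \<bar>f_obs K Ctl i s\<bar> \<le> b i" by metis
    have "b i \<le> (\<Sum>i\<in>{2..n}. \<bar>b i\<bar>)" if "i \<in> {2..n}" for i
      using member_le_sum[OF that, of "\<lambda>i. \<bar>b i\<bar>"] by auto
    then show ?thesis using b by (meson order_trans)
  qed
  then obtain b2 where b2: "\<And>i s. i \<in> {2..n} ==> \<bar>s\<bar> \<le> a1 ==> \<bar>f_obs K Ctl i s\<bar> \<le> b2" by blast
  define a15 where "a15 = a3 ^ n * a7 + a6^2 * a1 + a3 ^ n * b2"
  define a16 where "a16 = max a1 a8"
  define Bd where "Bd = Max {M * a16, a4, a12, M * a15, a12 + a14 * a16, a3, a14, a2}"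
  have "signals_within Bd w t"
    if S: "sol T w" "same_initial w0 w" and tT: "t \<in> horizon T" for T w t
  proof -
    interpret L: loop n ix jx K M G \<kappa> Bo Bc p q Bx bh bh' v1 v1' P H \<theta> m1 m1t m2 V T w
      by unfold_locales (rule S)
    have z: "0 \<in> horizon T" using horizon_sub[OF tT, of 0] L.HT_nonneg[OF tT] by simp
    have same: "\<And>s. s \<le> 0 ==> x_sig w s = x_sig wR s" "\<And>s. s \<le> 0 ==> psi_sig w s = psi_sig wR s"
      "\<And>s. s < 0 ==> u_sig w s = u_sig wR s" "xh_sig w 0 = xh_sig wR 0" "zeta_sig w 0 = zeta_sig wR 0"
      "r_sig w 0 = r_sig wR 0" "ru_sig w 0 = ru_sig wR 0" "th_sig w 0 = th_sig wR 0"
      using S(2) R(2) by (simp_all add: same_initial_def)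
    have u0: "u_sig w 0 = u_sig wR 0"
      using L.loop_eqs(1)[OF z] R.loop_eqs(1)[OF R(3)] same by (simp add: L.xc_def R.xc_def)
    have past: "L.Es0 \<sigma> = R.Es0 \<sigma>" "L.Ed0 \<sigma> = R.Ed0 \<sigma>" if "\<sigma> < 0" for \<sigma>
      using that same by (simp_all add: L.Es0_def R.Es0_def L.Ed0_def R.Ed0_def L.x1_def R.x1_def L.Sq_def R.Sq_def
          L.Sx_def R.Sx_def L.xc_def R.xc_def L.yy_def R.yy_def)
    have x10: "L.x1 0 = R.x1 0" "L.xc 0 = R.xc 0" using same by (auto simp: L.x1_def R.x1_def L.xc_def R.xc_def)
    have vp0: "L.vp 0 = R.vp 0" using same x10 by (simp add: L.vp_def R.vp_def)
    have om0: "L.om 0 = R.om 0" using vp0 by (auto simp: L.om_def R.om_def)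
    have ep0: "L.ep 0 = R.ep 0" using same x10 by (auto simp: L.ep_def R.ep_def L.zc_def R.zc_def)
    have ss0: "L.ss 0 = R.ss 0" using same x10 u0
      by (simp add: L.ss_def R.ss_def L.muc_def R.muc_def L.ut_def R.ut_def)
    have VV0: "L.VV 0 = R.VV 0" using same x10 om0 ep0 ss0
      by (simp add: L.VV_def R.VV_def L.coreV_def R.coreV_def)
    have wt0: "L.wt 0 = R.wt 0" using same by (simp add: L.wt_def R.wt_def)
    have V1: "L.VV s \<le> U0" if "s \<in> horizon T" for s
    proof -
      have "L.VV s + integral {0..s} L.Diss \<le> L.wt 0 * L.VV 0 + M * (L.wt 0 * c0 * delay P 0)"
        by (rule L.energy_bound[OF c(1) _ that]) (use c(2) past in auto)
      moreover have "0 \<le> integral {0..s} L.Diss"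
        by (rule integral_nonneg)
          (use L.Diss_nonneg L.sub_HT[OF that] in \<open>auto intro!: integrable_continuous_interval continuous_on_subset[OF L.cont_Diss]\<close>)
      ultimately show ?thesis unfolding U0_def VV0 wt0 by linarith
    qed
    have U00: "0 \<le> U0" using V1[OF z] L.VV_nonneg[OF z] by linarith
    have parts: "(L.x1 s)^2 / 2 + r_sig w s * L.ZZ s / M \<le> U0 \<and> (th_sig w s - (2 + \<theta>^2))^2 / 2 \<le> U0
        \<and> V (psi_sig w s) / r_sig w s ^ (2*n) \<le> U0" if "s \<in> horizon T" for s
    proof -
      have r: "1 \<le> r_sig w s" "1 \<le> ru_sig w s" using L.ge1[OF that] by auto
      have gen: "c + tq + vq + sq \<le> U ==> lo \<le> c ==> 0 \<le> lo ==> 0 \<le> vq ==> 0 \<le> sq ==> 0 \<le> tq ==> lo \<le> U \<and> tq \<le> U \<and> vq \<le> U"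
        for c tq vq sq U lo :: real by linarith
      show ?thesis
      proof (rule gen[OF V1[OF that, unfolded L.VV_def]])
        show "(L.x1 s)^2 / 2 + r_sig w s * L.ZZ s / M \<le> L.coreV s" using L.core_lower[OF that] by simp
        show "0 \<le> (L.x1 s)^2 / 2 + r_sig w s * L.ZZ s / M" using r L.ZZ_nonneg[of s] M1 by simp
        show "0 \<le> V (psi_sig w s) / r_sig w s ^ (2*n)" using r L.V_nonneg by simp
        show "0 \<le> (L.ss s)^2 / (2 * sqrt (ru_sig w s))" using r by simp
      qed simp
    qed
    have X: "\<bar>L.x1 s\<bar> \<le> a1" if "s \<in> horizon T" for s
    proof -
      have "0 \<le> r_sig w s * L.ZZ s / M" using L.ge1(1)[OF that] L.ZZ_nonneg[of s] M1 by simp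
      then have "\<bar>L.x1 s\<bar>^2 \<le> 2 * U0" using parts[OF that] by simp
      then show ?thesis unfolding a1_def by (rule real_le_rsqrt)
    qed
    have Th: "\<bar>th_sig w s\<bar> \<le> a2" if "s \<in> horizon T" for s
    proof -
      have "\<bar>th_sig w s - (2 + \<theta>^2)\<bar>^2 \<le> 2 * U0" using parts[OF that] by simp
      then have "\<bar>th_sig w s - (2 + \<theta>^2)\<bar> \<le> a1" unfolding a1_def by (rule real_le_rsqrt)
      then show ?thesis unfolding a2_def using zero_le_power2[of \<theta>] by linarith
    qed
    have rB: "r_sig w s \<le> a3" if "s \<in> horizon T" for s
      unfolding a3_def same(6)[symmetric]
      by (rule L.r_bound[OF _ that]) (use w1 X Th in \<open>fastforce\<close>)
    have ZB: "L.eN s \<le> a7 \<and> L.oN s \<le> a7" if "s \<in> horizon T" for s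
    proof -
      have "1 * L.ZZ s \<le> r_sig w s * L.ZZ s" using L.ge1(1)[OF that] L.ZZ_nonneg[of s] by (intro mult_right_mono) auto
      also have "r_sig w s * L.ZZ s = M * (r_sig w s * L.ZZ s / M)" using M1 by simp
      also have "... \<le> M * U0" using parts[OF that] M1 by (intro mult_left_mono) (auto intro: order_trans[rotated])
      finally have "L.ZZ s \<le> M * U0" by simp
      then have "(L.eN s)^2 \<le> M * U0" "(L.oN s)^2 \<le> M * U0"
        using zero_le_power2[of "L.eN s"] zero_le_power2[of "L.oN s"] unfolding L.ZZ_def by linarith+
      then show ?thesis unfolding a7_def by (auto intro: real_le_rsqrt)
    qed
    have psiB: "norm (psi_sig w s) \<le> a4" if "s \<in> horizon T" for s
    proof (rule a4)
      have r: "1 \<le> r_sig w s" using L.ge1[OF that] by auto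
      have "V (psi_sig w s) \<le> U0 * r_sig w s ^ (2*n)" using parts[OF that] r by (simp add: pos_divide_le_eq)
      also have "... \<le> U0 * a3 ^ (2*n)" using rB[OF that] r U00 by (intro mult_left_mono power_mono) auto
      finally show "V (psi_sig w s) \<le> U0 * a3 ^ (2*n)" .
    qed
    have B1B: "B1 (L.x1 s) (th_sig w s) \<le> a6" if "s \<in> horizon T" for s
      using a6[OF X[OF that] Th[OF that]] by linarith
    have a6p: "1 \<le> a6" using B1B[OF z] L.BB_ge(3)[of 0] by linarith
    have a3p: "1 \<le> a3" using rB[OF z] L.ge1(1)[OF z] by linarith
    have a7p: "0 \<le> a7" "0 \<le> a1" using U00 M1 by (auto simp: a7_def a1_def)
    have a8p: "0 \<le> a8" using a3p a7p by (simp add: a8_def)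
    have xcB: "\<bar>L.xc s j\<bar> \<le> a8" if "s \<in> horizon T" "j \<in> {2..n}" for s j
    proof -
      have r: "1 \<le> r_sig w s" using L.ge1[OF that(1)] by auto
      have "r_sig w s ^ (j-1) * (L.eN s + L.oN s) \<le> a3 ^ n * (2 * a7)"
      proof (intro mult_mono)
        have "r_sig w s ^ (j-1) \<le> a3 ^ (j-1)" using r rB[OF that(1)] by (intro power_mono) auto
        also have "... \<le> a3 ^ n" using a3p that by (intro power_increasing) auto
        finally show "r_sig w s ^ (j-1) \<le> a3 ^ n" .
      qed (use ZB[OF that(1)] L.eN_nonneg[of s] a3p in auto)
      moreover have "(B1 (L.x1 s) (th_sig w s))^2 * \<bar>L.x1 s\<bar> \<le> a6^2 * a1"
        using B1B[OF that(1)] L.BB_ge(3)[of s] X[OF that(1)] a6p by (intro mult_mono power_mono) auto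
      moreover have "0 \<le> a6^2 * a1" using a7p by simp
      ultimately show ?thesis using L.xc_bound[OF that] unfolding a8_def by (auto split: if_splits)
    qed
    have SxB: "L.Sx s \<le> M * a8" if "s \<in> horizon T" for s
    proof -
      have "L.Sx s \<le> real (card {2..n}) * a8" unfolding L.Sx_def using xcB[OF that] by (rule sum_bounded_above)
      also have "... \<le> M * a8" using L.card_II a8p by (rule mult_right_mono)
      finally show ?thesis .
    qed
    have mB: "m1 (psi_sig w s) \<le> mm \<and> m1t (psi_sig w s) \<le> mm \<and> m2 (psi_sig w s) \<le> mm" if "s \<in> horizon T" for s
      unfolding mm_def by (rule L.m_le[OF psiB[OF that]])
    have EdB: "L.Ed0 (L.dd s) \<le> a9" if "s \<in> horizon T" for s
    proof (cases "L.dd s < 0")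
      case True
      have "L.dd 0 \<le> L.dd s" using L.dd_strict[of 0 s] L.HT_nonneg[OF that] by (cases "s = 0") auto
      then show ?thesis using c(3)[of "L.dd s"] past(2)[OF True] True unfolding a9_def by auto
    next
      case False
      then have h: "L.dd s \<in> horizon T"
        using horizon_sub[OF that, of "L.dd s"] L.delay_props(2)[of s] L.HT_nonneg[OF that] by auto
      have "mu1a_bar K (L.x1 (L.dd s)) * (\<theta> * \<bar>L.x1 (L.dd s)\<bar> + L.Sx (L.dd s)) \<le> a6 * (\<theta> * a1 + M * a8)"
        using Bx_ge(7)[of "L.x1 (L.dd s)"] L.BB_ge(2)[of "L.dd s"] B1B[OF h] X[OF h] SxB[OF h] \<theta>0 L.Sx_nonneg a6p
        by (intro mult_mono add_mono mult_left_mono add_nonneg_nonneg mult_nonneg_nonneg) auto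
      then show ?thesis using mB[OF h] unfolding a9_def L.Ed0_def by auto
    qed
    have YB: "L.YY s \<le> Ym" if "s \<in> horizon T" for s
    proof -
      have "(1 + \<theta>) * \<bar>L.x1 s\<bar> \<le> (1 + \<theta>) * a1" using X[OF that] \<theta>0 by (intro mult_left_mono) auto
      then show ?thesis using ZB[OF that] unfolding L.YY_def Ym_def by linarith
    qed
    have ssB: "\<bar>L.ss s\<bar> \<le> a10" if "s \<in> horizon T" for s
    proof -
      have "(L.ss s)^2 \<le> (L.ss 0)^2 + 2 * (1 + C) + ((1 + C) / mu_lo K)^2"
      proof (rule L.tracking_error_bound[OF _ _ that])
        show "0 \<le> C" by (simp add: C_def)
        fix v assume v: "v \<in> horizon T" "0 < v"
        have "m2 (psi_sig w v) * L.YY v \<le> mm * Ym"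
          using mB[OF v(1)] YB[OF v(1)] L.YY_props(1)[of v] L.m_nonneg[of "psi_sig w v"] by (intro mult_mono) (auto intro: order_trans)
        then show "L.YY v + m1 (psi_sig w v) + m1t (psi_sig w v) + L.Ed0 (L.dd v) + m2 (psi_sig w v) * L.YY v + m2 (psi_sig w v) \<le> C"
          using mB[OF v(1)] YB[OF v(1)] EdB[OF v(1)] unfolding C_def by linarith
      qed
      then have "\<bar>L.ss s\<bar>^2 \<le> (R.ss 0)^2 + 2 * (1 + C) + ((1 + C) / mu_lo K)^2" by (simp add: ss0)
      then show ?thesis unfolding a10_def by (rule real_le_rsqrt)
    qed
    have muB: "\<bar>L.muc s\<bar> \<le> a11" if "s \<in> horizon T" for s
    proof -
      have "\<bar>L.ut s\<bar> \<le> a3 ^ n * (a6 * (M^2 * a7))"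
        by (rule order_trans[OF L.ut_abs[OF that]])
          (use rB[OF that] L.ge1(1)[OF that] B1B[OF that] ZB[OF that] L.eN_nonneg[of s] L.BB_ge(3)[of s] a3p a6p M1
            in \<open>auto intro!: mult_mono power_mono\<close>)
      then show ?thesis using ssB[OF that] unfolding a11_def L.ss_def by linarith
    qed
    have xnB: "\<bar>L.xc s n\<bar> \<le> a8" if "s \<in> horizon T" for s using xcB[OF that, of n] n2 by simp
    have yB: "norm (L.yy s) \<le> a1 + max a1 a8" if "s \<in> horizon T" for s
      using norm_Pair_le[of "L.x1 s" "L.xc s n"] X[OF that] xnB[OF that] by (simp add: L.yy_def outp_def L.x1_def L.xc_def)
    have uB: "\<bar>u_sig w s\<bar> \<le> a12" if "s \<in> horizon T" for s
    proof -
      have "mu_lo K * \<bar>u_sig w s\<bar> \<le> a11 + b0" using L.uu_bound[OF that] muB[OF that] b0[OF yB[OF that]] by linarith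
      then show ?thesis using known_nonneg(10) by (simp add: a12_def pos_le_divide_eq mult.commute)
    qed
    have rdB: "\<bar>L.rd s\<bar> \<le> a13" if "s \<in> horizon T" for s
    proof -
      have W: "0 \<le> W1 (L.x1 s) (th_sig w s)" using W1_ge[of "L.x1 s" "th_sig w s"] by linarith
      have "1 * W1 (L.x1 s) (th_sig w s) \<le> 8 * M^2 * W1 (L.x1 s) (th_sig w s)"
        using one_le_power[OF M1, of 2] W by (intro mult_right_mono) auto
      then have W': "W1 (L.x1 s) (th_sig w s) \<le> w1" using w1[OF X[OF that] Th[OF that]] by linarith
      have "\<bar>L.rd s\<bar> = gate (8 * M^2 * W1 (L.x1 s) (th_sig w s) - r_sig w s) * ((r_sig w s)^2 * W1 (L.x1 s) (th_sig w s))"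
        unfolding L.rd_eq using gate_props(1) W by (simp add: abs_mult)
      also have "... \<le> 1 * (a3^2 * w1)"
        using gate_props(1,2) rB[OF that] L.ge1(1)[OF that] W W' by (intro mult_mono power_mono) auto
      finally show ?thesis by (simp add: a13_def)
    qed
    have ruB: "ru_sig w s \<le> a14" if "s \<in> horizon T" for s
      unfolding a14_def same(7)[symmetric]
    proof (rule L.ru_bound[OF _ that])
      fix v assume v: "v \<in> horizon T"
      have vpn: "norm (L.vp v) \<le> a7" using ZB[OF v] by (simp add: norm_jx L.oN_def L.om_def[abs_def])
      have "norm (L.yy v, u_sig w v, r_sig w v, L.rd v, th_sig w v, L.vp v)
         \<le> (a1 + max a1 a8) + (a12 + (a3 + (a13 + (a2 + a7))))"
        by (intro order_trans[OF norm_Pair_le] add_mono)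
          (use yB[OF v] uB[OF v] rB[OF v] L.ge1(1)[OF v] rdB[OF v] Th[OF v] vpn in auto)
      from b1[OF this] show "Ruf (L.yy v) (u_sig w v) (r_sig w v) (L.rd v) (th_sig w v) (L.vp v) \<le> b1" by simp
    qed
    have x1c: "L.xc s 1 = L.x1 s" for s by (simp add: L.xc_def L.x1_def)
    have xB: "norm (x_sig w s) \<le> M * a16" if "s \<in> horizon T" for s
    proof -
      have "norm (x_sig w s) \<le> (\<Sum>i\<in>{1..n}. \<bar>L.xc s i\<bar>)" using norm_ix_le[of "x_sig w s"] by (simp add: L.xc_def)
      also have "... \<le> real (card {1..n}) * a16"
      proof (rule sum_bounded_above)
        fix i assume i: "i \<in> {1..n}"
        show "\<bar>L.xc s i\<bar> \<le> a16"
        proof (cases "i = 1")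
          case True
          then show ?thesis using X[OF that] by (simp add: x1c[unfolded One_nat_def] a16_def)
        next
          case False
          then show ?thesis using xcB[OF that, of i] i by (simp add: a16_def)
        qed
      qed
      also have "... \<le> M * a16" using nM a7p by (intro mult_right_mono) (auto simp: a16_def)
      finally show ?thesis .
    qed
    have xhB: "norm (xh_sig w s) \<le> M * a15" if "s \<in> horizon T" for s
    proof -
      have b20: "0 \<le> b2" using b2[of 2 0] a7p n2 by (simp add: order_trans[OF abs_ge_zero])
      have one: "\<bar>xh_sig w s $ jx i\<bar> \<le> a15" if i: "i \<in> {2..n}" for i
      proof -
        have r: "1 \<le> r_sig w s" "r_sig w s \<le> a3" using L.ge1(1)[OF \<open>s \<in> horizon T\<close>] rB[OF \<open>s \<in> horizon T\<close>] by auto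
        have rp: "r_sig w s ^ (i-1) \<le> a3 ^ n"
        proof -
          have "r_sig w s ^ (i-1) \<le> a3 ^ (i-1)" using r by (intro power_mono) auto
          also have "... \<le> a3 ^ n" using a3p i by (intro power_increasing) auto
          finally show ?thesis .
        qed
        have e: "xh_sig w s $ jx i = r_sig w s ^ (i-1) * L.om s i - (if i = 2 then L.vt s else 0) - r_sig w s ^ (i-1) * f_obs K Ctl i (L.x1 s)"
          using L.zc_eq[OF \<open>s \<in> horizon T\<close> i] by (simp add: L.zc_def)
        have "\<bar>r_sig w s ^ (i-1) * L.om s i\<bar> \<le> a3 ^ n * a7"
          unfolding abs_mult using rp r L.ep_om_abs(2)[OF i, of s] ZB[OF \<open>s \<in> horizon T\<close>] a3p by (intro mult_mono) auto
        moreover have "\<bar>r_sig w s ^ (i-1) * f_obs K Ctl i (L.x1 s)\<bar> \<le> a3 ^ n * b2"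
          unfolding abs_mult using rp r b2[OF i X[OF \<open>s \<in> horizon T\<close>]] a3p by (intro mult_mono) auto
        moreover have "\<bar>L.vt s\<bar> \<le> a6^2 * a1"
          by (rule order_trans[OF L.vt_bound[OF \<open>s \<in> horizon T\<close>]])
             (use B1B[OF \<open>s \<in> horizon T\<close>] L.BB_ge(3)[of s] X[OF \<open>s \<in> horizon T\<close>] a6p in \<open>auto intro!: mult_mono power_mono\<close>)
        moreover have "0 \<le> a6^2 * a1" using a7p by simp
        ultimately show ?thesis unfolding e a15_def by (auto split: if_splits)
      qed
      have "norm (xh_sig w s) \<le> M * a15" unfolding norm_jx
        by (rule L.L2_le_M[OF one]) (use a3p a7p b20 in \<open>auto simp: a15_def\<close>)
      then show ?thesis .
    qed
    have zB: "\<bar>zeta_sig w t\<bar> \<le> a12 + a14 * a16"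
    proof -
      have "\<bar>ru_sig w t * L.xc t n\<bar> \<le> a14 * a16"
        unfolding abs_mult using ruB[OF tT] L.ge1(2)[OF tT] xnB[OF tT] by (intro mult_mono) (auto simp: a16_def)
      then show ?thesis using uB[OF tT] L.loop_eqs(1)[OF tT] by linarith
    qed
    have le: "M * a16 \<le> Bd" "a4 \<le> Bd" "a12 \<le> Bd" "M * a15 \<le> Bd" "a12 + a14 * a16 \<le> Bd" "a3 \<le> Bd" "a14 \<le> Bd" "a2 \<le> Bd"
      unfolding Bd_def by (rule Max_ge; simp)+
    show ?thesis unfolding signals_within_def
      using xB[OF tT] psiB[OF tT] uB[OF tT] xhB[OF tT] zB rB[OF tT] ruB[OF tT] Th[OF tT] L.ge1[OF tT] le by auto
  qed
  then show ?thesis by blast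
qed

end

section \<open>Convergence\<close>

context loop begin

lemma coreV_le: "t \<in> HT ==> coreV t \<le> (XX t)^2 + M^9 * ((rr t)^2 * ZZ t)"
proof -
  assume t: "t \<in> HT"
  have r: "1 \<le> rr t" by (rule ge1(1)[OF t])
  have "M^8 * Bo (ep t) (ep t) \<le> M^8 * (M * (eN t)^2)"
    using Bo_hi[of "ep t" "ep t"] M1 by (intro mult_left_mono) (auto simp: eN_def power2_eq_square mult.assoc)
  then have 1: "M^8 * Bo (ep t) (ep t) \<le> M^9 * (eN t)^2" by (simp add: power_eq_if[of M 9] mult_ac)
  have "Bc (om t) (om t) \<le> M * (oN t)^2"
    using Bc_hi[of "om t" "om t"] by (auto simp: oN_def power2_eq_square mult.assoc)
  also have "... \<le> M^9 * (oN t)^2" using power_increasing[of 1 9 M] M1 by (intro mult_right_mono) auto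
  finally have "M^8 * Bo (ep t) (ep t) + Bc (om t) (om t) \<le> M^9 * ZZ t" using 1 by (simp add: ZZ_def distrib_left)
  then have "rr t * (M^8 * Bo (ep t) (ep t) + Bc (om t) (om t)) \<le> rr t * (M^9 * ZZ t)" using r by (intro mult_left_mono) auto
  also have "... \<le> (rr t)^2 * (M^9 * ZZ t)"
    using r ZZ_nonneg[of t] M1 by (intro mult_right_mono) (auto simp: power2_eq_square)
  finally have "rr t * (M^8 * Bo (ep t) (ep t) + Bc (om t) (om t)) \<le> M^9 * ((rr t)^2 * ZZ t)" by (simp add: mult_ac)
  moreover have "(x1 t)^2 / 2 \<le> (XX t)^2" by simp
  moreover have "coreV t = (x1 t)^2 / 2 + rr t * (M^8 * Bo (ep t) (ep t) + Bc (om t) (om t))"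
    by (simp add: coreV_def algebra_simps)
  ultimately show ?thesis by linarith
qed

lemma NN_nonneg: "t \<in> HT ==> 0 \<le> NN t"
  using ge1(3)[of t] phi_pos[of 1 "x1 t"] v1(3)[of "x1 t"] one_in by (simp add: NN_def less_imp_le)

text \<open>
  The quantity \<open>f = coreV + V(\<psi>) / r ^ (2n)\<close> is bounded by a multiple of the dissipation and hence
  integrable; its derivative is bounded above because all signals are bounded.
\<close>

lemma convergence:
  assumes Tinf: "T = \<infinity>" and within: "\<And>t. 0 \<le> t ==> signals_within Bd w t"
  shows "signals_converge w"
proof -
  note bd = within[unfolded signals_within_def]
  have HT: "t \<in> HT \<longleftrightarrow> 0 \<le> t" for t by (simp add: horizon_def Tinf)
  have z: "0 \<in> HT" by (simp add: HT)
  have Bd1: "1 \<le> Bd" using bd[of 0] ge1(1)[OF z] by auto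
  obtain c0 c1 where c: "0 \<le> c0" "\<And>\<sigma>. dd 0 \<le> \<sigma> ==> \<sigma> < 0 ==> Es0 \<sigma> + (Ed0 \<sigma>)^2 / (8 * M^2) \<le> c0"
    using history_bounds[OF z] by blast
  define U0 where "U0 = wt 0 * VV 0 + M * (wt 0 * c0 * delay P 0)"
  have E: "VV t + integral {0..t} Diss \<le> U0" if "0 \<le> t" for t
    unfolding U0_def by (rule energy_bound[OF c(1,2)]) (use that HT in auto)
  have contHT: "continuous_on {0..} g" if "continuous_on HT g" for g :: "real => real"
    using that HT by (auto elim!: continuous_on_subset)
  have intD: "Diss integrable_on {0..t}" for t
    by (intro integrable_continuous_interval continuous_on_subset[OF contHT[OF cont_Diss]]) auto
  have VU: "VV t \<le> U0" if "0 \<le> t" for t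
    using E[OF that] integral_nonneg[OF intD[of t]] Diss_nonneg HT by fastforce
  define f where "f t = coreV t + V (psi t) / rr t ^ (2*n)" for t
  have Vr: "0 \<le> V (psi t) / rr t ^ (2*n)" if "0 \<le> t" for t
    using V_nonneg[of "psi t"] ge1(1)[of t] that HT by (intro divide_nonneg_nonneg) auto
  have cl: "(XX t)^2 / 2 + rr t * ZZ t / M \<le> f t" if "0 \<le> t" for t
    using core_lower[of t] Vr[OF that] that HT by (simp add: f_def)
  have rZ: "0 \<le> rr t * ZZ t / M" if "0 \<le> t" for t using ge1(1)[of t] that HT ZZ_nonneg[of t] M1 by simp
  have f0: "0 \<le> f t" if "0 \<le> t" for t
    using order_trans[OF add_nonneg_nonneg cl[OF that]] rZ[OF that] by auto
  have cf: "continuous_on {0..} f"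
    unfolding f_def[abs_def] using ge1(1) by (intro contHT continuous_intros cont_coreV cont_Vpsi cont_sig) fastforce
  \<comment> \<open>the three terms of f are compared with those of Diss in x1, in Z and in psi\<close>
  define CC where "CC = 1 + 4 * M^11 + 4 / V_lo K"
  have Vl: "0 < V_lo K" using reg by (simp add: known_regular_def)
  have fD: "f t \<le> CC * Diss t" if t0: "0 \<le> t" for t
  proof -
    have t: "t \<in> HT" using that HT by simp
    define A1 A2 A3 A4 where "A1 = 1 / (4 * M^2) * (rr t)^2 * ZZ t" and "A2 = ri t * al t / 4" and "A3 = (XX t)^2"
      and "A4 = sqrt (rru t) * mu_lo K * (ss t)^2 / 2"
    have nn: "0 \<le> A1" "0 \<le> A2" "0 \<le> A3" "0 \<le> A4" unfolding A1_def A2_def A3_def A4_def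
      using M1 ZZ_nonneg[of t] ri_props[OF t] al_nonneg[of t] ge1[OF t] known_nonneg(10) by auto
    have D: "Diss t = A1 + A2 + A3 + A4" by (simp add: Diss_def A1_def A2_def A3_def A4_def)
    have "V (psi t) / rr t ^ (2*n) \<le> (al t / V_lo K) / rr t ^ (2*n)"
      using Vlo[of "psi t"] Vl ge1(1)[OF t] by (intro divide_right_mono) (auto simp: al_def pos_le_divide_eq mult.commute)
    also have "... = 4 / V_lo K * A2" by (simp add: A2_def ri_def field_simps)
    finally have 1: "V (psi t) / rr t ^ (2*n) \<le> 4 / V_lo K * A2" .
    have 2: "M^9 * ((rr t)^2 * ZZ t) = 4 * M^11 * A1" using M1 by (simp add: A1_def field_simps power_eq_if)
    have "f t \<le> A3 + 4 * M^11 * A1 + 4 / V_lo K * A2"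
      using coreV_le[OF t] 1 unfolding f_def 2[symmetric] A3_def by linarith
    also have "... \<le> CC * A3 + CC * A1 + CC * A2"
    proof -
      have a: "0 \<le> M^11" "0 \<le> 4 / V_lo K" using M1 Vl by auto
      have "1 * A3 \<le> CC * A3" "4 * M^11 * A1 \<le> CC * A1" "4 / V_lo K * A2 \<le> CC * A2"
        unfolding CC_def using a nn by (intro mult_right_mono; linarith)+
      then show ?thesis by linarith
    qed
    also have "... \<le> CC * Diss t" unfolding D using nn M1 Vl by (simp add: distrib_left CC_def)
    finally show ?thesis .
  qed
  have I: "integral {0..t} f \<le> CC * U0" if t: "0 \<le> t" for t
  proof -
    have "integral {0..t} f \<le> integral {0..t} (\<lambda>s. CC * Diss s)"
    proof (rule integral_le)
      show "f integrable_on {0..t}" by (intro integrable_continuous_interval continuous_on_subset[OF cf]) auto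
      have "continuous_on {0..} (\<lambda>s. CC * Diss s)" by (intro continuous_intros contHT cont_Diss)
      then show "(\<lambda>s. CC * Diss s) integrable_on {0..t}"
        by (intro integrable_continuous_interval) (auto elim: continuous_on_subset)
    qed (use fD in auto)
    also have "... = CC * integral {0..t} Diss" by simp
    also have "... \<le> CC * U0" using E[OF t] VV_nonneg[of t] t HT M1 Vl by (intro mult_left_mono) (auto simp: CC_def)
    finally show ?thesis .
  qed
  have bnd: "\<exists>b. \<forall>t\<ge>0. \<bar>g (x1 t) (tth t)\<bar> \<le> b"
    if cg: "continuous_on UNIV (\<lambda>z. g (fst z) (snd z))" for g :: "real => real => real"
  proof -
    obtain b where b: "\<And>z. norm z \<le> Bd + Bd ==> \<bar>g (fst z) (snd z)\<bar> \<le> b" using bounded_on_cball[OF cg] by blast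
    have "\<bar>g (x1 t) (tth t)\<bar> \<le> b" if "0 \<le> t" for t
      using b[of "(x1 t, tth t)"] norm_Pair_le[of "x1 t" "tth t"] bd[OF that] component_le_norm_cart[of "x_sig w t" "ix 1"]
      by (auto simp: x1_def)
    then show ?thesis by blast
  qed
  have "continuous_on UNIV (\<lambda>z. B1 (fst z) (snd z))" by (intro continuous_intros)
  then obtain b1 where b1: "\<And>t. 0 \<le> t ==> BB1 t \<le> b1" using bnd[of B1] abs_le_D1 by metis
  have xcB: "\<bar>xc t i\<bar> \<le> Bd" if "0 \<le> t" for t i
    using bd[OF that] component_le_norm_cart[of "x_sig w t" "ix i"] by (auto simp: xc_def)
  have xcx: "x1 t = xc t 1" for t by (simp add: x1_def xc_def)
  have kc: "continuous_on UNIV (\<lambda>(y, u). mu_bar K y u)" using reg by (auto simp: known_regular_def)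
  from bounded_on_cball[OF this] obtain b2 where b2: "\<And>z. norm z \<le> (Bd + Bd) + Bd ==> \<bar>case z of (y, u) => mu_bar K y u\<bar> \<le> b2" by metis
  have muB: "\<bar>muc t\<bar> \<le> b2" if t: "0 \<le> t" for t
  proof -
    have "norm (yy t) \<le> Bd + Bd" unfolding yy_def outp_def
      using norm_Pair_le[of "xc t 1" "xc t n"] xcB[OF t, of 1] xcB[OF t, of n] by (simp add: xc_def)
    then have "norm (yy t, uu t) \<le> (Bd + Bd) + Bd" using norm_Pair_le[of "yy t" "uu t"] bd[OF t] by auto
    moreover have "\<bar>muc t\<bar> \<le> mu_bar K (yy t) (uu t)"
      using mb psi_in[of t] t HT unfolding mu_bounds_def muc_def yy_outp by blast
    ultimately show ?thesis using b2[of "(yy t, uu t)"] by auto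
  qed
  have b1p: "1 \<le> b1" using b1[of 0] BB_ge(3)[of 0] by linarith
  define FM where "FM = 5 * M * b1^2 * 1 * ((1 + \<theta>^2) * Bd^2 + M * Bd^2 + b2^2) + 1 * alpha_psi K Bd / (4 * M)"
  have SqB: "Sq t \<le> M * Bd^2" if t: "0 \<le> t" for t
  proof -
    have "Sq t \<le> real (card {2..n}) * Bd^2" unfolding Sq_def
      by (rule sum_bounded_above) (use power_mono[OF xcB[OF t] abs_ge_zero, of _ 2] in simp)
    also have "... \<le> M * Bd^2" using card_II by (intro mult_right_mono) auto
    finally show ?thesis .
  qed
  have XXB: "(XX t)^2 \<le> Bd^2" if t: "0 \<le> t" for t using power_mono[OF xcB[OF t, of 1] abs_ge_zero, of 2] xcx by simp
  have FFB: "FF t \<le> FM" if t: "0 \<le> t" for t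
    unfolding FF_def FM_def
  proof (intro add_mono mult_mono divide_right_mono)
    have tH: "t \<in> HT" using t HT by simp
    show "(BB t)^2 \<le> b1^2" using b1[OF t] BB_ge(2)[of t] BB0[of t] by (intro power_mono) auto
    show "(muc t)^2 \<le> b2^2" using power_mono[OF muB[OF t] abs_ge_zero, of 2] by simp
    show "al t \<le> alpha_psi K Bd" using alpha_mono[OF norm_ge_zero, of "psi t" Bd] bd[OF t] by (simp add: al_def)
    show "ri t \<le> 1" using ri_props[OF tH] by auto
  qed (use t XXB SqB M1 BB0[of t] al_nonneg[of t] Sq_nonneg[of t] ri_props[of t] HT in auto)
  have EsB: "ri t * Es0 (dd t) \<le> FM + c0" if t: "0 \<le> t" for t
  proof -
    have tH: "t \<in> HT" using t HT by simp
    have FM0: "0 \<le> FM" using FFB[OF t] FF_nonneg[OF tH] by linarith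
    show ?thesis
    proof (cases "dd t < 0")
      case True
      have "dd 0 \<le> dd t" using dd_strict[of 0 t] t by (cases "t = 0") auto
      moreover have "0 \<le> (Ed0 (dd t))^2 / (8 * M^2)" by simp
      ultimately have "Es0 (dd t) \<le> c0" using c(2)[of "dd t"] True by linarith
      then have "ri t * Es0 (dd t) \<le> ri t * c0" using ri_props[OF tH] by (intro mult_left_mono) auto
      also have "... \<le> 1 * c0" using ri_props[OF tH] c(1) by (intro mult_right_mono) auto
      finally show ?thesis using FM0 by simp
    next
      case False
      then have d: "0 \<le> dd t" "dd t \<in> HT" using HT by auto
      have "ri t \<le> ri (dd t)"
        unfolding ri_def using r_mono[OF tH d(1)] delay_props(2)[OF t] ge1(1)[OF d(2)] by (intro divide_left_mono power_mono) auto
      then have "ri t * (Es0 (dd t) + (Ed0 (dd t))^2 / (8 * M^2)) \<le> FF (dd t)"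
        using ri_props[OF tH] by (intro emission_le_FF[OF d(2)]) auto
      moreover have "ri t * Es0 (dd t) \<le> ri t * (Es0 (dd t) + (Ed0 (dd t))^2 / (8 * M^2))"
        using ri_props[OF tH] by (intro mult_left_mono) auto
      ultimately show ?thesis using FFB[OF d(1)] c(1) by linarith
    qed
  qed
  define sM where "sM = U0 * (2 * Bd)"
  have ssB: "(ss t)^2 \<le> sM" if t: "0 \<le> t" for t
  proof -
    have tH: "t \<in> HT" using t HT by simp
    have "0 \<le> (XX t)^2 / 2 + rr t * ZZ t / M" using rZ[OF t] by simp
    then have "(ss t)^2 / (2 * sqrt (rru t)) \<le> U0" using VV_lower[OF tH] VU[OF t] by linarith
    then have "(ss t)^2 \<le> U0 * (2 * sqrt (rru t))" using ge1(2)[OF tH] by (simp add: pos_divide_le_eq)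
    also have "... \<le> U0 * (2 * Bd)"
    proof (intro mult_left_mono)
      have "sqrt (rru t) \<le> sqrt (Bd^2)"
        using bd[OF t] Bd1 mult_left_mono[of 1 Bd Bd] unfolding power2_eq_square by (intro real_sqrt_le_mono) linarith
      then show "sqrt (rru t) \<le> Bd" using Bd1 by simp
      show "0 \<le> U0" using VU[OF t] VV_nonneg[OF tH] by linarith
    qed simp
    finally show ?thesis by (simp add: sM_def)
  qed
  \<comment> \<open>the maximum with 1 only serves to make C positive\<close>
  define C where "C = max 1 (100 * M^28 * b1^10 * (M * U0) + 100 * M^28 * b1^4 * (1 + \<theta>^2) * Bd^2 + 100 * M^28 * sM + FM + (FM + c0))"
  obtain e where e: "\<And>t. 0 \<le> t ==> dd t = 0 ==> t = e" using crossing by blast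
  have slope: "f t - f s \<le> C * (t - s)" if st: "0 \<le> s" "s \<le> t" for s t
  proof -
    have "f t - C * t \<le> f s - C * s"
    proof (rule nonincreasing_except_one[where e = e and f = "\<lambda>t. f t - C * t"])
      show "continuous_on {s..t} (\<lambda>t. f t - C * t)"
        using st by (intro continuous_intros continuous_on_subset[OF cf]) auto
      fix v assume v: "s < v" "v < t" "v \<noteq> e"
      have v0: "0 < v" "0 \<le> v" and vH: "v \<in> HT" using v st HT by auto
      have dv: "dd v \<noteq> 0" using e[of v] v v0 by auto
      obtain D1 where D1: "(coreV has_real_derivative D1) (at v)" "D1 \<le> - (1 / (2 * M^2)) * (rr v)^2 * ZZ v
         + 100 * M^28 * BB1 v ^10 * rr v * ZZ v + 100 * M^28 * BB v ^4 * (1 + \<theta>^2) * (XX v)^2 + 100 * M^28 * (ss v)^2 - NN v"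
        using core_deriv[OF vH v0(1)] by blast
      obtain D2 where D2: "((\<lambda>s. V (psi s) / rr s ^ (2*n)) has_real_derivative D2) (at v)"
         "D2 \<le> - ri v * al v + FF v + ri v * Es0 (dd v)" using psi_part[OF vH v0(1) dv] by blast
      have r: "1 \<le> rr v" by (rule ge1(1)[OF vH])
      have t1: "- (1 / (2 * M^2)) * (rr v)^2 * ZZ v \<le> 0" using ZZ_nonneg[of v] by simp
      have t2: "100 * M^28 * BB1 v ^10 * rr v * ZZ v \<le> 100 * M^28 * b1^10 * (M * U0)"
      proof -
        have "rr v * ZZ v / M \<le> U0"
        proof -
          have "0 \<le> (XX v)^2 / 2" "0 \<le> (ss v)^2 / (2 * sqrt (rru v))" using ge1(2)[OF vH] by auto
          then show ?thesis using VV_lower[OF vH] VU[OF v0(2)] by linarith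
        qed
        then have "rr v * ZZ v \<le> M * U0" using M1 by (simp add: pos_divide_le_eq mult.commute)
        moreover have "BB1 v ^10 \<le> b1^10" using b1[OF v0(2)] BB0[of v] by (intro power_mono) auto
        ultimately have "(100 * M^28) * (BB1 v ^10 * (rr v * ZZ v)) \<le> (100 * M^28) * (b1^10 * (M * U0))"
          using BB0[of v] M1 r ZZ_nonneg[of v] b1p by (intro mult_left_mono mult_mono[of "BB1 v ^ 10"]) auto
        then show ?thesis by (simp add: mult.assoc)
      qed
      have t3: "100 * M^28 * BB v ^4 * (1 + \<theta>^2) * (XX v)^2 \<le> 100 * M^28 * b1 ^4 * (1 + \<theta>^2) * Bd^2"
      proof (rule mult_mono[OF _ XXB[OF v0(2)]])
        have "BB v ^ 4 \<le> b1 ^ 4" using b1[OF v0(2)] BB0[of v] BB_ge(2)[of v] by (intro power_mono) auto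
        then show "100 * M^28 * BB v ^4 * (1 + \<theta>^2) \<le> 100 * M^28 * b1 ^4 * (1 + \<theta>^2)"
          using M1 by (intro mult_right_mono mult_left_mono) auto
      qed (use M1 b1p in auto)
      have t4: "100 * M^28 * (ss v)^2 \<le> 100 * M^28 * sM" using ssB[OF v0(2)] M1 by (intro mult_left_mono) auto
      have t5: "- ri v * al v \<le> 0" using ri_props[OF vH] al_nonneg[of v] by simp
      have "D1 + D2 \<le> C" using D1(2) D2(2) t1 t2 t3 t4 t5 FFB[OF v0(2)] EsB[OF v0(2)] NN_nonneg[OF vH] unfolding C_def by linarith
      moreover have "((\<lambda>t. f t - C * t) has_real_derivative D1 + D2 - C * 1) (at v)"
        unfolding f_def by (intro DERIV_diff DERIV_add D1 D2 DERIV_cmult DERIV_ident)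
      ultimately show "\<exists>D\<le>0. ((\<lambda>t. f t - C * t) has_real_derivative D) (at v)" by (intro exI[of _ "D1 + D2 - C * 1"]) auto
    qed (rule st)
    then show ?thesis by (simp add: algebra_simps)
  qed
  have lim: "(f \<longlongrightarrow> 0) at_top"
    by (rule one_sided_barbalat[OF f0 cf _ slope I]) (auto simp: C_def)
  have ev0: "\<forall>\<^sub>F t in at_top. (0::real) \<le> t" by (rule eventually_ge_at_top)
  have null: "(g \<longlongrightarrow> 0) at_top" if h: "(h \<longlongrightarrow> 0) at_top" and le: "\<And>t. 0 \<le> t ==> \<bar>g t\<bar> \<le> h t" for g h :: "real => real"
  proof (rule Lim_null_comparison[OF _ h])
    show "\<forall>\<^sub>F t in at_top. norm (g t) \<le> h t" using ev0 by (rule eventually_mono) (use le in auto)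
  qed
  have sq: "((\<lambda>t. sqrt (c * f t)) \<longlongrightarrow> 0) at_top" for c
    using tendsto_real_sqrt[OF tendsto_mult_right_zero[OF lim, of c]] by simp
  have x1l: "(x1 \<longlongrightarrow> 0) at_top"
  proof (rule null[OF sq[of 2]])
    fix t :: real assume "0 \<le> t"
    then show "\<bar>x1 t\<bar> \<le> sqrt (2 * f t)" using cl[of t] rZ[of t] by (intro real_le_rsqrt) simp
  qed
  have eo: "eN t \<le> sqrt (M * f t) \<and> oN t \<le> sqrt (M * f t)" if t: "0 \<le> t" for t
  proof -
    have "1 * ZZ t \<le> rr t * ZZ t" using ge1(1)[of t] t HT ZZ_nonneg[of t] by (intro mult_right_mono) auto
    also have "... = M * (rr t * ZZ t / M)" using M1 by simp
    also have "... \<le> M * f t"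
    proof (intro mult_left_mono)
      have "0 \<le> (XX t)^2 / 2" by simp
      then show "rr t * ZZ t / M \<le> f t" using cl[OF t] by linarith
    qed (use M1 in auto)
    finally have "ZZ t \<le> M * f t" by simp
    then have "(eN t)^2 \<le> M * f t" "(oN t)^2 \<le> M * f t"
      using zero_le_power2[of "eN t"] zero_le_power2[of "oN t"] unfolding ZZ_def by linarith+
    then show ?thesis by (auto intro: real_le_rsqrt)
  qed
  have rpow: "\<bar>rr t ^ k\<bar> \<le> Bd ^ n" if "0 \<le> t" "k \<le> n" for t k
  proof -
    have "\<bar>rr t\<bar> ^ k \<le> Bd ^ k" using bd[OF that(1)] by (intro power_mono) auto
    also have "... \<le> Bd ^ n" using Bd1 that by (intro power_increasing) auto
    finally show ?thesis by (simp add: power_abs)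
  qed
  have vtB: "\<bar>vt t\<bar> \<le> b1^2 * \<bar>x1 t\<bar>" if "0 \<le> t" for t
    using b1[OF that] BB0(2)[of t] that HT by (intro order_trans[OF vt_bound] mult_right_mono power_mono) auto
  have x1n: "((\<lambda>t. b1^2 * \<bar>x1 t\<bar>) \<longlongrightarrow> 0) at_top" by (intro tendsto_mult_right_zero tendsto_rabs_zero x1l)
  have xcl: "((\<lambda>t. xc t i) \<longlongrightarrow> 0) at_top" if i: "i \<in> {1..n}" for i
  proof (cases "i = 1")
    case True
    then show ?thesis using x1l xcx[abs_def] by simp
  next
    case False
    then have i: "i \<in> {2..n}" using i by auto
    have "((\<lambda>t. Bd ^ n * (sqrt (M * f t) + sqrt (M * f t)) + b1^2 * \<bar>x1 t\<bar>) \<longlongrightarrow> 0) at_top"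
      by (intro tendsto_add_zero tendsto_mult_right_zero sq x1n)
    then show ?thesis
    proof (rule null)
      fix t :: real assume t: "0 \<le> t"
      then have tH: "t \<in> HT" using HT by simp
      have "xc t i = rr t ^ (i-1) * (om t i - ep t i) - (if i = 2 then vt t else 0)"
        using xc_eq[OF tH, of i] zc_eq[OF tH i] by (simp add: algebra_simps)
      moreover have "\<bar>rr t ^ (i-1) * (om t i - ep t i)\<bar> \<le> Bd ^ n * (sqrt (M * f t) + sqrt (M * f t))"
        unfolding abs_mult using rpow[OF t, of "i-1"] i ep_om_abs[OF i, of t] eo[OF t] Bd1 by (intro mult_mono) auto
      moreover have "\<bar>if i = 2 then vt t else 0\<bar> \<le> b1^2 * \<bar>x1 t\<bar>" using vtB[OF t] by simp
      ultimately show "\<bar>xc t i\<bar> \<le> Bd ^ n * (sqrt (M * f t) + sqrt (M * f t)) + b1^2 * \<bar>x1 t\<bar>" by linarith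
    qed
  qed
  have xhl: "((\<lambda>t. xh_sig w t $ jx i) \<longlongrightarrow> 0) at_top" if i: "i \<in> {2..n}" for i
  proof -
    have "isCont (f_obs K Ctl i) 0" using cont_f_obs[OF i] by (simp add: continuous_on_eq_continuous_at)
    then have "(f_obs K Ctl i \<longlongrightarrow> 0) (at 0)" "f_obs K Ctl i 0 = 0" by (auto simp: isCont_def f_obs_0)
    then have fo: "((\<lambda>t. f_obs K Ctl i (x1 t)) \<longlongrightarrow> 0) at_top"
      using isCont_tendsto_compose[OF \<open>isCont (f_obs K Ctl i) 0\<close> x1l] by simp
    have "((\<lambda>t. Bd ^ n * sqrt (M * f t) + b1^2 * \<bar>x1 t\<bar> + Bd ^ n * \<bar>f_obs K Ctl i (x1 t)\<bar>) \<longlongrightarrow> 0) at_top"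
      by (intro tendsto_add_zero tendsto_mult_right_zero tendsto_rabs_zero sq x1n fo)
    then show ?thesis
    proof (rule null)
      fix t :: real assume t: "0 \<le> t"
      then have tH: "t \<in> HT" using HT by simp
      have "xh_sig w t $ jx i = rr t ^ (i-1) * om t i - (if i = 2 then vt t else 0) - rr t ^ (i-1) * f_obs K Ctl i (x1 t)"
        using zc_eq[OF tH i] by (simp add: zc_def)
      moreover have "\<bar>rr t ^ (i-1) * om t i\<bar> \<le> Bd ^ n * sqrt (M * f t)"
        unfolding abs_mult using rpow[OF t, of "i-1"] i ep_om_abs(2)[OF i, of t] eo[OF t] Bd1 by (intro mult_mono) auto
      moreover have "\<bar>if i = 2 then vt t else 0\<bar> \<le> b1^2 * \<bar>x1 t\<bar>" using vtB[OF t] by simp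
      moreover have "\<bar>rr t ^ (i-1) * f_obs K Ctl i (x1 t)\<bar> \<le> Bd ^ n * \<bar>f_obs K Ctl i (x1 t)\<bar>"
        unfolding abs_mult using rpow[OF t, of "i-1"] i by (intro mult_right_mono) auto
      ultimately show "\<bar>xh_sig w t $ jx i\<bar> \<le> Bd ^ n * sqrt (M * f t) + b1^2 * \<bar>x1 t\<bar> + Bd ^ n * \<bar>f_obs K Ctl i (x1 t)\<bar>" by linarith
    qed
  qed
  have psil: "(psi \<longlongrightarrow> 0) at_top"
  proof (rule tendstoI)
    fix \<epsilon> :: real assume \<epsilon>: "0 < \<epsilon>"
    define S where "S = cball (0 :: real ^ 'p) Bd - ball 0 \<epsilon>"
    have "compact S" unfolding S_def by (intro compact_diff) auto
    have cV: "continuous_on S V"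
    proof (intro continuous_at_imp_continuous_on ballI)
      fix \<psi>
      obtain D where "GDERIV V \<psi> :> D" using Vc unfolding lyapunov_candidate_def by blast
      then show "isCont V \<psi>" unfolding gderiv_def by (rule has_derivative_continuous)
    qed
    obtain m where m: "0 < m" "\<And>\<psi>. \<psi> \<in> S ==> m \<le> V \<psi>"
    proof (cases "S = {}")
      case True
      then show thesis using that[of 1] by auto
    next
      case False
      from continuous_attains_inf[OF \<open>compact S\<close> False cV] obtain \<psi> where "\<psi> \<in> S" "\<forall>y\<in>S. V \<psi> \<le> V y" by blast
      moreover have "\<psi> \<noteq> 0" using \<open>\<psi> \<in> S\<close> \<epsilon> by (auto simp: S_def)
      ultimately show thesis using that[of "V \<psi>"] Vc by (auto simp: lyapunov_candidate_def)
    qed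
    have "((\<lambda>t. Bd ^ (2*n) * f t) \<longlongrightarrow> 0) at_top" by (rule tendsto_mult_right_zero[OF lim])
    from order_tendstoD(2)[OF this m(1)] ev0 show "\<forall>\<^sub>F t in at_top. dist (psi t) 0 < \<epsilon>"
    proof eventually_elim
      fix t :: real assume t: "Bd ^ (2*n) * f t < m" "0 \<le> t"
      then have tH: "t \<in> HT" using HT by simp
      have r: "1 \<le> rr t" by (rule ge1(1)[OF tH])
      have "0 \<le> coreV t" using core_lower[OF tH] rZ[OF t(2)] zero_le_power2[of "XX t"] by linarith
      then have "V (psi t) / rr t ^ (2*n) \<le> f t" by (simp add: f_def)
      then have "V (psi t) \<le> f t * rr t ^ (2*n)" using r by (simp add: pos_divide_le_eq)
      also have "... \<le> f t * Bd ^ (2*n)" using r bd[OF t(2)] f0[OF t(2)] by (intro mult_left_mono power_mono) auto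
      finally have "V (psi t) < m" using t(1) by (simp add: mult.commute)
      then have "psi t \<notin> S" using m(2)[of "psi t"] by force
      then show "dist (psi t) 0 < \<epsilon>" using bd[OF t(2)] by (auto simp: S_def)
    qed
  qed
  have "(x_sig w \<longlongrightarrow> 0) at_top"
  proof (rule vec_tendstoI)
    fix j :: 'n
    obtain i where i: "i \<in> {1..n}" "j = ix i" using ix unfolding bij_betw_def by (metis UNIV_I imageE)
    show "((\<lambda>t. x_sig w t $ j) \<longlongrightarrow> 0 $ j) at_top" using xcl[OF i(1)] i(2) by (simp add: xc_def)
  qed
  moreover have "(xh_sig w \<longlongrightarrow> 0) at_top"
  proof (rule vec_tendstoI)
    fix j :: 'm
    obtain i where i: "i \<in> {2..n}" "j = jx i" using jx unfolding bij_betw_def by (metis UNIV_I imageE)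
    show "((\<lambda>t. xh_sig w t $ j) \<longlongrightarrow> 0 $ j) at_top" using xhl[OF i(1)] i(2) by simp
  qed
  ultimately show ?thesis using psil by (simp add: signals_converge_def)
qed

end

lemma (in plant_data) bounded_and_convergent:
  assumes S: "sol \<infinity> w"
  shows "signals_bounded w \<and> signals_converge w"
proof -
  interpret L: loop n ix jx K M G \<kappa> Bo Bc p q Bx bh bh' v1 v1' P H \<theta> m1 m1t m2 V \<infinity> w
    by unfold_locales (rule S)
  have "same_initial w w" by (simp add: same_initial_def)
  moreover obtain Bd where "\<forall>T w'. sol T w' \<and> same_initial w w' \<longrightarrow> (\<forall>t\<in>horizon T. signals_within Bd w' t)"
    using uniform_bound[of w] by blast
  ultimately have Bd: "signals_within Bd w t" if "0 \<le> t" for t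
    using S that by (force simp: horizon_def)
  have "signals_converge w" by (rule L.convergence[of Bd]) (use Bd in auto)
  moreover have "signals_bounded w" unfolding signals_bounded_def bounded_iff using Bd unfolding signals_within_def by auto
  ultimately show ?thesis by blast
qed

section \<open>The closed loop as a delay differential equation\<close>

lemma same_initial_admissible:
  assumes s: "same_initial w w'" and a: "admissible_initial K C H w"
  shows "admissible_initial K C H w'"
proof -
  have eq: "\<And>t. t \<le> 0 ==> x_sig w t = x_sig w' t" "\<And>t. t \<le> 0 ==> psi_sig w t = psi_sig w' t"
    "\<And>t. t < 0 ==> u_sig w t = u_sig w' t" "r_sig w 0 = r_sig w' 0" "ru_sig w 0 = ru_sig w' 0" "th_sig w 0 = th_sig w' 0"
    using s by (simp_all add: same_initial_def)
  have p: "admissible_past K H (x_sig w) (psi_sig w) (u_sig w)" using a by (simp add: admissible_initial_def)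
  have "continuous_on {..0} (x_sig w')" "continuous_on {..0} (psi_sig w')" "continuous_on {..<0} (u_sig w')"
    using p eq unfolding admissible_past_def by (auto elim!: continuous_on_eq)
  moreover have "\<exists>L. (u_sig w' \<longlongrightarrow> L) (at_left 0)"
  proof -
    obtain L where "(u_sig w \<longlongrightarrow> L) (at_left 0)" using p by (auto simp: admissible_past_def)
    moreover have "\<forall>\<^sub>F t in at_left 0. u_sig w t = u_sig w' t" using eq(3) by (auto simp: eventually_at_filter)
    ultimately show ?thesis by (intro exI[of _ L]) (rule Lim_transform_eventually)
  qed
  moreover have "psi_sig w' 0 \<in> S_psi K" "\<forall>s<0. psi_sig w' s \<in> H" using p eq by (auto simp: admissible_past_def)
  ultimately show ?thesis using a eq unfolding admissible_initial_def admissible_past_def by auto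
qed

text \<open>
  The joint state in the order \<open>(x, \<psi>, xhat, \<zeta>, r, r\<^sub>u, \<theta>hat)\<close>, with a projection \<open>s...\<close> for each
  component.
\<close>

type_synonym ('n, 'p, 'm) state = "(real ^ 'n) \<times> (real ^ 'p) \<times> (real ^ 'm) \<times> real \<times> real \<times> real \<times> real"

definition sx :: "('n::finite, 'p::finite, 'm::finite) state => real ^ 'n" where "sx z = fst z"
definition sp :: "('n::finite, 'p::finite, 'm::finite) state => real ^ 'p" where "sp z = fst (snd z)"
definition sh :: "('n::finite, 'p::finite, 'm::finite) state => real ^ 'm" where "sh z = fst (snd (snd z))"
definition sz :: "('n::finite, 'p::finite, 'm::finite) state => real" where "sz z = fst (snd (snd (snd z)))"
definition sr :: "('n::finite, 'p::finite, 'm::finite) state => real" where "sr z = fst (snd (snd (snd (snd z))))"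
definition sru :: "('n::finite, 'p::finite, 'm::finite) state => real" where "sru z = fst (snd (snd (snd (snd (snd z)))))"
definition sth :: "('n::finite, 'p::finite, 'm::finite) state => real" where "sth z = snd (snd (snd (snd (snd (snd z)))))"
lemmas state_defs = sx_def sp_def sh_def sz_def sr_def sru_def sth_def

lemma state_linear: "bounded_linear sx" "bounded_linear sp" "bounded_linear sh" "bounded_linear sz"
  "bounded_linear sr" "bounded_linear sru" "bounded_linear sth"
  unfolding state_defs
  by (intro bounded_linear_fst_comp bounded_linear_snd_comp bounded_linear_ident)+

lemmas state_cont [continuous_intros] = state_linear[THEN bounded_linear.continuous_on]

definition state_at :: "('n::finite, 'p::finite, 'm::finite) signals => real => ('n, 'p, 'm) state" where
  "state_at w t = (x_sig w t, psi_sig w t, xh_sig w t, zeta_sig w t, r_sig w t, ru_sig w t, th_sig w t)"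

lemma state_at_sel [simp]: "sx (state_at w t) = x_sig w t" "sp (state_at w t) = psi_sig w t" "sh (state_at w t) = xh_sig w t"
  "sz (state_at w t) = zeta_sig w t" "sr (state_at w t) = r_sig w t" "sru (state_at w t) = ru_sig w t" "sth (state_at w t) = th_sig w t"
  by (simp_all add: state_defs state_at_def)

context plant_data begin

text \<open>
  The right-hand sides of the closed loop as functions of the joint state. Replacing \<open>r\<close> by
  \<open>max 1 r\<close> makes them continuous everywhere and changes nothing along solutions, where \<open>r \<ge> 1\<close>.
\<close>

definition "uS (z :: ('n, 'p, 'm) state) = sz z - sru z * sx z $ ix n"
definition "s1 (z :: ('n, 'p, 'm) state) = sx z $ ix 1"
definition "sR (z :: ('n, 'p, 'm) state) = max 1 (sr z)"
definition "ax t (z :: ('n, 'p, 'm) state) = (\<chi> j. let i = inv_into {1..n} ix j in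
   if i < n then phi K i (s1 z) * sx z $ ix (i+1) + drift P i t (sx z) else mu P t (sx z) (sp z) (uS z))"
definition "aw (z :: ('n, 'p, 'm) state) = varpi jx n K Ctl (s1 z) (sh z) (sR z) (sth z)"
definition "art (z :: ('n, 'p, 'm) state) = r_dot Ctl (s1 z) (sR z) (sth z)"
definition "aru (z :: ('n, 'p, 'm) state) = ru_dot jx n K Ctl (outp ix n (sx z)) (uS z) (sh z) (sR z) (sru z) (sth z)"
definition "aut (z :: ('n, 'p, 'm) state) = u_tilde jx n K Ctl (s1 z) (sh z) (sR z) (sth z)"
definition "azt (z :: ('n, 'p, 'm) state) = aru z * sx z $ ix n + sru z * aut z"
definition "ath (z :: ('n, 'p, 'm) state) = q (s1 z) * (s1 z)^2"
definition "ah (z :: ('n, 'p, 'm) state) = (\<chi> j. let i = inv_into {2..n} jx j in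
   (if i < n then phi K i (s1 z) * (sh z $ jx (i + 1) + sR z ^ i * f_obs K Ctl (i + 1) (s1 z)) else aut z)
   - sR z ^ (i-1) * g_gain Ctl i (s1 z) * (sh z $ jx 2 + sR z * f_obs K Ctl 2 (s1 z))
   - real (i-1) * art z * sR z ^ (i-2) * f_obs K Ctl i (s1 z))"
definition "aq t (z :: ('n, 'p, 'm) state) dl = (case dl of (xd, \<psi>d, ud) => q_psi P t (sx z) (sp z) (uS z) xd \<psi>d ud)"

definition "rhs t (z :: ('n, 'p, 'm) state) dl = (ax t z, aq t z dl, ah z, azt z, art z, aru z, ath z)"

lemma rhs_sel: "sx (rhs t z dl) = ax t z" "sp (rhs t z dl) = aq t z dl" "sh (rhs t z dl) = ah z" "sz (rhs t z dl) = azt z"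
  "sr (rhs t z dl) = art z" "sru (rhs t z dl) = aru z" "sth (rhs t z dl) = ath z"
  by (simp_all add: rhs_def state_defs)

lemma cont_parts [continuous_intros]:
  fixes z :: "'c::topological_space => ('n, 'p, 'm) state"
  assumes z: "continuous_on A z"
  shows "continuous_on A (\<lambda>c. uS (z c))" "continuous_on A (\<lambda>c. s1 (z c))" "continuous_on A (\<lambda>c. sR (z c))"
  unfolding uS_def s1_def sR_def by (intro continuous_intros z)+

lemma sR_ge: "1 \<le> sR z" by (simp add: sR_def)

lemma cont_aw [continuous_intros]:
  fixes z :: "'c::topological_space => ('n, 'p, 'm) state"
  assumes z: "continuous_on A z"
  shows "continuous_on A (\<lambda>c. aw (z c))"
proof -
  have "continuous_on A (\<lambda>c. aw (z c) $ j)" for j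
  proof -
    obtain i where i: "i \<in> {2..n}" "j = jx i" using jx unfolding bij_betw_def by (metis UNIV_I imageE)
    have two: "2 \<in> {2..n}" using n2 by simp
    have ne: "sR (z c) \<noteq> 0" for c using sR_ge[of "z c"] by linarith
    show ?thesis unfolding aw_def i(2) varpi_jx[OF i(1)] using z ne
      by (cases "i = 2") (auto intro!: continuous_intros cont_compose1[OF cont_f_obs[OF i(1)]] cont_compose1[OF cont_f_obs[OF two]] cont_compose1[OF cont_v1])
  qed
  then show ?thesis using continuous_on_vec_lambda[of A "\<lambda>i c. aw (z c) $ i"] by simp
qed

lemma cont_rates [continuous_intros]:
  fixes z :: "'c::topological_space => ('n, 'p, 'm) state"
  assumes z: "continuous_on A z"
  shows "continuous_on A (\<lambda>c. art (z c))" "continuous_on A (\<lambda>c. aru (z c))" "continuous_on A (\<lambda>c. aut (z c))"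
    "continuous_on A (\<lambda>c. azt (z c))" "continuous_on A (\<lambda>c. ath (z c))"
proof -
  show r: "continuous_on A (\<lambda>c. art (z c))" unfolding art_def r_dot_eq using z by (intro continuous_intros)
  have e: "aru z = gate (Ruf (outp ix n (sx z)) (uS z) (sR z) (art z) (sth z) (aw z) - sru z)
     * (\<bar>sru z\<bar>^3 * W2' (outp ix n (sx z)) (uS z) (sR z) (art z) (sth z) (aw z))" for z
    unfolding aru_def ru_dot_eq art_def aw_def s1_def by (simp add: outp_def)
  show ru: "continuous_on A (\<lambda>c. aru (z c))" unfolding e unfolding outp_def using z r by (intro continuous_intros)
  show ut: "continuous_on A (\<lambda>c. aut (z c))" unfolding aut_def u_tilde_eq unfolding aw_def[symmetric] using z
    by (intro continuous_intros cont_compose1[OF cont_bh])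
  show "continuous_on A (\<lambda>c. azt (z c))" unfolding azt_def using z by (intro continuous_intros ru ut)
  show "continuous_on A (\<lambda>c. ath (z c))" unfolding ath_def using z by (intro continuous_intros cont_compose1[OF cont_q])
qed

lemma cont_ah [continuous_intros]:
  fixes z :: "'c::topological_space => ('n, 'p, 'm) state"
  assumes z: "continuous_on A z"
  shows "continuous_on A (\<lambda>c. ah (z c))"
  unfolding ah_def
proof (rule continuous_on_vec_lambda)
  fix j
  obtain i where i: "i \<in> {2..n}" "j = jx i" using jx unfolding bij_betw_def by (metis UNIV_I imageE)
  have two: "2 \<in> {2..n}" using n2 by simp
  show "continuous_on A (\<lambda>c. let i = inv_into {2..n} jx j in
   (if i < n then phi K i (s1 (z c)) * (sh (z c) $ jx (i + 1) + sR (z c) ^ i * f_obs K Ctl (i + 1) (s1 (z c))) else aut (z c))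
   - sR (z c) ^ (i-1) * g_gain Ctl i (s1 (z c)) * (sh (z c) $ jx 2 + sR (z c) * f_obs K Ctl 2 (s1 (z c)))
   - real (i-1) * art (z c) * sR (z c) ^ (i-2) * f_obs K Ctl i (s1 (z c)))"
  proof (cases "i < n")
    case True
    then have k: "i + 1 \<in> {2..n}" "i \<in> {1..n-1}" using i by auto
    show ?thesis unfolding i(2) jx_inv[OF i(1)] Let_def Ctl_sel if_P[OF True] using z
      by (intro continuous_intros cont_compose1[OF cont_f_obs[OF k(1)]] cont_compose1[OF cont_f_obs[OF i(1)]]
          cont_compose1[OF cont_f_obs[OF two]] cont_compose1[OF cont_phi[OF k(2)]] cont_compose1[OF p_cont])
  next
    case False
    show ?thesis unfolding i(2) jx_inv[OF i(1)] Let_def Ctl_sel if_not_P[OF False] using z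
      by (intro continuous_intros cont_compose1[OF cont_f_obs[OF i(1)]]
          cont_compose1[OF cont_f_obs[OF two]] cont_compose1[OF p_cont])
  qed
qed

lemma cont_ax [continuous_intros]:
  fixes z :: "'c::topological_space => ('n, 'p, 'm) state"
  assumes z: "continuous_on A z" and t: "continuous_on A t"
  shows "continuous_on A (\<lambda>c. ax (t c) (z c))"
  unfolding ax_def
proof (rule continuous_on_vec_lambda)
  fix j
  obtain i where i: "i \<in> {1..n}" "j = ix i" using ix unfolding bij_betw_def by (metis UNIV_I imageE)
  have inv: "inv_into {1..n} ix (ix i) = i" using ix i by (simp add: bij_betw_def)
  show "continuous_on A (\<lambda>c. let i = inv_into {1..n} ix j in
   if i < n then phi K i (s1 (z c)) * sx (z c) $ ix (i+1) + drift P i (t c) (sx (z c)) else mu P (t c) (sx (z c)) (sp (z c)) (uS (z c)))"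
  proof (cases "i < n")
    case True
    then have k: "i \<in> {1..n-1}" using i by auto
    have d: "continuous_on UNIV (\<lambda>(t, x). drift P i t x)" using pc k by (auto simp: plant_continuous_def)
    have "continuous_on A (\<lambda>c. (t c, sx (z c)))" using z t by (intro continuous_intros)
    from continuous_on_compose2[OF d this] have "continuous_on A (\<lambda>c. drift P i (t c) (sx (z c)))" by simp
    then show ?thesis unfolding i(2) inv Let_def if_P[OF True] using z
      by (intro continuous_intros cont_compose1[OF cont_phi[OF k]])
  next
    case False
    have d: "continuous_on UNIV (\<lambda>(t, x, \<psi>, u). mu P t x \<psi> u)" using pc by (auto simp: plant_continuous_def)
    have "continuous_on A (\<lambda>c. (t c, sx (z c), sp (z c), uS (z c)))" using z t by (intro continuous_intros)
    from continuous_on_compose2[OF d this] show ?thesis unfolding i(2) inv Let_def if_not_P[OF False] by simp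
  qed
qed

lemma cont_aq [continuous_intros]:
  fixes z :: "'c::topological_space => ('n, 'p, 'm) state"
  assumes z: "continuous_on A z" and t: "continuous_on A t" and d: "continuous_on A dl"
  shows "continuous_on A (\<lambda>c. aq (t c) (z c) (dl c))"
proof -
  have q: "continuous_on UNIV (\<lambda>(t, x, \<psi>, u, xd, \<psi>d, ud). q_psi P t x \<psi> u xd \<psi>d ud)" using pc by (auto simp: plant_continuous_def)
  have "continuous_on A (\<lambda>c. (t c, sx (z c), sp (z c), uS (z c), dl c))" using z t d by (intro continuous_intros)
  from continuous_on_compose2[OF q this] show ?thesis by (simp add: aq_def split_def)
qed

lemma cont_rhs [continuous_intros]:
  fixes z :: "'c::topological_space => ('n, 'p, 'm) state"
  assumes z: "continuous_on A z" and t: "continuous_on A t" and d: "continuous_on A dl"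
  shows "continuous_on A (\<lambda>c. rhs (t c) (z c) (dl c))"
  unfolding rhs_def using assms by (intro continuous_intros)

definition "del w t = (x_sig w t, psi_sig w t, u_sig w t)"

definition ode_at :: "('n, 'p, 'm) signals => real => bool" where
  "ode_at w t \<longleftrightarrow> 1 \<le> r_sig w t \<and> u_sig w t = uS (state_at w t) \<and>
      (x_sig w has_vector_derivative ax t (state_at w t)) (at t within {0..}) \<and>
      (xh_sig w has_vector_derivative ah (state_at w t)) (at t within {0..}) \<and>
      (zeta_sig w has_vector_derivative azt (state_at w t)) (at t within {0..}) \<and>
      (r_sig w has_vector_derivative art (state_at w t)) (at t within {0..}) \<and>
      (ru_sig w has_vector_derivative aru (state_at w t)) (at t within {0..}) \<and>
      (th_sig w has_vector_derivative ath (state_at w t)) (at t within {0..}) \<and>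
      (t - delay P t \<noteq> 0 \<longrightarrow> (psi_sig w has_vector_derivative aq t (state_at w t) (del w (t - delay P t))) (at t within {0..}))"

lemma solution_iff_ode:
  "sol T w \<longleftrightarrow> admissible_initial K Ctl H w \<and> continuous_on (horizon T) (psi_sig w) \<and> continuous_on (horizon T) (u_sig w) \<and>
    (\<forall>t\<in>horizon T. ode_at w t)"
  (is "_ \<longleftrightarrow> ?R")
proof -
  have ixv: "ax t z $ ix i = (if i < n then phi K i (s1 z) * sx z $ ix (i+1) + drift P i t (sx z) else mu P t (sx z) (sp z) (uS z))"
    if "i \<in> {1..n}" for t z i using ix that by (simp add: ax_def bij_betw_def)
  have jxv: "ah z $ jx i = (if i < n then phi K i (s1 z) * (sh z $ jx (i + 1) + sR z ^ i * f_obs K Ctl (i + 1) (s1 z)) else aut z)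
   - sR z ^ (i-1) * g_gain Ctl i (s1 z) * (sh z $ jx 2 + sR z * f_obs K Ctl 2 (s1 z))
   - real (i-1) * art z * sR z ^ (i-2) * f_obs K Ctl i (s1 z)" if "i \<in> {2..n}" for z i
    using jx_inv[OF that] by (simp add: ah_def Let_def)
  have allix: "(\<forall>j. Q j) \<longleftrightarrow> (\<forall>i\<in>{1..n}. Q (ix i))" for Q :: "'n => bool"
    using ix unfolding bij_betw_def by (metis UNIV_I imageE)
  have alljx: "(\<forall>j. Q j) \<longleftrightarrow> (\<forall>i\<in>{2..n}. Q (jx i))" for Q :: "'m => bool"
    using jx unfolding bij_betw_def by (metis UNIV_I imageE)
  have vec: "(f has_vector_derivative D) (at t within S) \<longleftrightarrow> (\<forall>j. ((\<lambda>s. f s $ j) has_real_derivative D $ j) (at t within S))"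
    for f :: "real => real ^ 'k" and D t S
  proof
    assume "(f has_vector_derivative D) (at t within S)"
    then show "\<forall>j. ((\<lambda>s. f s $ j) has_real_derivative D $ j) (at t within S)"
      using bounded_linear.has_vector_derivative[OF bounded_linear_vec_nth]
      by (auto simp: has_real_derivative_iff_has_vector_derivative)
  qed (auto intro: has_vector_derivative_vec)
  have spl1: "(\<forall>i\<in>{1..n}. Q i) \<longleftrightarrow> (\<forall>i\<in>{1..n-1}. Q i) \<and> Q n" for Q
  proof -
    have "{1..n} = insert n {1..n-1}" using n2 by auto
    then show ?thesis by auto
  qed
  have spl2: "(\<forall>i\<in>{2..n}. Q i) \<longleftrightarrow> (\<forall>i\<in>{2..n-1}. Q i) \<and> Q n" for Q
  proof -
    have "{2..n} = insert n {2..n-1}" using n2 by auto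
    then show ?thesis by auto
  qed
  have xeq: "(x_sig w has_vector_derivative ax t (state_at w t)) (at t within {0..}) \<longleftrightarrow>
      (\<forall>i\<in>{1..n-1}. ((\<lambda>s. x_sig w s $ ix i) has_real_derivative
         phi K i (x_sig w t $ ix 1) * x_sig w t $ ix (i + 1) + drift P i t (x_sig w t)) (at t within {0..})) \<and>
      ((\<lambda>s. x_sig w s $ ix n) has_real_derivative mu P t (x_sig w t) (psi_sig w t) (uS (state_at w t))) (at t within {0..})" for t
  proof -
    have m: "ax t (state_at w t) $ ix i = phi K i (x_sig w t $ ix 1) * x_sig w t $ ix (i + 1) + drift P i t (x_sig w t)"
      if "i \<in> {1..n-1}" for i
    proof -
      have "i \<in> {1..n}" "i < n" using that n2 by auto
      then show ?thesis by (simp add: ixv s1_def)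
    qed
    have nn: "ax t (state_at w t) $ ix n = mu P t (x_sig w t) (psi_sig w t) (uS (state_at w t))" using n2 by (simp add: ixv)
    show ?thesis unfolding vec allix spl1 nn by (intro arg_cong2[where f="(\<and>)"] ball_cong refl) (simp only: m)
  qed
  have heq: "(xh_sig w has_vector_derivative ah (state_at w t)) (at t within {0..}) \<longleftrightarrow>
      (\<forall>i\<in>{2..n-1}. ((\<lambda>s. xh_sig w s $ jx i) has_real_derivative
               phi K i (x_sig w t $ ix 1) * (xh_sig w t $ jx (i + 1) + r_sig w t ^ i * f_obs K Ctl (i + 1) (x_sig w t $ ix 1))
               - r_sig w t ^ (i - 1) * g_gain Ctl i (x_sig w t $ ix 1) * (xh_sig w t $ jx 2 + r_sig w t * f_obs K Ctl 2 (x_sig w t $ ix 1))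
               - real (i - 1) * r_dot Ctl (x_sig w t $ ix 1) (r_sig w t) (th_sig w t) * r_sig w t ^ (i - 2) * f_obs K Ctl i (x_sig w t $ ix 1)) (at t within {0..})) \<and>
      ((\<lambda>s. xh_sig w s $ jx n) has_real_derivative
               u_tilde jx n K Ctl (x_sig w t $ ix 1) (xh_sig w t) (r_sig w t) (th_sig w t)
               - r_sig w t ^ (n - 1) * g_gain Ctl n (x_sig w t $ ix 1) * (xh_sig w t $ jx 2 + r_sig w t * f_obs K Ctl 2 (x_sig w t $ ix 1))
               - real (n - 1) * r_dot Ctl (x_sig w t $ ix 1) (r_sig w t) (th_sig w t) * r_sig w t ^ (n - 2) * f_obs K Ctl n (x_sig w t $ ix 1)) (at t within {0..})"
    if "1 \<le> r_sig w t" for t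
  proof -
    have R: "sR (state_at w t) = r_sig w t" using that by (simp add: sR_def)
    have m: "i \<in> {2..n-1} ==> i \<in> {2..n} \<and> i < n" for i using n2 by auto
    have nn: "n \<in> {2..n}" using n2 by simp
    show ?thesis unfolding vec alljx spl2 jxv[OF nn] using m
      by (simp add: jxv R aut_def art_def s1_def del: Ctl_sel)
  qed
  have r1: "1 \<le> r_sig w t" if "sol T w" "t \<in> horizon T" for t
  proof -
    interpret L: loop n ix jx K M G \<kappa> Bo Bc p q Bx bh bh' v1 v1' P H \<theta> m1 m1t m2 V T w
      by unfold_locales (rule that)
    show ?thesis by (rule L.ge1(1)[OF that(2)])
  qed
  have oth: "azt (state_at w t) = ru_dot jx n K Ctl (outp ix n (x_sig w t)) (uS (state_at w t)) (xh_sig w t) (r_sig w t) (ru_sig w t) (th_sig w t) * x_sig w t $ ix n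
      + ru_sig w t * u_tilde jx n K Ctl (x_sig w t $ ix 1) (xh_sig w t) (r_sig w t) (th_sig w t)"
    "art (state_at w t) = r_dot Ctl (x_sig w t $ ix 1) (r_sig w t) (th_sig w t)"
    "aru (state_at w t) = ru_dot jx n K Ctl (outp ix n (x_sig w t)) (uS (state_at w t)) (xh_sig w t) (r_sig w t) (ru_sig w t) (th_sig w t)"
    "ath (state_at w t) = Q_theta Ctl (x_sig w t $ ix 1)" if "1 \<le> r_sig w t" for t
    using that by (simp_all add: azt_def art_def aru_def ath_def aut_def sR_def s1_def)
  have uSe: "uS (state_at w t) = zeta_sig w t - ru_sig w t * x_sig w t $ ix n" for t by (simp add: uS_def)
  have aqe: "aq t (state_at w t) (del w d) = q_psi P t (x_sig w t) (psi_sig w t) (uS (state_at w t)) (x_sig w d) (psi_sig w d) (u_sig w d)" for t d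
    by (simp add: aq_def del_def)
  show ?thesis
  proof
    assume S: "sol T w"
    note A = S[unfolded closed_loop_solution_def plant_solution_def Let_def]
    have "ode_at w t" if t: "t \<in> horizon T" for t
    proof -
      note r = r1[OF S t]
      note A1 = A[THEN conjunct2, THEN conjunct2, THEN bspec, OF t]
      note A2 = A[THEN conjunct2, THEN conjunct1, THEN conjunct2, THEN conjunct2, THEN conjunct2, THEN bspec, OF t]
      have u: "u_sig w t = uS (state_at w t)" unfolding uSe using A1 by blast
      show ?thesis
        unfolding ode_at_def xeq heq[OF r] oth[OF r] aqe has_real_derivative_iff_has_vector_derivative[symmetric] u[symmetric]
        using r A1 A2 by blast
    qed
    then show ?R using A by blast
  next
    assume R: ?R
    show "sol T w" unfolding closed_loop_solution_def plant_solution_def Let_def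
    proof (intro conjI, goal_cases)
      case 5
      show ?case
      proof (rule ballI, goal_cases)
        case (1 t)
        then have A: "ode_at w t" using R by blast
        then have u: "u_sig w t = uS (state_at w t)" by (simp add: ode_at_def)
        show ?case using A[unfolded ode_at_def xeq aqe u[symmetric]] by blast
      qed
    next
      case 6
      show ?case
      proof (rule ballI, goal_cases)
        case (1 t)
        then have A: "ode_at w t" using R by blast
        then have r: "1 \<le> r_sig w t" and u: "u_sig w t = uS (state_at w t)" by (simp_all add: ode_at_def)
        show ?case
          using A[unfolded ode_at_def heq[OF r] oth[OF r] has_real_derivative_iff_has_vector_derivative[symmetric] u[symmetric]]
            u[unfolded uSe] by blast
      qed
    qed (use R in \<open>auto simp: admissible_initial_def\<close>)
  qed
qed

end

section \<open>Global existence\<close>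

lemma has_vector_derivative_Pair:
  assumes "(f has_vector_derivative f') (at x within S)" "(g has_vector_derivative g') (at x within S)"
  shows "((\<lambda>x. (f x, g x)) has_vector_derivative (f', g')) (at x within S)"
  using has_derivative_Pair[OF assms[unfolded has_vector_derivative_def]] by (simp add: has_vector_derivative_def)

lemma continuous_on_if_sign:
  fixes h :: "'a::topological_space => real"
  assumes h: "continuous_on A h" "\<And>x. x \<in> A ==> h x \<noteq> 0"
    and f: "continuous_on {x\<in>A. h x < 0} f" and g: "continuous_on {x\<in>A. 0 < h x} g"
  shows "continuous_on A (\<lambda>x. if h x < 0 then f x else g x)"
proof -
  let ?S = "A \<inter> h -` {..0}" and ?T = "A \<inter> h -` {0..}"
  have A: "?S \<union> ?T = A" by auto
  have ST: "?S = {x\<in>A. h x < 0}" "?T = {x\<in>A. 0 < h x}" using h(2) by (fastforce simp: less_le)+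
  have "continuous_on (?S \<union> ?T) (\<lambda>x. if h x < 0 then f x else g x)"
  proof (rule continuous_on_cases_local)
    show "closedin (top_of_set (?S \<union> ?T)) ?S" "closedin (top_of_set (?S \<union> ?T)) ?T"
      unfolding A by (intro continuous_closedin_preimage h(1) closed_atMost closed_atLeast)+
    show "continuous_on ?S f" "continuous_on ?T g" using f g unfolding ST .
    show "f x = g x" if "x \<in> ?S \<and> \<not> h x < 0 \<or> x \<in> ?T \<and> h x < 0" for x
      using that h(2)[of x] by auto
  qed
  then show ?thesis unfolding A .
qed

lemma derivative_from_integral:
  fixes g :: "real => 'a::banach"
  assumes I: "\<And>u. u \<in> {0..b} ==> (g has_integral (Y u - Y0)) {0..u}" and S: "finite S"
    and g: "continuous_on ({0..b} - S) g" and t: "t \<in> {0..<b} - S"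
  shows "(Y has_vector_derivative g t) (at t within {0..})"
proof -
  have tm: "t \<in> {0..b} - S" using t by auto
  have "g integrable_on {0..b}" using I[of b] t by (auto simp: integrable_on_def)
  moreover have "continuous (at t within ({0..b} - S)) g" using g tm by (simp add: continuous_on_eq_continuous_within)
  ultimately have "((\<lambda>u. integral {0..u} g) has_vector_derivative g t) (at t within ({0..b} - S))"
    using integral_has_vector_derivative_continuous_at[OF _ tm S] by blast
  then have "((\<lambda>u. Y0 + integral {0..u} g) has_vector_derivative g t) (at t within ({0..b} - S))"
    using has_vector_derivative_add[OF has_vector_derivative_const] by fastforce
  from has_vector_derivative_transform[OF tm _ this]
  have "(Y has_vector_derivative g t) (at t within ({0..b} - S))" using integral_unique[OF I] by simp
  moreover have "at t within ({0..b} - S) = at t within {0..}"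
    by (rule at_within_nhd[of t "{..<b} - S"]) (use t finite_imp_closed[OF S] in \<open>auto intro!: open_Diff\<close>)
  ultimately show ?thesis by simp
qed

context plant_data begin

text \<open>
  Peano's theorem is applied on \<open>[0, T + 1]\<close> to a modified equation: up to time \<open>T\<close> the right-hand
  side is prescribed by the given solution, which is thereby reproduced; after \<open>T\<close> the
  state is projected to a ball whose radius exceeds the uniform bound. As long as the new
  solution stays in the ball it solves the true equation and obeys the uniform bound, so
  it never reaches the boundary.
\<close>

lemma extension_by_one:
  assumes T: "0 \<le> T" and S: "sol (ereal T) w"
  shows "\<exists>w'. sol (ereal (T + 1)) w' \<and> same_initial w w' \<and> same_on_horizon (ereal T) w w'"
proof -
  interpret L: loop n ix jx K M G \<kappa> Bo Bc p q Bx bh bh' v1 v1' P H \<theta> m1 m1t m2 V "ereal T" w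
    by unfold_locales (rule S)
  define b where "b = T + 1"
  have b: "0 \<le> b" "T < b" using T by (auto simp: b_def)
  define d where "d t = t - delay P t" for t
  have dL: "L.dd = d" by (auto simp: L.dd_def d_def)
  have d: "continuous_on {0..} d" "\<And>t. 0 \<le> t ==> d t \<le> t" "\<And>s t. 0 \<le> s ==> s \<le> t ==> d s \<le> d t"
    using L.cont_dd L.delay_props(2) L.dd_strict by (auto simp: dL le_less)
  obtain e where e: "\<And>t. 0 \<le> t ==> d t = 0 ==> t = e" using L.crossing unfolding dL by blast
  have hor: "t \<in> horizon (ereal c) \<longleftrightarrow> 0 \<le> t \<and> t < c" for t c by (simp add: horizon_def)
  have init: "admissible_initial K Ctl H w" by (rule L.init)
  obtain Bd where Bd: "\<forall>T w'. sol T w' \<and> same_initial w w' \<longrightarrow> (\<forall>t\<in>horizon T. signals_within Bd w' t)"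
    using uniform_bound[of w] by blast
  define Rb where "Rb = Bd + (Bd + (Bd + (Bd + (Bd + (Bd + Bd)))))"
  have Rb: "norm (state_at w' t) \<le> Rb" if "sol T' w'" "same_initial w w'" "t \<in> horizon T'" for T' w' t
  proof -
    have B: "norm (x_sig w' t) \<le> Bd" "norm (psi_sig w' t) \<le> Bd" "norm (xh_sig w' t) \<le> Bd" "norm (zeta_sig w' t) \<le> Bd"
      "norm (r_sig w' t) \<le> Bd" "norm (ru_sig w' t) \<le> Bd" "norm (th_sig w' t) \<le> Bd" using Bd that unfolding signals_within_def by auto
    show ?thesis unfolding state_at_def Rb_def by (intro order_trans[OF norm_Pair_le] add_mono B)
  qed
  define Z where "Z = state_at w"
  define R where "R = max Rb (norm (Z 0)) + 1"
  have R: "Rb < R" "norm (Z 0) < R" "0 \<le> R" by (auto simp: R_def intro: order_trans[OF norm_ge_zero[of "Z 0"]])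
  define cl where "cl = closest_point (cball (0 :: ('n, 'p, 'm) state) R)"
  have cl: "continuous_on A cl" "norm (cl z) \<le> R" "norm z \<le> R ==> cl z = z" for A z
    unfolding cl_def using R(3) continuous_on_closest_point[of "cball (0 :: ('n, 'p, 'm) state) R" A]
      closest_point_in_set[of "cball (0 :: ('n, 'p, 'm) state) R" z] closest_point_self[of z "cball 0 R"] by auto
  define obs where "obs z = (sx z, sp z, uS z)" for z :: "('n, 'p, 'm) state"
  have cobs: "continuous_on A f ==> continuous_on A (\<lambda>c. obs (f c))" for A and f :: "'c::topological_space => ('n, 'p, 'm) state"
    unfolding obs_def by (intro continuous_intros)
  define pc where "pc t p = (if t - T < 0 then Z t else cl p)" for t p
  define qc where "qc t q = (if d t < 0 then del w (d t) else obs (if t - T < 0 then Z (d t) else cl q))" for t q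
  define F where "F t p q = rhs t (pc t p) (qc t q)" for t p q
  have ZR: "norm (Z t) \<le> R" if "0 \<le> t" "t < T" for t
    using Rb[OF S _ iffD2[OF hor]] R(1) that unfolding Z_def by (fastforce simp: same_initial_def)
  have uZ: "u_sig w t = uS (Z t)" if "0 \<le> t" "t < T" for t
    using L.loop_eqs(1)[of t] that hor by (simp add: uS_def Z_def L.xc_def)
  have cZ: "continuous_on {0..<T} Z"
  proof -
    have h: "horizon (ereal T) = {0..<T}" using hor by auto
    show ?thesis unfolding Z_def state_at_def using L.cont_sig unfolding h by (intro continuous_intros)
  qed
  have cdel: "continuous_on A (\<lambda>c. del w (f c))" if "continuous_on A f" "\<And>c. c \<in> A ==> f c < 0" for A and f :: "'c::topological_space => real"
  proof -
    have p: "continuous_on {..<0} (x_sig w)" "continuous_on {..<0} (psi_sig w)" "continuous_on {..<0} (u_sig w)"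
      using L.past unfolding admissible_past_def by (auto elim!: continuous_on_subset)
    have "continuous_on {..<0} (del w)" unfolding del_def[abs_def] by (intro continuous_intros p)
    then show ?thesis by (rule continuous_on_compose2[OF _ that(1)]) (use that(2) in auto)
  qed
  define E where "E = insert T {t. 0 \<le> t \<and> d t = 0}"
  have E: "finite E"
  proof -
    have "{t. 0 \<le> t \<and> d t = 0} \<subseteq> {e}" using e by auto
    then show ?thesis unfolding E_def by (auto intro: finite_subset)
  qed
  have cF: "continuous_on (({0..b} - E) \<times> UNIV \<times> UNIV) (\<lambda>(t, p, q). F t p q)"
  proof -
    let ?A = "({0..b} - E) \<times> (UNIV :: ('n, 'p, 'm) state set) \<times> (UNIV :: ('n, 'p, 'm) state set)"
    have dA: "continuous_on B (\<lambda>x. d (fst x))" if "B \<subseteq> ?A" for B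
      by (rule continuous_on_compose2[OF d(1)]) (use that in \<open>auto intro!: continuous_intros\<close>)
    have 1: "continuous_on ?A (\<lambda>x. pc (fst x) (fst (snd x)))" unfolding pc_def
    proof (rule continuous_on_if_sign)
      show "continuous_on ?A (\<lambda>x. fst x - T)" by (intro continuous_intros)
      show "fst x - T \<noteq> 0" if "x \<in> ?A" for x using that by (auto simp: E_def)
      show "continuous_on {x \<in> ?A. fst x - T < 0} (\<lambda>x. Z (fst x))"
        by (rule continuous_on_compose2[OF cZ]) (auto intro!: continuous_intros)
      show "continuous_on {x \<in> ?A. 0 < fst x - T} (\<lambda>x. cl (fst (snd x)))"
        by (rule continuous_on_compose2[OF cl(1)[of UNIV]]) (auto intro!: continuous_intros)
    qed
    have 2: "continuous_on ?A (\<lambda>x. qc (fst x) (snd (snd x)))" unfolding qc_def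
    proof (rule continuous_on_if_sign)
      show "continuous_on ?A (\<lambda>x. d (fst x))" by (rule dA) simp
      show "d (fst x) \<noteq> 0" if "x \<in> ?A" for x using that by (auto simp: E_def)
      show "continuous_on {x \<in> ?A. d (fst x) < 0} (\<lambda>x. del w (d (fst x)))"
        by (rule cdel[OF dA]) auto
      show "continuous_on {x \<in> ?A. 0 < d (fst x)} (\<lambda>x. obs (if fst x - T < 0 then Z (d (fst x)) else cl (snd (snd x))))"
      proof (rule cobs, rule continuous_on_if_sign)
        show "continuous_on {x \<in> ?A. 0 < d (fst x)} (\<lambda>x. fst x - T)" by (intro continuous_intros)
        show "fst x - T \<noteq> 0" if "x \<in> {x \<in> ?A. 0 < d (fst x)}" for x using that by (auto simp: E_def)
        show "continuous_on {x \<in> {x \<in> ?A. 0 < d (fst x)}. fst x - T < 0} (\<lambda>x. Z (d (fst x)))"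
        proof (rule continuous_on_compose2[OF cZ dA])
          show "(\<lambda>x. d (fst x)) ` {x \<in> {x \<in> ?A. 0 < d (fst x)}. fst x - T < 0} \<subseteq> {0..<T}"
          proof clarify
            fix t p q assume "t \<in> {0..b}" "0 < d (fst (t, p, q))" "fst (t, p :: ('n, 'p, 'm) state, q :: ('n, 'p, 'm) state) - T < 0"
            then show "d (fst (t, p, q)) \<in> {0..<T}" using d(2)[of t] by auto
          qed
        qed auto
        show "continuous_on {x \<in> {x \<in> ?A. 0 < d (fst x)}. 0 < fst x - T} (\<lambda>x. cl (snd (snd x)))"
          by (rule continuous_on_compose2[OF cl(1)[of UNIV]]) (auto intro!: continuous_intros)
      qed
    qed
    have "continuous_on ?A (\<lambda>x. rhs (fst x) (pc (fst x) (fst (snd x))) (qc (fst x) (snd (snd x))))"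
      by (intro continuous_intros 1 2)
    then show ?thesis by (simp add: F_def split_def)
  qed
  obtain MF where MF: "\<And>t p q. t \<in> {0..b} ==> norm (F t p q) \<le> MF"
  proof -
    have "compact (x_sig w ` {d 0..0})" "compact (psi_sig w ` {d 0..0})"
      using L.past by (auto intro!: compact_continuous_image elim!: continuous_on_subset simp: admissible_past_def)
    then obtain bx bp where bx: "\<forall>y\<in>x_sig w ` {d 0..0}. norm y \<le> bx" and bp: "\<forall>y\<in>psi_sig w ` {d 0..0}. norm y \<le> bp"
      using compact_imp_bounded bounded_iff by meson
    obtain bu where bu: "\<And>s. d 0 \<le> s ==> s < 0 ==> \<bar>u_sig w s\<bar> \<le> bu"
      using L.past past_u_bounded[of "u_sig w" _ "d 0"] unfolding admissible_past_def by blast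
    have "continuous_on UNIV (\<lambda>z. norm (obs z))" by (intro continuous_on_norm cobs continuous_on_id)
    from bounded_on_cball[OF this] obtain bo where bo: "\<And>z. norm z \<le> R ==> norm (obs z) \<le> bo" by fastforce
    define RQ where "RQ = max bo (bx + (bp + bu))"
    have qcB: "norm (qc t z) \<le> RQ" if t: "0 \<le> t" for t z
    proof (cases "d t < 0")
      case True
      have "d 0 \<le> d t" using d(3)[of 0 t] t by simp
      then have "norm (del w (d t)) \<le> bx + (bp + bu)" unfolding del_def
        using bx bp bu[of "d t"] True by (intro order_trans[OF norm_Pair_le] add_mono) auto
      then show ?thesis using True by (simp add: qc_def RQ_def)
    next
      case False
      have "norm (if t - T < 0 then Z (d t) else cl z) \<le> R" using ZR[of "d t"] d(2)[OF t] False cl(2) by auto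
      from bo[OF this] show ?thesis using False by (simp add: qc_def RQ_def)
    qed
    have pcB: "norm (pc t z) \<le> R" if "0 \<le> t" for t z using ZR[OF that] cl(2) by (auto simp: pc_def)
    have "continuous_on UNIV (\<lambda>(t, z, dl). norm (rhs t z dl))"
      unfolding split_def by (intro continuous_on_norm cont_rhs continuous_intros)
    from bounded_on_cball[OF this, of "b + (R + RQ)"] obtain c where
      c: "\<And>t z dl. norm (t, z, dl) \<le> b + (R + RQ) ==> norm (rhs t z dl) \<le> c" by fastforce
    have "norm (F t z z') \<le> c" if t: "t \<in> {0..b}" for t z z'
      unfolding F_def by (rule c) (use t qcB[of t z'] pcB[of t z] in \<open>intro order_trans[OF norm_Pair_le] add_mono; auto\<close>)
    then show thesis using that by blast
  qed
  obtain X where Xc: "continuous_on {0..b} X"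
    and X: "\<And>t. t \<in> {0..b} ==> ((\<lambda>s. F s (X s) (X (max 0 (d s)))) has_integral (X t - Z 0)) {0..t}"
  proof -
    have dc: "continuous_on {0..b} d" by (rule continuous_on_subset[OF d(1)]) auto
    obtain X where "continuous_on {0..b} X" "\<forall>t\<in>{0..b}. ((\<lambda>s. F s (X s) (X (max 0 (d s)))) has_integral (X t - Z 0)) {0..t}"
      using peano_delay[OF b(1) E cF MF dc, of "Z 0"] d(2) by (meson atLeastAtMost_iff)
    then show thesis by (intro that[of X]) blast+
  qed
  define g where "g s = F s (X s) (X (max 0 (d s)))" for s
  have X0: "X 0 = Z 0"
  proof -
    have "((\<lambda>s. F s (X s) (X (max 0 (d s)))) has_integral (X 0 - Z 0)) {0}" using X[of 0] b by simp
    from has_integral_unique[OF this has_integral_refl(2)] show ?thesis by simp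
  qed
  have Zd: "(Z has_vector_derivative rhs t (Z t) (del w (d t))) (at t)" if "0 < t" "t < T" "d t \<noteq> 0" for t
  proof -
    have tH: "t \<in> horizon (ereal T)" using that hor by auto
    note A = S[unfolded solution_iff_ode, THEN conjunct2, THEN conjunct2, THEN conjunct2, THEN bspec, OF tH,
        unfolded ode_at_def at_within_nonneg[OF that(1)] d_def[symmetric]]
    show ?thesis unfolding Z_def state_at_def[abs_def] rhs_def
      by (intro has_vector_derivative_Pair) (use A that(3) in \<open>unfold state_at_def, blast+\<close>)
  qed
  have gT: "g s = rhs s (Z s) (del w (d s))" if "0 \<le> s" "s < T" for s
  proof -
    have "obs (Z (d s)) = del w (d s)" if "0 \<le> d s"
      using uZ[of "d s"] d(2)[OF \<open>0 \<le> s\<close>] \<open>s < T\<close> that by (simp add: obs_def del_def Z_def)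
    then show ?thesis using that by (simp add: g_def F_def pc_def qc_def)
  qed
  have XZ: "X t = Z t" if t: "0 \<le> t" "t < T" for t
  proof -
    have "((\<lambda>s. rhs s (Z s) (del w (d s))) has_integral (Z t - Z 0)) {0..t}"
    proof (rule fundamental_theorem_of_calculus_interior_strong[OF E t(1)])
      show "(Z has_vector_derivative rhs s (Z s) (del w (d s))) (at s)" if "s \<in> {0<..<t} - E" for s
        using Zd[of s] that t by (auto simp: E_def)
      show "continuous_on {0..t} Z" by (rule continuous_on_subset[OF cZ]) (use t in auto)
    qed
    moreover have "((\<lambda>s. rhs s (Z s) (del w (d s))) has_integral (X t - Z 0)) {0..t}"
      using X[of t] t b gT[unfolded g_def] by (subst has_integral_cong[of _ _ g]) (auto simp: gT g_def[symmetric])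
    ultimately have "Z t - Z 0 = X t - Z 0" by (rule has_integral_unique)
    then show ?thesis by simp
  qed
  define w' where "w' = \<lparr> x_sig = (\<lambda>t. if t < 0 then x_sig w t else sx (X t)), psi_sig = (\<lambda>t. if t < 0 then psi_sig w t else sp (X t)),
     u_sig = (\<lambda>t. if t < 0 then u_sig w t else uS (X t)), xh_sig = (\<lambda>t. sh (X t)), zeta_sig = (\<lambda>t. sz (X t)), r_sig = (\<lambda>t. sr (X t)),
     ru_sig = (\<lambda>t. sru (X t)), th_sig = (\<lambda>t. sth (X t)) \<rparr>"
  have w's: "state_at w' t = X t" "u_sig w' t = uS (X t)" if "0 \<le> t" for t
    using that by (auto simp: w'_def state_at_def state_defs)
  have si: "same_initial w w'"
    unfolding same_initial_def using X0 by (auto simp: w'_def Z_def le_less)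
  have delw': "del w' (d t) = (if d t < 0 then del w (d t) else obs (X (d t)))" for t
    by (simp add: del_def w'_def obs_def)
  have pcX: "pc s (X s) = X s" if "0 \<le> s" "norm (X s) \<le> R" for s using that XZ[of s] cl(3) by (simp add: pc_def)
  have solves: "sol (ereal c) w'" if c: "c \<le> b" "\<And>t. 0 \<le> t ==> t < c ==> norm (X t) \<le> R" for c
  proof -
    have gr: "g s = rhs s (X s) (del w' (d s))" if s: "0 \<le> s" "s < c" for s
    proof -
      have "qc s (X (max 0 (d s))) = del w' (d s)"
      proof (cases "d s < 0")
        case False
        then have "0 \<le> d s" "d s \<le> s" using d(2)[OF s(1)] by auto
        then show ?thesis using False s c(2)[of "d s"] XZ[of "d s"] cl(3)[of "X (d s)"] by (auto simp: qc_def delw' max_def)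
      qed (simp add: qc_def delw')
      then show ?thesis unfolding g_def F_def pcX[OF s(1) c(2)[OF s]] by simp
    qed
    have lin: "((\<lambda>s. h (g s)) has_integral (h (X u) - h (Z 0))) {0..u}" if h: "bounded_linear h" and u: "0 \<le> u" "u < c"
      for u and h :: "('n, 'p, 'm) state => 'z::banach"
      using has_integral_linear[OF X[of u] h] u c(1) by (simp add: o_def g_def linear_diff[OF bounded_linear.linear[OF h]])
    have comp: "((\<lambda>s. h (X s)) has_vector_derivative a t (X t)) (at t within {0..})"
      if h: "bounded_linear h" and ha: "\<And>s z dl. h (rhs s z dl) = a s z" and t: "0 \<le> t" "t < c"
        and ca: "\<And>u. u < c ==> continuous_on {0..u} (\<lambda>s. a s (X s))" for h :: "('n, 'p, 'm) state => 'z::banach" and a t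
    proof -
      obtain b' where b': "t < b'" "b' < c" using dense[OF t(2)] by blast
      have "((\<lambda>s. h (X s)) has_vector_derivative (\<lambda>s. a s (X s)) t) (at t within {0..})"
      proof (rule derivative_from_integral[where S = "{}" and b = b'])
        fix u assume u: "u \<in> {0..b'}"
        have "((\<lambda>s. h (g s)) has_integral (h (X u) - h (Z 0))) {0..u}" by (rule lin[OF h]) (use u b' in auto)
        moreover have "h (g s) = a s (X s)" if "s \<in> {0..u}" for s using gr[of s] ha that u b' by auto
        ultimately show "((\<lambda>s. a s (X s)) has_integral (h (X u) - h (Z 0))) {0..u}" by (rule has_integral_eq[rotated])
      qed (use t b' ca in auto)
      then show ?thesis by simp
    qed
    have cX: "continuous_on {0..u} X" if "u < c" for u by (rule continuous_on_subset[OF Xc]) (use that c in auto)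
    have r1: "1 \<le> sr (X t)" if t: "0 \<le> t" "t < c" for t
    proof -
      have "0 \<le> sr (X t) - sr (Z 0)"
      proof (rule has_integral_nonneg[OF lin[OF state_linear(5) t]])
        fix s assume "s \<in> {0..t}"
        then have "sr (g s) = art (X s)" using gr[of s] t by (simp add: rhs_sel)
        also have "0 \<le> ..." unfolding art_def r_dot_eq using gate_props(1) W1_ge[of "s1 (X s)" "sth (X s)"] by (intro mult_nonneg_nonneg) auto
        finally show "0 \<le> sr (g s)" .
      qed
      moreover have "1 \<le> sr (Z 0)" using init by (simp add: Z_def admissible_initial_def)
      ultimately show ?thesis by linarith
    qed
    show ?thesis unfolding solution_iff_ode ode_at_def
    proof (intro conjI ballI impI)
      show "admissible_initial K Ctl H w'" by (rule same_initial_admissible[OF si init])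
      have cXh: "continuous_on (horizon (ereal c)) X" by (rule continuous_on_subset[OF Xc]) (use hor c in auto)
      have "continuous_on (horizon (ereal c)) (\<lambda>t. sp (X t))" "continuous_on (horizon (ereal c)) (\<lambda>t. uS (X t))"
        using cXh by (intro continuous_intros; assumption)+
      then show "continuous_on (horizon (ereal c)) (psi_sig w')" "continuous_on (horizon (ereal c)) (u_sig w')"
        by (auto elim!: continuous_on_eq simp: hor w'_def)
      fix t assume "t \<in> horizon (ereal c)"
      then have t: "0 \<le> t" "t < c" using hor by auto
      have tin: "t \<in> {0..}" using t by simp
      show "1 \<le> r_sig w' t" using r1[OF t] by (simp add: w'_def)
      show "u_sig w' t = uS (state_at w' t)" using w's[OF t(1)] by simp
      note co = has_vector_derivative_transform[OF tin _ comp[OF _ _ t]]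
      note st = w's(1)[OF t(1)]
      show "(x_sig w' has_vector_derivative ax t (state_at w' t)) (at t within {0..})"
        unfolding st by (rule co[OF _ state_linear(1) rhs_sel(1)]) (auto simp: w'_def intro!: continuous_intros cX)
      show "(xh_sig w' has_vector_derivative ah (state_at w' t)) (at t within {0..})"
        unfolding st by (rule co[OF _ state_linear(3) rhs_sel(3)]) (auto simp: w'_def intro!: continuous_intros cX)
      show "(zeta_sig w' has_vector_derivative azt (state_at w' t)) (at t within {0..})"
        unfolding st by (rule co[OF _ state_linear(4) rhs_sel(4)]) (auto simp: w'_def intro!: continuous_intros cX)
      show "(r_sig w' has_vector_derivative art (state_at w' t)) (at t within {0..})"
        unfolding st by (rule co[OF _ state_linear(5) rhs_sel(5)]) (auto simp: w'_def intro!: continuous_intros cX)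
      show "(ru_sig w' has_vector_derivative aru (state_at w' t)) (at t within {0..})"
        unfolding st by (rule co[OF _ state_linear(6) rhs_sel(6)]) (auto simp: w'_def intro!: continuous_intros cX)
      show "(th_sig w' has_vector_derivative ath (state_at w' t)) (at t within {0..})"
        unfolding st by (rule co[OF _ state_linear(7) rhs_sel(7)]) (auto simp: w'_def intro!: continuous_intros cX)
      assume dt: "t - delay P t \<noteq> 0"
      obtain b' where b': "t < b'" "b' < c" using dense[OF t(2)] by blast
      let ?E = "{s. 0 \<le> s \<and> d s = 0}"
      have "((\<lambda>s. sp (X s)) has_vector_derivative (\<lambda>s. aq s (X s) (del w' (d s))) t) (at t within {0..})"
      proof (rule derivative_from_integral[where S = ?E and b = b'])
        fix u assume u: "u \<in> {0..b'}"
        have "((\<lambda>s. sp (g s)) has_integral (sp (X u) - sp (Z 0))) {0..u}" by (rule lin[OF state_linear(2)]) (use u b' in auto)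
        moreover have "sp (g s) = aq s (X s) (del w' (d s))" if "s \<in> {0..u}" for s using gr[of s] rhs_sel(2) that u b' by auto
        ultimately show "((\<lambda>s. aq s (X s) (del w' (d s))) has_integral (sp (X u) - sp (Z 0))) {0..u}" by (rule has_integral_eq[rotated])
      next
        show "finite ?E" by (rule finite_subset[OF _ E]) (auto simp: E_def)
        show "t \<in> {0..<b'} - ?E" using t b' dt by (auto simp: d_def)
        have cX': "continuous_on A X" if "A \<subseteq> {0..b'}" for A by (rule continuous_on_subset[OF cX[OF b'(2)] that])
        have cd': "continuous_on A d" if "A \<subseteq> {0..b'}" for A by (rule continuous_on_subset[OF d(1)]) (use that in auto)
        have "continuous_on ({0..b'} - ?E) (\<lambda>s. del w' (d s))" unfolding delw'
        proof (rule continuous_on_if_sign)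
          show "continuous_on {x \<in> {0..b'} - ?E. d x < 0} (\<lambda>s. del w (d s))" by (rule cdel[OF cd']) auto
          show "continuous_on {x \<in> {0..b'} - ?E. 0 < d x} (\<lambda>s. obs (X (d s)))"
          proof (rule cobs, rule continuous_on_compose2[OF cX[OF b'(2)] cd'])
            show "d ` {x \<in> {0..b'} - ?E. 0 < d x} \<subseteq> {0..b'}" using d(2) by force
          qed auto
        qed (auto intro: cd')
        moreover have "continuous_on ({0..b'} - ?E) X" by (rule cX') auto
        ultimately show "continuous_on ({0..b'} - ?E) (\<lambda>s. aq s (X s) (del w' (d s)))" by (intro continuous_intros)
      qed
      then have "((\<lambda>s. sp (X s)) has_vector_derivative aq t (X t) (del w' (d t))) (at t within {0..})" by simp
      from has_vector_derivative_transform[OF tin _ this, of "psi_sig w'"]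
      show "(psi_sig w' has_vector_derivative aq t (state_at w' t) (del w' (t - delay P t))) (at t within {0..})"
        unfolding w's(1)[OF t(1)] d_def[symmetric] by (simp add: w'_def)
    qed
  qed
  have below: "norm (X t) < R" if "t \<in> {0..b}" for t
  proof (rule ccontr)
    assume nb: "\<not> norm (X t) < R"
    let ?S = "{0..b} \<inter> (\<lambda>t. norm (X t)) -` {R..}"
    have "closedin (top_of_set {0..b}) ?S" by (intro continuous_closedin_preimage continuous_on_norm Xc closed_atLeast)
    then have "compact ?S" using closedin_compact[OF compact_Icc] by blast
    moreover have "?S \<noteq> {}" using that nb by auto
    ultimately obtain t1 where t1: "t1 \<in> ?S" "\<And>s. s \<in> ?S ==> t1 \<le> s" using compact_attains_inf by metis
    have pos: "0 < t1" using t1(1) R(2) X0 by (cases "t1 = 0") auto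
    have lt: "norm (X s) \<le> R" if "0 \<le> s" "s < t1" for s using t1 that by force
    have "sol (ereal t1) w'" by (rule solves[OF _ lt]) (use t1 in auto)
    then have le: "norm (X s) \<le> Rb" if "s \<in> {0..<t1}" for s
      using Rb[OF _ si, of "ereal t1" s] that w's(1)[of s] hor by auto
    have cl: "closure {0..<t1} = {0..t1}" using pos by (simp add: closure_atLeastLessThan)
    have "continuous_on (closure {0..<t1}) X" unfolding cl by (rule continuous_on_subset[OF Xc]) (use t1 in auto)
    from continuous_on_closure_norm_le[OF this, of Rb t1] have "norm (X t1) \<le> Rb" using le cl pos by auto
    then show False using t1(1) R(1) by auto
  qed
  have "sol (ereal b) w'" by (rule solves) (use below in \<open>auto intro: less_imp_le\<close>)
  moreover have "same_on_horizon (ereal T) w w'"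
    unfolding same_on_horizon_def
  proof
    fix t assume "t \<in> horizon (ereal T)"
    then have t: "0 \<le> t" "t < T" using hor by auto
    show "x_sig w t = x_sig w' t \<and> psi_sig w t = psi_sig w' t \<and> u_sig w t = u_sig w' t \<and>
        xh_sig w t = xh_sig w' t \<and> zeta_sig w t = zeta_sig w' t \<and> r_sig w t = r_sig w' t \<and>
        ru_sig w t = ru_sig w' t \<and> th_sig w t = th_sig w' t"
      using t uZ[OF t] XZ[OF t] by (simp add: w'_def Z_def)
  qed
  ultimately show ?thesis using si unfolding b_def by blast
qed

end

context plant_data begin

lemma solution_cong:
  assumes S: "sol T w" and si: "same_initial w w'" and so: "same_on_horizon T w w'"
  shows "sol T w'"
proof -
  have e: "x_sig w t = x_sig w' t" "psi_sig w t = psi_sig w' t" "u_sig w t = u_sig w' t" "xh_sig w t = xh_sig w' t"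
    "zeta_sig w t = zeta_sig w' t" "r_sig w t = r_sig w' t" "ru_sig w t = ru_sig w' t" "th_sig w t = th_sig w' t"
    if "t \<in> horizon T" for t using so that unfolding same_on_horizon_def by blast+
  note A = S[unfolded solution_iff_ode]
  show ?thesis unfolding solution_iff_ode ode_at_def
  proof (intro conjI ballI impI)
    show "admissible_initial K Ctl H w'" by (rule same_initial_admissible[OF si]) (use A in blast)
    show "continuous_on (horizon T) (psi_sig w')" "continuous_on (horizon T) (u_sig w')"
      using A e by (auto elim!: continuous_on_eq)
    fix t assume t: "t \<in> horizon T"
    note B = A[THEN conjunct2, THEN conjunct2, THEN conjunct2, THEN bspec, OF t, unfolded ode_at_def]
    have st: "state_at w' t = state_at w t" using e[OF t] by (simp add: state_at_def)
    have t0: "t \<in> {0..}" using t by (simp add: horizon_def)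
    obtain t' where t': "t < t'" "t' \<in> horizon T"
    proof -
      have "ereal t < T" using t by (simp add: horizon_def)
      from ereal_dense2[OF this] obtain z where z: "ereal t < ereal z" "ereal z < T" by blast
      then show thesis using that[of z] t0 by (simp add: horizon_def)
    qed
    have tr: "(g has_vector_derivative D) (at t within {0..})"
      if "(f has_vector_derivative D) (at t within {0..})" "\<And>s. s \<in> horizon T ==> f s = g s" for f g :: "real => 'z::real_normed_vector" and D
    proof (rule has_vector_derivative_transform_within[OF that(1) _ t0])
      show "0 < t' - t" using t' by simp
      show "f s = g s" if "s \<in> {0..}" "dist s t < t' - t" for s
        using horizon_sub[OF t'(2), of s] that \<open>\<And>s. s \<in> horizon T ==> f s = g s\<close> by (auto simp: dist_real_def)
    qed
    show "1 \<le> r_sig w' t" "u_sig w' t = uS (state_at w' t)" using B st e[OF t] by auto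
    show "(x_sig w' has_vector_derivative ax t (state_at w' t)) (at t within {0..})" unfolding st by (rule tr[OF _ e(1)]) (use B in blast)
    show "(xh_sig w' has_vector_derivative ah (state_at w' t)) (at t within {0..})" unfolding st by (rule tr[OF _ e(4)]) (use B in blast)
    show "(zeta_sig w' has_vector_derivative azt (state_at w' t)) (at t within {0..})" unfolding st by (rule tr[OF _ e(5)]) (use B in blast)
    show "(r_sig w' has_vector_derivative art (state_at w' t)) (at t within {0..})" unfolding st by (rule tr[OF _ e(6)]) (use B in blast)
    show "(ru_sig w' has_vector_derivative aru (state_at w' t)) (at t within {0..})" unfolding st by (rule tr[OF _ e(7)]) (use B in blast)
    show "(th_sig w' has_vector_derivative ath (state_at w' t)) (at t within {0..})" unfolding st by (rule tr[OF _ e(8)]) (use B in blast)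
    assume d: "t - delay P t \<noteq> 0"
    have "del w' (t - delay P t) = del w (t - delay P t)"
    proof (cases "t - delay P t < 0")
      case True
      then show ?thesis using si by (simp add: del_def same_initial_def)
    next
      case False
      then have "t - delay P t \<in> horizon T" using horizon_sub[OF t, of "t - delay P t"] dlb t0 by (auto simp: delay_bound_def)
      then show ?thesis using e by (simp add: del_def)
    qed
    then show "(psi_sig w' has_vector_derivative aq t (state_at w' t) (del w' (t - delay P t))) (at t within {0..})"
      unfolding st by (simp, intro tr[OF _ e(2)]) (use B d in blast)+
  qed
qed

lemma global_extension:
  assumes T: "0 \<le> T" and S: "sol (ereal T) w"
  shows "\<exists>w'. sol \<infinity> w' \<and> same_initial w w' \<and> same_on_horizon (ereal T) w w'"
proof -
  have tr_i: "same_initial a c" if "same_initial a b" "same_initial b c" for a b c :: "('n, 'p, 'm) signals"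
    using that by (simp add: same_initial_def)
  have tr_h: "same_on_horizon T a c" if "same_on_horizon T a b" "same_on_horizon T b c" for a b c :: "('n, 'p, 'm) signals" and T
    using that by (simp add: same_on_horizon_def)
  have hor: "t \<in> horizon (ereal c) \<longleftrightarrow> 0 \<le> t \<and> t < c" for t c by (simp add: horizon_def)
  have mono_h: "same_on_horizon (ereal c) a b" if "same_on_horizon (ereal c') a b" "c \<le> c'" for a b :: "('n, 'p, 'm) signals" and c c'
  proof -
    have "t \<in> horizon (ereal c')" if "t \<in> horizon (ereal c)" for t using that \<open>c \<le> c'\<close> hor by auto
    then show ?thesis using that(1) unfolding same_on_horizon_def by blast
  qed
  have "\<exists>W. \<forall>k::nat. (sol (ereal (T + real k)) (W k) \<and> same_initial w (W k) \<and> (k = 0 \<longrightarrow> W k = w)) \<and>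
      same_on_horizon (ereal (T + real k)) (W k) (W (Suc k))"
  proof (rule dependent_nat_choice)
    show "\<exists>x. sol (ereal (T + real 0)) x \<and> same_initial w x \<and> (0 = (0::nat) \<longrightarrow> x = w)"
      using S by (intro exI[of _ w]) (simp add: same_initial_def)
    fix x k assume x: "sol (ereal (T + real k)) x \<and> same_initial w x \<and> (k = 0 \<longrightarrow> x = w)"
    obtain y where "sol (ereal (T + real k + 1)) y" "same_initial x y" "same_on_horizon (ereal (T + real k)) x y"
      using extension_by_one[of "T + real k" x] x T by auto
    then show "\<exists>y. (sol (ereal (T + real (Suc k))) y \<and> same_initial w y \<and> (Suc k = 0 \<longrightarrow> y = w)) \<and> same_on_horizon (ereal (T + real k)) x y"
      using x tr_i by (intro exI[of _ y]) (auto simp: add_ac)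
  qed
  then obtain W where W0: "\<And>k. (sol (ereal (T + real k)) (W k) \<and> same_initial w (W k) \<and> (k = 0 \<longrightarrow> W k = w)) \<and>
      same_on_horizon (ereal (T + real k)) (W k) (W (Suc k))" by (elim exE) (rule that, erule spec)
  have W: "sol (ereal (T + real k)) (W k)" "same_initial w (W k)" "W 0 = w"
    "same_on_horizon (ereal (T + real k)) (W k) (W (Suc k))" for k
    using W0[of k] W0[of 0] by simp_all
  have step: "same_on_horizon (ereal (T + real j)) (W j) (W k)" if "j \<le> k" for j k using that
  proof (induction rule: dec_induct)
    case base
    then show ?case by (simp add: same_on_horizon_def)
  next
    case (step k)
    then show ?case using tr_h mono_h[OF W(4)[of k], of "T + real j"] by auto
  qed
  have cons: "x_sig (W j) t = x_sig (W k) t \<and> psi_sig (W j) t = psi_sig (W k) t \<and> u_sig (W j) t = u_sig (W k) t \<and>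
      xh_sig (W j) t = xh_sig (W k) t \<and> zeta_sig (W j) t = zeta_sig (W k) t \<and> r_sig (W j) t = r_sig (W k) t \<and>
      ru_sig (W j) t = ru_sig (W k) t \<and> th_sig (W j) t = th_sig (W k) t" if "0 \<le> t" "t < T + real j" "t < T + real k" for j k t
  proof (cases "j \<le> k")
    case True
    have "t \<in> horizon (ereal (T + real j))" using that hor by simp
    from step[OF True, unfolded same_on_horizon_def, THEN bspec, OF this] show ?thesis .
  next
    case False
    then have "k \<le> j" by simp
    have "t \<in> horizon (ereal (T + real k))" using that hor by simp
    from step[OF \<open>k \<le> j\<close>, unfolded same_on_horizon_def, THEN bspec, OF this] show ?thesis by simp
  qed
  \<comment> \<open>N t is an index for which W (N t) is defined beyond t\<close>
  define N where "N t = nat \<lceil>t\<rceil> + 1" for t :: real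
  have N: "t < T + real (N t)" for t using T by (simp add: N_def) linarith
  define w' where "w' = \<lparr> x_sig = (\<lambda>t. x_sig (W (N t)) t), psi_sig = (\<lambda>t. psi_sig (W (N t)) t), u_sig = (\<lambda>t. u_sig (W (N t)) t),
    xh_sig = (\<lambda>t. xh_sig (W (N t)) t), zeta_sig = (\<lambda>t. zeta_sig (W (N t)) t), r_sig = (\<lambda>t. r_sig (W (N t)) t),
    ru_sig = (\<lambda>t. ru_sig (W (N t)) t), th_sig = (\<lambda>t. th_sig (W (N t)) t) \<rparr>"
  have so: "same_on_horizon (ereal (T + real k)) (W k) w'" for k
    unfolding same_on_horizon_def
  proof
    fix t assume "t \<in> horizon (ereal (T + real k))"
    then have "0 \<le> t" "t < T + real k" using hor by auto
    from cons[OF this N] show "x_sig (W k) t = x_sig w' t \<and> psi_sig (W k) t = psi_sig w' t \<and> u_sig (W k) t = u_sig w' t \<and>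
      xh_sig (W k) t = xh_sig w' t \<and> zeta_sig (W k) t = zeta_sig w' t \<and> r_sig (W k) t = r_sig w' t \<and>
      ru_sig (W k) t = ru_sig w' t \<and> th_sig (W k) t = th_sig w' t" by (simp add: w'_def)
  qed
  have si: "same_initial w w'"
    unfolding same_initial_def w'_def using W(2) by (simp add: same_initial_def)
  have si': "same_initial (W k) w'" for k
    using W(2)[of k] si by (simp add: same_initial_def)
  have Sk: "sol (ereal (T + real k)) w'" for k by (rule solution_cong[OF W(1) si' so])
  have ex: "t \<in> horizon (ereal (T + real (N t)))" if "0 \<le> t" for t using N[of t] that hor by auto
  have cont: "continuous_on (horizon \<infinity>) f" if f: "\<And>k. continuous_on (horizon (ereal (T + real k))) f" for f :: "real => 'z::topological_space"
    unfolding continuous_on_eq_continuous_within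
  proof
    fix t assume "t \<in> horizon \<infinity>"
    then have t: "0 \<le> t" by (simp add: horizon_def)
    have "continuous (at t within (horizon (ereal (T + real (N t))))) f"
      using f ex[OF t] by (auto simp: continuous_on_eq_continuous_within)
    moreover have "at t within (horizon (ereal (T + real (N t)))) = at t within (horizon \<infinity>)"
      by (rule at_within_nhd[of t "{..<T + real (N t)}"]) (use N in \<open>auto simp: horizon_def\<close>)
    ultimately show "continuous (at t within horizon \<infinity>) f" by simp
  qed
  have "sol \<infinity> w'" unfolding solution_iff_ode
  proof (intro conjI ballI)
    note A = Sk[unfolded solution_iff_ode]
    show "admissible_initial K Ctl H w'" using A[of 0] by blast
    show "continuous_on (horizon \<infinity>) (psi_sig w')" "continuous_on (horizon \<infinity>) (u_sig w')" by (rule cont; use A in blast)+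
    fix t assume "t \<in> horizon \<infinity>"
    then have "0 \<le> t" by (simp add: horizon_def)
    then show "ode_at w' t" using A ex by blast
  qed
  moreover have "same_on_horizon (ereal T) w w'" using so[of 0] W(3) by simp
  ultimately show ?thesis using si by blast
qed

lemma global_existence:
  assumes "admissible_initial K Ctl H w0"
  shows "\<exists>w. sol \<infinity> w \<and> same_initial w0 w"
proof -
  have "sol (ereal 0) w0"
  proof -
    have "horizon (ereal 0) = {}" by (auto simp: horizon_def)
    then show ?thesis using assms by (simp add: solution_iff_ode)
  qed
  from global_extension[OF order_refl this] show ?thesis by blast
qed

lemma global_continuation:
  assumes "0 < T" "sol T w"
  shows "\<exists>w'. sol \<infinity> w' \<and> same_initial w w' \<and> same_on_horizon T w w'"
proof (cases T)
  case (real c)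
  then show ?thesis using global_extension[of c w] assms by simp
next
  case PInf
  then show ?thesis using assms by (intro exI[of _ w]) (simp add: same_initial_def same_on_horizon_def)
qed (use assms in simp)

end

section \<open>Choice of the design data\<close>

text \<open>
  The assumption compares neighbouring coefficients; the comparison with \<open>\<phi>\<^bsub>(2,3)\<^esub>\<close> is the product along the
  chain.
\<close>

lemma cascade_bounds:
  assumes n: "2 \<le> n" and cd: "cascading_dominance n K" and pos: "\<And>i s. i \<in> {1..n-1} ==> 0 < phi K i s"
  shows "\<exists>c1 c2. 0 < c1 \<and> c1 \<le> 1 \<and> 1 \<le> c2 \<and> (\<forall>i\<in>{2..<n}. \<forall>s. c1 \<le> phi K i s / phi K 2 s \<and> phi K i s / phi K 2 s \<le> (c2::real))"
proof -
  obtain \<rho>1 \<rho>2 where \<rho>: "\<forall>i\<in>{3..n-1}. 0 < \<rho>1 i \<and> 0 < \<rho>2 i \<and>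
        (\<forall>s. \<rho>1 i * phi K (i - 1) s \<le> phi K i s \<and> phi K i s \<le> \<rho>2 i * phi K (i - 1) s)"
    using cd unfolding cascading_dominance_def by blast
  have "\<exists>a b. 0 < a \<and> 0 < b \<and> (\<forall>s. a * phi K 2 s \<le> phi K i s \<and> phi K i s \<le> b * phi K 2 s)" if "2 \<le> i" "i < n" for i
    using that
  proof (induction i rule: dec_induct)
    case base
    show ?case by (intro exI[of _ 1]) auto
  next
    case (step i)
    then obtain a b where ab: "0 < a" "0 < b" "\<And>s. a * phi K 2 s \<le> phi K i s \<and> phi K i s \<le> b * phi K 2 s" by auto
    have "Suc i \<in> {3..n-1}" using step by auto
    with \<rho> have r: "0 < \<rho>1 (Suc i)" "0 < \<rho>2 (Suc i)"
      "\<And>s. \<rho>1 (Suc i) * phi K i s \<le> phi K (Suc i) s \<and> phi K (Suc i) s \<le> \<rho>2 (Suc i) * phi K i s" by fastforce+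
    have "(\<rho>1 (Suc i) * a) * phi K 2 s \<le> phi K (Suc i) s \<and> phi K (Suc i) s \<le> (\<rho>2 (Suc i) * b) * phi K 2 s" for s
    proof
      have "\<rho>1 (Suc i) * (a * phi K 2 s) \<le> \<rho>1 (Suc i) * phi K i s" using ab r by (intro mult_left_mono) auto
      then show "(\<rho>1 (Suc i) * a) * phi K 2 s \<le> phi K (Suc i) s" using r(3)[of s] by (simp add: mult.assoc)
      have "\<rho>2 (Suc i) * phi K i s \<le> \<rho>2 (Suc i) * (b * phi K 2 s)" using ab r by (intro mult_left_mono) auto
      then show "phi K (Suc i) s \<le> (\<rho>2 (Suc i) * b) * phi K 2 s" using r(3)[of s] by (simp add: mult.assoc)
    qed
    then show ?case using ab r by (intro exI[of _ "\<rho>1 (Suc i) * a"] exI[of _ "\<rho>2 (Suc i) * b"]) simp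
  qed
  then have "\<forall>i\<in>{2..<n}. \<exists>a b. 0 < a \<and> 0 < b \<and> (\<forall>s. a * phi K 2 s \<le> phi K i s \<and> phi K i s \<le> b * phi K 2 s)" by auto
  then obtain a b where ab: "\<forall>i\<in>{2..<n}. 0 < a i \<and> 0 < b i \<and> (\<forall>s. a i * phi K 2 s \<le> phi K i s \<and> phi K i s \<le> b i * phi K 2 s)"
    by metis
  define c1 c2 where "c1 = Min (insert 1 (a ` {2..<n}))" and "c2 = Max (insert 1 (b ` {2..<n}))"
  have c: "0 < c1" "c1 \<le> 1" "1 \<le> c2" "\<And>i. i \<in> {2..<n} ==> c1 \<le> a i \<and> b i \<le> c2"
  proof -
    show "0 < c1" "c1 \<le> 1" "1 \<le> c2" using ab by (auto simp: c1_def c2_def)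
    show "c1 \<le> a i \<and> b i \<le> c2" if "i \<in> {2..<n}" for i
      unfolding c1_def c2_def using that by (intro conjI Min_le Max_ge) auto
  qed
  have "c1 \<le> phi K i s / phi K 2 s \<and> phi K i s / phi K 2 s \<le> c2" if i: "i \<in> {2..<n}" for i s
  proof -
    have p: "0 < phi K 2 s" using pos[of 2 s] i by auto
    have "c1 * phi K 2 s \<le> a i * phi K 2 s" "b i * phi K 2 s \<le> c2 * phi K 2 s" using c(4)[OF i] p by (auto intro: mult_right_mono)
    moreover have "a i * phi K 2 s \<le> phi K i s" "phi K i s \<le> b i * phi K 2 s" using ab i by blast+
    ultimately have "c1 * phi K 2 s \<le> phi K i s" "phi K i s \<le> c2 * phi K 2 s" by linarith+
    then show ?thesis using p by (simp add: pos_le_divide_eq pos_divide_le_eq)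
  qed
  then show ?thesis using c by blast
qed

theorem theorem1:
  fixes n :: nat
    and ix :: "nat \<Rightarrow> 'n::finite"
    and jx :: "nat \<Rightarrow> 'm::finite"
    and K :: "'p::finite known"
  assumes "2 \<le> n"
    and "bij_betw ix {1..n} UNIV"
    and "bij_betw jx {2..n} UNIV"
    and "known_regular n K"
    and "phi_lower_bound n K"
    and "cascading_dominance n K"
  shows "\<exists>C :: 'm ctrl. controller_regular n C \<and>
    (\<forall>(P :: ('n, 'p) plant) H. admissible_plant ix n K P H \<longrightarrow>
       (\<forall>w0. admissible_initial K C H w0 \<longrightarrow>
          (\<exists>w. closed_loop_solution ix jx n K C P H \<infinity> w \<and> same_initial w0 w)) \<and>
       (\<forall>T w. 0 < T \<and> closed_loop_solution ix jx n K C P H T w \<longrightarrow>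
          (\<exists>w'. closed_loop_solution ix jx n K C P H \<infinity> w' \<and> same_initial w w' \<and>
             same_on_horizon T w w')) \<and>
       (\<forall>w. closed_loop_solution ix jx n K C P H \<infinity> w \<longrightarrow>
          signals_bounded w \<and> signals_converge w))"
proof -
  note n2 = assms(1) and reg = assms(4)
  obtain \<sigma> where \<sigma>: "0 < \<sigma>" "\<And>i s. i \<in> {1..n-1} \<Longrightarrow> \<sigma> \<le> phi K i s" using assms(5) unfolding phi_lower_bound_def by blast
  have pos: "0 < phi K i s" if "i \<in> {1..n-1}" for i s using \<sigma>(1) \<sigma>(2)[OF that, of s] by linarith
  \<comment> \<open>for n = 2 the two chains have a single component and no ratio has to be controlled\<close>
  define k where "k = (if n = 2 then 1 else 2 :: nat)"
  have k: "k \<in> {1..n-1}" using n2 by (auto simp: k_def)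
  define p where "p = phi K k"
  have pp: "0 < p s" "\<sigma> \<le> p s" for s using pos[OF k] \<sigma>(2)[OF k] by (auto simp: p_def)
  obtain c1 c2 where c: "0 < c1" "c1 \<le> 1" "1 \<le> c2"
    and c12: "\<And>i s. i \<in> {2..<n} \<Longrightarrow> c1 \<le> phi K i s / p s \<and> phi K i s / p s \<le> c2"
  proof -
    obtain c1 c2 where "0 < c1" "c1 \<le> 1" "1 \<le> c2" "\<forall>i\<in>{2..<n}. \<forall>s. c1 \<le> phi K i s / phi K 2 s \<and> phi K i s / phi K 2 s \<le> (c2::real)"
      using cascade_bounds[OF n2 assms(6) pos] by blast
    then show thesis using that[of c1 c2] by (cases "n = 2") (auto simp: p_def k_def)
  qed
  obtain G Bo co where o: "robust_lyapunov {2..n} co Bo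
    {obs_op n 2 a a' G | a a'. (\<forall>i\<in>{2..<n}. c1 \<le> a i \<and> a i \<le> c2) \<and> c1 \<le> a' \<and> a' \<le> c2}"
    using observer_lyapunov_exists[OF c n2] by blast
  obtain \<kappa> Bc cc where f: "robust_lyapunov {2..n} cc Bc
    {fb_op n a b \<kappa> | a b. (\<forall>i\<in>{2..<n}. c1 \<le> a i \<and> a i \<le> c2) \<and> c1 \<le> b}"
    using feedback_lyapunov_exists[OF c n2] by blast
  obtain Co where Co: "0 \<le> Co" "\<And>v w. \<bar>Bo v w\<bar> \<le> Co * L2_set v {2..n} * L2_set w {2..n}"
    using o[unfolded robust_lyapunov_def, THEN conjunct2, THEN conjunct1, unfolded bform_def, THEN conjunct2, THEN conjunct2, THEN conjunct2]
    by blast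
  obtain Cc where Cc: "0 \<le> Cc" "\<And>v w. \<bar>Bc v w\<bar> \<le> Cc * L2_set v {2..n} * L2_set w {2..n}"
    using f[unfolded robust_lyapunov_def, THEN conjunct2, THEN conjunct1, unfolded bform_def, THEN conjunct2, THEN conjunct2, THEN conjunct2]
    by blast
  have co: "0 < co" and cc: "0 < cc" using o f by (auto simp: robust_lyapunov_def)
  have oL: "co * (L2_set v {2..n})^2 \<le> Bo v v" "co * (L2_set v {2..n})^2 \<le> Bo v (\<lambda>i. (real i - 3/2) * v i)" for v
    using o unfolding robust_lyapunov_def by simp_all
  have fL: "cc * (L2_set v {2..n})^2 \<le> Bc v v" "cc * (L2_set v {2..n})^2 \<le> Bc v (\<lambda>i. (real i - 3/2) * v i)" for v
    using f unfolding robust_lyapunov_def by simp_all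
  have kr: "0 < k_bar K" "Delta_bar K < 1" and cp: "continuous_on UNIV p"
    using reg k by (auto simp: known_regular_def p_def)
  obtain bh bh' where bh: "\<And>s. (bh has_real_derivative bh' s) (at s)" "continuous_on UNIV bh'" "\<And>s. p s \<le> bh s" "\<And>s. 0 \<le> bh s"
    using C1_majorant[OF cp] by blast
  define M where "M = real n + 1 / (1 - Delta_bar K) + k_bar K + 1 / \<sigma> + (\<Sum>i\<in>{2..n}. \<bar>G i\<bar>) + (\<Sum>i\<in>{2..n}. \<bar>\<kappa> i\<bar>) + Co + Cc + 1 / co + 1 / cc"
  have nn: "0 \<le> 1 / (1 - Delta_bar K)" "0 \<le> 1 / \<sigma>" "0 \<le> (\<Sum>i\<in>{2..n}. \<bar>G i\<bar>)" "0 \<le> (\<Sum>i\<in>{2..n}. \<bar>\<kappa> i\<bar>)" "0 \<le> 1 / co" "0 \<le> 1 / cc"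
    using kr \<sigma> co cc by (auto simp: sum_nonneg)
  have Mle: "real n \<le> M" "1 / (1 - Delta_bar K) \<le> M" "k_bar K \<le> M" "1 / \<sigma> \<le> M" "(\<Sum>i\<in>{2..n}. \<bar>G i\<bar>) \<le> M" "(\<Sum>i\<in>{2..n}. \<bar>\<kappa> i\<bar>) \<le> M"
    "Co \<le> M" "Cc \<le> M" "1 / co \<le> M" "1 / cc \<le> M"
    unfolding M_def using nn kr Co(1) Cc(1) by linarith+
  have M0: "0 < M" using Mle(1) n2 by linarith
  have inv: "1 / M \<le> x" if "0 < x" "1 / x \<le> M" for x using that M0 by (simp add: field_simps)
  define Bx where "Bx = (\<lambda>s. 1 + p s + (\<Sum>i\<in>{1..n-1}. phi K i s) + Gam K s + Gam2 K s + gam_s_bar K s + mu1a_bar K s)"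
  define q where "q = (\<lambda>s. 200 * M^28 * (Bx s)^4)"
  have "continuous_on UNIV Bx" unfolding Bx_def using reg by (auto simp: known_regular_def intro!: continuous_intros cp)
  then have "continuous_on UNIV (\<lambda>s. q s * M)" unfolding q_def by (intro continuous_intros)
  from C1_majorant[OF this] obtain v1 v1' where v1: "\<And>s. (v1 has_real_derivative v1' s) (at s)" "continuous_on UNIV v1'"
    "\<And>s. q s * M \<le> v1 s" "\<And>s. 0 \<le> v1 s" by blast
  have phi_lo: "1 / M \<le> phi K i s" if "i \<in> {1..n-1}" for i s using inv[OF \<sigma>(1) Mle(4)] \<sigma>(2)[OF that, of s] by linarith
  interpret design n ix jx K M G \<kappa> Bo Bc p q Bx bh bh' v1 v1'
  proof
    show "\<bar>G i\<bar> \<le> M" if "i \<in> {2..n}" for i using member_le_sum[OF that, of "\<lambda>i. \<bar>G i\<bar>"] Mle(5) by auto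
    show "\<bar>\<kappa> i\<bar> \<le> M" if "i \<in> {2..n}" for i using member_le_sum[OF that, of "\<lambda>i. \<bar>\<kappa> i\<bar>"] Mle(6) by auto
    show "bform {2..n} Bo" "bform {2..n} Bc" using o f by (auto simp: robust_lyapunov_def)
    show "\<bar>Bo v w\<bar> \<le> M * L2_set v {2..n} * L2_set w {2..n}" for v w
      by (rule order_trans[OF Co(2)]) (intro mult_right_mono Mle L2_set_nonneg)
    show "\<bar>Bc v w\<bar> \<le> M * L2_set v {2..n} * L2_set w {2..n}" for v w
      by (rule order_trans[OF Cc(2)]) (intro mult_right_mono Mle L2_set_nonneg)
    have lo: "1 / M * (L2_set v {2..n})^2 \<le> c * (L2_set v {2..n})^2" if "0 < c" "1 / c \<le> M" for c v
      using inv[OF that] by (intro mult_right_mono) auto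
    show "1 / M * (L2_set v {2..n})^2 \<le> Bo v v" "1 / M * (L2_set v {2..n})^2 \<le> Bc v v" for v
      using order_trans[OF lo[OF co Mle(9)] oL(1)[of v]] order_trans[OF lo[OF cc Mle(10)] fL(1)[of v]] by blast+
    show "0 \<le> Bo v (\<lambda>i. (real i - 3/2) * v i)" "0 \<le> Bc v (\<lambda>i. (real i - 3/2) * v i)" for v
    proof -
      have "0 \<le> co * (L2_set v {2..n})^2" "0 \<le> cc * (L2_set v {2..n})^2" using co cc by auto
      then show "0 \<le> Bo v (\<lambda>i. (real i - 3/2) * v i)" "0 \<le> Bc v (\<lambda>i. (real i - 3/2) * v i)"
        using oL(2)[of v] fL(2)[of v] by linarith+
    qed
    show "Bo v (obs_op n 2 (\<lambda>i. phi K i s / p s) 1 G v) \<le> - (1 / M) * (L2_set v {2..n})^2" for v s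
    proof -
      have "obs_op n 2 (\<lambda>i. phi K i s / p s) 1 G \<in>
        {obs_op n 2 a a' G | a a'. (\<forall>i\<in>{2..<n}. c1 \<le> a i \<and> a i \<le> c2) \<and> c1 \<le> a' \<and> a' \<le> c2}" using c c12 by blast
      then have "Bo v (obs_op n 2 (\<lambda>i. phi K i s / p s) 1 G v) \<le> - co * (L2_set v {2..n})^2"
        using o unfolding robust_lyapunov_def by blast
      then show ?thesis using lo[OF co Mle(9), of v] by simp
    qed
    show "Bc v (fb_op n (\<lambda>i. phi K i s / p s) (bh s / p s) \<kappa> v) \<le> - (1 / M) * (L2_set v {2..n})^2" for v s
    proof -
      have "1 \<le> bh s / p s" using bh(3)[of s] pp(1)[of s] by (simp add: pos_le_divide_eq)
      then have "c1 \<le> bh s / p s" using c by linarith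
      then have "fb_op n (\<lambda>i. phi K i s / p s) (bh s / p s) \<kappa> \<in>
        {fb_op n a b \<kappa> | a b. (\<forall>i\<in>{2..<n}. c1 \<le> a i \<and> a i \<le> c2) \<and> c1 \<le> b}" using c12 by blast
      then have "Bc v (fb_op n (\<lambda>i. phi K i s / p s) (bh s / p s) \<kappa> v) \<le> - cc * (L2_set v {2..n})^2"
        using f unfolding robust_lyapunov_def by blast
      then show ?thesis using lo[OF cc Mle(10), of v] by simp
    qed
    show "q s \<le> phi K 1 s * v1 s" for s
    proof -
      have "q s = 1 / M * (q s * M)" using M0 by simp
      also have "\<dots> \<le> 1 / M * v1 s" using v1(3) M0 by (intro mult_left_mono) auto
      also have "\<dots> \<le> phi K 1 s * v1 s" using phi_lo[of 1 s] v1(4) n2 by (intro mult_right_mono) auto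
      finally show ?thesis .
    qed
    show "1 / M \<le> p s" for s unfolding p_def by (rule phi_lo[OF k])
    show "2 \<le> n" "bij_betw ix {1..n} UNIV" "bij_betw jx {2..n} UNIV" "known_regular n K" by (rule assms)+
    show "real n \<le> M" "1 / (1 - Delta_bar K) \<le> M" "k_bar K \<le> M" by (rule Mle)+
    show "1 / M \<le> phi K i s" if "i \<in> {1..n-1}" for i s by (rule phi_lo[OF that])
    show "continuous_on UNIV p" by (rule cp)
    show "(bh has_real_derivative bh' s) (at s)" "continuous_on UNIV bh'" "0 \<le> bh s" for s by (rule bh)+
    show "(v1 has_real_derivative v1' s) (at s)" "continuous_on UNIV v1'" "0 \<le> v1 s" for s by (rule v1)+
    show "Bx = (\<lambda>s. 1 + p s + (\<Sum>i\<in>{1..n-1}. phi K i s) + Gam K s + Gam2 K s + gam_s_bar K s + mu1a_bar K s)" by (rule Bx_def)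
    show "q = (\<lambda>s. 200 * M^28 * (Bx s)^4)" by (rule q_def)
  qed
  have main: "(\<forall>w0. admissible_initial K Ctl H w0 \<longrightarrow>
          (\<exists>w. closed_loop_solution ix jx n K Ctl P H \<infinity> w \<and> same_initial w0 w)) \<and>
       (\<forall>T w. 0 < T \<and> closed_loop_solution ix jx n K Ctl P H T w \<longrightarrow>
          (\<exists>w'. closed_loop_solution ix jx n K Ctl P H \<infinity> w' \<and> same_initial w w' \<and>
             same_on_horizon T w w')) \<and>
       (\<forall>w. closed_loop_solution ix jx n K Ctl P H \<infinity> w \<longrightarrow> signals_bounded w \<and> signals_converge w)"
    if adm: "admissible_plant ix n K P H" for P :: "('n, 'p) plant" and H
  proof -
    obtain \<theta> m1 m1t m2 where A: "0 \<le> \<theta>" "drift_bound ix n K P \<theta>"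
      "mu_bounds ix n K P (psi_values ix n K P H) H \<theta> m1 m1t m2"
      "psi_dissipation ix n K P (psi_values ix n K P H) H \<theta> m1 m1t m2"
      using adm unfolding admissible_plant_def by blast
    note D = A(4)[unfolded psi_dissipation_def]
    from D[THEN conjunct1] obtain V where V: "lyapunov_candidate V"
        "(\<forall>t\<ge>0. \<forall>x u. \<forall>\<psi>\<in>psi_values ix n K P H. \<forall>D. GDERIV V \<psi> :> D \<longrightarrow>
           (\<forall>xd. \<forall>\<psi>d \<in> psi_values ix n K P H \<union> H. \<forall>ud.
              D \<bullet> q_psi P t x \<psi> u xd \<psi>d ud \<le> - alpha_psi K (norm \<psi>) +
                (Gam2 K (x $ ix 1) * (\<theta> * (x $ ix 1)^2 + (\<Sum>j=2..n. (x $ ix j)^2) +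
                    gam_s K (outp ix n x) u) +
                 Gam2 K (xd $ ix 1) * (\<theta> * (xd $ ix 1)^2 + (\<Sum>j=2..n. (xd $ ix j)^2) +
                    gam_s K (outp ix n xd) ud))))"
        "\<forall>\<psi>. V_lo K * V \<psi> \<le> alpha_psi K (norm \<psi>)" by blast
    have pcdb: "plant_continuous n P" "delay_bound K P" using adm unfolding admissible_plant_def by blast+
    interpret plant_data n ix jx K M G \<kappa> Bo Bc p q Bx bh bh' v1 v1' P H \<theta> m1 m1t m2 V
    proof (unfold_locales, goal_cases)
      case (7 t x u \<psi> D xd \<psi>d ud)
      then show ?case using V(2) by blast
    next
      case (8 \<psi>)
      then show ?case using V(3) by blast
    next
      case (9 t x u \<psi>)
      then show ?case using D[THEN conjunct2, THEN conjunct1] by blast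
    next
      case (10 \<psi>)
      then show ?case using D[THEN conjunct2, THEN conjunct2] by blast
    qed (use A V pcdb in blast)+
    show ?thesis using global_existence global_continuation bounded_and_convergent by blast
  qed
  show ?thesis using controller_regular_Ctl main by blast
qed

end
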